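(* Let $G_1$ and $G_2$ be two local Lie groupoids with Lie algebroids $A_1\to M_1$ and $A_2\to M_2$, respectively, and let $f:A_1\to A_2$ be a Lie algebroid morphism covering $f_M:M_1\to M_2$. There exists a local Lie groupoid map $F:G_1\dashrightarrow G_2$ integrating $f$, and any two such integrations coincide around the unit section. Explicitly, fixing a tubular structure on $G_1$, with induced scalar multiplication $(t,g)\mapsto tg$ along the source fibers, we have $F(g)=k_1$, where $t\mapsto k_t\in\sigma_2^{-1}(f_M(\sigma_1(g)))\subset G_2$ is the solution of the ODE $$\theta_{G_2}\Big(\frac{d}{dt}k_t\Big)=f\circ\theta_{G_1}\Big(\frac{d}{dt}(tg)\Big),\qquad k_0=f_M(\sigma_1(g)),$$ $\theta_{G_i}$ is the Maurer-Cartan form of $G_i$, and $g\in G_1$ is taken close enough to the unit section such that the solution is defined for $t\in[0,1]$.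
   Context: A local Lie groupoid on $(G,M,\sigma)$ consists of a manifold $G$, a closed embedded submanifold $M\subset G$ (units), a submersion $\sigma:G\to M$ with $\sigma|_M=\mathrm{id}_M$ (source), and smooth maps $\tau:G_\tau\to M$ (target), $\iota:G_\iota\to G$ (inversion), $\mu:G_\mu\to G$ (multiplication, $\mu(g,h)=gh$), where $G_\tau,G_\iota$ are open neighborhoods of $M$ in $G$, $\tau|_M=\mathrm{id}_M$, and $G_\mu$ is an open neighborhood of $\{(x,x):x\in M\}$ in $\{(g,h)\in G\times G_\tau:\sigma(g)=\tau(h)\}$, such that each Lie groupoid axiom holds on a neighborhood of $\{(x,\ldots,x):x\in M\}$ in the relevant space $G^{(k)}=\{(g_1,\ldots,g_k):\sigma(g_i)=\tau(g_{i+1})\}$. The axioms are: $\sigma(gh)=\sigma(h)$, $\tau(gh)=\tau(g)$, $(gh)k=g(hk)$, $\tau(g)g=g=g\sigma(g)$, $\iota|_M=\mathrm{id}_M$, $\iota(\iota(g))=g$, $\sigma(\iota(g))=\tau(g)$, $\tau(\iota(g))=\sigma(g)$, $g\,\iota(g)=\tau(g)$, $\iota(g)g=\sigma(g)$. Its Lie algebroid is $A=\ker(d\sigma)|_M$ with anchor $d\tau|_A$ and bracket obtained by identifying sections of $A$ with right-invariant vector fields on $G$. A dashed arrow denotes a map defined only on a neighborhood of the units. A local Lie groupoid map $F:G_1\dashrightarrow G_2$ is a smooth map defined on an open neighborhood of $M_1$, with $F(M_1)\subset M_2$, and such that $F(gh)=F(g)F(h)$ for all $(g,h)$ in an open neighborhood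 of $\{(x,x):x\in M_1\}$ in the space of composable pairs. It integrates $f$ if $dF|_{A_1}=f$ (in particular $F|_{M_1}=f_M$). The Maurer-Cartan form of $G$ is the vector bundle map $\theta_G:\ker(d\sigma)\dashrightarrow A$ covering $\tau$, defined near $M$ by $\theta_G\big(\frac{d}{dt}g_t|_{t=0}\big)=\frac{d}{dt}\mu(g_t,\iota(g_0))|_{t=0}\in A_{\tau(g_0)}$ for curves $g_t$ in a $\sigma$-fiber. A tubular structure on $G$ is an open embedding $\varphi:A\dashrightarrow G$ defined on a neighborhood of the zero section $M\subset A$, with $\sigma\circ\varphi=q$ (where $q:A\to M$ is the projection), $\varphi(0_x)=x$ for $x\in M$, and $\frac{d}{dt}\varphi(ta)|_{t=0}=a\in A_x\subset T_xG$ for $a\in A_x$. The induced scalar multiplication is $tg:=\varphi(t\varphi^{-1}(g))$, defined near $\{0\}\times M$ (and for $t\in[0,1]$, $g$ near $M$). *)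

theory Defs
  imports "HOL-Analysis.Analysis"
begin

section \<open>Smooth manifolds\<close>

text \<open>
  The model spaces of manifolds are finite-dimensional real inner product spaces. The class
  \<^class>\<open>euclidean_space\<close> demands a nonempty basis, which would exclude zero-dimensional
  manifolds; here the orthonormal basis may be empty.
\<close>

class model_space = real_inner +
  assumes ex_finite_orthonormal_basis:
    "\<exists>B. finite B \<and> (\<forall>u\<in>B. \<forall>v\<in>B. inner u v = (if u = v then 1 else 0)) \<and>
         (\<forall>x. (\<forall>u\<in>B. inner x u = 0) \<longrightarrow> x = 0)"

subclass (in euclidean_space) model_space
proof
  show "\<exists>B. finite B \<and> (\<forall>u\<in>B. \<forall>v\<in>B. inner u v = (if u = v then 1 else 0)) \<and>
            (\<forall>x. (\<forall>u\<in>B. inner x u = 0) \<longrightarrow> x = 0)"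
    by (rule exI[of _ Basis]) (auto simp: inner_Basis euclidean_all_zero_iff)
qed

text \<open>\<open>Ck_on k S f\<close> says that \<open>f\<close> is of class \<open>C\<^sup>k\<close>; it is meant for open \<open>S\<close> and a
  finite-dimensional domain, where it suffices to consider directional derivatives of the
  derivative.\<close>

primrec Ck_on :: "nat \<Rightarrow> 'a::real_normed_vector set \<Rightarrow> ('a \<Rightarrow> 'b::real_normed_vector) \<Rightarrow> bool" where
  "Ck_on 0 S f \<longleftrightarrow> continuous_on S f"
| "Ck_on (Suc k) S f \<longleftrightarrow>
     (\<forall>x\<in>S. f differentiable (at x)) \<and> (\<forall>v. Ck_on k S (\<lambda>x. frechet_derivative f (at x) v))"

definition smooth_on :: "'a::real_normed_vector set \<Rightarrow> ('a \<Rightarrow> 'b::real_normed_vector) \<Rightarrow> bool" where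
  "smooth_on S f \<longleftrightarrow> (\<forall>k. Ck_on k S f)"

text \<open>A manifold is given by an atlas; its underlying set and its topology are derived from it.\<close>

type_synonym ('m, 'e) chart = "'m set \<times> ('m \<Rightarrow> 'e)"

definition mfd_space :: "('m, 'e) chart set \<Rightarrow> 'm set" where
  "mfd_space A = (\<Union>(U, \<phi>)\<in>A. U)"

definition smooth_atlas :: "('m, 'e::real_normed_vector) chart set \<Rightarrow> bool" where
  "smooth_atlas A \<longleftrightarrow>
     (\<forall>(U, \<phi>)\<in>A. inj_on \<phi> U \<and> open (\<phi> ` U)) \<and>
     (\<forall>(U, \<phi>)\<in>A. \<forall>(V, \<psi>)\<in>A.
        open (\<phi> ` (U \<inter> V)) \<and> smooth_on (\<phi> ` (U \<inter> V)) (\<psi> \<circ> inv_into U \<phi>))"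

definition mfd_top :: "('m, 'e::real_normed_vector) chart set \<Rightarrow> 'm topology" where
  "mfd_top A = topology (\<lambda>W. W \<subseteq> mfd_space A \<and> (\<forall>(U, \<phi>)\<in>A. open (\<phi> ` (U \<inter> W))))"

lemma openin_mfd_top:
  assumes "smooth_atlas A"
  shows "openin (mfd_top A) W \<longleftrightarrow> W \<subseteq> mfd_space A \<and> (\<forall>(U, \<phi>)\<in>A. open (\<phi> ` (U \<inter> W)))"
proof -
  let ?L = "\<lambda>W. W \<subseteq> mfd_space A \<and> (\<forall>(U, \<phi>)\<in>A. open (\<phi> ` (U \<inter> W)))"
  have inj: "inj_on \<phi> U" if "(U, \<phi>) \<in> A" for U \<phi>
    using assms that unfolding smooth_atlas_def by fastforce
  have 1: "?L (S \<inter> T)" if S: "?L S" and T: "?L T" for S T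
  proof -
    have "open (\<phi> ` (U \<inter> (S \<inter> T)))" if c: "(U, \<phi>) \<in> A" for U \<phi>
    proof -
      have "\<phi> ` (U \<inter> (S \<inter> T)) = \<phi> ` (U \<inter> S) \<inter> \<phi> ` (U \<inter> T)"
        using inj_on_image_Int[OF inj[OF c], of "U \<inter> S" "U \<inter> T"]
        by (simp add: Int_ac)
      moreover have "open (\<phi> ` (U \<inter> S))" "open (\<phi> ` (U \<inter> T))"
        using S T c by fastforce+
      ultimately show ?thesis by (simp add: open_Int)
    qed
    then show ?thesis using S by fastforce
  qed
  have 2: "?L (\<Union>\<K>)" if K: "\<forall>K\<in>\<K>. ?L K" for \<K>
  proof -
    have "open (\<phi> ` (U \<inter> \<Union>\<K>))" if c: "(U, \<phi>) \<in> A" for U \<phi>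
    proof -
      have "\<phi> ` (U \<inter> \<Union>\<K>) = (\<Union>K\<in>\<K>. \<phi> ` (U \<inter> K))" by auto
      moreover have "\<forall>K\<in>\<K>. open (\<phi> ` (U \<inter> K))" using K c by fastforce
      ultimately show ?thesis by (simp add: open_UN)
    qed
    then show ?thesis using K by fastforce
  qed
  have "istopology ?L" unfolding istopology_def using 1 2 by blast
  then show ?thesis unfolding mfd_top_def by (simp add: topology_inverse')
qed

definition smooth_manifold :: "('m, 'e::model_space) chart set \<Rightarrow> bool" where
  "smooth_manifold A \<longleftrightarrow>
     smooth_atlas A \<and> Hausdorff_space (mfd_top A) \<and> second_countable (mfd_top A)"

text \<open>Slice charts may be any charts of the maximal atlas. The slice dimension is the same at
  all points of \<open>M\<close>.\<close>

definition embedded_submanifold :: "('m, 'e::real_normed_vector) chart set \<Rightarrow> 'm set \<Rightarrow> bool" where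
  "embedded_submanifold A M \<longleftrightarrow> M \<subseteq> mfd_space A \<and>
     (\<exists>L. subspace L \<and>
        (\<forall>x\<in>M. \<exists>U \<phi>. x \<in> U \<and> U \<subseteq> mfd_space A \<and> smooth_atlas (insert (U, \<phi>) A) \<and>
                     \<phi> ` (U \<inter> M) = \<phi> ` U \<inter> L))"

text \<open>
  Smoothness of a map on an arbitrary subset \<open>S\<close> of a manifold: locally around each point of \<open>S\<close>
  the map is the restriction of a smooth map defined on an open set of the ambient manifold. If
  \<open>S\<close> is open, or an embedded submanifold, this is the usual notion; a map into an embedded
  submanifold is smooth iff it is smooth as a map into the ambient manifold.
\<close>

definition smooth_map ::
  "('m, 'e::real_normed_vector) chart set \<Rightarrow> ('n, 'd::real_normed_vector) chart set \<Rightarrow>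
   'm set \<Rightarrow> ('m \<Rightarrow> 'n) \<Rightarrow> bool" where
  "smooth_map A B S f \<longleftrightarrow> S \<subseteq> mfd_space A \<and> f ` S \<subseteq> mfd_space B \<and>
     (\<forall>x\<in>S. \<exists>(U, \<phi>)\<in>A. \<exists>(V, \<psi>)\<in>B. \<exists>W h.
        x \<in> U \<and> f x \<in> V \<and> open W \<and> \<phi> x \<in> W \<and> W \<subseteq> \<phi> ` U \<and> smooth_on W h \<and>
        (\<forall>y\<in>S \<inter> U. \<phi> y \<in> W \<longrightarrow> f y \<in> V \<and> \<psi> (f y) = h (\<phi> y)))"

definition real_atlas :: "(real, real) chart set" where
  "real_atlas = {(UNIV, \<lambda>t. t)}"

definition prod_atlas ::
  "('m, 'e) chart set \<Rightarrow> ('n, 'd) chart set \<Rightarrow> ('m \<times> 'n, 'e \<times> 'd) chart set" where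
  "prod_atlas A B = {(U \<times> V, map_prod \<phi> \<psi>) | U \<phi> V \<psi>. (U, \<phi>) \<in> A \<and> (V, \<psi>) \<in> B}"


section \<open>Tangent vectors\<close>

text \<open>
  At each point a chart of the atlas is chosen once and for all. A tangent vector at \<open>x\<close> is
  represented by the pair \<open>(x, v)\<close> of its base point and its coordinate vector \<open>v\<close> with respect to
  the chart chosen at \<open>x\<close>. The chosen chart varies arbitrarily with \<open>x\<close>, so the topology and the
  smooth structure of the tangent bundle are those of \<open>tangent_atlas\<close> below, not those of a product.
\<close>

definition chart_at :: "('m, 'e) chart set \<Rightarrow> 'm \<Rightarrow> ('m, 'e) chart" where
  "chart_at A x = (SOME c. c \<in> A \<and> x \<in> fst c)"

definition coord :: "('m, 'e) chart set \<Rightarrow> 'm \<Rightarrow> 'm \<Rightarrow> 'e" where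
  "coord A x = snd (chart_at A x)"

definition coord_inv :: "('m, 'e) chart set \<Rightarrow> 'm \<Rightarrow> 'e \<Rightarrow> 'm" where
  "coord_inv A x = inv_into (fst (chart_at A x)) (coord A x)"

text \<open>The coordinates of the tangent vector \<open>(x, v)\<close> with respect to an arbitrary chart map.\<close>

definition tangent_coord ::
  "('m, 'e::real_normed_vector) chart set \<Rightarrow> ('m \<Rightarrow> 'e) \<Rightarrow> 'm \<Rightarrow> 'e \<Rightarrow> 'e" where
  "tangent_coord A \<phi> x v = frechet_derivative (\<phi> \<circ> coord_inv A x) (at (coord A x x)) v"

definition tangent_atlas ::
  "('m, 'e::real_normed_vector) chart set \<Rightarrow> ('m \<times> 'e, 'e \<times> 'e) chart set" where
  "tangent_atlas A = {(U \<times> UNIV, \<lambda>(x, v). (\<phi> x, tangent_coord A \<phi> x v)) | U \<phi>. (U, \<phi>) \<in> A}"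

definition differential ::
  "('m, 'e::real_normed_vector) chart set \<Rightarrow> ('n, 'd::real_normed_vector) chart set \<Rightarrow>
   ('m \<Rightarrow> 'n) \<Rightarrow> 'm \<Rightarrow> 'e \<Rightarrow> 'd" where
  "differential A B f x v = frechet_derivative (coord B (f x) \<circ> f \<circ> coord_inv A x) (at (coord A x x)) v"

text \<open>If \<open>T\<close> is a closed interval, the velocities at its endpoints are one-sided.\<close>

definition velocity ::
  "('m, 'e::real_normed_vector) chart set \<Rightarrow> real set \<Rightarrow> (real \<Rightarrow> 'm) \<Rightarrow> real \<Rightarrow> 'e" where
  "velocity A T c t = vector_derivative (\<lambda>s. coord A (c t) (c s)) (at t within T)"

definition curve_in ::
  "('m, 'e::real_normed_vector) chart set \<Rightarrow> 'm set \<Rightarrow> 'm \<Rightarrow> 'e \<Rightarrow> (real \<Rightarrow> 'm) \<Rightarrow> bool" where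
  "curve_in A S x v c \<longleftrightarrow>
     (\<exists>e>0. smooth_map real_atlas A {-e<..<e} c \<and> c ` {-e<..<e} \<subseteq> S) \<and>
     c 0 = x \<and> velocity A UNIV c 0 = v"

definition tangent_space ::
  "('m, 'e::real_normed_vector) chart set \<Rightarrow> 'm set \<Rightarrow> 'm \<Rightarrow> 'e set" where
  "tangent_space A S x = {v. \<exists>c. curve_in A S x v c}"

text \<open>
  The derivative, at \<open>x\<close> in direction \<open>v\<close>, of a map \<open>f\<close> which is only defined on a submanifold \<open>S\<close>
  (near \<open>x\<close>): the velocity of \<open>f \<circ> c\<close> for a curve \<open>c\<close> in \<open>S\<close> with velocity \<open>v\<close> at \<open>x\<close>. It does not
  depend on the curve when \<open>f\<close> is smooth on a neighbourhood of \<open>x\<close> in \<open>S\<close>.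
\<close>

definition derivative_along ::
  "('m, 'e::real_normed_vector) chart set \<Rightarrow> ('n, 'd::real_normed_vector) chart set \<Rightarrow>
   'm set \<Rightarrow> ('m \<Rightarrow> 'n) \<Rightarrow> 'm \<Rightarrow> 'e \<Rightarrow> 'd" where
  "derivative_along A B S f x v =
     (SOME w. \<exists>c. curve_in A S x v c \<and> velocity B UNIV (\<lambda>t. f (c t)) 0 = w)"

text \<open>A vector field is given by the coordinate vector \<open>X y\<close> at each point \<open>y\<close>; \<open>field_coord\<close> is
  its expression in the chart chosen at \<open>x\<close>.\<close>

definition field_coord ::
  "('m, 'e::real_normed_vector) chart set \<Rightarrow> 'm \<Rightarrow> ('m \<Rightarrow> 'e) \<Rightarrow> 'e \<Rightarrow> 'e" where
  "field_coord A x X u = (let y = coord_inv A x u in tangent_coord A (coord A x) y (X y))"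

definition lie_bracket ::
  "('m, 'e::real_normed_vector) chart set \<Rightarrow> ('m \<Rightarrow> 'e) \<Rightarrow> ('m \<Rightarrow> 'e) \<Rightarrow> 'm \<Rightarrow> 'e" where
  "lie_bracket A X Y x =
     frechet_derivative (field_coord A x Y) (at (coord A x x)) (X x) -
     frechet_derivative (field_coord A x X) (at (coord A x x)) (Y x)"


section \<open>Local Lie groupoids\<close>

record ('g, 'e) local_groupoid =
  atlas :: "('g, 'e) chart set"
  units :: "'g set"
  src :: "'g \<Rightarrow> 'g"
  tgt_dom :: "'g set"
  tgt :: "'g \<Rightarrow> 'g"
  inv_dom :: "'g set"
  invg :: "'g \<Rightarrow> 'g"
  mul_dom :: "('g \<times> 'g) set"
  mul :: "'g \<Rightarrow> 'g \<Rightarrow> 'g"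

abbreviation gspace :: "('g, 'e) local_groupoid \<Rightarrow> 'g set" where
  "gspace G \<equiv> mfd_space (atlas G)"

abbreviation gtop :: "('g, 'e::real_normed_vector) local_groupoid \<Rightarrow> 'g topology" where
  "gtop G \<equiv> mfd_top (atlas G)"

definition composable2 :: "('g, 'e) local_groupoid \<Rightarrow> ('g \<times> 'g) set" where
  "composable2 G = {(g, h). g \<in> gspace G \<and> h \<in> tgt_dom G \<and> src G g = tgt G h}"

definition composable3 :: "('g, 'e) local_groupoid \<Rightarrow> ('g \<times> 'g \<times> 'g) set" where
  "composable3 G = {(g, h, k). g \<in> gspace G \<and> h \<in> tgt_dom G \<and> k \<in> tgt_dom G \<and>
                               src G g = tgt G h \<and> src G h = tgt G k}"

text \<open>\<open>P\<close> holds on a neighbourhood of the units (embedded diagonally) in \<open>G\<close>, or in the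
  space of composable pairs or triples.\<close>

definition near_units1 :: "('g, 'e::real_normed_vector) local_groupoid \<Rightarrow> ('g \<Rightarrow> bool) \<Rightarrow> bool" where
  "near_units1 G P \<longleftrightarrow> (\<exists>W. openin (gtop G) W \<and> units G \<subseteq> W \<and> (\<forall>g\<in>W. P g))"

definition near_units2 ::
  "('g, 'e::real_normed_vector) local_groupoid \<Rightarrow> ('g \<Rightarrow> 'g \<Rightarrow> bool) \<Rightarrow> bool" where
  "near_units2 G P \<longleftrightarrow>
     (\<exists>W. openin (subtopology (prod_topology (gtop G) (gtop G)) (composable2 G)) W \<and>
          (\<forall>x\<in>units G. (x, x) \<in> W) \<and> (\<forall>(g, h)\<in>W. P g h))"

definition near_units3 ::
  "('g, 'e::real_normed_vector) local_groupoid \<Rightarrow> ('g \<Rightarrow> 'g \<Rightarrow> 'g \<Rightarrow> bool) \<Rightarrow> bool" where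
  "near_units3 G P \<longleftrightarrow>
     (\<exists>W. openin (subtopology (prod_topology (gtop G) (prod_topology (gtop G) (gtop G)))
                              (composable3 G)) W \<and>
          (\<forall>x\<in>units G. (x, x, x) \<in> W) \<and> (\<forall>(g, h, k)\<in>W. P g h k))"

text \<open>The axioms below include that the expressions in them are defined near the units; this is
  no restriction, since they are defined at the units and the domains are open.\<close>

definition local_Lie_groupoid :: "('g, 'e::model_space) local_groupoid \<Rightarrow> bool" where
  "local_Lie_groupoid G \<longleftrightarrow>
     smooth_manifold (atlas G) \<and>
     embedded_submanifold (atlas G) (units G) \<and> closedin (gtop G) (units G) \<and>
     smooth_map (atlas G) (atlas G) (gspace G) (src G) \<and> src G ` gspace G \<subseteq> units G \<and>
     (\<forall>g\<in>gspace G. range (differential (atlas G) (atlas G) (src G) g)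
                     = tangent_space (atlas G) (units G) (src G g)) \<and>
     (\<forall>x\<in>units G. src G x = x) \<and>
     openin (gtop G) (tgt_dom G) \<and> units G \<subseteq> tgt_dom G \<and>
     smooth_map (atlas G) (atlas G) (tgt_dom G) (tgt G) \<and> tgt G ` tgt_dom G \<subseteq> units G \<and>
     (\<forall>x\<in>units G. tgt G x = x) \<and>
     openin (gtop G) (inv_dom G) \<and> units G \<subseteq> inv_dom G \<and>
     smooth_map (atlas G) (atlas G) (inv_dom G) (invg G) \<and>
     (\<forall>x\<in>units G. invg G x = x) \<and>
     openin (subtopology (prod_topology (gtop G) (gtop G)) (composable2 G)) (mul_dom G) \<and>
     (\<forall>x\<in>units G. (x, x) \<in> mul_dom G) \<and>
     smooth_map (prod_atlas (atlas G) (atlas G)) (atlas G) (mul_dom G) (\<lambda>(g, h). mul G g h) \<and>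
     near_units2 G (\<lambda>g h. (g, h) \<in> mul_dom G \<and> src G (mul G g h) = src G h) \<and>
     near_units2 G (\<lambda>g h. (g, h) \<in> mul_dom G \<and> g \<in> tgt_dom G \<and> mul G g h \<in> tgt_dom G \<and>
                          tgt G (mul G g h) = tgt G g) \<and>
     near_units3 G (\<lambda>g h k. (g, h) \<in> mul_dom G \<and> (mul G g h, k) \<in> mul_dom G \<and>
                            (h, k) \<in> mul_dom G \<and> (g, mul G h k) \<in> mul_dom G \<and>
                            mul G (mul G g h) k = mul G g (mul G h k)) \<and>
     near_units1 G (\<lambda>g. g \<in> tgt_dom G \<and> (tgt G g, g) \<in> mul_dom G \<and> mul G (tgt G g) g = g) \<and>
     near_units1 G (\<lambda>g. (g, src G g) \<in> mul_dom G \<and> mul G g (src G g) = g) \<and>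
     near_units1 G (\<lambda>g. g \<in> inv_dom G \<and> invg G g \<in> inv_dom G \<and> invg G (invg G g) = g) \<and>
     near_units1 G (\<lambda>g. g \<in> inv_dom G \<and> g \<in> tgt_dom G \<and> src G (invg G g) = tgt G g) \<and>
     near_units1 G (\<lambda>g. g \<in> inv_dom G \<and> invg G g \<in> tgt_dom G \<and> tgt G (invg G g) = src G g) \<and>
     near_units1 G (\<lambda>g. g \<in> inv_dom G \<and> g \<in> tgt_dom G \<and> (g, invg G g) \<in> mul_dom G \<and>
                        mul G g (invg G g) = tgt G g) \<and>
     near_units1 G (\<lambda>g. g \<in> inv_dom G \<and> (invg G g, g) \<in> mul_dom G \<and>
                        mul G (invg G g) g = src G g)"

text \<open>A local map is given by its open domain \<open>D\<close> and a function relevant only on \<open>D\<close>.\<close>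

definition local_groupoid_map ::
  "('g, 'e::real_normed_vector) local_groupoid \<Rightarrow> ('h, 'd::real_normed_vector) local_groupoid \<Rightarrow>
   'g set \<Rightarrow> ('g \<Rightarrow> 'h) \<Rightarrow> bool" where
  "local_groupoid_map G H D F \<longleftrightarrow>
     openin (gtop G) D \<and> units G \<subseteq> D \<and> smooth_map (atlas G) (atlas H) D F \<and>
     F ` units G \<subseteq> units H \<and>
     near_units2 G (\<lambda>g h. g \<in> D \<and> h \<in> D \<and> (g, h) \<in> mul_dom G \<and> mul G g h \<in> D \<and>
                          (F g, F h) \<in> mul_dom H \<and> F (mul G g h) = mul H (F g) (F h))"


section \<open>The Lie algebroid\<close>

definition algebroid :: "('g, 'e::real_normed_vector) local_groupoid \<Rightarrow> ('g \<times> 'e) set" where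
  "algebroid G = {(x, a). x \<in> units G \<and> differential (atlas G) (atlas G) (src G) x a = 0}"

definition anchor :: "('g, 'e::real_normed_vector) local_groupoid \<Rightarrow> 'g \<Rightarrow> 'e \<Rightarrow> 'e" where
  "anchor G x a = differential (atlas G) (atlas G) (tgt G) x a"

text \<open>A section \<open>x \<mapsto> (x, \<alpha> x)\<close> is given by \<open>\<alpha>\<close>; values outside of the units are irrelevant.\<close>

definition algebroid_section ::
  "('g, 'e::real_normed_vector) local_groupoid \<Rightarrow> ('g \<Rightarrow> 'e) \<Rightarrow> bool" where
  "algebroid_section G \<alpha> \<longleftrightarrow> (\<forall>x\<in>units G. (x, \<alpha> x) \<in> algebroid G) \<and>
     smooth_map (atlas G) (tangent_atlas (atlas G)) (units G) (\<lambda>x. (x, \<alpha> x))"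

text \<open>The right-invariant vector field of a section: at \<open>g\<close> (near the units) it is the image of
  \<open>\<alpha> (tgt g)\<close> under the derivative of right translation by \<open>g\<close> at the unit \<open>tgt g\<close>.\<close>

definition right_invariant_field ::
  "('g, 'e::real_normed_vector) local_groupoid \<Rightarrow> ('g \<Rightarrow> 'e) \<Rightarrow> 'g \<Rightarrow> 'e" where
  "right_invariant_field G \<alpha> g =
     derivative_along (atlas G) (atlas G) {h \<in> gspace G. src G h = tgt G g} (\<lambda>h. mul G h g)
       (tgt G g) (\<alpha> (tgt G g))"

definition algebroid_bracket ::
  "('g, 'e::real_normed_vector) local_groupoid \<Rightarrow> ('g \<Rightarrow> 'e) \<Rightarrow> ('g \<Rightarrow> 'e) \<Rightarrow> 'g \<Rightarrow> 'e" where
  "algebroid_bracket G \<alpha> \<beta> =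
     lie_bracket (atlas G) (right_invariant_field G \<alpha>) (right_invariant_field G \<beta>)"

definition anchor_derivative ::
  "('g, 'e::real_normed_vector) local_groupoid \<Rightarrow> ('g \<Rightarrow> 'e) \<Rightarrow> ('g \<Rightarrow> real) \<Rightarrow> 'g \<Rightarrow> real" where
  "anchor_derivative G \<alpha> u x =
     derivative_along (atlas G) real_atlas (units G) u x (anchor G x (\<alpha> x))"

text \<open>A decomposition \<open>f \<circ> \<alpha> = (\<Sum>i<m. a i \<cdot> (\<xi> i \<circ> fM))\<close> with smooth functions \<open>a i\<close> on
  the units of \<open>G\<close> and sections \<open>\<xi> i\<close> of the algebroid of \<open>H\<close>.\<close>

definition decomposition ::
  "('g, 'e::real_normed_vector) local_groupoid \<Rightarrow> ('h, 'd::real_normed_vector) local_groupoid \<Rightarrow>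
   ('g \<times> 'e \<Rightarrow> 'h \<times> 'd) \<Rightarrow> ('g \<Rightarrow> 'h) \<Rightarrow> ('g \<Rightarrow> 'e) \<Rightarrow>
   nat \<Rightarrow> (nat \<Rightarrow> 'g \<Rightarrow> real) \<Rightarrow> (nat \<Rightarrow> 'h \<Rightarrow> 'd) \<Rightarrow> bool" where
  "decomposition G H f fM \<alpha> m a \<xi> \<longleftrightarrow>
     (\<forall>i<m. smooth_map (atlas G) real_atlas (units G) (a i) \<and> algebroid_section H (\<xi> i)) \<and>
     (\<forall>x\<in>units G. snd (f (x, \<alpha> x)) = (\<Sum>i<m. a i x *\<^sub>R \<xi> i (fM x)))"

text \<open>Morphisms of Lie algebroids over different bases, in the sense of Higgins and Mackenzie: the
  bracket condition is expressed through decompositions of the images of sections.\<close>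

definition algebroid_morphism ::
  "('g, 'e::real_normed_vector) local_groupoid \<Rightarrow> ('h, 'd::real_normed_vector) local_groupoid \<Rightarrow>
   ('g \<times> 'e \<Rightarrow> 'h \<times> 'd) \<Rightarrow> ('g \<Rightarrow> 'h) \<Rightarrow> bool" where
  "algebroid_morphism G H f fM \<longleftrightarrow>
     smooth_map (atlas G) (atlas H) (units G) fM \<and> fM ` units G \<subseteq> units H \<and>
     smooth_map (tangent_atlas (atlas G)) (tangent_atlas (atlas H)) (algebroid G) f \<and>
     f ` algebroid G \<subseteq> algebroid H \<and>
     (\<forall>(x, a)\<in>algebroid G. fst (f (x, a)) = fM x) \<and>
     (\<forall>x a b r s. (x, a) \<in> algebroid G \<longrightarrow> (x, b) \<in> algebroid G \<longrightarrow>
        snd (f (x, r *\<^sub>R a + s *\<^sub>R b)) = r *\<^sub>R snd (f (x, a)) + s *\<^sub>R snd (f (x, b))) \<and>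
     (\<forall>(x, a)\<in>algebroid G.
        anchor H (fM x) (snd (f (x, a)))
          = derivative_along (atlas G) (atlas H) (units G) fM x (anchor G x a)) \<and>
     (\<forall>\<alpha> \<beta> m a \<xi> n b \<eta>.
        algebroid_section G \<alpha> \<longrightarrow> algebroid_section G \<beta> \<longrightarrow>
        decomposition G H f fM \<alpha> m a \<xi> \<longrightarrow> decomposition G H f fM \<beta> n b \<eta> \<longrightarrow>
        (\<forall>x\<in>units G.
           snd (f (x, algebroid_bracket G \<alpha> \<beta> x)) =
             (\<Sum>i<m. \<Sum>j<n. (a i x * b j x) *\<^sub>R algebroid_bracket H (\<xi> i) (\<eta> j) (fM x)) +
             (\<Sum>j<n. anchor_derivative G \<alpha> (b j) x *\<^sub>R \<eta> j (fM x)) -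
             (\<Sum>i<m. anchor_derivative G \<beta> (a i) x *\<^sub>R \<xi> i (fM x))))"

definition integrates ::
  "('g, 'e::real_normed_vector) local_groupoid \<Rightarrow> ('h, 'd::real_normed_vector) local_groupoid \<Rightarrow>
   ('g \<Rightarrow> 'h) \<Rightarrow> ('g \<times> 'e \<Rightarrow> 'h \<times> 'd) \<Rightarrow> bool" where
  "integrates G H F f \<longleftrightarrow>
     (\<forall>(x, a)\<in>algebroid G. (F x, differential (atlas G) (atlas H) F x a) = f (x, a))"


section \<open>Maurer-Cartan form and tubular structures\<close>

text \<open>The set of arrows \<open>g\<close> at which the formula for the Maurer-Cartan form makes sense.\<close>

definition mc_dom :: "('g, 'e) local_groupoid \<Rightarrow> 'g set" where
  "mc_dom G = {g \<in> tgt_dom G \<inter> inv_dom G. (g, invg G g) \<in> mul_dom G \<and> mul G g (invg G g) = tgt G g}"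

text \<open>The argument \<open>v\<close> is a tangent vector at \<open>g\<close> to the source fibre through \<open>g\<close>.\<close>

definition mc_form ::
  "('g, 'e::real_normed_vector) local_groupoid \<Rightarrow> 'g \<Rightarrow> 'e \<Rightarrow> 'g \<times> 'e" where
  "mc_form G g v =
     (tgt G g,
      derivative_along (atlas G) (atlas G) {h \<in> gspace G. src G h = src G g}
        (\<lambda>h. mul G h (invg G g)) g v)"

definition tubular_structure ::
  "('g, 'e::real_normed_vector) local_groupoid \<Rightarrow> ('g \<times> 'e) set \<Rightarrow> ('g \<times> 'e \<Rightarrow> 'g) \<Rightarrow> bool" where
  "tubular_structure G E \<phi> \<longleftrightarrow>
     openin (subtopology (mfd_top (tangent_atlas (atlas G))) (algebroid G)) E \<and>
     (\<forall>x\<in>units G. (x, 0) \<in> E) \<and>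
     smooth_map (tangent_atlas (atlas G)) (atlas G) E \<phi> \<and> inj_on \<phi> E \<and>
     openin (gtop G) (\<phi> ` E) \<and>
     smooth_map (atlas G) (tangent_atlas (atlas G)) (\<phi> ` E) (inv_into E \<phi>) \<and>
     (\<forall>(x, a)\<in>E. src G (\<phi> (x, a)) = x) \<and>
     (\<forall>x\<in>units G. \<phi> (x, 0) = x) \<and>
     (\<forall>(x, a)\<in>algebroid G. velocity (atlas G) UNIV (\<lambda>t. \<phi> (x, t *\<^sub>R a)) 0 = a)"


definition scale_dom :: "('g \<times> 'e::real_normed_vector) set \<Rightarrow> ('g \<times> 'e \<Rightarrow> 'g) \<Rightarrow> (real \<times> 'g) set" where
  "scale_dom E \<phi> = {(t, g). g \<in> \<phi> ` E \<and> (let (x, a) = inv_into E \<phi> g in (x, t *\<^sub>R a) \<in> E)}"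

definition scale ::
  "('g \<times> 'e::real_normed_vector) set \<Rightarrow> ('g \<times> 'e \<Rightarrow> 'g) \<Rightarrow> real \<Rightarrow> 'g \<Rightarrow> 'g" where
  "scale E \<phi> t g = (let (x, a) = inv_into E \<phi> g in \<phi> (x, t *\<^sub>R a))"

definition mc_solution ::
  "('g, 'e::real_normed_vector) local_groupoid \<Rightarrow> ('h, 'd::real_normed_vector) local_groupoid \<Rightarrow>
   ('g \<times> 'e \<Rightarrow> 'h \<times> 'd) \<Rightarrow> ('g \<Rightarrow> 'h) \<Rightarrow> ('g \<times> 'e) set \<Rightarrow> ('g \<times> 'e \<Rightarrow> 'g) \<Rightarrow>
   'g \<Rightarrow> (real \<Rightarrow> 'h) \<Rightarrow> bool" where
  "mc_solution G H f fM E \<phi> g k \<longleftrightarrow>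
     smooth_map real_atlas (atlas H) {0..1} k \<and> k 0 = fM (src G g) \<and>
     (\<forall>t\<in>{0..1}.
        src H (k t) = fM (src G g) \<and>
        k t \<in> mc_dom H \<and> (t, g) \<in> scale_dom E \<phi> \<and> scale E \<phi> t g \<in> mc_dom G \<and>
        mc_form H (k t) (velocity (atlas H) {0..1} k t)
          = f (mc_form G (scale E \<phi> t g) (velocity (atlas G) {0..1} (\<lambda>s. scale E \<phi> s g) t)))"

end

theory Submission
  imports Defs
begin

text \<open>In a chart around a unit in which the source map is a linear projection, the multiplication yields
 right-invariant vector fields \<open>X\<close> and the Maurer-Cartan form \<open>th\<close>, and an integration \<open>F\<close> of \<open>f\<close> is
 characterised by the total differential equation \<open>th(dF) = f(th)\<close> along the source fibres. Restricted to the
 rays \<open>t g\<close> this is an ordinary differential equation, which is solved with smooth dependence on \<open>g\<close>.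
 Compatibility of \<open>f\<close> with the brackets is the integrability condition of the total equation: it makes the
 failure of the radial solution to satisfy that equation solve a homogeneous linear equation along
 each ray, and so vanish. Both \<open>g \<mapsto> F(g h)\<close> and \<open>g \<mapsto> F(g) F(h)\<close> then solve the same total equation along
 the source fibre with the same value at the unit, hence agree. Uniqueness is that of Maurer-Cartan
 curves, and it also lets the solutions in different charts be glued after shrinking their domains so
 that overlapping domains lie in a common chart.\<close>

\<comment> \<open>A local map carries no fixed domain, so every coordinate statement is a germ
  statement \<open>near z ~ 0\<close> in a chart centred at a unit. The units are the fixed points
  of the projection, and maps known only on units or on composable pairs are extended smoothly to
  full neighbourhoods.

  Existence integrates along the rays of such a chart, not along those of the given tubular
  structure. The formula for an arbitrary tubular structure comes afterwards: the equation for
  \<open>F\<close> holds in all directions tangent to the source fibres, hence also along t g.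

  The equation must be solved up to time 1. Its right side is linear in the velocity of the ray, so
  it is a contraction for short rays. The same contraction argument, with the identity in place of
  the integral, gives the inverse function theorem that straightens the source map.

  Two obstacles shape the rest. The bracket hypothesis speaks of global sections and decompositions,
  so constant sections have to be cut off. And solutions in different charts must be compared
  without coordinates, which is the purpose of \<open>mc_at\<close>.\<close>
syntax "_near" :: "pttrn => 'a => bool => bool" ("(3near _ ~ _./ _)" [0, 51, 10] 10)
translations "near x ~ a. R" == "CONST eventually (%x. R) (CONST nhds a)"

notation scaleR (infixr "*." 75)
  and has_vector_derivative (infix "hvd" 50)
  and has_derivative (infix "hder" 50)

lemmas near_self = eventually_nhds_x_imp_x
  and near_open_set = eventually_nhds_in_open

section \<open>Orthonormal bases and completeness of model spaces\<close>

definition mb :: "'a::model_space set" where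
 "mb = (SOME B. finite B & (ALL u:B. ALL v:B. inner u v = (if u = v then 1 else 0)) &
    (ALL x. (ALL u:B. inner x u = 0) --> x = 0))"

lemma mb_orthonormal:
 "finite (mb :: 'a::model_space set) & (ALL u:mb. ALL v:mb. inner u v = (if u = (v::'a) then 1 else 0)) &
  (ALL x::'a. (ALL u:mb. inner x u = 0) --> x = 0)"
 unfolding mb_def by (rule someI_ex) (rule ex_finite_orthonormal_basis)

lemma
 shows finite_mb [simp, intro]: "finite (mb :: 'a::model_space set)"
  and inner_mb: "u : mb ==> v : mb ==> inner u v = (if u = (v::'a) then 1 else 0)"
  and mb_zero: "(!!u. u : mb ==> inner (x::'a) u = 0) ==> x = 0"
 using mb_orthonormal[where ?'a='a] by blast+

text \<open>The difference of the two sides is orthogonal to \<open>mb\<close>, hence zero.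
  Finite-dimensionality enters later arguments through this expansion: a linear map, or a family of
  them, is controlled by its values on the finite set \<open>mb\<close>.\<close>

lemma mb_rep: "(SUM b:mb. inner x b *. b) = (x::'a::model_space)"
proof -
 have "x - (SUM b:mb. inner x b *. b) = 0"
 proof (rule mb_zero)
  fix u :: 'a assume u: "u : mb"
  have "inner (SUM b:mb. inner x b *. b) u = (SUM b:mb. if b = u then inner x u else 0)"
   unfolding inner_sum_left using u by (intro sum.cong) (auto simp: inner_mb)
  also have "\<dots> = inner x u" using u by simp
  finally show "inner (x - (SUM b:mb. inner x b *. b)) u = 0" by (simp add: inner_diff_left)
 qed
 thus ?thesis by simp
qed

lemma norm_mb: "b : mb ==> norm b = 1"
 by (simp add: norm_eq_sqrt_inner inner_mb)

lemma mb_nonzero: "b : mb ==> b ~= 0"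
 using norm_mb by force

lemma lin_mb_sum:
 assumes "linear f" shows "f x = (SUM b:mb. inner x b *. f (b::'a::model_space))"
proof -
 have "f x = f (SUM b:mb. inner x b *. b)" by (simp add: mb_rep)
 also have "\<dots> = (SUM b:mb. inner x b *. f b)"
  using assms by (simp add: linear_sum linear_scale)
 finally show ?thesis .
qed

lemma linear_norm_le:
 assumes "linear f" shows "norm (f x) <= (SUM b:mb. norm (f (b::'a::model_space))) * norm x"
proof -
 have "norm (f x) <= (SUM b:mb. norm (inner x b *. f b))"
  by (subst lin_mb_sum[OF assms]) (rule norm_sum)
 also have "\<dots> <= (SUM b:mb. norm x * norm (f b))"
 proof (rule sum_mono)
  fix b :: 'a assume "b : mb"
  hence "\<bar>inner x b\<bar> <= norm x" using Cauchy_Schwarz_ineq2[of x b] by (simp add: norm_mb)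
  thus "norm (inner x b *. f b) <= norm x * norm (f b)" by (simp add: mult_right_mono)
 qed
 finally show ?thesis by (simp add: sum_distrib_left mult.commute)
qed

lemma linear_imp_bounded_linear:
 fixes f :: "'a::model_space => 'b::real_normed_vector"
 assumes "linear f" shows "bounded_linear f"
proof -
 interpret linear f by fact
 show ?thesis
  by standard (metis linear_norm_le[OF assms] mult.commute)
qed

text \<open>Each coordinate of a Cauchy sequence converges, and the sequence is a finite sum of its
  coordinate parts. Completeness is needed for the uniform limits and the integrals in the fixed
  point argument.\<close>

instance model_space \<subseteq> banach
proof
 fix X :: "nat => 'a" assume X: "Cauchy X"
 have "convergent (%n. inner (X n) b *. b)" for b
 proof -
  have "Cauchy (%n. inner (X n) b)"
   by (rule bounded_linear.Cauchy[OF bounded_linear_inner_left X])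
  then obtain l where "(%n. inner (X n) b) \<longlonglongrightarrow> l"
   using real_Cauchy_convergent convergent_def by blast
  thus ?thesis unfolding convergent_def by (intro exI[of _ "l *. b"] tendsto_intros)
 qed
 hence "ALL b. EX l. (%n. inner (X n) b *. b) \<longlonglongrightarrow> l" by (simp add: convergent_def)
 then obtain l where l: "!!b. (%n. inner (X n) b *. b) \<longlonglongrightarrow> l b" by metis
 have "(%n. SUM b:mb. inner (X n) b *. b) \<longlonglongrightarrow> (SUM b:mb. l b)"
  by (intro tendsto_sum l)
 thus "convergent X" unfolding mb_rep convergent_def by blast
qed

instance prod :: (model_space, model_space) model_space
proof
 let ?B = "(%b. (b, 0)) ` (mb::'a set) \<union> (%b. (0, b)) ` (mb::'b set)"
 show "EX B::('a\<times>'b) set. finite B & (ALL u:B. ALL v:B. inner u v = (if u = v then 1 else 0)) &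
    (ALL x. (ALL u:B. inner x u = 0) --> x = 0)"
 proof (intro exI[of _ ?B] conjI allI impI)
  show "ALL u:?B. ALL v:?B. inner u v = (if u = v then 1 else 0)"
   by (auto dest: mb_nonzero simp: inner_mb inner_prod_def split: if_splits)
  fix x :: "'a \<times> 'b" assume x: "ALL u:?B. inner x u = 0"
  have "fst x = 0" by (rule mb_zero) (use x in \<open>auto simp: ball_Un inner_prod_def\<close>)
  moreover have "snd x = 0" by (rule mb_zero) (use x in \<open>auto simp: ball_Un inner_prod_def\<close>)
  ultimately show "x = 0" by (simp add: prod_eq_iff)
 qed auto
qed

text \<open>Only the parameter is differentiated. With respect to time a solution is merely
  continuous, jointly with all its parameter derivatives up to order k. The derivative is an
  existential witness, so that the usual derivative rules can supply it in the closure
  lemmas.\<close>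

primrec pCk :: "nat => real set => 'p::real_normed_vector set => (real => 'p => 'b::real_normed_vector) => bool" where
 "pCk 0 T W z \<longleftrightarrow> continuous_on (T \<times> W) (%(t, p). z t p)"
| "pCk (Suc k) T W z \<longleftrightarrow> continuous_on (T \<times> W) (%(t, p). z t p) &
  (EX z'. (ALL t:T. ALL p:W. (z t hder z' t p) (at p)) & (ALL v. pCk k T W (%t p. z' t p v)))"

lemma pCk_SucI:
 assumes "continuous_on (T \<times> W) (%(t, p). z t p)"
  and "!!t p. t : T ==> p : W ==> (z t hder z' t p) (at p)"
  and "!!v. pCk k T W (%t p. z' t p v)"
 shows "pCk (Suc k) T W z"
 using assms by auto

lemma pCk_SucE:
 assumes "pCk (Suc k) T W z"
 obtains z' where "!!t p. t : T ==> p : W ==> (z t hder z' t p) (at p)"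
  and "!!v. pCk k T W (%t p. z' t p v)"
 using assms by auto

lemma pCk_cont: "pCk k T W z ==> continuous_on (T \<times> W) (%(t, p). z t p)"
 by (cases k) auto

lemma pCk_cong:
 assumes "open W" "!!t p. t : T ==> p : W ==> z t p = y t p" "pCk k T W z"
 shows "pCk k T W y"
proof -
 have c: "continuous_on (T \<times> W) (%(t, p). y t p)"
  by (subst continuous_on_cong[OF refl, of _ _ "%(t, p). z t p"])
   (use assms pCk_cont in auto)
 show ?thesis
 proof (cases k)
  case (Suc j)
  with assms(3) obtain z' where z': "!!t p. t : T ==> p : W ==> (z t hder z' t p) (at p)"
   "!!v. pCk j T W (%t p. z' t p v)" by auto
  have "(y t hder z' t p) (at p)" if "t : T" "p : W" for t p
   by (rule has_derivative_transform_within_open[OF z'(1)[OF that] assms(1) that(2)]) (use that assms(2) in auto)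
  thus ?thesis unfolding Suc using c z'(2) by (intro pCk_SucI) auto
 qed (use c in simp)
qed

lemma pCk_Suc_imp: "pCk (Suc k) T W z ==> pCk k T W z"
proof (induction k arbitrary: z)
 case (Suc k)
 obtain z' where z': "!!t p. t : T ==> p : W ==> (z t hder z' t p) (at p)"
   "!!v. pCk (Suc k) T W (%t p. z' t p v)" using pCk_SucE[OF Suc.prems(1)] by blast
 show ?case by (rule pCk_SucI[OF pCk_cont[OF Suc.prems] z'(1) Suc.IH[OF z'(2)]])
qed (auto intro: pCk_cont)

lemma pCk_subset: "pCk k T W z ==> T' \<subseteq> T ==> W' \<subseteq> W ==> pCk k T' W' z"
proof (induction k arbitrary: z)
 case 0 thus ?case by (auto elim!: continuous_on_subset)
next
 case (Suc k)
 obtain z' where z': "!!t p. t : T ==> p : W ==> (z t hder z' t p) (at p)"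
   "!!v. pCk k T W (%t p. z' t p v)" using pCk_SucE[OF Suc.prems(1)] by blast
 have "continuous_on (T' \<times> W') (%(t, p). z t p)"
  by (rule continuous_on_subset[OF pCk_cont[OF Suc.prems(1)]]) (use Suc.prems in auto)
 moreover have "!!v. pCk k T' W' (%t p. z' t p v)" using Suc.IH z'(2) Suc.prems by blast
 ultimately show ?case using Suc.prems(2,3) by (intro pCk_SucI[of _ _ _ z'] z'(1)) auto
qed

lemma pCk_const:
 fixes c :: "real => 'b::real_normed_vector"
 shows "continuous_on T c ==> pCk k T W (%t p. c t)"
proof (induction k arbitrary: c)
 case 0
 thus ?case by (auto simp: split_def intro!: continuous_on_compose2[of T c _ fst] continuous_intros)
next
 case (Suc k)
 have "continuous_on (T \<times> W) (%(t, p). c t)"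
  using Suc.prems by (auto simp: split_def intro!: continuous_on_compose2[of T c _ fst] continuous_intros)
 moreover have "pCk k T W (%t p. 0 :: 'b)" by (rule Suc.IH[of "%_. 0"]) (intro continuous_intros)
 ultimately show ?case by (intro pCk_SucI[of _ _ _ "%t p v. 0"]) auto
qed

lemma pCk_linear:
 assumes "bounded_linear L" shows "pCk k T W (%t p. L p)"
proof -
 have c: "continuous_on (T \<times> W) (%(t, p). L p)"
  unfolding split_def by (intro bounded_linear.continuous_on[OF assms] continuous_intros)
 show ?thesis
 proof (cases k)
  case (Suc j)
  show ?thesis unfolding Suc
   by (rule pCk_SucI[OF c bounded_linear_imp_has_derivative[OF assms]]) (intro pCk_const continuous_intros)
 qed (use c in simp)
qed

lemma pCk_linear_image:
 assumes "bounded_linear L" "pCk k T W z" shows "pCk k T W (%t p. L (z t p))"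
 using assms(2)
proof (induction k arbitrary: z)
 case 0
 thus ?case using bounded_linear.continuous_on[OF assms(1), of "T \<times> W" "%(t, p). z t p"]
  by (simp add: split_def)
next
 case (Suc k)
 obtain z' where z': "!!t p. t : T ==> p : W ==> (z t hder z' t p) (at p)"
   "!!v. pCk k T W (%t p. z' t p v)" using pCk_SucE[OF Suc.prems(1)] by blast
 have "continuous_on (T \<times> W) (%(t, p). L (z t p))"
  using bounded_linear.continuous_on[OF assms(1) pCk_cont[OF Suc.prems]] by (simp add: split_def)
 thus ?case using z' Suc.IH
  by (intro pCk_SucI[of _ _ _ "%t p v. L (z' t p v)"]) (auto intro: bounded_linear.has_derivative[OF assms(1)])
qed

lemma pCk_add: "pCk k T W z ==> pCk k T W y ==> pCk k T W (%t p. z t p + y t p)"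
proof (induction k arbitrary: z y)
 case 0 thus ?case by (auto simp: split_def intro!: continuous_intros)
next
 case (Suc k)
 obtain z' where z': "!!t p. t : T ==> p : W ==> (z t hder z' t p) (at p)"
   "!!v. pCk k T W (%t p. z' t p v)" using pCk_SucE[OF Suc.prems(1)] by blast
 obtain y' where y': "!!t p. t : T ==> p : W ==> (y t hder y' t p) (at p)"
   "!!v. pCk k T W (%t p. y' t p v)" using pCk_SucE[OF Suc.prems(2)] by blast
 have "continuous_on (T \<times> W) (%(t, p). z t p + y t p)"
  using continuous_on_add[OF pCk_cont[OF Suc.prems(1)] pCk_cont[OF Suc.prems(2)]]
  by (simp add: split_def)
 thus ?case using z' y' Suc.IH
  by (intro pCk_SucI[of _ _ _ "%t p v. z' t p v + y' t p v"]) (auto intro: has_derivative_add)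
qed

lemma pCk_bilinear:
 assumes "bounded_bilinear B"
 shows "pCk k T W z ==> pCk k T W y ==> pCk k T W (%t p. B (z t p) (y t p))"
proof (induction k arbitrary: z y)
 case 0 thus ?case by (auto simp: split_def intro!: bounded_bilinear.continuous_on[OF assms])
next
 case (Suc k)
 obtain z' where z': "!!t p. t : T ==> p : W ==> (z t hder z' t p) (at p)"
   "!!v. pCk k T W (%t p. z' t p v)" using pCk_SucE[OF Suc.prems(1)] by blast
 obtain y' where y': "!!t p. t : T ==> p : W ==> (y t hder y' t p) (at p)"
   "!!v. pCk k T W (%t p. y' t p v)" using pCk_SucE[OF Suc.prems(2)] by blast
 have "continuous_on (T \<times> W) (%(t, p). B (z t p) (y t p))"
  using bounded_bilinear.continuous_on[OF assms pCk_cont[OF Suc.prems(1)] pCk_cont[OF Suc.prems(2)]]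
  by (simp add: split_def)
 thus ?case
  by (rule pCk_SucI[OF _ bounded_bilinear.FDERIV[OF assms z'(1) y'(1)]])
   (assumption+, intro pCk_add Suc.IH z'(2) y'(2) pCk_Suc_imp[OF Suc.prems(1)] pCk_Suc_imp[OF Suc.prems(2)])
qed

lemma pCk_sum:
 assumes "!!i. i : I ==> pCk k T W (z i)" shows "pCk k T W (%t p. SUM i:I. z i t p)"
 using assms
proof (induction I rule: infinite_finite_induct)
 case (insert x F) thus ?case by (auto intro!: pCk_add)
qed (auto intro!: pCk_const continuous_intros)

lemma pCk_Pair: "pCk k T W z ==> pCk k T W y ==> pCk k T W (%t p. (z t p, y t p))"
 using pCk_add[OF pCk_linear_image[of "%x. (x, 0)" k T W z] pCk_linear_image[of "%x. (0, x)" k T W y]]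
 by (simp add: bounded_linear_Pair bounded_linear_ident)

section \<open>The predicate \<open>Ck_on\<close> and smooth maps on open sets\<close>

lemma Ck_on_continuous: "Ck_on k S f ==> continuous_on S f"
 by (cases k) (auto intro!: differentiable_imp_continuous_on simp: differentiable_on_def differentiable_at_withinI)

lemma Ck_on_has_derivative:
 "Ck_on (Suc k) S f ==> x : S ==> (f hder frechet_derivative f (at x)) (at x)"
 by (auto simp: frechet_derivative_works)

lemma has_derivative_expand:
 fixes f :: "'a::model_space => 'b::real_normed_vector"
 assumes "(f hder f') F" shows "f' v = (SUM b:mb. inner v b *. f' b)"
 by (intro lin_mb_sum has_derivative_linear[OF assms])

lemma Ck_on_cong:
 assumes "open S"
 shows "(!!x. x : S ==> f x = g x) ==> Ck_on k S f ==> Ck_on k S g"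
proof (induction k arbitrary: f g)
 case 0 thus ?case using continuous_on_cong[of S S f g] by auto
next
 case (Suc k)
 have d: "(g hder frechet_derivative f (at x)) (at x)" if "x : S" for x
  by (rule has_derivative_transform_within_open[OF Ck_on_has_derivative[OF Suc.prems(2) that] assms(1) that])
   (rule Suc.prems(1))
 have "frechet_derivative f (at x) v = frechet_derivative g (at x) v" if "x : S" for x v
  using frechet_derivative_at[OF d[OF that]] by metis
 moreover have "Ck_on k S (%x. frechet_derivative f (at x) v)" for v using Suc.prems(2) by simp
 ultimately have "Ck_on k S (%x. frechet_derivative g (at x) v)" for v by (rule Suc.IH)
 moreover have "ALL x:S. g differentiable (at x)" using d by (blast intro: differentiableI)
 ultimately show ?case by simp
qed

lemma Ck_on_imp_pCk: "Ck_on k S f ==> pCk k T S (%_. f)"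
proof (induction k arbitrary: f)
 case 0 thus ?case by (auto simp: split_def intro!: continuous_on_compose2[of S f _ snd] continuous_intros)
next
 case (Suc k)
 have "continuous_on (T \<times> S) (%(t, p). f p)"
  using Ck_on_continuous[OF Suc.prems]
  by (auto simp: split_def intro!: continuous_on_compose2[of S f _ snd] continuous_intros)
 thus ?case
 proof (rule pCk_SucI)
  show "(f hder frechet_derivative f (at x)) (at x)" if "x : S" for x
   by (rule Ck_on_has_derivative[OF Suc.prems that])
  show "pCk k T S (%t p. frechet_derivative f (at p) v)" for v
   using Suc.prems by (intro Suc.IH) simp
 qed
qed

lemma pCk_imp_Ck_on:
 assumes "open S" "t : T" shows "pCk k T S z ==> Ck_on k S (z t)"
proof (induction k arbitrary: z)
 case 0
 hence "continuous_on S ((%(t, p). z t p) \<circ> (%p. (t, p)))"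
  using assms(2) by (intro continuous_on_compose continuous_intros) (auto elim!: continuous_on_subset)
 thus ?case by (simp add: o_def)
next
 case (Suc k)
 obtain z' where z': "!!t p. t : T ==> p : S ==> (z t hder z' t p) (at p)"
   "!!v. pCk k T S (%t p. z' t p v)" using pCk_SucE[OF Suc.prems(1)] by blast
 have "frechet_derivative (z t) (at x) = z' t x" if "x : S" for x
  using frechet_derivative_at[OF z'(1)[OF assms(2) that]] by simp
 hence "Ck_on k S (%x. frechet_derivative (z t) (at x) v)" for v
  by (intro Ck_on_cong[OF assms(1) _ Suc.IH[OF z'(2)]]) auto
 moreover have "ALL x:S. z t differentiable (at x)" using z'(1) assms(2) by (blast intro: differentiableI)
 ultimately show ?case by simp
qed

lemma pCk_pcompose:
 fixes h :: "real => 'a::model_space => 'b::real_normed_vector"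
 assumes "open W"
 shows "pCk k T W f ==> (!!t p. t : T ==> p : W ==> f t p : S) ==> pCk k T S h ==>
  pCk k T W (%t p. h t (f t p))"
proof (induction k arbitrary: h)
 case (0 h)
 have "continuous_on (T \<times> W) (%q. (fst q, f (fst q) (snd q)))"
  using pCk_cont[OF 0(1)] by (auto simp: split_def intro!: continuous_intros)
 hence "continuous_on (T \<times> W) (%q. case (fst q, f (fst q) (snd q)) of (t, p) => h t p)"
  by (rule continuous_on_compose2[OF pCk_cont[OF 0(3)]]) (use 0(2) in auto)
 thus ?case by (simp add: split_def)
next
 case (Suc k h)
 obtain f' where f': "!!t p. t : T ==> p : W ==> (f t hder f' t p) (at p)"
   "!!v. pCk k T W (%t p. f' t p v)" using pCk_SucE[OF Suc.prems(1)] by blast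
 obtain h' where h': "!!t p. t : T ==> p : S ==> (h t hder h' t p) (at p)"
   "!!v. pCk k T S (%t p. h' t p v)" using pCk_SucE[OF Suc.prems(3)] by blast
 have h: "(h t hder h' t (f t p)) (at (f t p))" if "t : T" "p : W" for t p
  by (rule h'(1)[OF that(1) Suc.prems(2)[OF that]])
 have c: "continuous_on (T \<times> W) (%(t, p). h t (f t p))"
 proof -
  have "continuous_on (T \<times> W) (%q. (fst q, f (fst q) (snd q)))"
   using pCk_cont[OF Suc.prems(1)] by (auto simp: split_def intro!: continuous_intros)
  hence "continuous_on (T \<times> W) (%q. case (fst q, f (fst q) (snd q)) of (t, p) => h t p)"
   by (rule continuous_on_compose2[OF pCk_cont[OF Suc.prems(3)]]) (use Suc.prems(2) in auto)
  thus ?thesis by (simp add: split_def)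
 qed
 show ?case
 proof (rule pCk_SucI[OF c, of "%t p v. h' t (f t p) (f' t p v)"])
  fix t p assume "t : T" "p : W"
  thus "((%p. h t (f t p)) hder (%v. h' t (f t p) (f' t p v))) (at p)"
   using has_derivative_compose[OF f'(1) h] by blast
 next
  fix v
  \<comment> \<open>The direction \<open>f' t p v\<close> varies with \<open>p\<close>, while
    \<open>pCk\<close> only speaks of derivatives in fixed directions; expanding over
    \<open>mb\<close> separates the two.\<close>
  have "pCk k T W (%t p. SUM b:mb. inner (f' t p v) b *. h' t (f t p) b)"
  proof (intro pCk_sum pCk_bilinear[OF bounded_bilinear_scaleR] pCk_linear_image[OF bounded_linear_inner_left] f'(2))
   fix b
   show "pCk k T W (%t p. h' t (f t p) b)"
    by (rule Suc.IH[OF pCk_Suc_imp[OF Suc.prems(1)] Suc.prems(2) h'(2)])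
  qed
  thus "pCk k T W (%t p. h' t (f t p) (f' t p v))"
   by (rule pCk_cong[OF assms(1), rotated]) (rule has_derivative_expand[OF h, symmetric])
 qed
qed

lemma pCk_compose:
 fixes h :: "'a::model_space => 'b::real_normed_vector"
 assumes "open W" "pCk k T W f" "!!t p. t : T ==> p : W ==> f t p : S" "Ck_on k S h"
 shows "pCk k T W (%t p. h (f t p))"
 by (rule pCk_pcompose[OF assms(1-3) Ck_on_imp_pCk[OF assms(4)]])

text \<open>With the one-point time set \<open>{0}\<close> the calculus of \<open>pCk\<close>
  becomes that of smooth maps, so each closure rule is proved only once.\<close>

lemma smooth_on_iff_pCk: "open S ==> smooth_on S f \<longleftrightarrow> (ALL k. pCk k {0} S (%_. f))"
 unfolding smooth_on_def using Ck_on_imp_pCk pCk_imp_Ck_on[of S 0 "{0}" _ "%_. f"] by blast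

lemma smooth_on_cong: "open S ==> (!!x. x : S ==> f x = g x) ==> smooth_on S f ==> smooth_on S g"
 unfolding smooth_on_def using Ck_on_cong by blast

lemma smooth_on_subset: "smooth_on S f ==> open S ==> open S' ==> S' \<subseteq> S ==> smooth_on S' f"
 by (auto simp: smooth_on_iff_pCk intro: pCk_subset)

lemma smooth_on_compose:
 fixes h :: "'a::model_space => 'b::real_normed_vector"
 assumes "open W" "smooth_on S h" "smooth_on W f" "!!x. x : W ==> f x : S"
 shows "smooth_on W (%x. h (f x))"
 using assms pCk_compose[OF assms(1), of _ "{0}" "%_. f" S h] by (simp add: smooth_on_iff_pCk smooth_on_def[of S])

lemma smooth_on_const: "open S ==> smooth_on S (%x. c)"
 by (simp add: smooth_on_iff_pCk pCk_const)

lemma smooth_on_linear: "open S ==> bounded_linear L ==> smooth_on S (%x. L x)"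
 by (simp add: smooth_on_iff_pCk pCk_linear)

lemma smooth_on_id: "open S ==> smooth_on S (%x. x)"
 by (rule smooth_on_linear[OF _ bounded_linear_ident])

lemma smooth_on_linear_image: "open S ==> bounded_linear L ==> smooth_on S f ==> smooth_on S (%x. L (f x))"
 using pCk_linear_image[of L _ "{0}" S "%_. f"] by (simp add: smooth_on_iff_pCk)

lemma smooth_on_add: "open S ==> smooth_on S f ==> smooth_on S g ==> smooth_on S (%x. f x + g x)"
 by (simp add: smooth_on_iff_pCk pCk_add)

lemma smooth_on_minus: "open S ==> smooth_on S f ==> smooth_on S (%x. - f x)"
 by (rule smooth_on_linear_image[OF _ bounded_linear_minus[OF bounded_linear_ident]])

lemma smooth_on_diff: "open S ==> smooth_on S f ==> smooth_on S g ==> smooth_on S (%x. f x - g x)"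
 using smooth_on_add[OF _ _ smooth_on_minus, of S f g] by simp

lemma smooth_on_bilinear:
 "bounded_bilinear B ==> open S ==> smooth_on S f ==> smooth_on S g ==> smooth_on S (%x. B (f x) (g x))"
 using pCk_bilinear[of B _ "{0}" S "%_. f" "%_. g"] by (simp add: smooth_on_iff_pCk)

lemmas smooth_on_scaleR = smooth_on_bilinear[OF bounded_bilinear_scaleR]
 and smooth_on_inner = smooth_on_bilinear[OF bounded_bilinear_inner]
 and smooth_on_mult = smooth_on_bilinear[OF bounded_bilinear_mult]

lemma smooth_on_Pair: "open S ==> smooth_on S f ==> smooth_on S g ==> smooth_on S (%x. (f x, g x))"
 by (simp add: smooth_on_iff_pCk pCk_Pair)

lemma smooth_on_snd: "open S ==> smooth_on S f ==> smooth_on S (%x. snd (f x))"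
 by (rule smooth_on_linear_image[OF _ bounded_linear_snd])

lemma smooth_on_continuous: "smooth_on S f ==> continuous_on S f"
 unfolding smooth_on_def using Ck_on_continuous by blast

lemma smooth_on_has_derivative:
 "smooth_on S f ==> x : S ==> (f hder frechet_derivative f (at x)) (at x)"
 unfolding smooth_on_def using Ck_on_has_derivative by blast

lemma smooth_on_frechet: "smooth_on S f ==> smooth_on S (%x. frechet_derivative f (at x) v)"
 unfolding smooth_on_def
proof
 fix k assume "ALL k. Ck_on k S f"
 hence "Ck_on (Suc k) S f" by blast
 thus "Ck_on k S (%x. frechet_derivative f (at x) v)" by simp
qed

lemma smooth_onI_local:
 assumes "!!x. x : S ==> EX U. open U & x : U & smooth_on U f" "open S"
 shows "smooth_on S f"
proof -
 have "Ck_on k S f" if "!!x. x : S ==> EX U. open U & x : U & Ck_on k U f" for k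
  using that
 proof (induction k arbitrary: f)
  case 0
  have "isCont f x" if "x : S" for x
   using 0[OF that] continuous_on_eq_continuous_at by auto
  thus ?case by (simp add: continuous_at_imp_continuous_on)
 next
  case (Suc k)
  have "f differentiable (at x)" if "x : S" for x using Suc.prems[OF that] by auto
  moreover have "Ck_on k S (%x. frechet_derivative f (at x) v)" for v
   by (rule Suc.IH) (use Suc.prems in fastforce)
  ultimately show ?case by simp
 qed
 thus ?thesis using assms(1) unfolding smooth_on_def by blast
qed

section \<open>Estimates that are uniform over the compact time interval\<close>

lemma uniform_in_parameter:
 fixes u :: "real => 'p::metric_space => 'b::metric_space"
 assumes "continuous_on ({0..1} \<times> W) (%(t, p). u t p)" "open W" "p : W" "ep > 0"
 obtains de where "de > 0" "ball p de \<subseteq> W"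
  "!!t x. t : {0..1} ==> x : ball p de ==> dist (u t x) (u t p) <= ep"
proof -
 have c: "continuous_on (W \<times> {0..1}) (%q. u (snd q) (fst q))"
 proof -
  have "continuous_on (W \<times> {0..1}) (%q. case (snd q, fst q) of (t, p) => u t p)"
   by (rule continuous_on_compose2[OF assms(1)]) (auto intro!: continuous_intros)
  thus ?thesis by simp
 qed
 obtain X0 where X0: "p : X0" "open X0"
  "ALL x:X0 \<inter> W. ALL t:{0..1}. dist (u (snd (x, t)) (fst (x, t))) (u (snd (p, t)) (fst (p, t))) <= ep"
  by (rule continuous_on_prod_compactE[OF c compact_Icc assms(3,4)])
 have "open (X0 \<inter> W)" "p : X0 \<inter> W" using X0 assms by auto
 then obtain de where de: "de > 0" "ball p de \<subseteq> X0 \<inter> W" by (rule openE)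
 show ?thesis
 proof (rule that[OF de(1)])
  show "ball p de \<subseteq> W" using de(2) by blast
  show "dist (u t x) (u t p) <= ep" if "t : {0..1}" "x : ball p de" for t x
   using X0(3) de(2) that by fastforce
 qed
qed

text \<open>Mean value inequality for \<open>u t - u' t p\<close> on a convex ball: its derivative
  is small there uniformly in \<open>t\<close>, because its values on the finitely many basis
  vectors are. Both end points x and y vary, so Lipschitz and contraction constants can be read
  off.\<close>

lemma uniform_taylor:
 fixes u :: "real => 'p::model_space => 'b::real_normed_vector"
 assumes "open W" "p : W" "ep > 0"
  and d: "!!t p. t : {0..1} ==> p : W ==> (u t hder u' t p) (at p)"
  and c: "!!b. continuous_on ({0..1} \<times> W) (%(t, p). u' t p b)"
 obtains de where "de > 0" "ball p de \<subseteq> W"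
  "!!t x y. t : {0..1} ==> x : ball p de ==> y : ball p de ==>
   norm (u t y - u t x - u' t p (y - x)) <= ep * norm (y - x)"
proof -
 \<comment> \<open>The summand 1 keeps \<open>ep / n\<close> positive when \<open>mb\<close> is
   empty.\<close>
 define n where "n = card (mb :: 'p set) + 1"
 have "\<exists>de>0. ball p de \<subseteq> W & (ALL t:{0..1}. ALL x:ball p de. dist (u' t x b) (u' t p b) <= ep / n)" for b
  by (rule uniform_in_parameter[OF c assms(1,2), of "ep / n" b]) (use assms(3) in \<open>auto simp: n_def\<close>)
 then obtain de' where de': "!!b. de' b > 0" "!!b. ball p (de' b) \<subseteq> W"
  "!!b t x. t : {0..1} ==> x : ball p (de' b) ==> dist (u' t x b) (u' t p b) <= ep / n"
  by metis
 \<comment> \<open>Including \<open>de' 0\<close> makes the set nonempty and gives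
   \<open>ball p de \<subseteq> W\<close> even if \<open>mb\<close> is empty.\<close>
 define de where "de = Min (insert (de' 0) (de' ` mb))"
 have de: "de > 0" "de <= de' 0" "!!b. b : mb ==> de <= de' b"
  using de'(1) by (auto simp: de_def)
 have sub: "ball p de \<subseteq> W" using de(2) de'(2)[of 0] by (meson order_trans subset_ball)
 have n: "real (card (mb :: 'p set)) * (ep / n) <= ep"
  using assms(3) by (auto simp: n_def field_simps)
 have b: "norm (u' t x v - u' t p v) <= ep * norm v" if "t : {0..1}" "x : ball p de" for t x v
 proof -
  have x: "x : W" using sub that by blast
  have "linear (%v. u' t x v - u' t p v)"
   using has_derivative_linear[OF d[OF that(1) x]] has_derivative_linear[OF d[OF that(1) assms(2)]]
   by (rule linear_compose_sub)
  hence "norm (u' t x v - u' t p v) <= (SUM b:mb. norm (u' t x b - u' t p b)) * norm v"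
   by (rule linear_norm_le)
  also have "(SUM b:mb. norm (u' t x b - u' t p b)) <= (SUM b:(mb::'p set). ep / n)"
  proof (rule sum_mono)
   fix b :: 'p assume b: "b : mb"
   have "x : ball p (de' b)" using that(2) de(3)[OF b] by auto
   thus "norm (u' t x b - u' t p b) <= ep / n" using de'(3)[OF that(1)] by (simp add: dist_norm)
  qed
  also have "\<dots> <= ep" using n by simp
  finally show ?thesis by (simp add: mult_right_mono)
 qed
 have "norm (u t y - u t x - u' t p (y - x)) <= ep * norm (y - x)"
  if "t : {0..1}" "x : ball p de" "y : ball p de" for t x y
 proof -
  let ?g = "%z. u t z - u' t p z"
  have lin: "bounded_linear (u' t p)" using d[OF that(1) assms(2)] by (rule has_derivative_bounded_linear)
  have "norm (?g y - ?g x) <= ep * norm (y - x)"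
  proof (rule differentiable_bound[of "ball p de" _ "%z v. u' t z v - u' t p v"])
   fix z assume z: "z : ball p de"
   hence zW: "z : W" using sub by blast
   show "(?g hder (%v. u' t z v - u' t p v)) (at z within ball p de)"
    by (intro has_derivative_diff has_derivative_at_withinI[OF d[OF that(1) zW]] bounded_linear_imp_has_derivative lin)
   show "onorm (%v. u' t z v - u' t p v) <= ep"
    by (rule onorm_bound) (use assms(3) b[OF that(1) z] in auto)
  qed (use that in auto)
  moreover have "u t y - u t x - u' t p (y - x) = ?g y - ?g x"
   by (simp add: linear_diff[OF bounded_linear.linear[OF lin]])
  ultimately show ?thesis by (simp only:)
 qed
 thus ?thesis using that[of de] de(1) sub by blast
qed

lemma has_derivative_norm_le:
 assumes "(f hder f') (at x)" "open S" "x : S"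
  "!!y. y : S ==> norm (f y - f x) <= L * norm (y - x)"
 shows "norm (f' v) <= L * norm v"
proof (cases "v = 0")
 case True
 thus ?thesis using linear_0[OF has_derivative_linear[OF assms(1)]] by simp
next
 case False
 have "norm (f' v) / norm v <= L + e" if e: "e > 0" for e
 proof -
  obtain d where d: "d > 0" "!!y. norm (y - x) < d ==> norm (f y - f x - f' (y - x)) <= e * norm (y - x)"
   using assms(1) e unfolding has_derivative_at_alt by blast
  obtain r where r: "r > 0" "ball x r \<subseteq> S" using openE[OF assms(2,3)] by blast
  define h where "h = min d r / (2 * norm v)"
  have h: "h > 0" "norm (h *. v) < d" "norm (h *. v) < r"
   using d(1) r(1) False by (auto simp: h_def min_def)
  have "x + h *. v : S" using r(2) h(3) by (auto simp: dist_norm)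
  hence "norm (f (x + h *. v) - f x) <= L * norm (h *. v)" using assms(4) by fastforce
  moreover have "norm (f (x + h *. v) - f x - f' (h *. v)) <= e * norm (h *. v)"
   using d(2)[of "x + h *. v"] h(2) by simp
  ultimately have "norm (f' (h *. v)) <= (L + e) * norm (h *. v)"
   using norm_triangle_ineq4[of "f (x + h *. v) - f x" "f (x + h *. v) - f x - f' (h *. v)"]
   by (simp add: algebra_simps)
  hence "h * norm (f' v) <= h * ((L + e) * norm v)"
   using h(1) linear_scale[OF has_derivative_linear[OF assms(1)], of h v] by (simp add: mult_ac)
  hence "norm (f' v) <= (L + e) * norm v" using h(1) by simp
  thus ?thesis using False by (simp add: divide_le_eq)
 qed
 hence "norm (f' v) / norm v <= L" by (rule field_le_epsilon)
 thus ?thesis using False by (simp add: divide_le_eq)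
qed

lemma cont_uncurry:
 assumes "continuous_on (T \<times> K) (%(t, k). V t k)" "continuous_on T w" "!!t. t : T ==> w t : K"
 shows "continuous_on T (%t. V t (w t))"
proof -
 have "continuous_on T (%t. case (t, w t) of (t, k) => V t k)"
  by (rule continuous_on_compose2[OF assms(1)]) (use assms(2,3) in \<open>auto intro!: continuous_intros\<close>)
 thus ?thesis by simp
qed

section \<open>Smooth dependence of solutions of differential equations\<close>

text \<open>\<open>J\<close> stands for the identity, which leads to the inverse function theorem,
  or for integration from 0, which leads to differential equations. Both are linear and do not
  increase the maximum norm on \<open>{0..1}\<close>, so z = fi + J (V z) is a contraction as soon
  as \<open>V\<close> is Lipschitz with constant 1/2.\<close>

locale contraction_operator =
 fixes J :: "(real => 'e::model_space) => real => 'e"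
 assumes J_cont: "continuous_on {0..1} u ==> continuous_on {0..1} (J u)"
  and J_add: "continuous_on {0..1} u ==> continuous_on {0..1} v ==> t : {0..1} ==>
   J (%s. u s + v s) t = J u t + J v t"
  and J_scale: "continuous_on {0..1} u ==> t : {0..1} ==> J (%s. r *. u s) t = r *. J u t"
  and J_bound: "continuous_on {0..1} u ==> (!!s. s : {0..1} ==> norm (u s) <= B) ==> t : {0..1} ==>
   norm (J u t) <= B"
begin

lemma J_diff: "continuous_on {0..1} u ==> continuous_on {0..1} v ==> t : {0..1} ==>
   J u t - J v t = J (%s. u s - v s) t"
 using J_add[of "%s. u s - v s" v t] by (simp add: continuous_on_diff)

end

text \<open>With \<open>B\<close> the attained maximum of the norm, the improvement reads max \<le>
  c + max / 2. This plays the part of a Gronwall estimate for all fixed points below.\<close>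

lemma half_bound:
 fixes u :: "real => 'e::real_normed_vector"
 assumes "continuous_on {0..1} u"
  "!!B. (!!t. t : {0..1} ==> norm (u t) <= B) ==> (!!t. t : {0..1} ==> norm (u t) <= c + B / 2)"
  "t : {0..1}"
 shows "norm (u t) <= 2 * c"
proof -
 obtain t0 where t0: "t0 : {0..1}" "!!t. t : {0..1} ==> norm (u t) <= norm (u t0)"
  using continuous_attains_sup[of "{0..1::real}" "%t. norm (u t)"] continuous_on_norm[OF assms(1)]
  by fastforce
 have "norm (u t0) <= c + norm (u t0) / 2" using assms(2)[OF t0(2) t0(1)] by blast
 thus ?thesis using t0(2)[OF assms(3)] by simp
qed

context contraction_operator begin

lemma fixpoint_unique:
 assumes "continuous_on ({0..1} \<times> K) (%(t, k). V t k)"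
  and lip: "!!t k k'. t : {0..1} ==> k : K ==> k' : K ==> norm (V t k - V t k') <= norm (k - k') / 2"
  and z: "continuous_on {0..1} z" "!!t. t : {0..1} ==> z t : K" "!!t. t : {0..1} ==> z t = fi t + J (%s. V s (z s)) t"
  and y: "continuous_on {0..1} y" "!!t. t : {0..1} ==> y t : K" "!!t. t : {0..1} ==> y t = fi t + J (%s. V s (y s)) t"
  and t: "t : {0..1}"
 shows "z t = y t"
proof -
 have cV: "continuous_on {0..1} (%s. V s (w s))" if "continuous_on {0..1} w" "!!t. t : {0..1} ==> w t : K" for w
  by (rule cont_uncurry[OF assms(1) that])
 have "norm (z t - y t) <= 2 * 0"
 proof (rule half_bound[where u="%t. z t - y t", OF _ _ t])
  fix B t assume B: "!!t. t : {0..1} ==> norm (z t - y t) <= B" and t: "t : {0..1::real}"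
  have "z t - y t = J (%s. V s (z s) - V s (y s)) t"
   using z(3)[OF t] y(3)[OF t] J_diff[OF cV[OF z(1,2)] cV[OF y(1,2)] t] by simp
  also have "norm \<dots> <= B / 2"
  proof (rule J_bound[OF _ _ t])
   show "continuous_on {0..1} (%s. V s (z s) - V s (y s))" by (intro continuous_on_diff cV z y)
   show "norm (V s (z s) - V s (y s)) <= B / 2" if "s : {0..1}" for s
    using lip[OF that z(2)[OF that] y(2)[OF that]] B[OF that] by simp
  qed
  finally show "norm (z t - y t) <= 0 + B / 2" by simp
 qed (intro continuous_on_diff z y)
 thus ?thesis by simp
qed

text \<open>Picard iteration from 0. The radius is preserved because r/4 + (r/4 + r/2) = r, the
  terms coming from \<open>fi\<close>, from \<open>V t 0\<close> and from the Lipschitz bound.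
  Consecutive iterates differ by at most r / 2^n, so the telescoping series of increments converges
  uniformly.\<close>

lemma fixpoint_exists:
 assumes cV: "continuous_on ({0..1} \<times> cball 0 r) (%(t, k). V t k)"
  and lip: "!!t k k'. t : {0..1} ==> k : cball 0 r ==> k' : cball 0 r ==> norm (V t k - V t k') <= norm (k - k') / 2"
  and cfi: "continuous_on {0..1} fi"
  and b: "!!t. t : {0..1} ==> norm (fi t) <= r / 4" "!!t. t : {0..1} ==> norm (V t 0) <= r / 4"
 obtains z where "continuous_on {0..1} z" "!!t. t : {0..1} ==> norm (z t) <= r"
  "!!t. t : {0..1} ==> z t = fi t + J (%s. V s (z s)) t"
proof -
 have r: "r >= 0"
 proof -
  have "norm (fi 0) <= r / 4" by (rule b(1)) simp
  thus ?thesis using norm_ge_zero[of "fi 0"] by linarith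
 qed
 have cV': "continuous_on {0..1} (%s. V s (w s))" if "continuous_on {0..1} w" "!!t. t : {0..1} ==> norm (w t) <= r" for w
 proof (rule cont_uncurry[OF cV that(1)])
  show "w t : cball 0 r" if "t : {0..1}" for t
   using \<open>!!t. t : {0..1} ==> norm (w t) <= r\<close>[OF that] by simp
 qed
 have step: "norm (J (%s. V s (w s)) t - J (%s. V s (w' s)) t) <= d / 2"
  if st: "continuous_on {0..1} w" "!!t. t : {0..1} ==> norm (w t) <= r"
   "continuous_on {0..1} w'" "!!t. t : {0..1} ==> norm (w' t) <= r"
   "!!t. t : {0..1} ==> norm (w t - w' t) <= d" "t : {0..1}" for w w' d t
 proof -
  have "J (%s. V s (w s)) t - J (%s. V s (w' s)) t = J (%s. V s (w s) - V s (w' s)) t"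
   using J_diff[OF cV'[OF st(1,2)] cV'[OF st(3,4)] st(6)] by simp
  also have "norm \<dots> <= d / 2"
  proof (rule J_bound[OF _ _ st(6)])
   show "continuous_on {0..1} (%s. V s (w s) - V s (w' s))" by (intro continuous_on_diff cV' st)
   show "norm (V s (w s) - V s (w' s)) <= d / 2" if s: "s : {0..1}" for s
    using lip[OF s, of "w s" "w' s"] st(2,4,5)[OF s] by simp
  qed
  finally show ?thesis .
 qed
 define Z where "Z = rec_nat (%_. 0) (%_ w t. fi t + J (%s. V s (w s)) t)"
 have Z0: "Z 0 = (%_. 0)" and ZS: "Z (Suc n) = (%t. fi t + J (%s. V s (Z n s)) t)" for n
  by (simp_all add: Z_def)
 have ZS': "Z (Suc n) t = fi t + J (%s. V s (Z n s)) t" for n t by (simp add: ZS)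
 have Z: "continuous_on {0..1} (Z n) & (ALL t:{0..1}. norm (Z n t) <= r)" for n
 proof (induction n)
  case 0 thus ?case using r by (simp add: Z0)
 next
  case (Suc n)
  have "norm (Z (Suc n) t) <= r" if t: "t : {0..1}" for t
  proof -
   have "norm (J (%s. V s (Z n s)) t) <= r / 4 + r / 2"
   proof (rule J_bound[OF cV' _ t])
    fix s :: real assume s: "s : {0..1}"
    have "norm (V s (Z n s) - V s 0) <= r / 2" using lip[OF s, of "Z n s" 0] Suc r s by force
    thus "norm (V s (Z n s)) <= r / 4 + r / 2"
     using b(2)[OF s] norm_triangle_ineq2[of "V s (Z n s)" "V s 0"] by simp
   qed (use Suc in auto)
   thus ?thesis unfolding ZS' using b(1)[OF t] norm_triangle_ineq[of "fi t" "J (%s. V s (Z n s)) t"] by simp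
  qed
  moreover have "continuous_on {0..1} (Z (Suc n))"
   unfolding ZS by (intro continuous_on_add cfi J_cont cV') (use Suc in auto)
  ultimately show ?case by blast
 qed
 have Zc: "continuous_on {0..1} (Z n)" and Zb: "t : {0..1} ==> norm (Z n t) <= r" for n t
  using Z[of n] by blast+
 have inc: "ALL t:{0..1}. norm (Z (Suc n) t - Z n t) <= r * (1 / 2) ^ n" for n
 proof (induction n)
  case 0 thus ?case using Zb[of _ 1] by (simp add: Z0)
 next
  case (Suc n)
  have "norm (J (%s. V s (Z (Suc n) s)) t - J (%s. V s (Z n s)) t) <= r * (1 / 2) ^ n / 2" if "t : {0..1}" for t
   by (rule step[OF Zc Zb Zc Zb bspec[OF Suc.IH] that])
  thus ?case using ZS'[of "Suc n"] ZS'[of n] by simp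
 qed
 define S where "S n t = (\<Sum>i<n. Z (Suc i) t - Z i t)" for n t
 have SZ: "S n t = Z n t" for n t unfolding S_def using sum_lessThan_telescope[of "%i. Z i t" n] by (simp add: Z0)
 have "uniform_limit {0..1} (%n t. \<Sum>i<n. Z (Suc i) t - Z i t) (%t. \<Sum>i. Z (Suc i) t - Z i t) sequentially"
  by (rule Weierstrass_m_test[where M="%n. r * (1 / 2) ^ n"]) (rule bspec[OF inc], assumption, intro summable_mult summable_geometric, simp)
 then obtain z where lim: "uniform_limit {0..1} Z z sequentially"
  unfolding S_def[symmetric] SZ by blast
 have cz: "continuous_on {0..1} z"
  by (rule uniform_limit_theorem[OF _ lim]) (simp_all add: Zc)
 have pl: "(%n. Z n t) \<longlonglongrightarrow> z t" if "t : {0..1}" for t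
  by (rule tendsto_uniform_limitI[OF lim that])
 have bz: "norm (z t) <= r" if "t : {0..1}" for t
  by (rule tendsto_upperbound[OF tendsto_norm[OF pl[OF that]]]) (use that in \<open>simp_all add: Zb\<close>)
 have "z t = fi t + J (%s. V s (z s)) t" if t: "t : {0..1}" for t
 proof -
  have "(%n. J (%s. V s (Z n s)) t) \<longlonglongrightarrow> J (%s. V s (z s)) t"
  proof (rule metric_LIMSEQ_I)
   fix e :: real assume e: "e > 0"
   obtain N where N: "ALL n>=N. ALL t:{0..1}. dist (Z n t) (z t) < e"
    using uniform_limitD[OF lim e] unfolding eventually_sequentially by blast
   have "dist (J (%s. V s (Z n s)) t) (J (%s. V s (z s)) t) <= e / 2" if "n >= N" for n
    unfolding dist_norm
    by (rule step[OF Zc Zb cz bz _ t]) (use N that in \<open>auto simp: dist_norm intro: less_imp_le\<close>)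
   thus "EX N. ALL n>=N. dist (J (%s. V s (Z n s)) t) (J (%s. V s (z s)) t) < e"
    using e by (intro exI[of _ N]) fastforce
  qed
  hence "(%n. Z (Suc n) t) \<longlonglongrightarrow> fi t + J (%s. V s (z s)) t"
   unfolding ZS' by (intro tendsto_intros)
  thus ?thesis using LIMSEQ_Suc[OF pl[OF t]] LIMSEQ_unique by blast
 qed
 thus ?thesis using that cz bz by blast
qed

end

lemma compact_subset_open_margin:
 fixes C :: "'a::real_normed_vector set"
 assumes "compact C" "open K" "C \<subseteq> K"
 obtains ro where "ro > 0" "!!x y. x : C ==> norm y < ro ==> x + y : K"
proof -
 obtain ro where "ro > 0" "(UN x:C. ball x ro) \<subseteq> K"
  by (rule compact_subset_open_imp_ball_epsilon_subset[OF assms])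
 thus ?thesis by (intro that[of ro]) (auto simp: dist_norm subset_eq)
qed

lemma norm_add3_le:
 "norm a <= A ==> norm b <= B ==> norm c <= C ==> norm (a + b + c) <= A + B + (C::real)"
 by (intro norm_triangle_mono)

context contraction_operator begin

text \<open>The difference of the solutions at two parameters is estimated by
  \<open>half_bound\<close>: the halved part comes from the Lipschitz bound, the constant part from
  varying the parameter in \<open>fi\<close> and in \<open>V\<close> with the solution frozen at
  \<open>p\<close>. This is uniform in time and combines with continuity in time at
  \<open>p\<close>.\<close>

lemma fixpoint_continuous:
 fixes fi :: "real => 'p::real_normed_vector => 'e"
 assumes W: "open W"
  and fi: "continuous_on ({0..1} \<times> W) (%(t, p). fi t p)"
  and V: "continuous_on ({0..1} \<times> W \<times> K) (%(t, q). V t q)"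
  and lip: "!!t p k k'. t : {0..1} ==> p : W ==> k : K ==> k' : K ==>
   norm (V t (p, k) - V t (p, k')) <= norm (k - k') / 2"
  and zc: "!!p. p : W ==> continuous_on {0..1} (%t. z t p)"
  and zK: "!!t p. t : {0..1} ==> p : W ==> z t p : K"
  and z: "!!t p. t : {0..1} ==> p : W ==> z t p = fi t p + J (%s. V s (p, z s p)) t"
 shows "continuous_on ({0..1} \<times> W) (%(t, p). z t p)"
proof -
 have cV: "continuous_on {0..1} (%s. V s (p, w s))"
  if "p : W" "continuous_on {0..1} w" "!!t. t : {0..1} ==> w t : K" for w p
  by (rule cont_uncurry[OF V]) (use that in \<open>auto intro!: continuous_intros\<close>)
 have ev: "\<exists>de>0. ball p de \<subseteq> W & (ALL x:ball p de. ALL t:{0..1}. norm (z t x - z t p) <= e)"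
  if p: "p : W" and e: "e > 0" for p e
 proof -
  obtain de1 where d1: "de1 > 0" "ball p de1 \<subseteq> W"
   "!!t x. t : {0..1} ==> x : ball p de1 ==> dist (fi t x) (fi t p) <= e / 4"
   by (rule uniform_in_parameter[OF fi W p, of "e / 4"]) (use e in auto)
  have "continuous_on ({0..1} \<times> W) (%q. V (fst q) (snd q, z (fst q) p))"
  proof -
   have "continuous_on ({0..1} \<times> W) (%q. z (fst q) p)"
    by (rule continuous_on_compose2[OF zc[OF p]]) (auto intro!: continuous_intros)
   hence "continuous_on ({0..1} \<times> W) (%q. case (fst q, snd q, z (fst q) p) of (t, q) => V t q)"
    by (intro continuous_on_compose2[OF V]) (use zK p in \<open>auto intro!: continuous_intros\<close>)
   thus ?thesis by simp
  qed
  then obtain de2 where d2: "de2 > 0" "ball p de2 \<subseteq> W"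
   "!!t x. t : {0..1} ==> x : ball p de2 ==> dist (V t (x, z t p)) (V t (p, z t p)) <= e / 4"
   using uniform_in_parameter[of W "%t x. V t (x, z t p)" p "e / 4"] W p e
   by (auto simp: split_def)
  show ?thesis
  proof (intro exI[of _ "min de1 de2"] conjI ballI)
   show "ball p (min de1 de2) \<subseteq> W" using d1 by auto
   fix x t assume x: "x : ball p (min de1 de2)" and t: "t : {0..1::real}"
   hence xW: "x : W" using d1 by auto
   have "norm (z t x - z t p) <= 2 * (e / 2)"
   proof (rule half_bound[where u="%t. z t x - z t p", OF _ _ t])
    show "continuous_on {0..1} (%t. z t x - z t p)" by (intro continuous_on_diff zc xW p)
    fix B t assume B: "!!t. t : {0..1} ==> norm (z t x - z t p) <= B" and t: "t : {0..1::real}"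
    have "J (%s. V s (x, z s x)) t - J (%s. V s (p, z s p)) t = J (%s. V s (x, z s x) - V s (p, z s p)) t"
     by (rule J_diff[OF cV cV t]) (use xW p zK zc in auto)
    also have "norm \<dots> <= e / 4 + B / 2"
    proof (rule J_bound[OF _ _ t])
     show "continuous_on {0..1} (%s. V s (x, z s x) - V s (p, z s p))"
      by (intro continuous_on_diff cV zc xW p zK)
     fix s assume s: "s : {0..1::real}"
     have "norm (V s (x, z s x) - V s (x, z s p)) <= B / 2"
      using lip[OF s xW zK[OF s xW] zK[OF s p]] B[OF s] by simp
     moreover have "norm (V s (x, z s p) - V s (p, z s p)) <= e / 4"
      using d2(3)[OF s, of x] x by (simp add: dist_norm)
     ultimately show "norm (V s (x, z s x) - V s (p, z s p)) <= e / 4 + B / 2"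
      using norm_triangle_ineq[of "V s (x, z s x) - V s (x, z s p)" "V s (x, z s p) - V s (p, z s p)"] by simp
    qed
    finally have "norm (J (%s. V s (x, z s x)) t - J (%s. V s (p, z s p)) t) <= e / 4 + B / 2" .
    moreover have "norm (fi t x - fi t p) <= e / 4"
     using d1(3)[OF t, of x] x by (simp add: dist_norm)
    ultimately show "norm (z t x - z t p) <= e / 2 + B / 2"
     using norm_triangle_ineq[of "fi t x - fi t p" "J (%s. V s (x, z s x)) t - J (%s. V s (p, z s p)) t"]
     unfolding z[OF t xW] z[OF t p] by (simp add: algebra_simps)
   qed
   thus "norm (z t x - z t p) <= e" by simp
  qed (use d1 d2 in auto)
 qed
 show ?thesis
  unfolding continuous_on_iff
 proof (intro ballI allI impI)
  fix tp :: "real \<times> 'p" and e :: real assume "tp : {0..1} \<times> W" and e: "e > 0"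
  then obtain t p where tp: "tp = (t, p)" and t: "t : {0..1::real}" and p: "p : W" by (cases tp) auto
  obtain de where d: "de > 0" "ALL x:ball p de. ALL t:{0..1}. norm (z t x - z t p) <= e / 2"
   using ev[OF p, of "e / 2"] e by auto
  obtain d' where d': "d' > 0" "!!s. s : {0..1} ==> dist s t < d' ==> dist (z s p) (z t p) < e / 2"
   using zc[OF p] t e unfolding continuous_on_iff by (metis half_gt_zero)
  show "EX d>0. ALL x':{0..1} \<times> W. dist x' tp < d -->
    dist (case x' of (t, p) => z t p) (case tp of (t, p) => z t p) < e"
  proof (intro exI[of _ "min de d'"] conjI ballI impI)
   fix sx assume "sx : {0..1} \<times> W" and "dist sx tp < min de d'"
   then obtain s x where sx: "sx = (s, x)" and s: "s : {0..1::real}" and x: "x : W"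
    and ds: "dist (s, x) (t, p) < min de d'" by (cases sx) (auto simp: tp)
   have "dist s t < d'" "dist x p < de"
    using dist_fst_le[of "(s, x)" "(t, p)"] dist_snd_le[of "(s, x)" "(t, p)"] ds by auto
   hence "norm (z s x - z s p) <= e / 2" "dist (z s p) (z t p) < e / 2"
    using d(2) d'(2)[OF s] s by (auto simp: dist_commute)
   thus "dist (case sx of (t, p) => z t p) (case tp of (t, p) => z t p) < e"
    using dist_triangle[of "z s x" "z t p" "z s p"] by (simp add: dist_norm sx tp)
  qed (use d d' in auto)
 qed
qed


text \<open>\<open>A t\<close> is defined and contracting on the whole space, so the radius required
  by \<open>fixpoint_exists\<close> can be chosen after \<open>b\<close>. This serves the linearised
  equation.\<close>

lemma linear_fixpoint_exists:
 fixes A :: "real => 'e => 'e"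
 assumes A: "continuous_on ({0..1} \<times> UNIV) (%(t, k). A t k)"
  and lip: "!!t k k'. t : {0..1} ==> norm (A t k - A t k') <= norm (k - k') / 2"
  and b: "continuous_on {0..1} b"
 obtains y where "continuous_on {0..1} y" "!!t. t : {0..1} ==> y t = b t + J (%s. A s (y s)) t"
proof -
 have "continuous_on {0..1} (%t. norm (b t) + norm (A t 0))"
  by (intro continuous_on_add continuous_on_norm b cont_uncurry[OF A]) auto
 then obtain t0 where t0: "t0 : {0..1}"
  "ALL t:{0..1}. norm (b t) + norm (A t 0) <= norm (b t0) + norm (A t0 0)"
  using continuous_attains_sup[of "{0..1::real}" "%t. norm (b t) + norm (A t 0)"] by fastforce
 define r where "r = 4 * (norm (b t0) + norm (A t0 0))"
 have r: "norm (b t) + norm (A t 0) <= r / 4" if "t : {0..1}" for t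
  using bspec[OF t0(2) that] by (simp add: r_def)
 obtain y where "continuous_on {0..1} y" "!!t. t : {0..1} ==> y t = b t + J (%s. A s (y s)) t"
 proof (rule fixpoint_exists[of r A b])
  show "continuous_on ({0..1} \<times> cball 0 r) (%(t, k). A t k)"
   by (rule continuous_on_subset[OF A]) auto
  show "norm (b t) <= r / 4" "norm (A t 0) <= r / 4" if "t : {0..1}" for t
   using r[OF that] norm_ge_zero[of "b t"] norm_ge_zero[of "A t 0"] by linarith+
 qed (use lip b in auto)
 thus ?thesis using that by blast
qed

text \<open>The candidate derivative in direction v solves the linearised equation y = fi' v + J (V'
  (v, y)). That equation contracts, since a Lipschitz bound in k passes to the partial derivative in
  k. Uniqueness makes y linear in v. Two applications of \<open>half_bound\<close> then show that
  the increment \<open>ka\<close> of the solution is O(norm v), and that \<open>ka - y v\<close> is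
  o(norm v).\<close>

lemma fixpoint_differentiable:
 fixes fi :: "real => 'p::model_space => 'e"
 assumes W: "open W" and K: "open K"
  and fi: "!!t p. t : {0..1} ==> p : W ==> (fi t hder fi' t p) (at p)"
  and cfi': "!!v. continuous_on ({0..1} \<times> W) (%(t, p). fi' t p v)"
  and cV: "continuous_on ({0..1} \<times> W \<times> K) (%(t, q). V t q)"
  and V: "!!t q. t : {0..1} ==> q : W \<times> K ==> (V t hder V' t q) (at q)"
  and cV': "!!v. continuous_on ({0..1} \<times> W \<times> K) (%(t, q). V' t q v)"
  and lip: "!!t p k k'. t : {0..1} ==> p : W ==> k : K ==> k' : K ==>
   norm (V t (p, k) - V t (p, k')) <= norm (k - k') / 2"
  and zc: "continuous_on ({0..1} \<times> W) (%(t, p). z t p)"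
  and zK: "!!t p. t : {0..1} ==> p : W ==> z t p : K"
  and z: "!!t p. t : {0..1} ==> p : W ==> z t p = fi t p + J (%s. V s (p, z s p)) t"
  and p: "p : W"
 obtains et where "!!t. t : {0..1} ==> (z t hder et t) (at p)"
  and "!!v. continuous_on {0..1} (%t. et t v)"
  and "!!t v. t : {0..1} ==> et t v = fi' t p v + J (%s. V' s (p, z s p) (v, et s v)) t"
proof -
 have zc1: "continuous_on {0..1} (%s. z s x)" if "x : W" for x
  by (rule cont_uncurry[OF zc]) (use that in auto)
 have lin: "linear (V' s (p, z s p))" if "s : {0..1}" for s
  by (rule has_derivative_linear[OF V[OF that]]) (use zK that p in auto)
 define L where "L s v k = V' s (p, z s p) (v, k)" for s v k
 have L_add: "L s (v + w) (k + l) = L s v k + L s w l" if "s : {0..1}" for s v w k l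
  using linear_add[OF lin[OF that], of "(v, k)" "(w, l)"] by (simp add: L_def)
 have L_scale: "L s (r *. v) (r *. k) = r *. L s v k" if "s : {0..1}" for s v k r
  using linear_scale[OF lin[OF that], of r "(v, k)"] by (simp add: L_def)
 have L_diff: "L s (v - w) (k - l) = L s v k - L s w l" if "s : {0..1}" for s v w k l
  using linear_diff[OF lin[OF that], of "(v, k)" "(w, l)"] by (simp add: L_def)
 have L_lin: "linear (%k. L s 0 k)" "linear (%v. L s v 0)" if "s : {0..1}" for s
 proof -
  show "linear (%k. L s 0 k)"
   by (rule linearI) (use L_add[OF that, of 0 0] L_scale[OF that, of _ 0] in simp_all)
  show "linear (%v. L s v 0)"
   by (rule linearI) (use L_add[OF that, of _ _ 0 0] L_scale[OF that, of _ _ 0] in simp_all)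
 qed
 have cV'z: "continuous_on {0..1} (%s. V' s (p, z s p) b)" for b
  by (rule cont_uncurry[OF cV']) (use zc1 zK p in \<open>auto intro!: continuous_intros\<close>)
 have L_exp: "L s v k = L s v 0 + (SUM b:mb. inner k b *. L s 0 b)" if "s : {0..1}" for s v k
  using L_add[OF that, of v 0 0 k] lin_mb_sum[OF L_lin(1)[OF that], of k] by simp
 have cL: "continuous_on ({0..1} \<times> UNIV) (%(s, k). L s v k)" for v
 proof -
  have c: "continuous_on ({0..1} \<times> UNIV) (%q. L (fst q) v' b)" for v' b
   unfolding L_def by (rule continuous_on_compose2[OF cV'z]) (auto intro!: continuous_intros)
  have "continuous_on ({0..1} \<times> UNIV) (%q. L (fst q) v 0 + (SUM b:mb. inner (snd q) b *. L (fst q) 0 b))"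
   by (intro continuous_intros c)
  thus ?thesis
  proof (rule continuous_on_eq)
   fix q :: "real \<times> 'e" assume "q : {0..1} \<times> UNIV"
   thus "L (fst q) v 0 + (SUM b:mb. inner (snd q) b *. L (fst q) 0 b) = (case q of (s, k) => L s v k)"
    using L_exp[of "fst q" v "snd q"] by (simp add: split_def mem_Times_iff)
  qed
 qed
 have L_half: "norm (L s 0 k) <= norm k / 2" if s: "s : {0..1}" for s k
 proof -
  have "((%k. (p, k)) hder (%k. (0, k))) (at (z s p))"
   by (auto intro!: derivative_eq_intros)
  moreover have "(V s hder V' s (p, z s p)) (at (p, z s p))"
   by (rule V[OF s]) (use zK s p in auto)
  ultimately have "((%k. V s (p, k)) hder (%k. V' s (p, z s p) (0, k))) (at (z s p))"
   by (rule has_derivative_compose)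
  hence "norm (V' s (p, z s p) (0, k)) <= 1 / 2 * norm k"
   by (rule has_derivative_norm_le[OF _ K zK[OF s p]]) (use lip[OF s p _ zK[OF s p]] in auto)
  thus ?thesis by (simp add: L_def)
 qed
 have L_lip: "norm (L s v k - L s v k') <= norm (k - k') / 2" if s: "s : {0..1}" for s v k k'
  using L_half[OF s, of "k - k'"] L_diff[OF s, of v v k k'] by simp
 have cfi1: "continuous_on {0..1} (%t. fi' t p v)" for v
  by (rule cont_uncurry[OF cfi']) (use p in auto)
 have "EX y. continuous_on {0..1} y & (ALL t:{0..1}. y t = fi' t p v + J (%s. L s v (y s)) t)" for v
  by (rule linear_fixpoint_exists[OF cL[of v] L_lip cfi1[of v]]) auto
 then obtain y where y: "!!v. continuous_on {0..1} (y v)"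
  "!!v. ALL t:{0..1}. y v t = fi' t p v + J (%s. L s v (y v s)) t"
  by metis
 have yeq: "y v t = fi' t p v + J (%s. L s v (y v s)) t" if "t : {0..1}" for v t
  using y(2) that by blast
 have filin: "linear (fi' t p)" if "t : {0..1}" for t
  by (rule has_derivative_linear[OF fi[OF that p]])
 have cLy: "continuous_on {0..1} (%s. L s v (w s))" if "continuous_on {0..1} w" for v w
  by (rule cont_uncurry[OF cL that]) auto
 have J_cong: "J u t = J v t" if "continuous_on {0..1} u" "continuous_on {0..1} v"
  "!!s. s : {0..1} ==> u s = v s" "t : {0..1}" for u v t
 proof -
  have "norm (J (%s. u s - v s) t) <= 0"
   by (rule J_bound) (use that in \<open>auto intro!: continuous_on_diff\<close>)
  thus ?thesis using J_diff[OF that(1,2,4)] by simp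
 qed
 have y_lin: "linear (%v. y v t)" if t: "t : {0..1}" for t
 proof (rule linearI)
  fix v w
  have "y (v + w) t = y v t + y w t"
  proof (rule fixpoint_unique[OF cL[of "v + w"] L_lip y(1) _ yeq _ _ _ t])
   show "continuous_on {0..1} (%t. y v t + y w t)" by (intro continuous_on_add y)
   fix t :: real assume t: "t : {0..1}"
   have "J (%s. L s (v + w) (y v s + y w s)) t = J (%s. L s v (y v s) + L s w (y w s)) t"
    by (rule J_cong) (use t L_add y(1) in \<open>auto intro!: cLy continuous_on_add\<close>)
   also have "\<dots> = J (%s. L s v (y v s)) t + J (%s. L s w (y w s)) t"
    by (rule J_add) (use t y(1) in \<open>auto intro!: cLy\<close>)
   finally show "y v t + y w t = fi' t p (v + w) + J (%s. L s (v + w) (y v s + y w s)) t"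
    using yeq[OF t, of v] yeq[OF t, of w] linear_add[OF filin[OF t]] by simp
  qed auto
  thus "y (v + w) t = y v t + y w t" .
 next
  fix r v
  have "y (r *. v) t = r *. y v t"
  proof (rule fixpoint_unique[OF cL[of "r *. v"] L_lip y(1) _ yeq _ _ _ t])
   show "continuous_on {0..1} (%t. r *. y v t)" by (intro continuous_on_scaleR continuous_on_const y)
   fix t :: real assume t: "t : {0..1}"
   have "J (%s. L s (r *. v) (r *. y v s)) t = J (%s. r *. L s v (y v s)) t"
    by (rule J_cong) (use t L_scale y(1) in \<open>auto intro!: cLy continuous_intros\<close>)
   also have "\<dots> = r *. J (%s. L s v (y v s)) t"
    by (rule J_scale) (use t y(1) in \<open>auto intro!: cLy\<close>)
   finally show "r *. y v t = fi' t p (r *. v) + J (%s. L s (r *. v) (r *. y v s)) t"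
    using yeq[OF t, of v] linear_scale[OF filin[OF t]] by (simp add: scaleR_add_right)
  qed auto
  thus "y (r *. v) t = r *. y v t" .
 qed
 have sup: "EX C>=0. ALL t:{0..1}. ALL v. norm (G t v) <= C * norm v"
  if "!!v. continuous_on {0..1} (%t. G t v)" "!!t. t : {0..1} ==> linear (G t)" for G :: "real => 'p => 'e"
 proof -
  have "continuous_on {0..1} (%t. SUM b:mb. norm (G t b))" by (intro continuous_intros that)
  then obtain t0 where t0: "ALL t:{0..1}. (SUM b:mb. norm (G t b)) <= (SUM b:mb. norm (G t0 b))"
   using continuous_attains_sup[of "{0..1::real}" "%t. SUM b:mb. norm (G t b)"] by fastforce
  show ?thesis
  proof (intro exI[of _ "SUM b:mb. norm (G t0 b)"] conjI ballI allI)
   fix t :: real and v assume t: "t : {0..1}"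
   show "norm (G t v) <= (SUM b:mb. norm (G t0 b)) * norm v"
    using linear_norm_le[OF that(2)[OF t], of v] mult_right_mono[OF bspec[OF t0 t], of "norm v"] by simp
  qed (simp add: sum_nonneg)
 qed
 obtain C1 where C1: "C1 >= 0" "ALL t:{0..1}. ALL v. norm (fi' t p v) <= C1 * norm v"
  using sup[OF cfi1 filin] by blast
 have "continuous_on {0..1} (%s. L s v 0)" for v by (rule cLy) simp
 then obtain C2 where C2: "C2 >= 0" "ALL t:{0..1}. ALL v. norm (L t v 0) <= C2 * norm v"
  using sup[of "%s v. L s v 0"] L_lin(2) by blast
 \<comment> \<open>The Lipschitz constant of \<open>ka\<close>: the Taylor remainders of
   \<open>fi\<close> and \<open>V\<close> count 1 each, their first-order terms count
   \<open>C1\<close> and \<open>C2\<close>, and \<open>half_bound\<close> doubles the sum.\<close>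
 define C where "C = 2 * (2 + C1 + C2)"
 have "compact ((%s. z s p) ` {0..1})" by (intro compact_continuous_image zc1 p compact_Icc)
 then obtain ro where ro: "ro > 0" "!!x y. x : (%s. z s p) ` {0..1} ==> norm y < ro ==> x + y : K"
  by (rule compact_subset_open_margin[OF _ K]) (use zK p in auto)
 have zK': "z s p + k : K" if "s : {0..1}" "k : ball 0 ro" for s k
  using ro(2)[of "z s p" k] that by auto
 have key: "EX d>0. ALL x. norm (x - p) < d -->
   (ALL t:{0..1}. norm (z t x - z t p - y (x - p) t) <= e * norm (x - p))" if e: "e > 0" for e
 proof -
  \<comment> \<open>The bound 1 makes the Taylor remainders at most \<open>norm v\<close> in the
    estimate of \<open>ka\<close>; the other bound gives 2 ep (2 + C) \<le> e, which is what the
    estimate of the remainder ends with.\<close>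
  define ep where "ep = min 1 (e / (2 * (2 + C)))"
  have C: "C >= 0" using C1 C2 by (simp add: C_def)
  have "ep <= e / (2 * (2 + C))" by (simp add: ep_def)
  hence "ep * (2 * (2 + C)) <= e" using C by (simp add: pos_le_divide_eq)
  hence ep: "ep > 0" "ep <= 1" "2 * (ep * (2 + C)) <= e"
   using e C by (auto simp: ep_def algebra_simps)
  obtain de1 where d1: "de1 > 0" "ball p de1 \<subseteq> W"
   "!!t x y. t : {0..1} ==> x : ball p de1 ==> y : ball p de1 ==>
    norm (fi t y - fi t x - fi' t p (y - x)) <= ep * norm (y - x)"
   apply (rule uniform_taylor[OF W p ep(1) fi cfi'], assumption, assumption)
   subgoal premises pr for d by (rule pr(1)[OF pr(2,3)]) (rule pr(4))
   done
  \<comment> \<open>The solution \<open>z t p\<close> moves with \<open>t\<close>. Translating it to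
    the origin gives the fixed expansion point (p, 0), as a Taylor estimate uniform in
    \<open>t\<close> demands.\<close>
  have shift: "((%q. V t (fst q, z t p + snd q)) hder V' t (fst q, z t p + snd q)) (at q)"
   if "t : {0..1}" "q : W \<times> ball 0 ro" for t q
  proof -
   have "((%q. (fst q, z t p + snd q)) hder (%q. q)) (at q)"
    by (auto intro!: derivative_eq_intros)
   from has_derivative_compose[OF this V[OF that(1)]] show ?thesis using zK' that by auto
  qed
  have cshift: "continuous_on ({0..1} \<times> W \<times> ball 0 ro) (%(t, q). V' t (fst q, z t p + snd q) b)" for b
  proof -
   have "continuous_on ({0..1} \<times> W \<times> ball 0 ro) (%q. z (fst q) p)"
    by (rule continuous_on_compose2[OF zc1[OF p]]) (auto intro!: continuous_intros)
   hence "continuous_on ({0..1} \<times> W \<times> ball 0 ro)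
    (%r. case (fst r, fst (snd r), z (fst r) p + snd (snd r)) of (t, q) => V' t q b)"
    by (intro continuous_on_compose2[OF cV']) (use zK' in \<open>auto intro!: continuous_intros\<close>)
   thus ?thesis by (simp add: split_def)
  qed
  have WK: "open (W \<times> ball 0 ro)" "(p, 0) : W \<times> ball (0::'e) ro" using W p ro(1) by (auto intro: open_Times)
  obtain de2 where d2: "de2 > 0" "ball (p, 0::'e) de2 \<subseteq> W \<times> ball 0 ro"
   "!!t x y. t : {0..1} ==> x : ball (p, 0) de2 ==> y : ball (p, 0) de2 ==>
    norm (V t (fst y, z t p + snd y) - V t (fst x, z t p + snd x) -
     V' t (fst (p, 0::'e), z t p + snd (p, 0::'e)) (y - x)) <= ep * norm (y - x)"
   apply (rule uniform_taylor[OF WK ep(1) shift cshift], assumption, assumption)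
   subgoal premises pr for d by (rule pr(1)[OF pr(2,3)]) (rule pr(4))
   done
  obtain de3 where d3: "de3 > 0" "ball p de3 \<subseteq> W"
   "!!t x. t : {0..1} ==> x : ball p de3 ==> dist (z t x) (z t p) <= de2 / 3"
   apply (rule uniform_in_parameter[OF zc W p, of "de2 / 3"])
   subgoal using d2(1) by simp
   subgoal premises pr for d by (rule pr(1)[OF pr(2,3)]) (rule pr(4))
   done
  show ?thesis
  proof (intro exI[of _ "min de1 (min (de2 / 3) de3)"] conjI allI impI)
   fix x assume x: "norm (x - p) < min de1 (min (de2 / 3) de3)"
   define v where "v = x - p"
   have xW: "x : W" using d1(2) x by (auto simp: dist_norm norm_minus_commute subset_eq)
   define ka where "ka s = z s x - z s p" for s
   have kad: "norm (ka s) <= de2 / 3" if "s : {0..1}" for s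
    using d3(3)[OF that, of x] x by (simp add: dist_norm norm_minus_commute ka_def)
   have cka: "continuous_on {0..1} ka" unfolding ka_def by (intro continuous_on_diff zc1 xW p)
   have inb: "(x, k) : ball (p, 0) de2" if "norm k <= de2 / 3" for k :: 'e
   proof -
    have "norm ((x, k) - (p, 0)) < de2" using norm_Pair_le[of "x - p" k] x that d2(1) by simp
    thus ?thesis by (metis mem_ball dist_commute dist_norm)
   qed
   have TV: "norm (V s (x, z s p + k) - V s (p, z s p) - L s v k) <= ep * (norm v + norm k)"
    if s: "s : {0..1}" and k: "norm k <= de2 / 3" for s k
   proof -
    have "norm (V s (x, z s p + k) - V s (p, z s p) - L s v k) <= ep * norm (v, k)"
     using d2(3)[OF s _ inb[OF k], of "(p, 0)"] d2(1) by (simp add: L_def v_def)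
    also have "\<dots> <= ep * (norm v + norm k)" using ep(1) norm_Pair_le[of v k] by simp
    finally show ?thesis .
   qed
   have Tfi: "norm (fi t x - fi t p - fi' t p v) <= ep * norm v" if "t : {0..1}" for t
    using d1(3)[OF that, of p x] d1(1) x by (simp add: v_def dist_norm norm_minus_commute)
   have cVx: "continuous_on {0..1} (%s. V s (x, w s))"
    if "x : W" "continuous_on {0..1} w" "!!t. t : {0..1} ==> w t : K" for w x
    by (rule cont_uncurry[OF cV]) (use that in \<open>auto intro!: continuous_intros\<close>)
   have cVx': "continuous_on {0..1} (%s. V s (x, z s x))" "continuous_on {0..1} (%s. V s (p, z s p))"
    by (rule cVx[OF xW zc1[OF xW] zK[OF _ xW]], assumption) (rule cVx[OF p zc1[OF p] zK[OF _ p]])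
   have kaeq: "ka t = (fi t x - fi t p) + J (%s. V s (x, z s x) - V s (p, z s p)) t" if t: "t : {0..1}" for t
    using z[OF t xW] z[OF t p] J_diff[OF cVx' t] by (simp add: ka_def)
   have kab: "norm (ka t) <= C * norm v" if t: "t : {0..1}" for t
   proof -
    have "norm (ka t) <= 2 * ((2 + C1 + C2) * norm v)"
    proof (rule half_bound[where u=ka, OF cka _ t])
     fix B t assume B: "!!t. t : {0..1} ==> norm (ka t) <= B" and t: "t : {0..1::real}"
     have "norm (J (%s. V s (x, z s x) - V s (p, z s p)) t) <= (1 + C2) * norm v + B / 2"
     proof (rule J_bound[OF continuous_on_diff[OF cVx'] _ t])
      fix s :: real assume s: "s : {0..1}"
      have a: "norm (V s (x, z s x) - V s (x, z s p)) <= B / 2"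
       using lip[OF s xW zK[OF s xW] zK[OF s p]] B[OF s] by (simp add: ka_def)
      have b: "norm (V s (x, z s p) - V s (p, z s p) - L s v 0) <= 1 * norm v"
       using TV[OF s, of 0] d2(1) mult_right_mono[OF ep(2) norm_ge_zero[of v]] by simp
      have c: "norm (L s v 0) <= C2 * norm v" using C2(2) s by blast
      show "norm (V s (x, z s x) - V s (p, z s p)) <= (1 + C2) * norm v + B / 2"
       using norm_add3_le[OF a b c] by (simp add: algebra_simps)
     qed
     note c = this
     have a: "norm (fi t x - fi t p - fi' t p v) <= 1 * norm v"
      using Tfi[OF t] mult_right_mono[OF ep(2) norm_ge_zero[of v]] by simp
     have b: "norm (fi' t p v) <= C1 * norm v" using C1(2) t by blast
     show "norm (ka t) <= (2 + C1 + C2) * norm v + B / 2"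
      using norm_add3_le[OF a b c] unfolding kaeq[OF t] by (simp add: algebra_simps)
    qed
    thus ?thesis by (simp only: C_def mult.assoc)
   qed
   show "ALL t:{0..1}. norm (z t x - z t p - y (x - p) t) <= e * norm (x - p)"
   proof
    fix t :: real assume t: "t : {0..1}"
    define r where "r s = ka s - y v s" for s
    have "norm (r t) <= 2 * (ep * (2 + C) * norm v)"
    proof (rule half_bound[where u=r, OF _ _ t])
     show "continuous_on {0..1} r" unfolding r_def by (intro continuous_on_diff cka y)
     fix B t assume B: "!!t. t : {0..1} ==> norm (r t) <= B" and t: "t : {0..1::real}"
     have "J (%s. V s (x, z s x) - V s (p, z s p)) t - J (%s. L s v (y v s)) t =
      J (%s. V s (x, z s x) - V s (p, z s p) - L s v (y v s)) t"
      by (rule J_diff[OF continuous_on_diff[OF cVx'] cLy[OF y(1)] t])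
     also have "norm \<dots> <= ep * (1 + C) * norm v + B / 2"
     proof (rule J_bound[OF continuous_on_diff[OF continuous_on_diff[OF cVx'] cLy[OF y(1)]] _ t])
      fix s :: real assume s: "s : {0..1}"
      have "norm (V s (x, z s p + ka s) - V s (p, z s p) - L s v (ka s)) <= ep * (norm v + norm (ka s))"
       by (rule TV[OF s kad[OF s]])
      also have "\<dots> <= ep * (norm v + C * norm v)" using kab[OF s] ep(1) by simp
      finally have 1: "norm (V s (x, z s x) - V s (p, z s p) - L s v (ka s)) <= ep * (1 + C) * norm v"
       by (simp add: ka_def algebra_simps)
      have "L s v (ka s) - L s v (y v s) = L s 0 (r s)"
       using L_diff[OF s, of v v "ka s" "y v s"] by (simp add: r_def)
      moreover have "norm (L s 0 (r s)) <= B / 2" using L_half[OF s, of "r s"] B[OF s] by simp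
      ultimately have 2: "norm (L s v (ka s) - L s v (y v s)) <= B / 2" by simp
      show "norm (V s (x, z s x) - V s (p, z s p) - L s v (y v s)) <= ep * (1 + C) * norm v + B / 2"
       using norm_triangle_mono[OF 1 2] by simp
     qed
     finally have 1: "norm (J (%s. V s (x, z s x) - V s (p, z s p)) t - J (%s. L s v (y v s)) t) <=
      ep * (1 + C) * norm v + B / 2" .
     have "r t = (fi t x - fi t p - fi' t p v) +
      (J (%s. V s (x, z s x) - V s (p, z s p)) t - J (%s. L s v (y v s)) t)"
      unfolding r_def kaeq[OF t] yeq[OF t, of v] by simp
     hence "norm (r t) <= ep * norm v + (ep * (1 + C) * norm v + B / 2)"
      using norm_triangle_mono[OF Tfi[OF t] 1] by simp
     thus "norm (r t) <= ep * (2 + C) * norm v + B / 2" by (simp add: algebra_simps)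
    qed
    also have "\<dots> <= e * norm v"
     using mult_right_mono[OF ep(3) norm_ge_zero[of v]] by (simp add: mult_ac)
    finally show "norm (z t x - z t p - y (x - p) t) <= e * norm (x - p)"
     by (simp add: r_def ka_def v_def)
   qed
  qed (use d1 d2 d3 in auto)
 qed
 show ?thesis
 proof (rule that[of "%t v. y v t"])
  fix t :: real assume t: "t : {0..1}"
  show "(z t hder (%v. y v t)) (at p)"
   unfolding has_derivative_at_alt
   using linear_imp_bounded_linear[OF y_lin[OF t]] key t by blast
 next
  show "y v t = fi' t p v + J (%s. V' s (p, z s p) (v, y v s)) t" if "t : {0..1}" for t v
   using yeq[OF that] by (simp add: L_def)
 qed (rule y(1))
qed

end

lemma pCk_linear_compose:
 fixes z :: "real => 'p::model_space => 'b::real_normed_vector"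
 assumes "open W" "bounded_linear L" "pCk k T S z" "!!x. x : W ==> L x : S"
 shows "pCk k T W (%t x. z t (L x))"
 by (rule pCk_pcompose[OF assms(1) pCk_linear[OF assms(2)] _ assms(3)]) (use assms(4) in auto)

context contraction_operator begin

text \<open>Induction on k. The derivative of the solution in a fixed direction solves the
  linearised equation, which has the same form. Its data are of class C^k once the solution itself
  is, and the induction hypothesis gives that first. The new unknown ranges over the whole space,
  hence \<open>UNIV\<close> for \<open>K\<close>.\<close>

theorem fixpoint_pCk:
 fixes fi :: "real => 'p::model_space => 'e"
 assumes W: "open W"
 shows "open K ==> pCk k {0..1} W fi ==> pCk k {0..1} (W \<times> K) V ==>
  (!!t p k k'. t : {0..1} ==> p : W ==> k : K ==> k' : K ==>
   norm (V t (p, k) - V t (p, k')) <= norm (k - k') / 2) ==>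
  (!!p. p : W ==> continuous_on {0..1} (%t. z t p)) ==>
  (!!t p. t : {0..1} ==> p : W ==> z t p : K) ==>
  (!!t p. t : {0..1} ==> p : W ==> z t p = fi t p + J (%s. V s (p, z s p)) t) ==>
  pCk k {0..1} W z"
proof (induction k arbitrary: fi V z K)
 case 0
 have "continuous_on ({0..1} \<times> W) (%(t, p). z t p)"
  by (rule fixpoint_continuous[OF W pCk_cont[OF 0(2)] pCk_cont[OF 0(3)] 0(4-7)])
 thus ?case by simp
next
 case (Suc k)
 note K = Suc.prems(1) and fi = Suc.prems(2) and V = Suc.prems(3) and lip = Suc.prems(4)
  and zc = Suc.prems(5) and zK = Suc.prems(6) and z = Suc.prems(7)
 have cz: "continuous_on ({0..1} \<times> W) (%(t, p). z t p)"
  by (rule fixpoint_continuous[OF W pCk_cont[OF fi] pCk_cont[OF V] lip zc zK z])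
 have zk: "pCk k {0..1} W z"
  by (rule Suc.IH[OF K pCk_Suc_imp[OF fi] pCk_Suc_imp[OF V] lip zc zK z])
 obtain fi' where fi': "!!t p. t : {0..1} ==> p : W ==> (fi t hder fi' t p) (at p)"
   "!!v. pCk k {0..1} W (%t p. fi' t p v)" using pCk_SucE[OF fi] by blast
 obtain V' where V': "!!t q. t : {0..1} ==> q : W \<times> K ==> (V t hder V' t q) (at q)"
   "!!v. pCk k {0..1} (W \<times> K) (%t p. V' t p v)" using pCk_SucE[OF V] by blast
 have "\<exists>et. (ALL t:{0..1}. (z t hder et t) (at p)) & (ALL v. continuous_on {0..1} (%t. et t v)) &
  (ALL v. ALL t:{0..1}. et t v = fi' t p v + J (%s. V' s (p, z s p) (v, et s v)) t)" if p: "p : W" for p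
  apply (rule fixpoint_differentiable[OF W K fi'(1) pCk_cont[OF fi'(2)] pCk_cont[OF V] V'(1)
    pCk_cont[OF V'(2)] lip cz zK z p], assumption+)
  subgoal for et by (rule exI[of _ et]) blast
  done
 hence "ALL p. \<exists>et. p : W --> (ALL t:{0..1}. (z t hder et t) (at p)) &
  (ALL v. continuous_on {0..1} (%t. et t v)) &
  (ALL v. ALL t:{0..1}. et t v = fi' t p v + J (%s. V' s (p, z s p) (v, et s v)) t)" by blast
 from choice[OF this] obtain et where et0: "ALL p. p : W --> (ALL t:{0..1}. (z t hder et p t) (at p)) &
  (ALL v. continuous_on {0..1} (%t. et p t v)) &
  (ALL v. ALL t:{0..1}. et p t v = fi' t p v + J (%s. V' s (p, z s p) (v, et p s v)) t)" ..
 have et: "!!p t. p : W ==> t : {0..1} ==> (z t hder et p t) (at p)"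
  "!!p v. p : W ==> continuous_on {0..1} (%t. et p t v)"
  "!!p v t. p : W ==> t : {0..1} ==> et p t v = fi' t p v + J (%s. V' s (p, z s p) (v, et p s v)) t"
  using et0 by blast+
 have lin: "linear (V' t (p, z t p))" if "t : {0..1}" "p : W" for t p
  by (rule has_derivative_linear[OF V'(1)]) (use that zK in auto)
 show ?case
 proof (rule pCk_SucI[OF cz, of "%t p. et p t"])
  fix v
  let ?V = "%t q. V' t (fst q, z t (fst q)) (v, snd q)"
  show "pCk k {0..1} W (%t p. et p t v)"
  proof (rule Suc.IH[of UNIV "%t p. fi' t p v" ?V])
   have WU: "open (W \<times> (UNIV :: 'e set))" using W by (intro open_Times) auto
   have pt: "pCk k {0..1} (W \<times> (UNIV :: 'e set)) (%t q. (fst q, z t (fst q)))"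
    by (rule pCk_Pair[OF pCk_linear[OF bounded_linear_fst] pCk_linear_compose[OF WU bounded_linear_fst zk]]) auto
   have pV: "pCk k {0..1} (W \<times> (UNIV :: 'e set)) (%t q. V' t (fst q, z t (fst q)) u)" for u
    by (rule pCk_pcompose[OF WU pt _ V'(2)]) (use zK in auto)
   \<comment> \<open>The right side of the linearised equation is affine in the unknown; the
     expansion over \<open>mb\<close> exhibits it as a combination of values in fixed
     directions.\<close>
   have "pCk k {0..1} (W \<times> UNIV) (%t q. V' t (fst q, z t (fst q)) (v, 0) +
     (SUM b:mb. inner (snd q) b *. V' t (fst q, z t (fst q)) (0, b)))"
    by (intro pCk_add pV pCk_sum pCk_bilinear[OF bounded_bilinear_scaleR] pCk_linear
      bounded_linear_compose[OF bounded_linear_inner_left bounded_linear_snd])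
   thus "pCk k {0..1} (W \<times> UNIV) ?V"
   proof (rule pCk_cong[OF WU, rotated])
    fix t :: real and q :: "'p \<times> 'e" assume t: "t : {0..1}" and q: "q : W \<times> UNIV"
    let ?l = "V' t (fst q, z t (fst q))"
    have l: "linear ?l" by (rule lin[OF t]) (use q in auto)
    have "linear (%k. ?l (0, k))"
     using linear_compose[OF _ l, of "%k. (0, k)"] by (simp add: o_def linear_iff)
    hence "?l (0, snd q) = (SUM b:mb. inner (snd q) b *. ?l (0, b))"
     by (rule lin_mb_sum)
    thus "?l (v, 0) + (SUM b:mb. inner (snd q) b *. ?l (0, b)) = ?V t q"
     using linear_add[OF l, of "(v, 0)" "(0, snd q)"] by simp
   qed
   fix t :: real and p and k k' :: 'e assume t: "t : {0..1}" and p: "p : W"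
   have "((%k. (p, k)) hder (%k. (0, k))) (at (z t p))"
    by (auto intro!: derivative_eq_intros)
   moreover have "(V t hder V' t (p, z t p)) (at (p, z t p))"
    by (rule V'(1)[OF t]) (use zK t p in auto)
   ultimately have "((%k. V t (p, k)) hder (%k. V' t (p, z t p) (0, k))) (at (z t p))"
    by (rule has_derivative_compose)
   hence "norm (V' t (p, z t p) (0, k - k')) <= 1 / 2 * norm (k - k')"
    by (rule has_derivative_norm_le[OF _ K zK[OF t p]]) (use lip[OF t p _ zK[OF t p]] in auto)
   thus "norm (?V t (p, k) - ?V t (p, k')) <= norm (k - k') / 2"
    using linear_diff[OF lin[OF t p], of "(v, k)" "(v, k')"] by simp
  qed (use fi'(2) et in auto)
 qed (use et in auto)
qed

text \<open>The gap between \<open>r\<close> and \<open>R\<close> keeps the solutions inside an open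
  ball on which \<open>V\<close> is smooth, as \<open>fixpoint_pCk\<close> demands.\<close>

lemma smooth_fixpoint:
 fixes fi :: "real => 'p::model_space => 'e"
 assumes W: "open W" and r: "r < R"
  and fi: "!!k. pCk k {0..1} W fi" and V: "!!k. pCk k {0..1} (W \<times> ball 0 R) V"
  and lip: "!!t p k k'. t : {0..1} ==> p : W ==> norm k < R ==> norm k' < R ==>
   norm (V t (p, k) - V t (p, k')) <= norm (k - k') / 2"
  and b: "!!t p. t : {0..1} ==> p : W ==> norm (fi t p) <= r / 4"
   "!!t p. t : {0..1} ==> p : W ==> norm (V t (p, 0)) <= r / 4"
 obtains z where "!!k. pCk k {0..1} W z" "!!t p. t : {0..1} ==> p : W ==> norm (z t p) <= r"
  "!!t p. t : {0..1} ==> p : W ==> z t p = fi t p + J (%s. V s (p, z s p)) t"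
proof -
 have "EX y. continuous_on {0..1} y & (ALL t:{0..1}. norm (y t) <= r) &
   (ALL t:{0..1}. y t = fi t p + J (%s. V s (p, y s)) t)" if p: "p : W" for p
 proof (rule fixpoint_exists[of r "%t k. V t (p, k)" "%t. fi t p"])
  have "continuous_on ({0..1} \<times> cball 0 r) (%q. case (fst q, p, snd q) of (t, q) => V t q)"
   by (rule continuous_on_compose2[OF pCk_cont[OF V]])
    (use p r in \<open>auto intro!: continuous_intros\<close>)
  thus "continuous_on ({0..1} \<times> cball 0 r) (%(t, k). V t (p, k))" by (simp add: split_def)
  show "continuous_on {0..1} (%t. fi t p)"
   by (rule cont_uncurry[OF pCk_cont[OF fi]]) (use p in auto)
 qed (use lip[OF _ p] b p r in auto)
 hence "ALL p. EX y. p : W --> continuous_on {0..1} y & (ALL t:{0..1}. norm (y t) <= r) &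
   (ALL t:{0..1}. y t = fi t p + J (%s. V s (p, y s)) t)" by blast
 from choice[OF this] obtain y where y0: "ALL p. p : W --> continuous_on {0..1} (y p) & (ALL t:{0..1}. norm (y p t) <= r) &
   (ALL t:{0..1}. y p t = fi t p + J (%s. V s (p, y p s)) t)" ..
 have y: "!!p. p : W ==> continuous_on {0..1} (y p)"
  "!!p t. p : W ==> t : {0..1} ==> norm (y p t) <= r"
  "!!p t. p : W ==> t : {0..1} ==> y p t = fi t p + J (%s. V s (p, y p s)) t"
  using y0 by blast+
 show ?thesis
 proof (rule that[of "%t p. y p t"])
  show "pCk k {0..1} W (%t p. y p t)" for k
  proof (rule fixpoint_pCk[OF W _ fi V])
   show "y p t : ball 0 R" if "t : {0..1}" "p : W" for t p
    using y(2)[OF that(2,1)] r by simp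
  qed (use lip y in auto)
 qed (use y in auto)
qed

end

interpretation id_contraction: contraction_operator "%u. u"
 by standard auto

interpretation integral_contraction: contraction_operator "%u t. integral {0..t} u"
proof
 fix u v :: "real => 'e::model_space" and t B r :: real assume u: "continuous_on {0..1} u"
 have i: "w integrable_on {0..t}" if "continuous_on {0..1} w" "t : {0..1}" for t and w :: "real => 'e"
  by (rule integrable_continuous_real) (rule continuous_on_subset[OF that(1)], use that in auto)
 show "continuous_on {0..1} (%t. integral {0..t} u)"
  by (rule indefinite_integral_continuous_1) (use i[OF u, of 1] in simp)
 show "integral {0..t} (%s. u s + v s) = integral {0..t} u + integral {0..t} v"
  if "continuous_on {0..1} v" "t : {0..1}" by (rule integral_add) (use that i u in auto)
 show "integral {0..t} (%s. r *. u s) = r *. integral {0..t} u" by (rule integral_cmul)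
 show "norm (integral {0..t} u) <= B" if "!!s. s : {0..1} ==> norm (u s) <= B" and t: "t : {0..1}"
 proof -
  have "norm (integral {0..t} u) <= B * (t - 0)"
   by (rule integral_bound) (use that in \<open>auto intro: continuous_on_subset[OF u]\<close>)
  moreover have "B >= 0" using order_trans[OF norm_ge_zero that(1)[of 0]] by simp
  ultimately show ?thesis using t mult_left_mono[of t 1 B] by auto
 qed
qed

text \<open>The equation Ps (x0 + z) = Ps x0 + p is rewritten as z = p + (Ps x0 + z - Ps (x0 + z)).
  The bracket is Lipschitz with constant 1/2 near 0, because the derivative of \<open>Ps\<close> at
  \<open>x0\<close> is the identity. This is a fixed point equation with the identity as
  \<open>J\<close> and no dependence on time.\<close>

lemma smooth_inverse_function:
 fixes Ps :: "'e::model_space => 'e"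
 assumes S: "open S" "x0 : S" "smooth_on S Ps" and d: "!!v. frechet_derivative Ps (at x0) v = v"
 obtains U V Th where "open U" "x0 : U" "U \<subseteq> S" "open V" "smooth_on V Th"
  "!!x. x : U ==> Ps x : V & Th (Ps x) = x" "!!y. y : V ==> Th y : U & Ps (Th y) = y"
proof -
 have d': "(Ps hder frechet_derivative Ps (at x)) (at x)" if "x : S" for x
  by (rule smooth_on_has_derivative[OF S(3) that])
 have c: "continuous_on ({0..1::real} \<times> S) (%(t, x). frechet_derivative Ps (at x) b)" for b
  using pCk_cont[OF Ck_on_imp_pCk[of 0]] smooth_on_continuous[OF smooth_on_frechet[OF S(3)]] by force
 obtain R where R: "R > 0" "ball x0 R \<subseteq> S"
  and lip: "!!t x y. t : {0..1::real} ==> x : ball x0 R ==> y : ball x0 R ==>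
   norm (Ps y - Ps x - frechet_derivative Ps (at x0) (y - x)) <= 1 / 2 * norm (y - x)"
  apply (rule uniform_taylor[OF S(1,2) _ d' c, of "1 / 2"], simp, assumption)
  subgoal premises pr for d by (rule pr(1)[OF pr(2,3)]) (rule pr(4))
  done
 define r where "r = R / 2"
 define W where "W = ball (0::'e) (r / 4)"
 have r: "r > 0" "r < R" using R by (auto simp: r_def)
 define V :: "real => 'e \<times> 'e => 'e" where "V = (%t q. Ps x0 + snd q - Ps (x0 + snd q))"
 have WK: "open (W \<times> ball (0::'e) R)" by (auto simp: W_def intro: open_Times)
 have "smooth_on (W \<times> ball 0 R) (%q. Ps x0 + snd q - Ps (x0 + snd q))"
  by (intro smooth_on_diff smooth_on_add smooth_on_const smooth_on_snd smooth_on_id WK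
    smooth_on_compose[OF WK S(3)]) (use R in \<open>auto simp: dist_norm subset_eq\<close>)
 hence V: "pCk k {0..1} (W \<times> ball 0 R) V" for k
  unfolding V_def smooth_on_def by (intro Ck_on_imp_pCk) auto
 obtain z where z: "!!k. pCk k {0..1} W z" "!!t p. t : {0..1} ==> p : W ==> norm (z t p) <= r"
  "!!t p. t : {0..1} ==> p : W ==> z t p = p + V t (p, z t p)"
 proof (rule id_contraction.smooth_fixpoint[OF _ r(2) _ V, of "%t p. p"])
  show "norm (V t (p, k) - V t (p, k')) <= norm (k - k') / 2" if "norm k < R" "norm k' < R" for t p k k'
   using lip[of 0 "x0 + k" "x0 + k'"] that
   by (simp add: V_def d dist_norm norm_minus_commute algebra_simps)
  show "pCk k {0..1} W (%t p. p)" for k by (rule pCk_linear[OF bounded_linear_ident])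
 qed (use r in \<open>auto simp: W_def V_def\<close>)
 define Th where "Th y = x0 + z 0 (y - Ps x0)" for y
 define V0 where "V0 = ball (Ps x0) (r / 4)"
 define U where "U = ball x0 R \<inter> Ps -` V0"
 have inW: "y - Ps x0 : W" if "y : V0" for y using that by (simp add: V0_def W_def dist_norm norm_minus_commute)
 have Th: "Th y : ball x0 R & Ps (Th y) = y" if "y : V0" for y
  using z(2)[of 0, OF _ inW[OF that]] z(3)[of 0, OF _ inW[OF that]] r
  by (auto simp: Th_def V_def dist_norm algebra_simps)
 have inj: "x = y" if "x : ball x0 R" "y : ball x0 R" "Ps x = Ps y" for x y
  using lip[of 0 x y] that by (simp add: d norm_minus_commute)
 show ?thesis
 proof (rule that[of U V0 Th])
  show "open U" unfolding U_def
   using continuous_on_subset[OF smooth_on_continuous[OF S(3)] R(2)]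
   by (subst Int_commute, intro continuous_on_open_vimage[THEN iffD1, rule_format]) (auto simp: V0_def)
  have "smooth_on W (z 0)" unfolding smooth_on_def
   using pCk_imp_Ck_on[OF _ _ z(1), of 0] by (auto simp: W_def)
  thus "smooth_on V0 Th" unfolding Th_def
   by (intro smooth_on_add smooth_on_const smooth_on_compose[of V0 W "z 0"] smooth_on_diff smooth_on_id inW)
    (auto simp: V0_def)
  show "x0 : U" using R r by (auto simp: U_def V0_def)
  show "U \<subseteq> S" using R by (auto simp: U_def)
  show "Ps x : V0 & Th (Ps x) = x" if "x : U" for x
   using that Th[of "Ps x"] inj[of "Th (Ps x)" x] by (auto simp: U_def)
  show "Th y : U & Ps (Th y) = y" if "y : V0" for y
   using Th[OF that] that by (auto simp: U_def)
 qed (auto simp: V0_def)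
qed

section \<open>Uniqueness from linear differential inequalities\<close>

lemma vector_derivative_zero_forward:
 fixes u :: "real => 'e::real_inner"
 assumes d: "!!t. t : {a..b} ==> (u hvd u' t) (at t within {a..b})"
  and le: "!!t. t : {a..b} ==> norm (u' t) <= L * norm (u t)"
  and u0: "u a = 0" and t: "t : {a..b}"
 shows "u t = 0"
proof (cases "t = a")
 case False
 hence at: "a < t" using t by simp
 \<comment> \<open>The weight for a Gronwall argument: the hypothesis \<open>le\<close> makes this
   weighted squared norm nonincreasing, and it starts at 0.\<close>
 let ?g = "%s. exp (- 2 * L * s) * inner (u s) (u s)"
 let ?g' = "%s. exp (- 2 * L * s) * (2 * inner (u' s) (u s) - 2 * L * inner (u s) (u s))"
 have gd: "(?g hder (%h. h * ?g' s)) (at s within {a..t})" if "s : {a..t}" for s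
 proof -
  have "(u hder (%h. h *. u' s)) (at s within {a..t})"
   using has_vector_derivative_within_subset[OF d[of s], of "{a..t}"] that t
   by (auto simp: has_vector_derivative_def)
  thus ?thesis
   by (auto intro!: derivative_eq_intros simp: algebra_simps inner_commute fun_eq_iff)
 qed
 obtain s where s: "s : {a<..<t}" and eq: "?g t - ?g a = (t - a) * ?g' s"
  using mvt_simple[OF at, of ?g "%s h. h * ?g' s"] gd by auto
 have "inner (u' s) (u s) <= norm (u' s) * norm (u s)" by (rule norm_cauchy_schwarz)
 also have "\<dots> <= L * norm (u s) * norm (u s)"
  using le[of s] s t by (intro mult_right_mono) auto
 finally have "2 * inner (u' s) (u s) - 2 * L * inner (u s) (u s) <= 0"
  by (simp add: dot_square_norm power2_eq_square)
 hence "?g' s <= 0" by (simp add: mult_nonneg_nonpos)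
 hence "(t - a) * ?g' s <= 0" using at by (simp only: mult_nonneg_nonpos diff_ge_0_iff_ge less_imp_le)
 hence "?g t <= 0" using eq u0 by simp
 hence "inner (u t) (u t) <= 0" by (simp add: mult_le_0_iff)
 hence "inner (u t) (u t) = 0" using inner_ge_zero[of "u t"] by linarith
 thus ?thesis by simp
qed (simp add: u0)

text \<open>The zero may occur at any time of the interval; for earlier times the forward case is
  applied to the time-reversed function.\<close>

lemma vector_derivative_zero:
 fixes u :: "real => 'e::real_inner"
 assumes d: "!!t. t : {a..b} ==> (u hvd u' t) (at t within {a..b})"
  and le: "!!t. t : {a..b} ==> norm (u' t) <= L * norm (u t)"
  and u0: "u c = 0" and c: "c : {a..b}" and t: "t : {a..b}"
 shows "u t = 0"
proof (cases "c <= t")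
 case True
 show ?thesis
  by (rule vector_derivative_zero_forward[of c b u u' L])
   (use True t c u0 in \<open>auto intro!: has_vector_derivative_within_subset[OF d] le\<close>)
next
 case False
 have "((%s. u (- s)) hvd - u' (- s)) (at s within {- c..- a})" if "s : {- c..- a}" for s
 proof -
  have "((%s. - s) hvd - 1) (at s within {- c..- a})"
   by (auto intro!: derivative_eq_intros)
  moreover have "(u hvd u' (- s)) (at (- s) within uminus ` {- c..- a})"
   by (rule has_vector_derivative_within_subset[OF d]) (use that c in auto)
  ultimately show ?thesis
   using vector_diff_chain_within[of uminus "-1" s "{- c..- a}" u "u' (- s)"] by (simp add: o_def)
 qed
 hence "u (- (- t)) = 0"
  by (rule vector_derivative_zero_forward[of "- c" "- a" "%s. u (- s)" "%s. - u' (- s)" L])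
   (use False t c u0 in \<open>auto intro!: le\<close>)
 thus ?thesis by simp
qed

text \<open>Mean value inequality in s, for the difference of f between the parallel segments x + s
  v + h w and x + s v, minus the linear term s h g' w. Only the derivative of
  \<open>%y. f' y v\<close> at the point \<open>x\<close> itself enters.\<close>

lemma second_difference_limit:
 fixes f :: "'a::real_normed_vector => 'b::real_normed_vector"
 assumes S: "open S" "x : S"
  and f: "!!y. y : S ==> (f hder f' y) (at y)"
  and g: "((%y. f' y v) hder g') (at x)" and e: "e > 0"
 shows "EX d>0. ALL h. 0 < h & h < d -->
  norm (f (x + h *. v + h *. w) - f (x + h *. v) - f (x + h *. w) + f x - (h * h) *. g' w) <= e * (h * h)"
proof -
 \<comment> \<open>The points involved lie within h N of \<open>x\<close>, and the two error terms
   add up to at most e h because 2 (norm v + norm w) \<le> N.\<close>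
 define N where "N = 2 * (norm v + norm w) + 1"
 have N: "N > 0" by (simp add: N_def add_nonneg_pos)
 obtain r where r: "r > 0" "ball x r \<subseteq> S" using openE[OF S] by blast
 obtain d where d: "d > 0" "!!y. norm (y - x) < d ==> norm (f' y v - f' x v - g' (y - x)) <= e / N * norm (y - x)"
  using g[unfolded has_derivative_at_alt] e N by (metis divide_pos_pos)
 have lin: "linear g'" using g by (rule has_derivative_linear)
 have main: "norm (f (x + h *. v + h *. w) - f (x + h *. v) - f (x + h *. w) + f x - (h * h) *. g' w) <= e * (h * h)"
  if h: "0 < h" "h < min d r / N" for h
 proof -
  have small: "norm (s *. v + a *. h *. w) < min d r" if "s : {0..h}" "a : {0,1}" for s a
  proof -
   have "norm (s *. v + a *. h *. w) <= h * norm v + h * norm w"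
    using that h by (intro order_trans[OF norm_triangle_ineq] add_mono) (auto simp: mult_right_mono)
   also have "\<dots> = h * (norm v + norm w)" by (rule distrib_left[symmetric])
   also have "\<dots> <= h * N" using h by (intro mult_left_mono) (auto simp: N_def)
   also have "\<dots> < min d r" using h N by (simp add: pos_less_divide_eq)
   finally show ?thesis .
  qed
  have inS: "x + (s *. v + a *. h *. w) : S" if "s : {0..h}" "a : {0,1}" for s a
  proof -
   have "dist (x + (s *. v + a *. h *. w)) x < r" using small[OF that] by (simp add: dist_norm)
   thus ?thesis using r(2) by (auto simp: subset_eq dist_commute)
  qed
  let ?p = "%a s. f (x + (s *. v + a *. h *. w))"
  let ?q = "%a s. f' (x + (s *. v + a *. h *. w)) v"
  have pd: "(?p a hder (%k. k *. ?q a s)) (at s within {0..h})" if "s : {0..h}" "a : {0,1}" for s a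
  proof -
   have "((%s. x + (s *. v + a *. h *. w)) hder (%k. 0 + (k *. v + 0))) (at s within {0..h})"
    by (intro has_derivative_add has_derivative_const has_derivative_scaleR_left has_derivative_ident)
   from has_derivative_compose[OF this f[OF inS[OF that]]]
   show ?thesis
    unfolding add_0_left add_0_right linear_scale[OF has_derivative_linear[OF f[OF inS[OF that]]]] .
  qed
  let ?F = "%s. ?p 1 s - ?p 0 s - (s * h) *. g' w"
  let ?F' = "%s k. k *. (?q 1 s - ?q 0 s - h *. g' w)"
  have "norm (?F h - ?F 0) <= (e * h) * norm (h - 0)"
  proof (rule differentiable_bound[of "{0..h}" _ ?F'])
   fix s assume s: "s : {0..h}"
   have "((%s. (s * h) *. g' w) hder (%k. (k * h) *. g' w)) (at s within {0..h})"
    by (auto intro!: derivative_eq_intros)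
   from has_derivative_diff[OF has_derivative_diff[OF pd[OF s, of 1] pd[OF s, of 0]] this]
   show "(?F hder ?F' s) (at s within {0..h})"
    by (simp add: scaleR_diff_right)
   have eq: "?q 1 s - ?q 0 s - h *. g' w =
    (?q 1 s - f' x v - g' (s *. v + 1 *. h *. w)) - (?q 0 s - f' x v - g' (s *. v + 0 *. h *. w))"
    using linear_add[OF lin, of "s *. v" "h *. w"] linear_scale[OF lin, of h w] by simp
   have b: "norm (?q a s - f' x v - g' (s *. v + a *. h *. w)) <= e / N * (h * (norm v + norm w))" if "a : {0,1}" for a
   proof -
    have n: "norm (s *. v + a *. h *. w) <= h * norm v + h * norm w"
     using that s h by (intro order_trans[OF norm_triangle_ineq] add_mono) (auto simp: mult_right_mono)
    have "norm (?q a s - f' x v - g' (s *. v + a *. h *. w)) <= e / N * norm (s *. v + a *. h *. w)"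
     using d(2)[of "x + (s *. v + a *. h *. w)"] small[OF s that] by simp
    also have "\<dots> <= e / N * (h * (norm v + norm w))"
     unfolding distrib_left[of h] using n e N by (intro mult_left_mono) auto
    finally show ?thesis .
   qed
   have "norm (?q 1 s - ?q 0 s - h *. g' w) <= e / N * (h * (norm v + norm w)) + e / N * (h * (norm v + norm w))"
    unfolding eq by (intro norm_triangle_le_diff add_mono b) auto
   also have "\<dots> = e * h * ((2 * (norm v + norm w)) / N)" by simp
   also have "\<dots> <= e * h * 1" using e h N by (intro mult_left_mono) (auto simp: N_def)
   finally have "norm (?q 1 s - ?q 0 s - h *. g' w) <= e * h" by simp
   thus "onorm (?F' s) <= e * h"
    using e h by (intro onorm_bound) (auto simp: mult.commute mult_left_mono)
  qed (use h in auto)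
  thus ?thesis using h by (simp add: algebra_simps)
 qed
 show ?thesis
  by (intro exI[of _ "min d r / N"]) (use main d r N in auto)
qed

text \<open>Up to exchanging v and w, both orders of differentiation approximate the same second
  difference divided by h^2.\<close>

lemma second_derivative_symmetric:
 fixes f :: "'a::model_space => 'b::real_normed_vector"
 assumes S: "open S" "x : S" "smooth_on S f"
 shows "frechet_derivative (%y. frechet_derivative f (at y) v) (at x) w =
  frechet_derivative (%y. frechet_derivative f (at y) w) (at x) v" (is "?A = ?B")
proof -
 have f: "(f hder frechet_derivative f (at y)) (at y)" if "y : S" for y
  by (rule smooth_on_has_derivative[OF S(3) that])
 have g: "((%y. frechet_derivative f (at y) v) has_derivative
   frechet_derivative (%y. frechet_derivative f (at y) v) (at x)) (at x)" for v
  by (rule smooth_on_has_derivative[OF smooth_on_frechet[OF S(3)] S(2)])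
 have "norm (?A - ?B) <= 0 + e" if e: "e > 0" for e
 proof -
  obtain d1 where d1: "d1 > 0" "!!h. 0 < h & h < d1 ==>
   norm (f (x + h *. v + h *. w) - f (x + h *. v) - f (x + h *. w) + f x - (h * h) *. ?A) <= e / 2 * (h * h)"
   using second_difference_limit[OF S(1,2) f g[of v], of "e / 2" w] e by auto
  obtain d2 where d2: "d2 > 0" "!!h. 0 < h & h < d2 ==>
   norm (f (x + h *. w + h *. v) - f (x + h *. w) - f (x + h *. v) + f x - (h * h) *. ?B) <= e / 2 * (h * h)"
   using second_difference_limit[OF S(1,2) f g[of w], of "e / 2" v] e by auto
  define h where "h = min d1 d2 / 2"
  have h: "0 < h" "h < d1" "h < d2" using d1 d2 by (auto simp: h_def)
  define D where "D = f (x + h *. v + h *. w) - f (x + h *. v) - f (x + h *. w) + f x"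
  have 1: "norm (D - (h * h) *. ?A) <= e / 2 * (h * h)" using d1(2)[of h] h by (simp add: D_def)
  have 2: "norm (D - (h * h) *. ?B) <= e / 2 * (h * h)" using d2(2)[of h] h by (simp add: D_def algebra_simps)
  have "norm ((h * h) *. (?A - ?B)) <= e / 2 * (h * h) + e / 2 * (h * h)"
   using norm_triangle_le_diff[OF add_mono[OF 2 1]] by (simp add: scaleR_diff_right)
  hence "(h * h) * norm (?A - ?B) <= (h * h) * e" by (simp add: mult.commute[of _ e])
  thus ?thesis using h by simp
 qed
 hence "norm (?A - ?B) <= 0" by (rule field_le_epsilon)
 thus ?thesis by simp
qed

lemma Ck_on_iff_pCk: "open S ==> Ck_on k S f \<longleftrightarrow> pCk k {0} S (%_. f)"
 using Ck_on_imp_pCk pCk_imp_Ck_on[of S 0 "{0}" k "%_. f"] by blast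

section \<open>Cutoff functions\<close>

text \<open>Derivatives of \<open>flat n\<close> are linear combinations of the functions \<open>flat m\<close>, which makes
 \<open>flat 0\<close> smooth.\<close>

definition flat :: "nat => real => real" where
 "flat n t = (if t > 0 then inverse t ^ n / exp (inverse t) else 0)"

lemma flat_tendsto: "(flat n \<longlongrightarrow> 0) (at 0)"
proof -
 have "((%t. inverse t ^ n / exp (inverse t)) \<longlongrightarrow> (0::real)) (at_right 0)"
  using filterlim_compose[OF tendsto_power_div_exp_0 filterlim_inverse_at_top_right] .
 hence "(flat n \<longlongrightarrow> 0) (at_right 0)"
  by (rule Lim_transform_eventually) (auto simp: flat_def eventually_at_filter)
 moreover have "(flat n \<longlongrightarrow> 0) (at_left 0)"
  by (rule Lim_transform_eventually[OF tendsto_const]) (auto simp: flat_def eventually_at_filter)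
 ultimately show ?thesis by (simp add: filterlim_split_at)
qed

lemma flat_has_derivative:
 "(flat n hder (%v. v * (flat (n + 2) t - real n * flat (n + 1) t))) (at t)"
proof -
 consider "t > 0" | "t < 0" | "t = 0" by linarith
 hence "(flat n has_real_derivative (flat (n + 2) t - real n * flat (n + 1) t)) (at t)"
 proof cases
  case 1
  have "((%t. inverse t ^ n / exp (inverse t)) has_real_derivative
    (flat (n + 2) t - real n * flat (n + 1) t)) (at t)"
  proof -
   have "((%u. u ^ n / exp u) has_real_derivative (real n * inverse t ^ (n - 1) - inverse t ^ n) / exp (inverse t))
     (at (inverse t))"
    by (auto intro!: derivative_eq_intros simp: diff_divide_distrib left_diff_distrib power2_eq_square)
   moreover have "(inverse has_real_derivative - (inverse t * inverse t)) (at t)"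
    using DERIV_inverse[of t UNIV] 1 by (simp add: numeral_2_eq_2)
   ultimately have "((%t. inverse t ^ n / exp (inverse t)) has_real_derivative
     (real n * inverse t ^ (n - 1) - inverse t ^ n) / exp (inverse t) * - (inverse t * inverse t)) (at t)"
    by (rule DERIV_chain2)
   moreover have "(real n * u ^ (n - 1) - u ^ n) / exp u * - (u * u) = u ^ (n + 2) / exp u - real n * (u ^ (n + 1) / exp u)" for u :: real
    by (cases n) (simp_all add: algebra_simps diff_divide_distrib add_divide_distrib)
   ultimately show ?thesis using 1 by (simp add: flat_def)
  qed
  thus ?thesis
   by (rule has_field_derivative_transform_within_open[of _ _ _ "{0<..}"]) (use 1 in \<open>auto simp: flat_def\<close>)
 next
  case 2
  have "((%t. 0::real) has_real_derivative 0) (at t)" by simp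
  hence "(flat n has_real_derivative 0) (at t)"
   by (rule has_field_derivative_transform_within_open[of _ _ _ "{..<0}"]) (use 2 in \<open>auto simp: flat_def\<close>)
  thus ?thesis using 2 by (simp add: flat_def)
 next
  case 3
  have "((%h. (flat n (0 + h) - flat n 0) / h) \<longlongrightarrow> 0) (at 0)"
   using flat_tendsto[of "Suc n"]
   by (rule Lim_transform_eventually) (auto simp: flat_def eventually_at_filter field_simps)
  hence "(flat n has_real_derivative 0) (at 0)" by (simp add: DERIV_def)
  thus ?thesis using 3 by (simp add: flat_def)
 qed
 thus ?thesis unfolding has_field_derivative_def by (simp add: mult_commute_abs)
qed

lemma smooth_on_flat: "smooth_on UNIV (flat n)"
 unfolding smooth_on_def
proof
 fix k show "Ck_on k UNIV (flat n)"
 proof (induction k arbitrary: n)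
  case 0
  have "isCont (flat n) t" for t using has_derivative_continuous[OF flat_has_derivative] .
  thus ?case by (simp add: continuous_at_imp_continuous_on)
 next
  case (Suc k)
  have "frechet_derivative (flat n) (at t) v = v * (flat (n + 2) t - real n * flat (n + 1) t)" for t v
   using frechet_derivative_at[OF flat_has_derivative[of n t]] by metis
  moreover have "Ck_on k UNIV (%t. v * (flat (n + 2) t - real n * flat (n + 1) t))" for v
  proof -
   have "pCk k {0} UNIV (%_ t. v * (flat (n + 2) t + (- real n) * flat (n + 1) t))"
    using Suc.IH[of "n + 2"] Suc.IH[of "n + 1"] unfolding Ck_on_iff_pCk[OF open_UNIV]
    by (intro pCk_linear_image[OF bounded_linear_mult_right] pCk_add)
   thus ?thesis by (simp add: Ck_on_iff_pCk)
  qed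
  moreover have "flat n differentiable (at t)" for t using flat_has_derivative by (blast intro: differentiableI)
  ultimately show ?case by simp
 qed
qed

lemma smooth_on_inverse: "smooth_on {0<..} (inverse :: real => real)"
 unfolding smooth_on_def
proof
 fix k show "Ck_on k {0<..} (inverse :: real => real)"
 proof (induction k)
  case 0 show ?case by (auto intro!: continuous_intros)
 next
  case (Suc k)
  have d: "(inverse hder (%v. - (inverse t * v * inverse t))) (at t)" if "t > 0" for t :: real
   by (rule has_derivative_inverse') (use that in auto)
  have "Ck_on k {0<..} (%t. - (inverse t * v * inverse t))" for v :: real
  proof -
   have "pCk k {0} {0<..} (%_ t. (- v) * (inverse t * inverse t))"
    using Suc.IH unfolding Ck_on_iff_pCk[OF open_greaterThan]
    by (intro pCk_linear_image[OF bounded_linear_mult_right] pCk_bilinear[OF bounded_bilinear_mult])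
   thus ?thesis by (simp add: Ck_on_iff_pCk mult_ac)
  qed
  moreover have "- (inverse t * v * inverse t) = frechet_derivative inverse (at t) v" if "t > 0" for t v :: real
   using fun_cong[OF frechet_derivative_at[OF d[OF that]], of v] .
  ultimately have "Ck_on k {0<..} (%t. frechet_derivative inverse (at t) v)" for v :: real
   using Ck_on_cong[OF open_greaterThan, of 0 "%t. - (inverse t * v * inverse t)"] by (simp add: greaterThan_iff)
  moreover have "ALL t:{0<..}. inverse differentiable (at (t::real))" using d by (auto simp: differentiable_def)
  ultimately show ?case by simp
 qed
qed

lemma bump_function:
 assumes "r > 0"
 obtains be :: "'e::model_space => real" where "smooth_on UNIV be" "!!z. norm z <= r ==> be z = 1"
  "!!z. norm z >= 2 * r ==> be z = 0" "!!z. 0 <= be z" "!!z. be z <= 1"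
proof -
 \<comment> \<open>The squared norm is smooth at the origin. The cutoff drops from 1 to 0 for
   \<open>s\<close> between 1 and 2, while norm 2 r corresponds to \<open>s\<close> = 4.\<close>
 define s :: "'e => real" where "s z = inner z z / r\<^sup>2" for z
 define N where "N z = flat 0 (2 - s z) + flat 0 (s z - 1)" for z
 define be where "be z = flat 0 (2 - s z) * inverse (N z)" for z
 have nn: "flat 0 t >= 0" for t by (simp add: flat_def)
 have pos: "flat 0 t > 0" if "t > 0" for t using that by (simp add: flat_def)
 \<comment> \<open>The two arguments of \<open>flat 0\<close> add up to 1, so one of them is
   positive.\<close>
 have N: "N z > 0" for z
  using nn pos[of "2 - s z"] pos[of "s z - 1"] unfolding N_def
  by (cases "s z < 2") (auto intro: add_pos_nonneg add_nonneg_pos)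
 have sm_s: "smooth_on UNIV s" unfolding s_def divide_inverse
  by (intro smooth_on_mult smooth_on_inner smooth_on_id smooth_on_const open_UNIV)
 have f1: "smooth_on UNIV (%z. flat 0 (2 - s z))" "smooth_on UNIV (%z. flat 0 (s z - 1))"
  by (intro smooth_on_compose[OF open_UNIV smooth_on_flat] smooth_on_diff smooth_on_const open_UNIV sm_s UNIV_I)+
 have sm_N: "smooth_on UNIV N" unfolding N_def by (intro smooth_on_add f1 open_UNIV)
 have "smooth_on UNIV be" unfolding be_def
  by (intro smooth_on_mult f1 open_UNIV smooth_on_compose[OF open_UNIV smooth_on_inverse sm_N]) (simp add: N)
 moreover have "be z = 1" if "norm z <= r" for z
 proof -
  have "(norm z)\<^sup>2 <= r\<^sup>2" using that by (intro power_mono) auto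
  hence "s z <= 1" using assms by (simp add: s_def dot_square_norm)
  thus ?thesis using N[of z] by (auto simp: be_def N_def flat_def)
 qed
 moreover have "be z = 0" if "norm z >= 2 * r" for z
 proof -
  have "(2 * r)\<^sup>2 <= (norm z)\<^sup>2" using that assms by (intro power_mono) auto
  hence "s z >= 4" using assms by (simp add: s_def dot_square_norm pos_le_divide_eq power2_eq_square)
  thus ?thesis by (simp add: be_def flat_def)
 qed
 moreover have "0 <= be z" for z using nn N[of z] by (simp add: be_def)
 moreover have "be z <= 1" for z
  using N[of z] nn[of "s z - 1"] unfolding be_def N_def by (simp add: field_simps)
 ultimately show ?thesis using that by blast
qed

section \<open>Germs of smooth maps\<close>

abbreviation D :: "('a::real_normed_vector => 'b::real_normed_vector) => 'a => 'a => 'b" where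
 "D f x \<equiv> frechet_derivative f (at x)"

text \<open>Smoothness of a germ. Domains of local maps are left to the filter of neighbourhoods, so
  that finitely many conditions are intersected automatically.\<close>

definition sm_at :: "('a::real_normed_vector => 'b::real_normed_vector) => 'a => bool" where
 "sm_at f x \<longleftrightarrow> (EX S. open S & x : S & smooth_on S f)"

lemma sm_at_on: "smooth_on S f ==> open S ==> x : S ==> sm_at f x"
 unfolding sm_at_def by blast

lemma sm_at_near: "sm_at f x ==> near y ~ x. sm_at f y"
 unfolding sm_at_def eventually_nhds by blast

lemma smooth_on_iff_near: "open S ==> smooth_on S f \<longleftrightarrow> (ALL x:S. sm_at f x)"
 using smooth_onI_local[of S f] unfolding sm_at_def by blast

lemma sm_at_transform:
 assumes "sm_at f x" "near y ~ x. f y = g y" shows "sm_at g x"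
proof -
 obtain S where S: "open S" "x : S" "smooth_on S f" using assms(1) unfolding sm_at_def by blast
 obtain T where T: "open T" "x : T" "!!y. y : T ==> f y = g y" using assms(2) unfolding eventually_nhds by blast
 have "smooth_on (S \<inter> T) f" by (rule smooth_on_subset[OF S(3,1)]) (use S T in auto)
 hence "smooth_on (S \<inter> T) g" by (rule smooth_on_cong[rotated 2]) (use S T in auto)
 thus ?thesis using S T by (intro sm_at_on[of "S \<inter> T"]) auto
qed

lemma sm_at_has_derivative: "sm_at f x ==> (f hder D f x) (at x)"
 unfolding sm_at_def using smooth_on_has_derivative by blast

lemma sm_at_linear: "sm_at f x ==> linear (D f x)"
 by (rule has_derivative_linear[OF sm_at_has_derivative])

lemma sm_at_isCont: "sm_at f x ==> isCont f x"
 using sm_at_has_derivative has_derivative_continuous by blast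

lemma isCont_eventually: "isCont f x ==> near y ~ (f x). Q y ==> near z ~ x. Q (f z)"
 unfolding isCont_def by (metis eventually_compose_filterlim tendsto_at_iff_tendsto_nhds)

lemma sm_at_eventually:
 "sm_at f x ==> near y ~ (f x). Q y ==> near z ~ x. Q (f z)"
 by (rule isCont_eventually[OF sm_at_isCont])

text \<open>This is what allows an identity valid near 0 to be differentiated at every point near
  0.\<close>

lemma near_near: "near y ~ x. Q y ==> near y ~ x. near z ~ y. Q z"
 by (simp add: eventually_eventually)

lemma eventually_along: 
 assumes "sm_at f x" "near y ~ (f x). Q y"
 shows "near z ~ x. near y ~ (f z). Q y"
 by (rule sm_at_eventually[OF assms(1) near_near[OF assms(2)]])

lemma sm_at_compose:
 fixes g :: "'b::model_space => 'c::real_normed_vector"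
 assumes "sm_at f x" "sm_at g (f x)" shows "sm_at (%z. g (f z)) x"
proof -
 obtain S where S: "open S" "x : S" "smooth_on S f" using assms(1) unfolding sm_at_def by blast
 obtain T where T: "open T" "f x : T" "smooth_on T g" using assms(2) unfolding sm_at_def by blast
 let ?U = "S \<inter> f -` T"
 have o: "open ?U" using continuous_on_open_vimage[OF S(1), of f] smooth_on_continuous[OF S(3)] T(1)
  by (simp add: Int_commute)
 have "smooth_on ?U (%z. g (f z))"
  by (rule smooth_on_compose[OF o T(3) smooth_on_subset[OF S(3,1) o]]) auto
 thus ?thesis using o S T by (intro sm_at_on[of ?U]) auto
qed

lemma
 shows sm_at_const: "sm_at (%x. c) x"
  and sm_at_id: "sm_at (%x. x) x"
 by (rule sm_at_on[of UNIV]; simp add: smooth_on_const smooth_on_id)+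

lemma sm_at_blinear: "bounded_linear L ==> sm_at (%x. L x) x"
 by (rule sm_at_on[of UNIV]) (simp_all add: smooth_on_linear)

lemma sm_at_both:
 assumes "sm_at f x" "sm_at g x"
 obtains S where "open S" "x : S" "smooth_on S f" "smooth_on S g"
proof -
 obtain S where S: "open S" "x : S" "smooth_on S f" using assms(1) unfolding sm_at_def by blast
 obtain T where T: "open T" "x : T" "smooth_on T g" using assms(2) unfolding sm_at_def by blast
 have "open (S \<inter> T)" using S T by auto
 thus ?thesis
  using that[of "S \<inter> T"] S(2) T(2) smooth_on_subset[OF S(3,1), of "S \<inter> T"] smooth_on_subset[OF T(3,1), of "S \<inter> T"] by blast
qed

lemma sm_at_linear_image: "bounded_linear L ==> sm_at f x ==> sm_at (%x. L (f x)) x"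
 unfolding sm_at_def using smooth_on_linear_image by blast

lemma sm_at_lin:
 fixes L :: "'b::model_space => 'c::real_normed_vector"
 shows "linear L ==> sm_at f x ==> sm_at (%x. L (f x)) x"
 using sm_at_linear_image linear_imp_bounded_linear by blast

lemma sm_at_add: "sm_at f x ==> sm_at g x ==> sm_at (%x. f x + g x) x"
 by (rule sm_at_both, assumption, assumption, rule sm_at_on, rule smooth_on_add)

lemma sm_at_diff: "sm_at f x ==> sm_at g x ==> sm_at (%x. f x - g x) x"
 by (rule sm_at_both, assumption, assumption, rule sm_at_on, rule smooth_on_diff)

lemma sm_at_Pair: "sm_at f x ==> sm_at g x ==> sm_at (%x. (f x, g x)) x"
 by (rule sm_at_both, assumption, assumption, rule sm_at_on, rule smooth_on_Pair)

lemma sm_at_scaleR: "sm_at f x ==> sm_at g x ==> sm_at (%x. f x *. g x) x"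
 by (rule sm_at_both, assumption, assumption, rule sm_at_on, rule smooth_on_scaleR)

lemma sm_at_fst: "sm_at f x ==> sm_at (%x. fst (f x)) x"
 by (rule sm_at_linear_image[OF bounded_linear_fst])

lemma sm_at_snd: "sm_at f x ==> sm_at (%x. snd (f x)) x"
 by (rule sm_at_linear_image[OF bounded_linear_snd])

lemma sm_at_inner_const: "sm_at f x ==> sm_at (%x. inner (f x) b) x"
 by (rule sm_at_linear_image[OF bounded_linear_inner_left])

lemma sm_at_sum: "(!!i. i : I ==> sm_at (f i) x) ==> sm_at (%x. SUM i:I. f i x) x"
proof (induction I rule: infinite_finite_induct)
 case (insert i F)
 have "sm_at (%x. f i x + (SUM i:F. f i x)) x" using insert by (intro sm_at_add) auto
 thus ?case using insert by simp
qed (auto intro: sm_at_const)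

lemma sm_at_D: "sm_at f x ==> sm_at (%x. D f x v) x"
 unfolding sm_at_def using smooth_on_frechet by blast

lemma sm_at_D_compose:
 fixes f :: "'a::model_space => 'b::real_normed_vector"
 assumes "sm_at f (g x)" "sm_at g x" "sm_at u x"
 shows "sm_at (%x. D f (g x) (u x)) x"
proof -
 have "sm_at (%x. SUM b:mb. inner (u x) b *. D f (g x) b) x"
  by (intro sm_at_sum sm_at_scaleR sm_at_inner_const assms(3)
    sm_at_compose[OF assms(2) sm_at_D[OF assms(1)]])
 moreover have "near y ~ x. (SUM b:mb. inner (u y) b *. D f (g y) b) = D f (g y) (u y)"
  using sm_at_eventually[OF assms(2) sm_at_near[OF assms(1)]]
  by eventually_elim (simp add: lin_mb_sum[OF sm_at_linear, symmetric])
 ultimately show ?thesis by (rule sm_at_transform)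
qed

lemma D_eqI: "(f hder f') (at x) ==> D f x v = f' v"
 using frechet_derivative_at[of f f' x] by metis

lemma curve_deriv:
 assumes "sm_at f (c 0)" "(c hvd v) (at (0::real))"
 shows "((%e. f (c e)) hvd D f (c 0) v) (at 0)"
proof -
 have "((%e. f (c e)) hder (%h. D f (c 0) (h *. v))) (at 0)"
  using has_derivative_compose[OF assms(2)[unfolded has_vector_derivative_def] sm_at_has_derivative[OF assms(1)]] .
 thus ?thesis
  unfolding has_vector_derivative_def linear_scale[OF sm_at_linear[OF assms(1)]] .
qed

lemma line_derivative: "((%e. x + e *. v) hvd v) (at e)"
 by (auto intro!: derivative_eq_intros)

lemma hder_transform:
 assumes "(f hder f') (at x)" "near y ~ x. f y = g y" shows "(g hder f') (at x)"
proof -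
 obtain S where S: "open S" "x : S" "!!y. y : S ==> f y = g y" using assms(2) unfolding eventually_nhds by blast
 show ?thesis by (rule has_derivative_transform_within_open[OF assms(1) S])
qed

lemma hvd_transform:
 assumes "(f hvd f') (at x)" "near y ~ x. f y = g y"
 shows "(g hvd f') (at x)"
 using assms hder_transform unfolding has_vector_derivative_def by blast

text \<open>The principle behind the coordinate computations: both sides of a groupoid axiom agree
  along a curve, hence so do their derivatives.\<close>

lemma curve_deriv_unique:
 assumes "near e ~ (0::real). c e = d e"
  "(c hvd v) (at 0)" "(d hvd w) (at 0)"
 shows "v = w"
proof -
 have "(d hvd v) (at 0)"
  by (rule hvd_transform[OF assms(2,1)])
 thus ?thesis using assms(3) by (rule vector_derivative_unique_at)
qed

lemma eventually_on_line:
 fixes x :: "'a::real_normed_vector"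
 assumes "near z ~ x. Q z" shows "near e ~ (0::real). Q (x + e *. v)"
proof (rule isCont_eventually[where f="%e. x + e *. v" and Q=Q])
 show "isCont (%e. x + e *. v) (0::real)" by (intro continuous_intros)
qed (use assms in simp)

text \<open>Product rule for a moving linear map applied to a moving vector. Expansion over
  \<open>mb\<close> reduces it to real coefficients times curves; linearity is required only near
  the base point.\<close>

lemma linear_family_curve:
 fixes L :: "'p::real_normed_vector => 'a::model_space => 'b::real_normed_vector"
 assumes lin: "near p ~ (c 0). linear (L p)" and L: "!!b. sm_at (%p. L p b) (c 0)"
  and c: "(c hvd c') (at (0::real))" and a: "(a hvd a') (at 0)"
 shows "((%e. L (c e) (a e)) hvd D (%p. L p (a 0)) (c 0) c' + L (c 0) a') (at 0)"
proof -
 have isc: "isCont c 0" using c has_vector_derivative_continuous by blast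
 have sum: "((%e. SUM b:mb. inner (a e) b *. L (c e) b) has_vector_derivative
  (SUM b:mb. inner (a 0) b *. D (%p. L p b) (c 0) c' + inner a' b *. L (c 0) b)) (at 0)"
 proof (rule has_vector_derivative_sum)
  fix b :: 'a
  have "((%e. inner (a e) b) hvd inner a' b) (at 0)"
   by (rule bounded_linear.has_vector_derivative[OF bounded_linear_inner_left a])
  hence "((%e. inner (a e) b) has_real_derivative inner a' b) (at 0)"
   by (simp add: has_real_derivative_iff_has_vector_derivative)
  from has_vector_derivative_scaleR[OF this curve_deriv[of "%p. L p b", OF L c]]
  show "((%e. inner (a e) b *. L (c e) b) has_vector_derivative
   inner (a 0) b *. D (%p. L p b) (c 0) c' + inner a' b *. L (c 0) b) (at 0)" .
 qed
 have "((%p. SUM b:mb. inner (a 0) b *. L p b) has_derivative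
   (%v. SUM b:mb. inner (a 0) b *. D (%p. L p b) (c 0) v)) (at (c 0))"
  by (intro has_derivative_sum has_derivative_scaleR_right sm_at_has_derivative L)
 moreover have "near p ~ (c 0). (SUM b:mb. inner (a 0) b *. L p b) = L p (a 0)"
  using lin by eventually_elim (simp add: lin_mb_sum[symmetric])
 ultimately have "((%p. L p (a 0)) has_derivative
   (%v. SUM b:mb. inner (a 0) b *. D (%p. L p b) (c 0) v)) (at (c 0))"
  by (rule hder_transform)
 hence 1: "D (%p. L p (a 0)) (c 0) c' = (SUM b:mb. inner (a 0) b *. D (%p. L p b) (c 0) c')"
  by (rule D_eqI)
 have 2: "L (c 0) a' = (SUM b:mb. inner a' b *. L (c 0) b)"
  by (rule lin_mb_sum[OF near_self[OF lin]])
 have "near e ~ 0. (SUM b:mb. inner (a e) b *. L (c e) b) = L (c e) (a e)"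
  using isCont_eventually[OF isc lin] by eventually_elim (simp add: lin_mb_sum[symmetric])
 with sum show ?thesis unfolding 1 2 sum.distrib[symmetric]
  by (rule hvd_transform)
qed

lemma D_curve:
 fixes f :: "'a::model_space => 'b::real_normed_vector"
 assumes f: "sm_at f (c 0)" and c: "(c hvd c') (at (0::real))"
  and a: "(a hvd a') (at 0)"
 shows "((%e. D f (c e) (a e)) has_vector_derivative
  D (%p. D f p (a 0)) (c 0) c' + D f (c 0) a') (at 0)"
proof (rule linear_family_curve[OF _ _ c a])
 show "near p ~ (c 0). linear (D f p)"
  using sm_at_near[OF f] by eventually_elim (rule sm_at_linear)
qed (rule sm_at_D[OF f])

lemma sm_at_linear_family:
 fixes L :: "'p::model_space => 'a::model_space => 'b::real_normed_vector"
 assumes lin: "near p ~ (g x). linear (L p)" and L: "!!b. sm_at (%p. L p b) (g x)"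
  and g: "sm_at g x" and u: "sm_at u x"
 shows "sm_at (%x. L (g x) (u x)) x"
proof (rule sm_at_transform)
 show "sm_at (%x. SUM b:mb. inner (u x) b *. L (g x) b) x"
  by (intro sm_at_sum sm_at_scaleR sm_at_inner_const u sm_at_compose[OF g L])
 show "near y ~ x. (SUM b:mb. inner (u y) b *. L (g y) b) = L (g y) (u y)"
  using sm_at_eventually[OF g lin] by eventually_elim (simp add: lin_mb_sum[symmetric])
qed

lemma sm_at_lipschitz:
 fixes f :: "'a::model_space => 'b::real_normed_vector"
 assumes "sm_at f x"
 shows "EX L>=0. \<forall>\<^sub>F r in at_right 0. ALL y:ball x r. ALL z:ball x r. norm (f y - f z) <= L * norm (y - z)"
proof -
 obtain S where S: "open S" "x : S" "smooth_on S f" using assms unfolding sm_at_def by blast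
 have c: "continuous_on ({0..1::real} \<times> S) (%(t, y). D f y b)" for b
  using pCk_cont[OF Ck_on_imp_pCk[of 0]] smooth_on_continuous[OF smooth_on_frechet[OF S(3)]] by force
 obtain R where R: "R > 0" "ball x R \<subseteq> S"
  and t: "!!t z y. t : {0..1::real} ==> z : ball x R ==> y : ball x R ==>
   norm (f y - f z - D f x (y - z)) <= 1 * norm (y - z)"
  apply (rule uniform_taylor[OF S(1,2) _ smooth_on_has_derivative[OF S(3)] c, of 1], simp, assumption)
  subgoal premises pr for d by (rule pr(1)[OF pr(2,3)]) (rule pr(4))
  done
 define C where "C = (SUM b:mb. norm (D f x b))"
 have C: "norm (D f x v) <= C * norm v" for v
  unfolding C_def by (rule linear_norm_le[OF sm_at_linear[OF assms]])
 have "norm (f y - f z) <= (1 + C) * norm (y - z)" if "y : ball x R" "z : ball x R" for y z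
 proof -
  have "norm (f y - f z) <= norm (f y - f z - D f x (y - z)) + norm (D f x (y - z))"
   using norm_triangle_ineq[of "f y - f z - D f x (y - z)" "D f x (y - z)"] by simp
  also have "\<dots> <= 1 * norm (y - z) + C * norm (y - z)"
   using t[of 0 z y] that C[of "y - z"] by (intro add_mono) auto
  finally show ?thesis by (simp add: distrib_right)
 qed
 hence "\<forall>\<^sub>F r in at_right 0. ALL y:ball x r. ALL z:ball x r. norm (f y - f z) <= (1 + C) * norm (y - z)"
  unfolding eventually_at_right_field using R(1) by (intro exI[of _ R]) (auto simp: subset_eq)
 thus ?thesis by (intro exI[of _ "1 + C"]) (auto simp: C_def sum_nonneg)
qed

lemma second_derivative_symmetric_near:
 fixes f :: "'a::model_space => 'b::real_normed_vector"
 assumes "sm_at f x" shows "D (%y. D f y v) x w = D (%y. D f y w) x v"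
 using assms second_derivative_symmetric unfolding sm_at_def by blast

lemma linear_ode_zero:
 fixes u :: "real => 'e::model_space"
 assumes d: "!!t. t : {a..b} ==> (u hvd A t (u t)) (at t within {a..b})"
  and A: "!!t. t : {a..b} ==> linear (A t)" "!!v. continuous_on {a..b} (%t. A t v)"
  and u: "u c = 0" "c : {a..b}" and t: "t : {a..b}"
 shows "u t = 0"
proof -
 have "continuous_on {a..b} (%t. SUM b:mb. norm (A t b))" by (intro continuous_intros A)
 then obtain t0 where t0: "ALL t:{a..b}. (SUM b:mb. norm (A t b)) <= (SUM b:mb. norm (A t0 b))"
  using continuous_attains_sup[of "{a..b}" "%t. SUM b:mb. norm (A t b)"] t by fastforce
 show ?thesis
 proof (rule vector_derivative_zero[OF d _ u t, of "SUM b:mb. norm (A t0 b)"])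
  fix t assume t: "t : {a..b}"
  show "norm (A t (u t)) <= (SUM b:mb. norm (A t0 b)) * norm (u t)"
   using linear_norm_le[OF A(1)[OF t], of "u t"] mult_right_mono[OF bspec[OF t0 t], of "norm (u t)"] by simp
 qed
qed

lemma line_fst:
 fixes g u :: "'a::real_normed_vector" and h :: "'b::real_normed_vector"
 shows "near q ~ (g, h). R q ==> near e ~ (0::real). R (g + e *. u, h)"
 using eventually_on_line[where x="(g, h)" and v="(u, 0)"] by simp

lemma line_fst3:
 fixes g u :: "'a::real_normed_vector" and h :: "'b::real_normed_vector" and k :: "'c::real_normed_vector"
 shows "near q ~ (g, h, k). R q ==> near e ~ (0::real). R (g + e *. u, h, k)"
 using eventually_on_line[where x="(g, h, k)" and v="(u, 0, 0)"] by simp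

lemma near_fst: "near x ~ (0 :: 'b::real_normed_vector). R x ==> near q ~ (0, 0 :: 'a::real_normed_vector). R (fst q)"
 using sm_at_eventually[OF sm_at_blinear[OF bounded_linear_fst], where x="(0, 0)"] by simp

lemma near_snd: "near x ~ (0 :: 'b::real_normed_vector). R x ==> near q ~ (0 :: 'a::real_normed_vector, 0). R (snd q)"
 using sm_at_eventually[OF sm_at_blinear[OF bounded_linear_snd], where x="(0, 0)"] by simp

section \<open>Local groupoids in coordinates\<close>

text \<open>The germ at a unit of a local groupoid, in a chart centred there: the source is the
  linear projection \<open>P\<close> and the units are its fixed points. The map \<open>m\<close> is
  smooth on a full neighbourhood, but represents the multiplication only on composable pairs; hence
  the implications in the axioms.\<close>

locale local_model =
 fixes P tg io :: "'e::model_space => 'e" and m :: "'e \<times> 'e => 'e"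
 assumes linear_P: "linear P" and P_P [simp]: "P (P z) = P z"
  and smooth_tau: "sm_at tg 0" and smooth_inv: "sm_at io 0" and smooth_mul: "sm_at m (0, 0)"
  and tau_unit: "near x ~ 0. P x = x --> tg x = x"
  and P_tau: "near g ~ 0. P (tg g) = tg g"
  and P_mul: "near q ~ (0, 0). P (fst q) = tg (snd q) --> P (m q) = P (snd q)"
  and tau_mul: "near q ~ (0, 0). P (fst q) = tg (snd q) --> tg (m q) = tg (fst q)"
  and assoc: "near q ~ (0, 0, 0). P (fst q) = tg (fst (snd q)) & P (fst (snd q)) = tg (snd (snd q)) -->
   m (m (fst q, fst (snd q)), snd (snd q)) = m (fst q, m (snd q))"
  and unit_mul: "near g ~ 0. m (tg g, g) = g" and mul_unit: "near g ~ 0. m (g, P g) = g"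
  and inv_zero [simp]: "io 0 = 0"
  and P_inv: "near g ~ 0. P (io g) = tg g" and tau_inv: "near g ~ 0. tg (io g) = P g"
  and mul_inv: "near g ~ 0. m (g, io g) = tg g" and inv_mul: "near g ~ 0. m (io g, g) = P g"
begin

text \<open>The projection onto the kernel of \<open>P\<close>, which is the tangent space of every
  source fibre in this chart.\<close>

definition Q :: "'e => 'e" where "Q v = v - P v"

text \<open>\<open>X v\<close> is the right-invariant vector field of the section \<open>x \<mapsto> Q v\<close>, and \<open>th g\<close> is the
 Maurer-Cartan form at \<open>g\<close>, in a chart in which the source map is the linear projection \<open>P\<close>.\<close>

definition X :: "'e => 'e => 'e" where "X v h = D m (tg h, h) (Q v, 0)"

definition th :: "'e => 'e => 'e" where "th g w = D m (g, io g) (Q w, 0)"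

text \<open>The Lie bracket of the fields \<open>X v\<close> and \<open>X w\<close>. At a unit it is
  the algebroid bracket of the constant sections \<open>Q v\<close> and \<open>Q w\<close>.\<close>

definition br :: "'e => 'e => 'e => 'e" where "br v w h = D (X w) h (X v h) - D (X v) h (X w h)"

lemma P_0 [simp]: "P 0 = 0" using linear_0[OF linear_P] .

lemma P_add: "P (x + y) = P x + P y" using linear_add[OF linear_P] .

lemma P_diff: "P (x - y) = P x - P y" using linear_diff[OF linear_P] .

lemma P_scale: "P (r *. x) = r *. P x" using linear_scale[OF linear_P] .

lemma bounded_P: "bounded_linear P" by (rule linear_imp_bounded_linear[OF linear_P])

lemma linear_Q: "linear Q"
 by (rule linearI) (simp_all add: Q_def P_add P_scale scaleR_diff_right)

lemma bounded_Q: "bounded_linear Q" by (rule linear_imp_bounded_linear[OF linear_Q])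

lemma P_Q [simp]: "P (Q v) = 0" by (simp add: Q_def P_diff)

lemma Q_ker: "P u = 0 ==> Q u = u" by (simp add: Q_def)

lemma Q_Q [simp]: "Q (Q v) = Q v" by (simp add: Q_ker)

lemma Q_P [simp]: "Q (P v) = 0" by (simp add: Q_def)

lemma Q_0 [simp]: "Q 0 = 0" by (simp add: Q_def)

lemma P_Q_add: "P v + Q v = v" by (simp add: Q_def)

lemma P_line [simp]: "P (x + e *. Q v) = P x" by (simp add: P_add P_scale)

lemma Q_line [simp]: "Q (P x + e *. Q v) = e *. Q v"
 by (simp add: linear_add[OF linear_Q] linear_scale[OF linear_Q])

lemma tau_0 [simp]: "tg 0 = 0" using near_self[OF tau_unit] by simp

lemma mul_0 [simp]: "m (0, 0) = 0" using near_self[OF unit_mul] by simp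

lemma near_tau: "near x ~ 0. R x ==> near h ~ 0. R (tg h)"
 by (rule sm_at_eventually[OF smooth_tau]) simp

lemma near_tau_pair: "near q ~ (0, 0). R q ==> near h ~ 0. near q ~ (tg h, h). R q"
 by (rule eventually_along[where f="%h. (tg h, h)"])
  (auto intro: sm_at_Pair smooth_tau sm_at_id)

lemma near_inv_pair: "near q ~ (0, 0). R q ==> near h ~ 0. near q ~ (h, io h). R q"
 by (rule eventually_along[where f="%h. (h, io h)"])
  (auto intro: sm_at_Pair smooth_inv sm_at_id)

lemma mul_line_derivative:
 assumes "sm_at m (g, h)" 
 shows "((%e. m (g + e *. u, h)) hvd D m (g, h) (u, 0)) (at 0)"
proof -
 have "((%e. (g + e *. u, h)) hvd (u, 0)) (at 0)"
  using line_derivative[of "(g, h)" "(u, 0)" 0] by simp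
 from curve_deriv[of m, OF _ this] assms show ?thesis by simp
qed

lemma near_smooth_X: "near h ~ 0. sm_at m (tg h, h)"
 using near_tau_pair[OF sm_at_near[OF smooth_mul]]
 by (rule eventually_mono) (rule near_self)

lemma near_smooth_theta: "near h ~ 0. sm_at m (h, io h)"
 using near_inv_pair[OF sm_at_near[OF smooth_mul]]
 by (rule eventually_mono) (rule near_self)

lemma smooth_X2: "sm_at (%q. X (fst q) (snd q)) (v, 0)"
 unfolding X_def
 by (intro sm_at_D_compose sm_at_Pair sm_at_snd sm_at_fst sm_at_id sm_at_const
   sm_at_lin[OF linear_Q] sm_at_compose[of snd _ tg])
  (auto intro: smooth_mul smooth_tau sm_at_blinear bounded_linear_snd)

lemma smooth_X: "sm_at (X v) 0"
 using sm_at_compose[of "%h. (v, h)" 0 "%q. X (fst q) (snd q)"] smooth_X2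
 by (simp add: sm_at_Pair sm_at_const sm_at_id)

lemma smooth_theta: "sm_at (%q. th (fst q) (snd q)) (0, w)"
 unfolding th_def
 by (intro sm_at_D_compose sm_at_Pair sm_at_snd sm_at_fst sm_at_id sm_at_const
   sm_at_lin[OF linear_Q] sm_at_compose[of fst _ io])
  (auto intro: smooth_mul smooth_inv sm_at_blinear bounded_linear_fst)

lemma linear_X: "near h ~ 0. linear (%v. X v h)"
 using near_smooth_X
proof eventually_elim
 case (elim h)
 hence "linear (D m (tg h, h))" by (rule sm_at_linear)
 from linear_compose[OF linear_compose[OF linear_Q, of "%u. (u, 0)"] this] show ?case
  by (simp add: X_def[abs_def] o_def linear_iff)
qed

lemma linear_theta: "near h ~ 0. linear (th h)"
 using near_smooth_theta
proof eventually_elim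
 case (elim h)
 hence "linear (D m (h, io h))" by (rule sm_at_linear)
 from linear_compose[OF linear_compose[OF linear_Q, of "%u. (u, 0)"] this] show ?case
  by (simp add: th_def[abs_def] o_def linear_iff)
qed

lemma X_Q: "X (Q v) h = X v h" by (simp add: X_def)

lemma theta_Q: "th g (Q w) = th g w" by (simp add: th_def)

text \<open>This identity and the next ones arise by differentiating a groupoid axiom along the line
  \<open>tg h + e *. Q v\<close> in the source fibre through the unit \<open>tg h\<close>. The line
  stays composable with \<open>h\<close>, because \<open>P\<close> is constant along it.\<close>

lemma P_X: "near h ~ 0. ALL v. P (X v h) = 0"
 using near_tau_pair[OF P_mul] P_tau near_smooth_X
proof eventually_elim
 case (elim h)
 show ?case
 proof
  fix v
  have "((%e. P (m (tg h + e *. Q v, h))) hvd P (X v h)) (at 0)"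
   unfolding X_def by (rule bounded_linear.has_vector_derivative[OF bounded_P mul_line_derivative[OF elim(3)]])
  moreover have "((%e::real. P h) hvd 0) (at 0)" by simp
  moreover have "near e ~ 0. P (m (tg h + e *. Q v, h)) = P h"
   using line_fst[OF elim(1), of "Q v"] by eventually_elim (use elim(2) in simp)
  ultimately show "P (X v h) = 0" by (rule curve_deriv_unique[rotated])
 qed
qed

lemma X_unit: "near x ~ 0. P x = x --> (ALL v. X v x = Q v)"
 using near_near[OF mul_unit] near_smooth_X tau_unit
proof eventually_elim
 case (elim x)
 show ?case
 proof (intro impI allI)
  fix v assume x: "P x = x"
  hence t: "tg x = x" using elim(3) by simp
  have "((%e. m (tg x + e *. Q v, x)) hvd X v x) (at 0)"
   unfolding X_def by (rule mul_line_derivative[OF elim(2)])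
  moreover have "((%e. x + e *. Q v) hvd Q v) (at 0)" by (rule line_derivative)
  moreover have "near e ~ 0. m (tg x + e *. Q v, x) = x + e *. Q v"
   using eventually_on_line[OF elim(1), of "Q v"] by eventually_elim (use x t in simp)
  ultimately show "X v x = Q v" by (rule curve_deriv_unique[rotated])
 qed
qed

text \<open>From tg (k h) = tg k: the target projects the right-invariant field to the
  anchor.\<close>

lemma D_tau_X: "near h ~ 0. ALL v. D tg h (X v h) = D tg (tg h) (Q v)"
 using near_tau_pair[OF tau_mul] P_tau near_smooth_X unit_mul sm_at_near[OF smooth_tau]
  near_tau[OF sm_at_near[OF smooth_tau]]
proof eventually_elim
 case (elim h)
 show ?case
 proof
  fix v
  have "((%e. tg (m (tg h + e *. Q v, h))) hvd D tg h (X v h)) (at 0)"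
   using curve_deriv[OF _ mul_line_derivative[OF elim(3), of "Q v"], of tg] elim(4,5)
   by (simp add: X_def)
  moreover have "((%e. tg (tg h + e *. Q v)) hvd D tg (tg h) (Q v)) (at 0)"
   using curve_deriv[OF _ line_derivative[of "tg h" "Q v" 0], of tg] elim(6) by simp
  moreover have "near e ~ 0. tg (m (tg h + e *. Q v, h)) = tg (tg h + e *. Q v)"
   using line_fst[OF elim(1), of "Q v"] by eventually_elim (use elim(2) in simp)
  ultimately show "D tg h (X v h) = D tg (tg h) (Q v)" by (rule curve_deriv_unique[rotated])
 qed
qed

lemma near_mul: "near x ~ 0. R x ==> near q ~ (0, 0). R (m q)"
 by (rule sm_at_eventually[OF smooth_mul]) simp

text \<open>Associativity (k g) h = k (g h), differentiated in k at the unit \<open>tg g\<close>: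
  right translation by h preserves the right-invariant fields.\<close>

lemma D_mul_X: "near q ~ (0, 0). P (fst q) = tg (snd q) --> (ALL v. D m q (X v (fst q), 0) = X v (m q))"
proof -
 have "near q ~ (0, 0). near r ~ (tg (fst q), fst q, snd q).
   P (fst r) = tg (fst (snd r)) & P (fst (snd r)) = tg (snd (snd r)) -->
   m (m (fst r, fst (snd r)), snd (snd r)) = m (fst r, m (snd r))"
 proof (rule eventually_along[where f="%q. (tg (fst q), fst q, snd q)"])
  show "sm_at (%q. (tg (fst q), fst q, snd q)) (0, 0)"
   by (intro sm_at_Pair sm_at_compose[of fst _ tg] sm_at_fst sm_at_snd sm_at_id)
    (simp add: smooth_tau)
 qed (use assoc in simp)
 thus ?thesis
  using near_fst[OF near_smooth_X] sm_at_near[OF smooth_mul] near_fst[OF unit_mul]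
   near_mul[OF near_smooth_X] near_fst[OF P_tau] tau_mul
 proof eventually_elim
  case (elim q)
  obtain g h where q: "q = (g, h)" by (cases q)
  show ?case
  proof (intro impI allI)
   fix v assume c: "P (fst q) = tg (snd q)"
   let ?c = "%e. tg g + e *. Q v"
   have "((%e. m (?c e, g)) hvd X v g) (at 0)"
    unfolding X_def by (rule mul_line_derivative) (use elim(2) q in simp)
   hence "((%e. (m (?c e, g), h)) hvd (X v g, 0)) (at 0)"
    by (intro has_vector_derivative_Pair) auto
   hence "((%e. m (m (?c e, g), h)) hvd D m q (X v g, 0)) (at 0)"
    using curve_deriv[of m "%e. (m (?c e, g), h)"] elim(3,4) q by simp
   moreover have "((%e. m (?c e, m q)) hvd X v (m q)) (at 0)"
    using mul_line_derivative[of "tg g" "m q" "Q v"] elim(5,7) c q by (simp add: X_def)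
   moreover have "near e ~ 0. m (m (?c e, g), h) = m (?c e, m q)"
    using line_fst3[OF elim(1)[unfolded q fst_conv snd_conv], of "Q v"]
    by eventually_elim (use elim(6) c q in simp)
   ultimately show "D m q (X v (fst q), 0) = X v (m q)"
    using curve_deriv_unique q by fastforce
  qed
 qed
qed

text \<open>The identity (k g) g^-1 = k, differentiated in k at the unit \<open>tg g\<close>.
  Together with \<open>X_theta\<close> this makes \<open>th g\<close> and \<open>%v. X v g\<close>
  mutually inverse on the kernel of \<open>P\<close>.\<close>

lemma theta_X: "near g ~ 0. ALL v. th g (X v g) = Q v"
proof -
 have "near g ~ 0. near r ~ (tg g, g, io g).
   P (fst r) = tg (fst (snd r)) & P (fst (snd r)) = tg (snd (snd r)) -->
   m (m (fst r, fst (snd r)), snd (snd r)) = m (fst r, m (snd r))"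
  by (rule eventually_along[where f="%g. (tg g, g, io g)"])
   (use assoc in \<open>auto intro!: sm_at_Pair smooth_tau smooth_inv sm_at_id\<close>)
 thus ?thesis
  using near_smooth_X near_smooth_theta unit_mul P_tau mul_inv P_X tau_inv
   near_tau[OF near_near[OF mul_unit]]
 proof eventually_elim
  case (elim g)
  show ?case
  proof
   fix v
   let ?c = "%e. tg g + e *. Q v"
   have "((%e. m (?c e, g)) hvd X v g) (at 0)"
    unfolding X_def by (rule mul_line_derivative[OF elim(2)])
   hence "((%e. (m (?c e, g), io g)) hvd (X v g, 0)) (at 0)"
    by (intro has_vector_derivative_Pair) auto
   hence "((%e. m (m (?c e, g), io g)) hvd th g (X v g)) (at 0)"
    using curve_deriv[of m "%e. (m (?c e, g), io g)"] elim(3,4,7) by (simp add: th_def Q_ker)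
   moreover have "(?c hvd Q v) (at 0)" by (rule line_derivative)
   moreover have "near e ~ 0. m (m (?c e, g), io g) = ?c e"
    using line_fst3[OF elim(1), of "Q v"] eventually_on_line[OF elim(9), of "Q v"]
    by eventually_elim (use elim(5,6,8) in simp)
   ultimately show "th g (X v g) = Q v" by (rule curve_deriv_unique[rotated])
  qed
 qed
qed

lemma P_theta: "near g ~ 0. ALL w. P (th g w) = 0"
 using near_inv_pair[OF P_mul] near_smooth_theta tau_inv
proof eventually_elim
 case (elim g)
 show ?case
 proof
  fix w
  have "((%e. P (m (g + e *. Q w, io g))) hvd P (th g w)) (at 0)"
   unfolding th_def by (rule bounded_linear.has_vector_derivative[OF bounded_P mul_line_derivative[OF elim(2)]])
  moreover have "((%e::real. P (io g)) hvd 0) (at 0)" by simp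
  moreover have "near e ~ 0. P (m (g + e *. Q w, io g)) = P (io g)"
   using line_fst[OF elim(1), of "Q w"] by eventually_elim (use elim(3) in simp)
  ultimately show "P (th g w) = 0" by (rule curve_deriv_unique[rotated])
 qed
qed

text \<open>The identity (k g^-1) g = k, differentiated in k at \<open>g\<close> along the source
  fibre.\<close>

lemma X_theta: "near g ~ 0. ALL w. X (th g w) g = Q w"
proof -
 have "near g ~ 0. near r ~ (g, io g, g).
   P (fst r) = tg (fst (snd r)) & P (fst (snd r)) = tg (snd (snd r)) -->
   m (m (fst r, fst (snd r)), snd (snd r)) = m (fst r, m (snd r))"
  by (rule eventually_along[where f="%g. (g, io g, g)"])
   (use assoc in \<open>auto intro!: sm_at_Pair smooth_tau smooth_inv sm_at_id\<close>)
 thus ?thesis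
  using near_smooth_X near_smooth_theta mul_inv P_theta tau_inv P_inv inv_mul
   near_near[OF mul_unit]
 proof eventually_elim
  case (elim g)
  show ?case
  proof
   fix w
   let ?c = "%e. g + e *. Q w"
   have "((%e. m (?c e, io g)) hvd th g w) (at 0)"
    unfolding th_def by (rule mul_line_derivative[OF elim(3)])
   hence "((%e. (m (?c e, io g), g)) hvd (th g w, 0)) (at 0)"
    by (intro has_vector_derivative_Pair) auto
   hence "((%e. m (m (?c e, io g), g)) hvd X (th g w) g) (at 0)"
    using curve_deriv[of m "%e. (m (?c e, io g), g)"] elim(2,4,5) by (simp add: X_def Q_ker)
   moreover have "(?c hvd Q w) (at 0)" by (rule line_derivative)
   moreover have "near e ~ 0. m (m (?c e, io g), g) = ?c e"
    using line_fst3[OF elim(1), of "Q w"] eventually_on_line[OF elim(9), of "Q w"]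
    by eventually_elim (use elim(6,7,8) in simp)
   ultimately show "X (th g w) g = Q w" by (rule curve_deriv_unique[rotated])
  qed
 qed
qed

text \<open>A single open set on which \<open>m\<close> is smooth serves all \<open>v\<close> at
  once.\<close>

lemma near_smooth_Xv: "near h ~ 0. ALL v. sm_at (X v) h"
proof -
 obtain S where S: "open S" "(0, 0) : S" "smooth_on S m" using smooth_mul unfolding sm_at_def by blast
 have "near h ~ 0. (tg h, h) : S & sm_at tg h"
 proof (rule eventually_conj)
  show "near h ~ 0. (tg h, h) : S"
   by (rule sm_at_eventually[where f="%h. (tg h, h)" and Q="%q. q : S"])
    (use S in \<open>auto intro!: sm_at_Pair smooth_tau sm_at_id near_open_set\<close>)
 qed (rule sm_at_near[OF smooth_tau])
 thus ?thesis
 proof eventually_elim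
  case (elim h)
  have "sm_at (%h. D m (tg h, h) (Q v, 0)) h" for v
   by (intro sm_at_D_compose sm_at_on[OF S(3,1)] sm_at_Pair sm_at_id sm_at_const)
    (use elim in auto)
  thus ?case by (simp add: X_def[abs_def])
 qed
qed

text \<open>Differentiate \<open>D_mul_X\<close> along the source fibre; the second derivatives of \<open>m\<close> cancel.\<close>

lemma br_right_invariant: "near h ~ 0. ALL v w. br v w h = X (br v w (tg h)) h"
proof -
 show ?thesis
  using near_tau_pair[OF D_mul_X] near_smooth_X near_smooth_Xv near_tau[OF near_smooth_Xv] P_tau near_tau[OF X_unit] unit_mul
   near_tau[OF near_near[OF P_X]] 
 proof eventually_elim
  case (elim h)
  have XQ: "X v (tg h) = Q v" for v using elim(5,6) by simp
  have DX: "D (X v) h (X w h) = D (%p. D m p (Q v, 0)) (tg h, h) (Q w, 0) + D m (tg h, h) (D (X v) (tg h) (Q w), 0)" for v w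
  proof -
   let ?c = "%e. tg h + e *. Q w"
   have "((%e. X v (?c e)) hvd D (X v) (tg h) (Q w)) (at 0)"
    using curve_deriv[OF _ line_derivative[of "tg h" "Q w" 0], of "X v"] elim(4) by simp
   hence "((%e. (X v (?c e), 0)) hvd (D (X v) (tg h) (Q w), 0)) (at 0)"
    by (intro has_vector_derivative_Pair) auto
   moreover have "((%e. (?c e, h)) hvd (Q w, 0)) (at 0)"
    using line_derivative[of "(tg h, h)" "(Q w, 0)" 0] by simp
   ultimately have "((%e. D m (?c e, h) (X v (?c e), 0)) has_vector_derivative
     D (%p. D m p (Q v, 0)) (tg h, h) (Q w, 0) + D m (tg h, h) (D (X v) (tg h) (Q w), 0)) (at 0)"
    using D_curve[of m "%e. (?c e, h)" _ "%e. (X v (?c e), 0)"] elim(2) by (simp add: XQ)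
   moreover have "((%e. X v (m (?c e, h))) hvd D (X v) h (X w h)) (at 0)"
    using curve_deriv[OF _ mul_line_derivative[OF elim(2), of "Q w"], of "X v"] elim(3,7)
    by (simp add: X_def[of w])
   moreover have "near e ~ 0. D m (?c e, h) (X v (?c e), 0) = X v (m (?c e, h))"
    using line_fst[OF elim(1), of "Q w"] by eventually_elim (use elim(5) in simp)
   ultimately show ?thesis using curve_deriv_unique by fastforce
  qed
  have PDX: "P (D (X v) (tg h) u) = 0" for v u
  proof -
   have "((%e. P (X v (tg h + e *. u))) hvd P (D (X v) (tg h) u)) (at 0)"
    using bounded_linear.has_vector_derivative[OF bounded_P curve_deriv[OF _ line_derivative[of "tg h" u 0], of "X v"]] elim(4)
    by simp
   moreover have "((%e::real. 0 :: 'e) hvd 0) (at 0)" by simp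
   moreover have "near e ~ 0. P (X v (tg h + e *. u)) = 0"
    using eventually_on_line[OF elim(8), of u] by eventually_elim simp
   ultimately show ?thesis by (rule curve_deriv_unique[rotated])
  qed
  show ?case
  proof (intro allI)
   fix v w
   let ?b = "br v w (tg h)"
   have b: "?b = D (X w) (tg h) (Q v) - D (X v) (tg h) (Q w)" by (simp add: br_def XQ)
   have Qb: "Q ?b = ?b" by (rule Q_ker) (simp add: b P_diff PDX)
   have "br v w h = D m (tg h, h) (D (X w) (tg h) (Q v), 0) - D m (tg h, h) (D (X v) (tg h) (Q w), 0)"
    unfolding br_def DX
    using second_derivative_symmetric_near[OF elim(2), of "(Q v, 0)" "(Q w, 0)"] by simp
   also have "\<dots> = D m (tg h, h) (?b, 0)"
    using linear_diff[OF sm_at_linear[OF elim(2)], symmetric] by (simp add: b)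
   finally show "br v w h = X (br v w (tg h)) h" by (simp add: X_def Qb)
  qed
 qed
qed

lemma P_br: "near x ~ 0. ALL v w. P (br v w x) = 0"
 using br_right_invariant P_X by eventually_elim simp

end

lemma linear_family_lipschitz:
 fixes L :: "'p::model_space => 'a::model_space => 'b::real_normed_vector"
 assumes lin: "near p ~ 0. linear (L p)" and sm: "!!b. sm_at (%p. L p b) 0"
 shows "EX K>=0. EX r>0. ALL y:ball 0 r. ALL z:ball 0 r. ALL v. norm (L y v - L z v) <= K * norm v * norm (y - z)"
proof -
 have "ALL b. EX K. K >= 0 & (\<forall>\<^sub>F r in at_right 0. ALL y:ball 0 r. ALL z:ball 0 r. norm (L y b - L z b) <= K * norm (y - z))"
  using sm_at_lipschitz[OF sm] by blast
 from choice[OF this] obtain K where K: "!!b. K b >= 0"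
  "!!b. \<forall>\<^sub>F r in at_right 0. ALL y:ball 0 r. ALL z:ball 0 r. norm (L y b - L z b) <= K b * norm (y - z)"
  by blast
 obtain S where S: "open S" "0 : S" "!!h. h : S ==> linear (L h)"
  using lin unfolding eventually_nhds by blast
 obtain R where R: "R > 0" "ball 0 R \<subseteq> S" using openE[OF S(1,2)] by blast
 have "\<forall>\<^sub>F r in at_right 0. (ALL b:mb. ALL y:ball 0 r. ALL z:ball 0 r. norm (L y b - L z b) <= K b * norm (y - z)) & r < R & 0 < r"
  using K(2) R(1) by (intro eventually_conj eventually_ball_finite finite_mb eventually_at_right_less)
   (auto simp: eventually_at_right_field)
 then obtain r where r: "!!b y z. b : mb ==> y : ball 0 r ==> z : ball 0 r ==> norm (L y b - L z b) <= K b * norm (y - z)"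
   "r < R" "0 < r"
  using eventually_happens'[OF trivial_limit_at_right_real] by blast
 have "norm (L y v - L z v) <= (SUM b:mb. K b) * norm v * norm (y - z)" if y: "y : ball 0 r" and z: "z : ball 0 r" for v y z
 proof -
  have l: "linear (%v. L y v - L z v)"
   by (intro linear_compose_sub S(3)) (use y z r(2) R(2) in auto)
  have "norm (L y v - L z v) <= (SUM b:mb. norm (L y b - L z b)) * norm v" by (rule linear_norm_le[OF l])
  also have "\<dots> <= (SUM b:mb. K b * norm (y - z)) * norm v"
   by (intro mult_right_mono sum_mono r(1) y z) auto
  finally show ?thesis by (simp add: sum_distrib_right mult_ac)
 qed
 thus ?thesis using K(1) r(3) by (intro exI[of _ "SUM b:mb. K b"] conjI exI[of _ r]) (auto simp: sum_nonneg)
qed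

context local_model begin

lemma X_lipschitz:
 "EX L>=0. EX r>0. ALL y:ball 0 r. ALL z:ball 0 r. ALL v. norm (X v y - X v z) <= L * norm v * norm (y - z)"
 using linear_family_lipschitz[of "%h v. X v h"] linear_X smooth_X by blast

text \<open>By \<open>X_lipschitz\<close> the difference of two solutions satisfies norm u' \<le> L
  M norm u. The radius comes before all other quantifiers: it depends neither on the driving curve
  \<open>c\<close> and its bound nor on the interval. The common value may be taken at any time
  \<open>s\<close>.\<close>

lemma X_ode_unique:
 "EX r>0. ALL (c :: real => 'e) k l a b M s. (ALL t:{a..b}. norm (c t) <= M & norm (k t) < r & norm (l t) < r &
   (k hvd X (c t) (k t)) (at t within {a..b}) &
   (l hvd X (c t) (l t)) (at t within {a..b})) & s : {a..b} & k s = l s -->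
   (ALL t:{a..b}. k t = l t)"
proof -
 obtain L r where L: "L >= 0" "r > 0"
  "!!y z v. y : ball 0 r ==> z : ball 0 r ==> norm (X v y - X v z) <= L * norm v * norm (y - z)"
  using X_lipschitz by blast
 show ?thesis
 proof (intro exI[of _ r] conjI allI impI ballI L(2))
  fix c :: "real => 'e" and k l a b M s t
  assume H: "(ALL t:{a..b}. norm (c t) <= M & norm (k t) < r & norm (l t) < r &
   (k hvd X (c t) (k t)) (at t within {a..b}) &
   (l hvd X (c t) (l t)) (at t within {a..b})) & s : {a..b} & k s = l s" and t: "t : {a..b}"
  have "k t - l t = 0"
  proof (rule vector_derivative_zero[of a b "%t. k t - l t" _ "L * M", OF _ _ _ _ t])
   fix t assume t: "t : {a..b}"
   show "((%t. k t - l t) hvd X (c t) (k t) - X (c t) (l t)) (at t within {a..b})"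
    by (intro has_vector_derivative_diff) (use H t in auto)
   have "norm (X (c t) (k t) - X (c t) (l t)) <= L * norm (c t) * norm (k t - l t)"
    by (rule L(3)) (use H t in auto)
   also have "\<dots> <= L * M * norm (k t - l t)"
    using H t L(1) by (intro mult_right_mono mult_left_mono) auto
   finally show "norm (X (c t) (k t) - X (c t) (l t)) <= L * M * norm (k t - l t)" .
  qed (use H in auto)
  thus "k t = l t" by simp
 qed
qed

text \<open>Rays run from the unit \<open>P g\<close> at time 0 to \<open>g\<close> at time 1 inside
  a source fibre. This lemma makes every germ condition available along the whole ray.\<close>

lemma near_ray:
 assumes "near g ~ 0. R g" shows "near g ~ 0. ALL t:{0..1}. R (P g + t *. Q g)"
proof -
 obtain r where r: "r > 0" "!!g. norm g < r ==> R g"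
  using assms unfolding eventually_nhds_metric by (auto simp: dist_norm)
 define C where "C = onorm P + onorm Q + 1"
 have C: "C > 0" using onorm_pos_le[OF bounded_P] onorm_pos_le[OF bounded_Q] by (simp add: C_def)
 have "R (P g + t *. Q g)" if g: "norm g < r / C" and t: "t : {0..1}" for g t
 proof (rule r(2))
  have "norm (t *. Q g) <= 1 * (onorm Q * norm g)"
   unfolding norm_scaleR by (rule mult_mono) (use t in \<open>auto intro: onorm[OF bounded_Q]\<close>)
  hence "norm (P g + t *. Q g) <= onorm P * norm g + 1 * (onorm Q * norm g)"
   by (intro order_trans[OF norm_triangle_ineq] add_mono onorm[OF bounded_P])
  also have "\<dots> <= C * norm g" by (simp add: C_def distrib_right)
  also have "\<dots> < r" using g C by (simp add: pos_less_divide_eq mult.commute)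
  finally show "norm (P g + t *. Q g) < r" .
 qed
 thus ?thesis using r(1) C unfolding eventually_nhds_metric
  by (intro exI[of _ "r / C"]) (auto simp: dist_norm)
qed

lemma P_ray [simp]: "P (P g + t *. Q g) = P g" by (simp add: P_add P_scale)

end

section \<open>The Maurer-Cartan equation in coordinates\<close>

text \<open>The coordinate form of an algebroid morphism. The base map \<open>fi\<close> and the
  fibre maps \<open>f x\<close> are extended off the units by means of \<open>P1\<close>, and off
  the kernel of \<open>P1\<close> by means of \<open>G.Q\<close>. The bracket condition is stated
  for constant sections, whose images have variable coefficients; hence the two derivative
  terms.\<close>

locale local_morphism = G: local_model P1 tg1 io1 m1 + H: local_model P2 tg2 io2 m2
 for P1 tg1 io1 :: "'a::model_space => 'a" and m1 and P2 tg2 io2 :: "'b::model_space => 'b" and m2 +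
 fixes fi :: "'a => 'b" and f :: "'a => 'a => 'b"
 assumes phi_P [simp]: "fi (P1 z) = fi z" and phi_0 [simp]: "fi 0 = 0" and smooth_phi: "sm_at fi 0"
  and P_phi: "near x ~ 0. P2 (fi x) = fi x"
  and smooth_f: "sm_at (%x. f x v) 0" and linear_f: "linear (f x)"
  and P_f: "near x ~ 0. ALL v. P2 (f x v) = 0" and f_Q [simp]: "f x (G.Q v) = f x v"
  and anchor_f: "near x ~ 0. P1 x = x --> (ALL v. D fi x (D tg1 x (G.Q v)) = D tg2 (fi x) (f x v))"
  and bracket_f: "near x ~ 0. P1 x = x --> (ALL v w. f x (G.br v w x) = H.br (f x v) (f x w) (fi x) +
   D (%x. f x w) x (D tg1 x (G.Q v)) - D (%x. f x v) x (D tg1 x (G.Q w)))"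
begin

text \<open>The equation th(dF) = f(th) solved for dF: since \<open>H.X\<close> inverts the
  Maurer-Cartan form, it reads \<open>D F g w = B (g, F g) w\<close> for w tangent to the source
  fibre.\<close>

definition B :: "'a \<times> 'b => 'a => 'b" where
 "B q w = H.X (f (tg1 (fst q)) (G.th (fst q) w)) (snd q)"

lemma linear_B: "near q ~ (0, 0). linear (B q)"
 using near_fst[OF G.linear_theta] near_snd[OF H.linear_X]
proof eventually_elim
 case (elim q)
 from linear_compose[OF linear_compose[OF elim(1) linear_f, of "tg1 (fst q)"] elim(2)]
 show ?case by (simp add: o_def B_def[abs_def])
qed

lemma B_Q [simp]: "B q (G.Q w) = B q w" by (simp add: B_def G.theta_Q)

lemma smooth_f2: "sm_at (%p. f (fst p) (snd p)) (0, v)"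
 by (rule sm_at_linear_family[where g=fst and u=snd])
  (auto simp: linear_f intro: smooth_f sm_at_blinear bounded_linear_fst bounded_linear_snd)

lemma smooth_B3: "sm_at (%p. B (fst p) (snd p)) ((0, 0), w)"
proof -
 have g: "sm_at (%p::('a \<times> 'b) \<times> 'a. fst (fst p)) ((0, 0), w)" "sm_at (%p::('a \<times> 'b) \<times> 'a. snd p) ((0, 0), w)"
  "sm_at (%p::('a \<times> 'b) \<times> 'a. snd (fst p)) ((0, 0), w)"
  by (intro sm_at_fst sm_at_snd sm_at_id)+
 have t: "sm_at (%p::('a \<times> 'b) \<times> 'a. tg1 (fst (fst p))) ((0, 0), w)"
  by (rule sm_at_compose[OF g(1)]) (simp add: G.smooth_tau)
 have th: "sm_at (%p::('a \<times> 'b) \<times> 'a. G.th (fst (fst p)) (snd p)) ((0, 0), w)"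
  using sm_at_compose[OF sm_at_Pair[OF g(1,2)], of "%q. G.th (fst q) (snd q)"] G.smooth_theta by simp
 have "sm_at (%p::('a \<times> 'b) \<times> 'a. f (tg1 (fst (fst p))) (G.th (fst (fst p)) (snd p))) ((0, 0), w)"
  using sm_at_compose[OF sm_at_Pair[OF t th], of "%q. f (fst q) (snd q)"] smooth_f2 by simp
 from sm_at_compose[OF sm_at_Pair[OF this g(3)], of "%q. H.X (fst q) (snd q)"] H.smooth_X2
 show ?thesis by (simp add: B_def)
qed

lemma smooth_B: "sm_at (%q. B q w) (0, 0)"
proof -
 have "sm_at (%q. (q, w)) ((0, 0) :: 'a \<times> 'b)"
  by (intro sm_at_Pair sm_at_id sm_at_const)
 from sm_at_compose[OF this, of "%p. B (fst p) (snd p)"] smooth_B3 show ?thesis by simp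
qed

text \<open>Linearity reduces the statement to the finitely many directions in \<open>mb\<close>,
  which have a common neighbourhood.\<close>

lemma near_smooth_B: "near q ~ (0, 0). ALL w. sm_at (%q. B q w) q"
proof -
 have "near q ~ (0, 0). ALL b:mb. sm_at (%q. B q b) q"
  by (intro eventually_ball_finite ballI sm_at_near smooth_B) simp
 thus ?thesis using near_near[OF linear_B]
 proof eventually_elim
  case (elim q)
  show ?case
  proof
   fix w
   have "sm_at (%q. SUM b:mb. inner w b *. B q b) q"
    by (intro sm_at_sum sm_at_scaleR sm_at_const) (use elim(1) in auto)
   moreover have "near q ~ q. (SUM b:mb. inner w b *. B q b) = B q w"
    using elim(2) by eventually_elim (simp add: lin_mb_sum[symmetric])
   ultimately show "sm_at (%q. B q w) q" by (rule sm_at_transform)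
  qed
 qed
qed

lemma B_X: "near q ~ (0, 0). ALL v. B q (G.X v (fst q)) = H.X (f (tg1 (fst q)) v) (snd q)"
 using near_fst[OF G.theta_X] by eventually_elim (simp add: B_def)

lemma near_smooth_f: "near x ~ 0. ALL v. sm_at (%x. f x v) x"
proof -
 have "near x ~ 0. ALL b:mb. sm_at (%x. f x b) x"
  by (intro eventually_ball_finite ballI sm_at_near smooth_f) simp
 thus ?thesis
 proof eventually_elim
  case (elim x)
  have "(%x. f x v) = (%x. SUM b:mb. inner v b *. f x b)" for v
   using lin_mb_sum[OF linear_f] by blast
  thus ?case using elim by (auto intro!: sm_at_sum sm_at_scaleR sm_at_const)
 qed
qed

text \<open>The defect of symmetry of the total derivative of \<open>B\<close> vanishes where the targets match;
 this is the bracket condition, evaluated on right-invariant vector fields.\<close>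

lemma B_integrable_X:
 "near q ~ (0, 0). tg2 (snd q) = fi (tg1 (fst q)) --> (ALL v w.
  D (%p. B p (G.X v (fst q))) q (G.X w (fst q), B q (G.X w (fst q))) =
  D (%p. B p (G.X w (fst q))) q (G.X v (fst q), B q (G.X v (fst q))))"
 using near_smooth_B near_near[OF linear_B] near_near[OF B_X]
  near_fst[OF G.near_smooth_Xv] near_snd[OF H.near_smooth_Xv] near_snd[OF near_near[OF H.linear_X]]
  near_fst[OF G.near_tau[OF near_smooth_f]] near_fst[OF sm_at_near[OF G.smooth_tau]]
  near_fst[OF G.D_tau_X] near_fst[OF G.br_right_invariant] near_snd[OF H.br_right_invariant]
  near_fst[OF G.near_tau[OF bracket_f]] near_fst[OF G.P_tau]
proof eventually_elim
 case (elim q)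
 obtain y k where q: "q = (y, k)" by (cases q)
 note e = elim[unfolded q fst_conv snd_conv]
 let ?x = "tg1 y"
 have linB: "linear (B (y, k))" by (rule near_self[OF e(2)])
 have linX: "linear (%v. H.X v k)" by (rule near_self[OF e(6)])
 have XB: "B (y, k) (G.X v y) = H.X (f ?x v) k" for v
  using near_self[OF e(3)] by simp
 \<comment> \<open>The product rule for the identity \<open>B_X\<close>, differentiated along the
   direction \<open>(G.X w y, B (y, k) (G.X w y))\<close>. Exchanging v and w and subtracting then
   produces the two brackets.\<close>
 have I: "D (%p. B p (G.X v y)) (y, k) (G.X w y, B (y, k) (G.X w y)) + B (y, k) (D (G.X v) y (G.X w y)) =
  D (H.X (f ?x v)) k (H.X (f ?x w) k) + H.X (D (%x. f x v) ?x (D tg1 ?x (G.Q w))) k" for v w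
 proof -
  let ?c = "%e::real. (y, k) + e *. (G.X w y, H.X (f ?x w) k)"
  have c: "(?c hvd (G.X w y, H.X (f ?x w) k)) (at 0)" by (rule line_derivative)
  have c1: "((%e. y + e *. G.X w y) hvd G.X w y) (at 0)"
   and c2: "((%e. k + e *. H.X (f ?x w) k) hvd H.X (f ?x w) k) (at 0)"
   by (rule line_derivative)+
  have "((%e. G.X v (y + e *. G.X w y)) hvd D (G.X v) y (G.X w y)) (at 0)"
   using curve_deriv[OF _ c1, of "G.X v"] e(4) by simp
  from linear_family_curve[where c="?c" and L=B, OF _ _ c this]
  have "((%e. B (?c e) (G.X v (y + e *. G.X w y))) has_vector_derivative
   D (%p. B p (G.X v y)) (y, k) (G.X w y, H.X (f ?x w) k) + B (y, k) (D (G.X v) y (G.X w y))) (at 0)"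
   using e(1,2) by simp
  moreover have "((%e. H.X (f (tg1 (y + e *. G.X w y)) v) (k + e *. H.X (f ?x w) k)) has_vector_derivative
   D (H.X (f ?x v)) k (H.X (f ?x w) k) + H.X (D (%x. f x v) ?x (D tg1 ?x (G.Q w))) k) (at 0)"
  proof -
   have "((%e. tg1 (y + e *. G.X w y)) hvd D tg1 y (G.X w y)) (at 0)"
    using curve_deriv[OF _ c1, of tg1] e(8) by simp
   from curve_deriv[OF _ this, of "%x. f x v"]
   have "((%e. f (tg1 (y + e *. G.X w y)) v) has_vector_derivative
     D (%x. f x v) ?x (D tg1 ?x (G.Q w))) (at 0)"
    using e(7,9) by simp
   from linear_family_curve[where c="%e. k + e *. H.X (f ?x w) k" and L="%k u. H.X u k", OF _ _ c2 this]
   show ?thesis using e(5,6) by simp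
  qed
  moreover have "near e ~ 0. B (?c e) (G.X v (y + e *. G.X w y)) =
   H.X (f (tg1 (y + e *. G.X w y)) v) (k + e *. H.X (f ?x w) k)"
   using eventually_on_line[OF e(3), of "(G.X w y, H.X (f ?x w) k)"] by eventually_elim simp
  ultimately show ?thesis unfolding XB[of w] by (rule curve_deriv_unique[rotated])
 qed
 show ?case unfolding q fst_conv snd_conv
 proof (intro impI allI)
  fix v w assume S: "tg2 k = fi ?x"
  have x: "P1 ?x = ?x" by (rule e(13))
  let ?E = "%v w. D (%x. f x v) ?x (D tg1 ?x (G.Q w))"
  have "H.br (f ?x w) (f ?x v) k = H.X (H.br (f ?x w) (f ?x v) (fi ?x)) k" using e(11) S by simp
  moreover have "f ?x (G.br w v ?x) = H.br (f ?x w) (f ?x v) (fi ?x) + ?E v w - ?E w v"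
   using e(12) x by simp
  ultimately have 1: "H.X (f ?x (G.br w v ?x)) k = H.br (f ?x w) (f ?x v) k + H.X (?E v w) k - H.X (?E w v) k"
   using linear_add[OF linX] linear_diff[OF linX] by simp
  have "G.br w v y = G.X (G.br w v ?x) y" using e(10) by simp
  hence 2: "B (y, k) (G.br w v y) = H.X (f ?x (G.br w v ?x)) k" by (simp add: XB)
  have 3: "B (y, k) (G.br w v y) = B (y, k) (D (G.X v) y (G.X w y)) - B (y, k) (D (G.X w) y (G.X v y))"
   unfolding G.br_def by (rule linear_diff[OF linB])
  show "D (%p. B p (G.X v y)) (y, k) (G.X w y, B (y, k) (G.X w y)) =
   D (%p. B p (G.X w y)) (y, k) (G.X v y, B (y, k) (G.X v y))"
  proof -
   have cancel: "a = b" if "a + p = r" "b + p' = r'" "p - p' = r - r'" for a b p p' r r' :: 'b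
   proof -
    have "a = r - p" "b = r' - p'" using that(1,2) by (simp_all add: eq_diff_eq)
    hence "a - b = (r - r') - (p - p')" by simp
    thus ?thesis using that(3) by simp
   qed
   show ?thesis
   proof (rule cancel[OF I[of v w] I[of w v]])
    show "B (y, k) (D (G.X v) y (G.X w y)) - B (y, k) (D (G.X w) y (G.X v y)) =
     (D (H.X (f ?x v)) k (H.X (f ?x w) k) + H.X (?E v w) k) -
     (D (H.X (f ?x w)) k (H.X (f ?x v) k) + H.X (?E w v) k)"
     unfolding 3[symmetric] 2 1 H.br_def by (simp add: algebra_simps)
   qed
  qed
 qed
qed

text \<open>By \<open>X_theta\<close>, every vector tangent to the source fibre at a point is the
  value there of a right-invariant field.\<close>

lemma B_integrable:
 "near q ~ (0, 0). tg2 (snd q) = fi (tg1 (fst q)) --> (ALL u w. P1 u = 0 --> P1 w = 0 -->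
  D (%p. B p u) q (w, B q w) = D (%p. B p w) q (u, B q u))"
 using B_integrable_X near_fst[OF G.X_theta]
proof eventually_elim
 case (elim q)
 have "u = G.X (G.th (fst q) u) (fst q)" if "P1 u = 0" for u
  using elim(2) G.Q_ker[OF that] by simp
 thus ?case using elim(1) by metis
qed

end

lemma near_norm_less: "r > 0 ==> near y ~ 0. norm (y::'a::real_normed_vector) < r"
 unfolding eventually_nhds_metric by (intro exI[of _ r]) (auto simp: dist_norm)

context local_morphism begin

text \<open>The equation along the ray of g, with g as parameter and initial value
  \<open>fi (P1 g)\<close>. Its right side is linear in \<open>G.Q g\<close>, so for small g its
  Lipschitz constant is at most 1/2 and the solution reaches time 1. \<open>F\<close> is the value
  at time 1.\<close>

lemma radial_solution:
 obtains F where "sm_at F 0" "F 0 = 0" "near g ~ 0. F (P1 g) = fi g"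
  "near g ~ 0. ALL t:{0..1}. ((%s. F (P1 g + s *. G.Q g)) has_vector_derivative
   B (P1 g + t *. G.Q g, F (P1 g + t *. G.Q g)) (G.Q g)) (at t within {0..1})"
proof -
 define h where "h p = B (fst p) (snd p)" for p
 define p0 :: "('a \<times> 'b) \<times> 'a" where "p0 = ((0, 0), 0)"
 obtain S0 where S0: "open S0" "p0 : S0" "smooth_on S0 h"
  using smooth_B3[of 0] unfolding sm_at_def h_def[abs_def, symmetric] p0_def by blast
 have c: "continuous_on ({0..1::real} \<times> S0) (%(t, y). D h y b)" for b
  using pCk_cont[OF Ck_on_imp_pCk[of 0 S0 "%y. D h y b" "{0..1}"]]
   smooth_on_continuous[OF smooth_on_frechet[OF S0(3)], of b] by simp
 obtain de where d: "de > 0" "ball p0 de \<subseteq> S0"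
  and taylor: "!!t x y. t : {0..1::real} ==> x : ball p0 de ==> y : ball p0 de ==>
   norm (h y - h x - D h p0 (y - x)) <= 1 / 2 * norm (y - x)"
  apply (rule uniform_taylor[OF S0(1,2) _ smooth_on_has_derivative[OF S0(3)] c, of "1 / 2"], simp, assumption)
  subgoal premises pr for d by (rule pr(1)[OF pr(2,3)]) (rule pr(4))
  done
 have lin0: "near p ~ p0. linear (B (fst p))"
  using near_fst[of "%q. linear (B q)"] linear_B by (simp add: p0_def zero_prod_def)
 have p0z: "p0 + ((0, 0), 0) = p0" by (simp add: p0_def)
 \<comment> \<open>Being linear in its last argument, \<open>h\<close> vanishes on this line.
   Without a first-order term in k, the Taylor estimate turns into the Lipschitz bound 1/2 for
   \<open>V\<close>.\<close>
 have Dh: "D h p0 ((0, ka), 0) = 0" for ka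
 proof -
  have "((%e. h (p0 + e *. ((0, ka), 0))) hvd D h p0 ((0, ka), 0)) (at 0)"
   using curve_deriv[OF _ line_derivative[of p0 "((0, ka), 0)" 0], of h] sm_at_on[OF S0(3,1,2)] by (simp add: p0z)
  moreover have "((%e::real. 0 :: 'b) hvd 0) (at 0)" by simp
  moreover have "near e ~ 0. h (p0 + e *. ((0, ka), 0)) = 0"
   using eventually_on_line[OF lin0, of "((0, ka), 0)"]
   by eventually_elim (simp add: h_def p0_def linear_0)
  ultimately show ?thesis by (rule curve_deriv_unique[rotated])
 qed
 have "linear (B (0, 0))" using near_self[OF lin0] by (simp add: p0_def)
 hence h0: "h p0 = 0" by (simp add: h_def p0_def linear_0)
 obtain de0 where d0: "de0 > 0" "!!p. dist p p0 < de0 ==> linear (B (fst p))"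
  using lin0 unfolding eventually_nhds_metric by blast
 define R where "R = min de de0 / 4"
 define r where "r = R / 2"
 have Rr: "R > 0" "r > 0" "r < R" using d d0 by (auto simp: R_def r_def)
 have "near p ~ p0. norm (h p) < r / 4"
  by (rule isCont_eventually[where Q="%y. norm y < r / 4", OF sm_at_isCont[OF sm_at_on[OF S0(3,1,2)]]])
   (unfold h0, rule near_norm_less, use Rr in simp)
 then obtain de1 where d1: "de1 > 0" "!!p. dist p p0 < de1 ==> norm (h p) < r / 4"
  unfolding eventually_nhds_metric by blast
 have "near x ~ 0. norm (fi x) < r / 4 & sm_at fi x"
  by (intro eventually_conj sm_at_near smooth_phi
   isCont_eventually[where Q="%y. norm y < r / 4", OF sm_at_isCont[OF smooth_phi]])
   (unfold phi_0, rule near_norm_less, use Rr in simp)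
 then obtain de2 where d2: "de2 > 0" "!!x. norm x < de2 ==> norm (fi x) < r / 4 & sm_at fi x"
  unfolding eventually_nhds_metric by auto
 \<comment> \<open>The arguments of \<open>h\<close> have norm below 2 ro + R + ro, with
   \<open>ro\<close> at most an eighth and \<open>R\<close> at most a quarter of \<open>de\<close>
   and \<open>de0\<close>, so they stay within both radii.\<close>
 define ro where "ro = min (min de de0 / 8) (min (de1 / 8) de2)"
 have ro: "ro > 0" "ro <= de / 8" "ro <= de1 / 8" "ro <= de2" "ro <= de0 / 8" using d d0 d1 d2 by (auto simp: ro_def)
 define W where "W = {g. norm (P1 g) < ro & norm (G.Q g) < ro}"
 have oW: "open W" unfolding W_def
  by (intro open_Collect_conj open_Collect_less continuous_intros bounded_linear.continuous_on[OF G.bounded_P]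
    bounded_linear.continuous_on[OF G.bounded_Q])
 have W0: "0 : W" using ro by (simp add: W_def)
 have ray_norm: "norm (P1 g + t *. G.Q g) < 2 * ro" if "g : W" "t : {0..1}" for g t
 proof -
  have "norm (t *. G.Q g) <= 1 * norm (G.Q g)" unfolding norm_scaleR by (rule mult_right_mono) (use that in auto)
  thus ?thesis using that norm_triangle_ineq[of "P1 g" "t *. G.Q g"] by (simp add: W_def)
 qed
 have norm3: "dist ((a, k), w) p0 <= norm a + norm k + norm w" for a k w
  using norm_Pair_le[of "(a, k)" w] norm_Pair_le[of a k] by (simp add: p0_def dist_norm)
 have inb: "((P1 g + t *. G.Q g, k), G.Q g) : ball p0 de" if "g : W" "t : {0..1}" "norm k < R" for g t k
  using norm3[of "P1 g + t *. G.Q g" k "G.Q g"] ray_norm[OF that(1,2)] that(1,3) ro d(1)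
  by (simp add: W_def R_def dist_commute)
 define V where "V t q = h ((P1 (fst q) + t *. G.Q (fst q), snd q), G.Q (fst q))" for t q
 have oWR: "open (W \<times> ball (0::'b) R)" by (intro open_Times oW) simp
 have pV: "pCk k {0..1} (W \<times> ball 0 R) V" for k
  unfolding V_def[abs_def]
 proof (rule pCk_compose[OF oWR, where S=S0])
  have lP: "bounded_linear (%q::'a \<times> 'b. P1 (fst q))" "bounded_linear (%q::'a \<times> 'b. G.Q (fst q))"
   using bounded_linear_compose[OF G.bounded_P bounded_linear_fst] bounded_linear_compose[OF G.bounded_Q bounded_linear_fst] .
  show "pCk k {0..1} (W \<times> ball (0::'b) R) (%t q. ((P1 (fst q) + t *. G.Q (fst q), snd q), G.Q (fst q)))"
   by (intro pCk_Pair pCk_add pCk_bilinear[OF bounded_bilinear_scaleR] pCk_const pCk_linear lP bounded_linear_snd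
     continuous_on_id)
  show "((P1 (fst q) + t *. G.Q (fst q), snd q), G.Q (fst q)) : S0" if "t : {0..1}" "q : W \<times> ball 0 R" for t q
   using inb[of "fst q" t "snd q"] that d(2) by (auto simp: mem_Times_iff)
  show "Ck_on k S0 h" using S0(3) by (simp add: smooth_on_def)
 qed
 have lip: "norm (V t (g, k) - V t (g, k')) <= norm (k - k') / 2"
  if "t : {0..1}" "g : W" "norm k < R" "norm k' < R" for t g k k'
  using taylor[OF that(1) inb[OF that(2,1,4)] inb[OF that(2,1,3)]] Dh[of "k - k'"] by (simp add: V_def)
 have dist1: "dist ((P1 g + t *. G.Q g, 0), G.Q g) p0 < de1" if "g : W" "t : {0..1}" for g t
  using norm3[of "P1 g + t *. G.Q g" 0 "G.Q g"] ray_norm[OF that] that(1) ro by (simp add: W_def)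
 obtain z where z: "!!k. pCk k {0..1} W z" "!!t p. t : {0..1} ==> p : W ==> norm (z t p) <= r"
  "!!t p. t : {0..1} ==> p : W ==> z t p = fi (P1 p) + integral {0..t} (%s. V s (p, z s p))"
 proof (rule integral_contraction.smooth_fixpoint[OF oW Rr(3) _ pV lip, of "%t p. fi (P1 p)"])
  have "smooth_on W (%p. fi (P1 p))"
   unfolding smooth_on_iff_near[OF oW]
   by (intro ballI sm_at_compose[OF sm_at_blinear[OF G.bounded_P]]) (use d2(2) ro in \<open>auto simp: W_def\<close>)
  thus "pCk k {0..1} W (%t p. fi (P1 p))" for k
   unfolding smooth_on_def by (intro Ck_on_imp_pCk) blast
  show "norm (fi (P1 p)) <= r / 4" if "p : W" for p
   using d2(2)[of "P1 p"] that ro by (simp add: W_def)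
  show "norm (V t (p, 0)) <= r / 4" if "t : {0..1}" "p : W" for t p
   using d1(2)[OF dist1[OF that(2,1)]] by (simp add: V_def)
  fix z assume z: "!!k. pCk k {0..1} W z" "!!t p. t : {0..1} ==> p : W ==> norm (z t p) <= r"
   "!!t p. t : {0..1} ==> p : W ==> z t p = fi (P1 p) + integral {0..t} (%s. V s (p, z s p))"
  show thesis by (rule that[OF z])
 qed
 define F where "F = z 1"
 have cz: "continuous_on {0..1} (%t. z t p)" if "p : W" for p
  by (rule cont_uncurry[OF pCk_cont[OF z(1)]]) (use that in auto)
 have dz: "((%t. z t p) hvd V t (p, z t p)) (at t within {0..1})" if t: "t : {0..1}" and p: "p : W" for t p
 proof -
  have "continuous_on {0..1} (%s. V s (p, z s p))"
   by (rule cont_uncurry[OF pCk_cont[OF pV]])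
    (use p Rr(3) z(2)[OF _ p] in \<open>force intro!: continuous_intros cz\<close>)+
  from integral_has_vector_derivative[OF this t]
  have "((%t. fi (P1 p) + integral {0..t} (%s. V s (p, z s p))) hvd V t (p, z t p)) (at t within {0..1})"
   by (auto intro!: derivative_eq_intros)
  thus ?thesis
   by (rule has_vector_derivative_transform[OF t, rotated]) (use z(3)[OF _ p] in auto)
 qed
 have linB: "linear (B (P1 g + t *. G.Q g, k))" if "g : W" "t : {0..1}" "norm k < R" for g t k
  using d0(2)[of "((P1 g + t *. G.Q g, k), G.Q g)"] norm3[of "P1 g + t *. G.Q g" k "G.Q g"]
   ray_norm[OF that(1,2)] that(1,3) ro by (simp add: W_def R_def)
 \<comment> \<open>As functions of s, \<open>z (s * t) p\<close> and
   \<open>z s (P1 p + t *. G.Q p)\<close> solve the same equation, because \<open>B\<close> is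
   linear in the velocity. Hence \<open>F\<close> traces the solution along the whole ray.\<close>
 have zF: "z t p = F (P1 p + t *. G.Q p)" if t: "t : {0..1}" and p: "p : W" for t p
 proof -
  let ?p = "P1 p + t *. G.Q p"
  have p': "?p : W"
   using p t mult_right_mono[of t 1 "norm (G.Q p)"] by (auto simp: W_def)
  have st: "s * t : {0..1}" if "s : {0..1}" for s using that t by (auto intro: mult_le_one)
  have "z (1 * t) p - z 1 ?p = 0"
  proof (rule vector_derivative_zero[of 0 1 "%s. z (s * t) p - z s ?p" _ "1 / 2" 0 1])
   fix s :: real assume s: "s : {0..1}"
   have "((%s. z (s * t) p) hvd t *. V (s * t) (p, z (s * t) p)) (at s within {0..1})"
   proof -
    have "((%s. s * t) hvd t) (at s within {0..1})"
     by (auto intro!: derivative_eq_intros)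
    moreover have "((%s. z s p) hvd V (s * t) (p, z (s * t) p)) (at (s * t) within (%s. s * t) ` {0..1})"
     by (rule has_vector_derivative_within_subset[OF dz[OF st[OF s] p]]) (use st in blast)
    ultimately show ?thesis
     using vector_diff_chain_within[of "%s. s * t" t s "{0..1}" "%s. z s p"] by (simp add: o_def)
   qed
   thus "((%s. z (s * t) p - z s ?p) has_vector_derivative
     t *. V (s * t) (p, z (s * t) p) - V s (?p, z s ?p)) (at s within {0..1})"
    by (intro has_vector_derivative_diff dz s p')
   have zb: "norm (z (s * t) p) < R" "norm (z s ?p) < R" using z(2)[OF st[OF s] p] z(2)[OF s p'] Rr(3) by auto
   have "t *. V (s * t) (p, z (s * t) p) = V s (?p, z (s * t) p)"
    using linear_scale[OF linB[OF p st[OF s] zb(1)], of t "G.Q p"] by (simp add: V_def h_def)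
   thus "norm (t *. V (s * t) (p, z (s * t) p) - V s (?p, z s ?p)) <= 1 / 2 * norm (z (s * t) p - z s ?p)"
    using lip[OF s p' zb] by simp
  qed (use z(3)[OF _ p, of 0] z(3)[OF _ p', of 0] in auto)
  thus ?thesis by (simp add: F_def)
 qed
 have evW: "near g ~ 0. g : W" by (rule near_open_set[OF oW W0])
 have F1: "F (P1 g) = fi g" if "g : W" for g
  using zF[of 0 g] z(3)[of 0 g] that by simp
 show ?thesis
 proof (rule that[of F])
  have "Ck_on k W F" for k unfolding F_def by (rule pCk_imp_Ck_on[OF oW _ z(1)]) simp
  thus "sm_at F 0" by (intro sm_at_on[OF _ oW W0]) (simp add: smooth_on_def)
  show "F 0 = 0" using F1[OF W0] by simp
  show "near g ~ 0. F (P1 g) = fi g" using evW by eventually_elim (rule F1)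
  show "near g ~ 0. ALL t:{0..1}. ((%s. F (P1 g + s *. G.Q g)) has_vector_derivative
   B (P1 g + t *. G.Q g, F (P1 g + t *. G.Q g)) (G.Q g)) (at t within {0..1})"
   using evW
  proof eventually_elim
   case (elim g)
   show ?case
   proof
    fix t :: real assume t: "t : {0..1}"
    have "((%t. z t g) hvd B (P1 g + t *. G.Q g, F (P1 g + t *. G.Q g)) (G.Q g)) (at t within {0..1})"
     using dz[OF t elim] zF[OF t elim] by (simp add: V_def h_def)
    thus "((%s. F (P1 g + s *. G.Q g)) has_vector_derivative
      B (P1 g + t *. G.Q g, F (P1 g + t *. G.Q g)) (G.Q g)) (at t within {0..1})"
     by (rule has_vector_derivative_transform[OF t, rotated]) (use zF elim in auto)
   qed
  qed
 qed
qed

end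

lemma linear_family_bounded:
 fixes L :: "'p::real_normed_vector => 'a::model_space => 'b::real_normed_vector"
 assumes lin: "near p ~ x. linear (L p)" and L: "!!b. isCont (%p. L p b) x"
 shows "EX M>=0. near p ~ x. ALL v. norm (L p v) <= M * norm v"
proof -
 have "near p ~ x. ALL b:mb. norm (L p b) < norm (L x b) + 1"
 proof (intro eventually_ball_finite ballI finite_mb)
  fix b
  have "isCont (%p. norm (L p b)) x" using L by (rule continuous_norm)
  moreover have "near y ~ (norm (L x b)). y < norm (L x b) + 1"
   using near_open_set[of "{..<norm (L x b) + 1}" "norm (L x b)"] by simp
  ultimately show "near p ~ x. norm (L p b) < norm (L x b) + 1"
   by (rule isCont_eventually[where Q="%y. y < norm (L x b) + 1"])
 qed
 hence "near p ~ x. ALL v. norm (L p v) <= (SUM b:mb. norm (L x b) + 1) * norm v"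
  using lin
 proof eventually_elim
  case (elim p)
  show ?case
  proof
   fix v
   have "norm (L p v) <= (SUM b:mb. norm (L p b)) * norm v" by (rule linear_norm_le[OF elim(2)])
   also have "\<dots> <= (SUM b:mb. norm (L x b) + 1) * norm v"
    using elim(1) by (intro mult_right_mono sum_mono) (auto intro: less_imp_le)
   finally show "norm (L p v) <= (SUM b:mb. norm (L x b) + 1) * norm v" .
  qed
 qed
 thus ?thesis by (intro exI[of _ "SUM b:mb. norm (L x b) + 1"]) (auto intro!: sum_nonneg add_nonneg_nonneg)
qed

lemma curve_deriv_within:
 assumes "sm_at f (c t)" "(c hvd v) (at (t::real) within S)"
 shows "((%e. f (c e)) hvd D f (c t) v) (at t within S)"
proof -
 have "((%e. f (c e)) hder (%h. D f (c t) (h *. v))) (at t within S)"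
  using has_derivative_compose[OF assms(2)[unfolded has_vector_derivative_def] sm_at_has_derivative[OF assms(1)]] .
 thus ?thesis
  unfolding has_vector_derivative_def linear_scale[OF sm_at_linear[OF assms(1)]] .
qed

context local_model begin

lemma near_ray_pair:
 assumes "near q ~ (0, 0 :: 'b::real_normed_vector). R q"
 shows "near q ~ (0, 0). ALL t:{0..1}. R (P (fst q) + t *. Q (fst q), snd q)"
proof -
 obtain A C where A: "near x ~ 0. A x" and C: "near y ~ 0. C y" and R: "!!x y. A x ==> C y ==> R (x, y)"
  using assms unfolding nhds_prod eventually_prod_filter by blast
 show ?thesis using near_fst[OF near_ray[OF A]] near_snd[OF C] by eventually_elim (auto intro: R)
qed

lemma ray_derivative: "((%s. P g + s *. Q g) hvd Q g) (at t within S)"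
 using has_vector_derivative_at_within[OF line_derivative] .

end

locale radial_solution = local_morphism +
 fixes F
 assumes smooth_F: "sm_at F 0" and F_0 [simp]: "F 0 = 0"
  and F_P: "near g ~ 0. F (P1 g) = fi g"
  and F_ray: "near g ~ 0. ALL t:{0..1}. ((%s. F (P1 g + s *. G.Q g)) has_vector_derivative
   B (P1 g + t *. G.Q g, F (P1 g + t *. G.Q g)) (G.Q g)) (at t within {0..1})"
begin

abbreviation ray where "ray g t \<equiv> P1 g + t *. G.Q g"

declare G.P_Q_add [simp] B_Q [simp del]

lemma near_F: "near y ~ 0. R y ==> near g ~ 0. R (F g)"
 by (rule sm_at_eventually[OF smooth_F]) simp

lemma near_graph: "near q ~ (0, 0). R q ==> near g ~ 0. R (g, F g)"
 by (rule sm_at_eventually[where f="%g. (g, F g)"]) (auto intro: sm_at_Pair sm_at_id smooth_F)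

lemma near_graph_nhds: "near q ~ (0, 0). R q ==> near g ~ 0. near q ~ (g, F g). R q"
 by (rule eventually_along[where f="%g. (g, F g)"]) (auto intro: sm_at_Pair sm_at_id smooth_F)

text \<open>Right-invariant fields are tangent to the source fibres, so the source of
  \<open>F\<close> is constant along a ray and equals its value at the initial unit.\<close>

lemma P_F: "near g ~ 0. P2 (F g) = fi g"
 using F_ray F_P P_phi G.near_ray[OF near_F[OF H.P_X]]
proof eventually_elim
 case (elim g)
 have "P2 (F (ray g 1)) - fi g = 0"
 proof (rule vector_derivative_zero[of 0 1 "%t. P2 (F (ray g t)) - fi g" "%t. 0" 0 0 1])
  fix t :: real assume t: "t : {0..1}"
  have "((%t. P2 (F (ray g t))) hvd P2 (B (ray g t, F (ray g t)) (G.Q g))) (at t within {0..1})"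
   using elim(1) t by (intro bounded_linear.has_vector_derivative[OF H.bounded_P]) auto
  thus "((%t. P2 (F (ray g t)) - fi g) hvd 0) (at t within {0..1})"
   using elim(4) t by (auto simp: B_def intro!: derivative_eq_intros)
 qed (use elim(2,3) in auto)
 thus ?case by simp
qed

text \<open>The prescribed Maurer-Cartan form of the image of the ray: \<open>F\<close> along the
  ray solves k' = X (cc g t) k.\<close>

definition cc :: "'a => real => 'b" where
 "cc g t = f (tg1 (ray g t)) (G.th (ray g t) (G.Q g))"

lemma B_cc: "B (ray g t, k) (G.Q g) = H.X (cc g t) k" by (simp add: B_def cc_def)

lemma cc_bounded: "EX M>=0. near g ~ 0. ALL t:{0..1}. norm (cc g t) <= M * norm (G.Q g)"
proof -
 have lin: "near g ~ 0. linear (%w. f (tg1 g) (G.th g w))"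
  using G.linear_theta
 proof eventually_elim
  case (elim g)
  from linear_compose[OF elim linear_f, of "tg1 g"] show ?case by (simp add: o_def)
 qed
 have "isCont (%g. f (tg1 g) (G.th g w)) 0" for w
 proof -
  have "sm_at (%g. G.th g w) 0"
   using sm_at_compose[of "%g. (g, w)" 0 "%q. G.th (fst q) (snd q)"] G.smooth_theta
   by (simp add: sm_at_Pair sm_at_id sm_at_const)
  from sm_at_compose[OF sm_at_Pair[OF G.smooth_tau this], of "%p. f (fst p) (snd p)"] smooth_f2
  have "sm_at (%g. f (tg1 g) (G.th g w)) 0" by simp
  thus ?thesis by (rule sm_at_isCont)
 qed
 from linear_family_bounded[OF lin this] obtain M where M: "M >= 0"
  "near g ~ 0. ALL w. norm (f (tg1 g) (G.th g w)) <= M * norm w" by blast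
 from G.near_ray[OF M(2)] have "near g ~ 0. ALL t:{0..1}. norm (cc g t) <= M * norm (G.Q g)"
  by eventually_elim (simp add: cc_def)
 thus ?thesis using M(1) by blast
qed

text \<open>Along a ray both sides solve c' = D tg2 c (cc g t): the left one because the target
  projects right-invariant fields to the anchor, the right one by compatibility of the anchors. The
  equality puts the graph of \<open>F\<close> where \<open>B_integrable\<close> applies.\<close>

lemma tau_F: "near g ~ 0. tg2 (F g) = fi (tg1 g)"
proof -
 have linD: "near y ~ 0. linear (D tg2 y)"
  using sm_at_near[OF H.smooth_tau] by eventually_elim (rule sm_at_linear)
 obtain L r where L: "L >= 0" "r > 0"
  "ALL y:ball 0 r. ALL z:ball 0 r. ALL v. norm (D tg2 y v - D tg2 z v) <= L * norm v * norm (y - z)"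
  using linear_family_lipschitz[OF linD sm_at_D[OF H.smooth_tau]] by blast
 obtain M where M: "M >= 0" "near g ~ 0. ALL t:{0..1}. norm (cc g t) <= M * norm (G.Q g)"
  using cc_bounded by blast
 have sphi: "near g ~ 0. sm_at fi (tg1 g)"
  by (rule G.near_tau[OF sm_at_near[OF smooth_phi]])
 have inb: "near g ~ 0. norm (tg2 (F g)) < r & norm (fi (tg1 g)) < r"
  by (intro eventually_conj near_F[OF H.near_tau] G.near_tau near_norm_less L(2)
    sm_at_eventually[OF smooth_phi, where Q="%y. norm y < r"]) (simp add: L near_norm_less)
 show ?thesis
  using F_ray F_P P_phi M(2) G.near_ray[OF near_F[OF H.D_tau_X]]
   G.near_ray[OF near_F[OF sm_at_near[OF H.smooth_tau]]]
   G.near_ray[OF sphi] G.near_ray[OF sm_at_near[OF G.smooth_tau]]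
   G.near_ray[OF G.X_theta] G.near_ray[OF G.D_tau_X] G.near_ray[OF G.P_tau]
   G.near_ray[OF G.near_tau[OF anchor_f]] G.near_ray[OF G.near_tau[OF P_f]] G.near_ray[OF inb]
   sm_at_eventually[OF smooth_phi, unfolded phi_0, OF H.tau_unit]
   sm_at_eventually[OF sm_at_blinear[OF G.bounded_P], where x=0, unfolded G.P_0, OF G.tau_unit]
 proof eventually_elim
  case (elim g)
  have "tg2 (F (ray g 1)) - fi (tg1 (ray g 1)) = 0"
  proof (rule vector_derivative_zero[of 0 1 "%t. tg2 (F (ray g t)) - fi (tg1 (ray g t))" _ "L * (M * norm (G.Q g))" 0 1])
   fix t :: real assume t: "t : {0..1}"
   let ?y = "ray g t" and ?c = "cc g t"
   have Pc: "H.Q ?c = ?c" using elim(13) t by (intro H.Q_ker) (simp add: cc_def)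
   have d1: "((%t. tg2 (F (ray g t))) hvd D tg2 (F ?y) (B (?y, F ?y) (G.Q g))) (at t within {0..1})"
    by (rule curve_deriv_within[of tg2 "%t. F (ray g t)"]) (use elim(1,6) t in auto)
   have e1: "D tg2 (F ?y) (B (?y, F ?y) (G.Q g)) = D tg2 (tg2 (F ?y)) ?c"
    using bspec[OF elim(5) t] Pc by (simp add: B_cc)
   have d2: "((%t. fi (tg1 (ray g t))) hvd D fi (tg1 ?y) (D tg1 ?y (G.Q g))) (at t within {0..1})"
    by (rule curve_deriv_within[of fi "%t. tg1 (ray g t)", OF _ curve_deriv_within[of tg1 "ray g", OF _ G.ray_derivative]])
     (use elim(7,8) t in auto)
   have e2: "D fi (tg1 ?y) (D tg1 ?y (G.Q g)) = D tg2 (fi (tg1 ?y)) ?c"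
   proof -
    let ?a = "G.th ?y (G.Q g)"
    have "D tg1 ?y (G.Q g) = D tg1 ?y (G.X ?a ?y)" using bspec[OF elim(9) t] by simp
    also have "\<dots> = D tg1 (tg1 ?y) (G.Q ?a)" using bspec[OF elim(10) t] by simp
    finally show ?thesis using bspec[OF elim(12) t] bspec[OF elim(11) t] by (simp add: cc_def)
   qed
   show "((%t. tg2 (F (ray g t)) - fi (tg1 (ray g t))) has_vector_derivative
     D tg2 (tg2 (F ?y)) ?c - D tg2 (fi (tg1 ?y)) ?c) (at t within {0..1})"
    by (rule has_vector_derivative_diff[OF d1[unfolded e1] d2[unfolded e2]])
   have "norm (D tg2 (tg2 (F ?y)) ?c - D tg2 (fi (tg1 ?y)) ?c) <= L * norm ?c * norm (tg2 (F ?y) - fi (tg1 ?y))"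
    using L(3) elim(14) t by auto
   also have "\<dots> <= L * (M * norm (G.Q g)) * norm (tg2 (F ?y) - fi (tg1 ?y))"
    using elim(4) t L(1) by (intro mult_right_mono mult_left_mono) auto
   finally show "norm (D tg2 (tg2 (F ?y)) ?c - D tg2 (fi (tg1 ?y)) ?c) <= L * (M * norm (G.Q g)) * norm (tg2 (F ?y) - fi (tg1 ?y))" .
  qed (use elim(2,3,15,16) in auto)
  thus ?case by simp
 qed
qed

definition defect :: "'a => 'a => 'b" where
 "defect w y = D F y (G.Q w) - B (y, F y) (G.Q w)"

text \<open>The radial equation \<open>D F y (Q y) = B (y, F y) (Q y)\<close> is differentiated in the direction \<open>Q w\<close>;
 by integrability and symmetry of the second derivative of \<open>F\<close> the defect satisfies a linear
 equation along rays.\<close>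

lemma defect_derivative:
 "near y ~ 0. ALL w. sm_at (defect w) y &
  D (defect w) y (G.Q y) = D (%p. B p (G.Q y)) (y, F y) (0, defect w y) - defect w y"
proof -
 have radial: "near y ~ 0. D F y (G.Q y) = B (y, F y) (G.Q y)"
  using F_ray sm_at_near[OF smooth_F]
 proof eventually_elim
  case (elim y)
  have "((%s. F (ray y s)) hvd D F y (G.Q y)) (at 1 within {0..1})"
   using curve_deriv_within[of F "ray y" 1, OF _ G.ray_derivative] elim(2) by simp
  moreover have "((%s. F (ray y s)) hvd B (y, F y) (G.Q y)) (at 1 within {0..1})"
   using bspec[OF elim(1), of 1] by simp
  ultimately show ?case
   using vector_derivative_unique_within[of 1 "{0..1}"] trivial_limit_within[of "1::real" "{0..1}"]
   by (auto simp: islimpt_Icc)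
 qed
 show ?thesis
  using near_near[OF radial] sm_at_near[OF smooth_F] near_graph[OF near_smooth_B]
   near_graph_nhds[OF linear_B] near_graph[OF B_integrable] tau_F
 proof eventually_elim
  case (elim y)
  let ?q = "(y, F y)"
  show ?case
  proof (intro allI conjI)
   fix w
   let ?u = "G.Q w" and ?v = "G.Q y"
   have sg: "sm_at (%p. (p, F p)) y" by (intro sm_at_Pair sm_at_id elim(2))
   have sB: "sm_at (%p. B (p, F p) a) y" for a
    by (rule sm_at_compose[OF sg]) (use elim(3) in simp)
   have lB: "linear (B ?q)" by (rule near_self[OF elim(4)])
   show sd: "sm_at (defect w) y"
    unfolding defect_def[abs_def] by (intro sm_at_diff sm_at_D elim(2) sB)
   have cg: "((%e. (y + e *. a, F (y + e *. a))) hvd (a, D F y a)) (at 0)" for a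
    using curve_deriv[OF _ line_derivative[of y a 0], of F] elim(2)
    by (intro has_vector_derivative_Pair line_derivative) simp
   have "((%e. D F (y + e *. ?u) (G.Q (y + e *. ?u))) has_vector_derivative
     D (%p. D F p ?v) y ?u + D F y ?u) (at 0)"
    using D_curve[OF _ line_derivative[of y ?u 0], of F "%e. G.Q (y + e *. ?u)"] elim(2)
     bounded_linear.has_vector_derivative[OF G.bounded_Q line_derivative[of y ?u 0]] by simp
   moreover have "((%e. B (y + e *. ?u, F (y + e *. ?u)) (G.Q (y + e *. ?u))) has_vector_derivative
     D (%p. B p ?v) ?q (?u, D F y ?u) + B ?q ?u) (at 0)"
    using linear_family_curve[where c="%e. (y + e *. ?u, F (y + e *. ?u))" and L=B, OF _ _ cg
      bounded_linear.has_vector_derivative[OF G.bounded_Q line_derivative[of y ?u 0]]] elim(3,4) by simp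
   moreover have "near e ~ 0. D F (y + e *. ?u) (G.Q (y + e *. ?u)) =
     B (y + e *. ?u, F (y + e *. ?u)) (G.Q (y + e *. ?u))"
    by (rule eventually_on_line[OF elim(1)])
   ultimately have 1: "D (%p. D F p ?v) y ?u + D F y ?u = D (%p. B p ?v) ?q (?u, D F y ?u) + B ?q ?u"
    by (rule curve_deriv_unique[rotated])
   have "((%e. defect w (y + e *. ?v)) hvd D (defect w) y ?v) (at 0)"
    using curve_deriv[OF _ line_derivative[of y ?v 0], of "defect w"] sd by simp
   moreover have "((%e. D F (y + e *. ?v) ?u - B (y + e *. ?v, F (y + e *. ?v)) ?u) has_vector_derivative
     D (%p. D F p ?u) y ?v - D (%p. B p ?u) ?q (?v, D F y ?v)) (at 0)"
    using curve_deriv[OF _ line_derivative[of y ?v 0], of "%p. D F p ?u"]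
     curve_deriv[OF _ cg[of ?v], of "%p. B p ?u"] elim(2,3)
    by (intro has_vector_derivative_diff) (simp_all add: sm_at_D)
   ultimately have 2: "D (defect w) y ?v = D (%p. D F p ?u) y ?v - D (%p. B p ?u) ?q (?v, D F y ?v)"
    unfolding defect_def by (rule vector_derivative_unique_at)
   have 3: "D (%p. D F p ?u) y ?v = D (%p. D F p ?v) y ?u"
    by (rule second_derivative_symmetric_near[OF elim(2)])
   have 4: "D (%p. B p ?u) ?q (?v, D F y ?v) = D (%p. B p ?v) ?q (?u, B ?q ?u)"
    using elim(5,6) near_self[OF elim(1)] by simp
   have "linear (D (%p. B p ?v) ?q)" by (rule sm_at_linear) (use elim(3) in simp)
   from linear_diff[OF this, of "(?u, D F y ?u)" "(?u, B ?q ?u)"]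
   have 5: "D (%p. B p ?v) ?q (0, defect w y) = D (%p. B p ?v) ?q (?u, D F y ?u) - D (%p. B p ?v) ?q (?u, B ?q ?u)"
    by (simp add: defect_def)
   show "D (defect w) y ?v = D (%p. B p ?v) ?q (0, defect w y) - defect w y"
    unfolding 2 3 4 5 using 1 by (simp add: defect_def algebra_simps)
  qed
 qed
qed

text \<open>Since \<open>G.Q (ray g t) = t *. G.Q g\<close>, the equation for the defect along a ray
  is singular at t = 0. Multiplying the defect by t absorbs the term \<open>- defect w y\<close> and
  leaves a regular linear equation with initial value 0, whose solution at t = 1 is the defect at
  g.\<close>

lemma defect_zero: "near g ~ 0. ALL w. defect w g = 0"
 using G.near_ray[OF defect_derivative] G.near_ray[OF near_graph[OF near_smooth_B]]
  G.near_ray[OF near_graph_nhds[OF linear_B]] G.near_ray[OF sm_at_near[OF smooth_F]]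
proof eventually_elim
 case (elim g)
 show ?case
 proof
  fix w
  let ?A = "%t v. D (%p. B p (G.Q g)) (ray g t, F (ray g t)) (0, v)"
  have linA: "linear (?A t)" if "t : {0..1}" for t
  proof -
   have "linear (D (%p. B p (G.Q g)) (ray g t, F (ray g t)))"
    by (rule sm_at_linear) (use elim(2) that in blast)
   from linear_compose[OF _ this, of "%v. (0, v)"] show ?thesis by (simp add: o_def linear_iff)
  qed
  have "1 *. defect w (ray g 1) = 0"
  proof (rule linear_ode_zero[of 0 1 "%t. t *. defect w (ray g t)" ?A 0 1])
   fix t :: real assume t: "t : {0..1}"
   let ?y = "ray g t" and ?q = "(ray g t, F (ray g t))"
   have sd: "sm_at (defect w) ?y"
    and de: "D (defect w) ?y (G.Q ?y) = D (%p. B p (G.Q ?y)) ?q (0, defect w ?y) - defect w ?y"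
    using elim(1) t by blast+
   have "((%t. defect w (ray g t)) hvd D (defect w) ?y (G.Q g)) (at t within {0..1})"
    by (rule curve_deriv_within[OF sd G.ray_derivative])
   hence dd: "((%t. t *. defect w (ray g t)) has_vector_derivative
     t *. D (defect w) ?y (G.Q g) + 1 *. defect w ?y) (at t within {0..1})"
    by (intro has_vector_derivative_scaleR) (auto intro!: derivative_eq_intros)
   have "D (%p. B p (t *. G.Q g)) ?q u = t *. D (%p. B p (G.Q g)) ?q u" for u
   proof (rule D_eqI)
    have "((%p. t *. B p (G.Q g)) hder (%u. t *. D (%p. B p (G.Q g)) ?q u)) (at ?q)"
     by (intro has_derivative_scaleR_right sm_at_has_derivative) (use elim(2) t in blast)
    moreover have "near p ~ ?q. t *. B p (G.Q g) = B p (t *. G.Q g)"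
     using bspec[OF elim(3) t] by eventually_elim (simp add: linear_scale)
    ultimately show "((%p. B p (t *. G.Q g)) hder (%u. t *. D (%p. B p (G.Q g)) ?q u)) (at ?q)"
     by (rule hder_transform)
   qed
   hence "t *. D (defect w) ?y (G.Q g) + 1 *. defect w ?y = ?A t (t *. defect w ?y)"
    using de linear_scale[OF sm_at_linear[OF sd], of t "G.Q g"] linear_scale[OF linA[OF t], of t "defect w ?y"]
    by simp
   with dd show "((%t. t *. defect w (ray g t)) hvd ?A t (t *. defect w ?y)) (at t within {0..1})"
    by simp
   show "linear (?A t)" by (rule linA[OF t])
  next
   fix v
   have "isCont (%t. ?A t v) t" if t: "t : {0..1}" for t
   proof -
    have r: "sm_at (ray g) t"
     by (intro sm_at_add sm_at_const sm_at_scaleR sm_at_id)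
    have "sm_at (%t. (ray g t, F (ray g t))) t"
     by (intro sm_at_Pair r sm_at_compose[OF r]) (use elim(4) t in blast)
    hence "sm_at (%t. ?A t v) t"
     by (rule sm_at_compose) (rule sm_at_D, use elim(2) t in blast)
    thus ?thesis by (rule sm_at_isCont)
   qed
   thus "continuous_on {0..1} (%t. ?A t v)" by (simp add: continuous_at_imp_continuous_on)
  qed auto
  thus "defect w g = 0" by simp
 qed
qed

lemma F_related: "near g ~ 0. ALL v. D F g (G.X v g) = H.X (f (tg1 g) v) (F g)"
 using defect_zero near_graph[OF B_X] G.P_X
proof eventually_elim
 case (elim g)
 show ?case
 proof
  fix v
  have "defect (G.X v g) g = 0" using elim(1) by blast
  thus "D F g (G.X v g) = H.X (f (tg1 g) v) (F g)"
   using elim(2,3) by (simp add: defect_def G.Q_ker)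
 qed
qed

end

section \<open>Multiplicativity of the radial solution\<close>

context radial_solution begin

lemma near_FF: "near q ~ (0, 0). R q ==> near q ~ (0, 0). R (F (fst q), F (snd q))"
proof (rule sm_at_eventually[where f="%q. (F (fst q), F (snd q))" and Q=R])
 show "sm_at (%q. (F (fst q), F (snd q))) (0, 0)"
  by (intro sm_at_Pair sm_at_compose[of fst _ F] sm_at_compose[of snd _ F] sm_at_fst
    sm_at_snd sm_at_id) (simp_all add: smooth_F)
qed simp

lemma F_mul: "near q ~ (0, 0). P1 (fst q) = tg1 (snd q) --> F (m1 q) = m2 (F (fst q), F (snd q))"
proof -
 obtain r where r: "r > 0" "!!(c :: real => 'b) k l a b M s. (ALL t:{a..b}. norm (c t) <= M & norm (k t) < r & norm (l t) < r &
   (k hvd H.X (c t) (k t)) (at t within {a..b}) &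
   (l hvd H.X (c t) (l t)) (at t within {a..b})) & s : {a..b} & k s = l s ==>
   ALL t:{a..b}. k t = l t"
  using H.X_ode_unique by blast
 obtain M where M: "M >= 0" "near g ~ 0. ALL t:{0..1}. norm (cc g t) <= M * norm (G.Q g)"
  using cc_bounded by blast
 have Fm1: "near q ~ (0, 0). norm (F (m1 q)) < r"
  by (rule G.near_mul[OF near_F[OF near_norm_less[OF r(1)]]])
 have Fm2: "near q ~ (0, 0). norm (m2 (F (fst q), F (snd q))) < r"
  by (rule near_FF[OF H.near_mul[OF near_norm_less[OF r(1)]]])
 show ?thesis
  using near_fst[OF M(2)] G.near_ray_pair[OF Fm1] G.near_ray_pair[OF Fm2] G.near_ray_pair[OF G.D_mul_X]
   G.near_ray_pair[OF G.tau_mul] G.near_ray_pair[OF G.near_mul[OF F_related]]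
   G.near_ray_pair[OF G.near_mul[OF sm_at_near[OF smooth_F]]]
   G.near_ray_pair[OF sm_at_near[OF G.smooth_mul]]
   G.near_ray_pair[OF near_fst[OF F_related]] G.near_ray_pair[OF near_FF[OF H.D_mul_X]]
   G.near_ray_pair[OF near_FF[OF sm_at_near[OF H.smooth_mul]]]
   G.near_ray_pair[OF near_fst[OF G.X_theta]] near_snd[OF tau_F] G.near_ray_pair[OF near_fst[OF P_F]]
   G.near_ray_pair[OF near_fst[OF sm_at_near[OF smooth_F]]]
   near_snd[OF G.unit_mul] near_snd[OF near_F[OF H.unit_mul]] near_fst[OF F_P]
 proof eventually_elim
  case (elim q)
  obtain g h where q: "q = (g, h)" by (cases q)
  note e = elim[unfolded q fst_conv snd_conv]
  show ?case unfolding q fst_conv snd_conv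
  proof
   assume c: "P1 g = tg1 h"
   have Ph: "fi g = fi (tg1 h)" using c phi_P[of g] by simp
   \<comment> \<open>Both curves are driven by \<open>cc g\<close>: the first by
     \<open>F_related\<close> at the product and \<open>D_mul_X\<close> in the first groupoid, the
     second by \<open>F_related\<close> on the ray and \<open>D_mul_X\<close> in the second
     groupoid.\<close>
   have "ALL t:{0..1}. F (m1 (ray g t, h)) = m2 (F (ray g t), F h)"
   proof (rule r(2)[of 0 1 "cc g" "M * norm (G.Q g)" "%t. F (m1 (ray g t, h))" "%t. m2 (F (ray g t), F h)" 0], intro conjI ballI)
    fix t :: real assume t: "t : {0..1}"
    let ?y = "ray g t"
    let ?a = "G.th ?y (G.Q g)"
    have Qg: "G.X ?a ?y = G.Q g" using e(12) t by simp
    have comp: "P1 ?y = tg1 h" using G.P_ray[of g t] unfolding c[symmetric] .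
    show "norm (cc g t) <= M * norm (G.Q g)" "norm (F (m1 (?y, h))) < r" "norm (m2 (F ?y, F h)) < r"
     using e(1,2,3) t by auto
    have cr: "((%t. (ray g t, h)) hvd (G.Q g, 0)) (at t within {0..1})"
     by (intro has_vector_derivative_Pair G.ray_derivative) simp
    have "((%t. F (m1 (ray g t, h))) hvd D F (m1 (?y, h)) (D m1 (?y, h) (G.Q g, 0))) (at t within {0..1})"
     by (rule curve_deriv_within[of F "%t. m1 (ray g t, h)", OF _ curve_deriv_within[of m1 "%t. (ray g t, h)", OF _ cr]])
      (use e(7,8) t in auto)
    moreover have "D F (m1 (?y, h)) (D m1 (?y, h) (G.Q g, 0)) = H.X (cc g t) (F (m1 (?y, h)))"
    proof -
     have "D m1 (?y, h) (G.X ?a ?y, 0) = G.X ?a (m1 (?y, h))" using bspec[OF e(4) t] comp by blast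
     moreover have "D F (m1 (?y, h)) (G.X ?a (m1 (?y, h))) = H.X (f (tg1 (m1 (?y, h))) ?a) (F (m1 (?y, h)))"
      using bspec[OF e(6) t] by blast
     moreover have "tg1 (m1 (?y, h)) = tg1 ?y" using bspec[OF e(5) t] comp by blast
     ultimately show ?thesis unfolding Qg by (simp add: cc_def)
    qed
    ultimately show "((%t. F (m1 (ray g t, h))) hvd H.X (cc g t) (F (m1 (?y, h)))) (at t within {0..1})"
     by (simp only:)
    have "((%t. F (ray g t)) hvd D F ?y (G.Q g)) (at t within {0..1})"
     by (rule curve_deriv_within[of F "ray g", OF _ G.ray_derivative]) (use e(15) t in auto)
    hence "((%t. (F (ray g t), F h)) hvd (D F ?y (G.Q g), 0)) (at t within {0..1})"
     by (intro has_vector_derivative_Pair has_vector_derivative_const)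
    hence "((%t. m2 (F (ray g t), F h)) hvd D m2 (F ?y, F h) (D F ?y (G.Q g), 0)) (at t within {0..1})"
     by (rule curve_deriv_within[of m2 "%t. (F (ray g t), F h)", rotated]) (use e(11) t in auto)
    moreover have "D m2 (F ?y, F h) (D F ?y (G.Q g), 0) = H.X (cc g t) (m2 (F ?y, F h))"
    proof -
     have "D F ?y (G.X ?a ?y) = H.X (cc g t) (F ?y)" using bspec[OF e(9) t] by (simp add: cc_def)
     moreover have "P2 (F ?y) = tg2 (F h)"
      using bspec[OF e(14) t] e(13) Ph phi_P[of ?y] by simp
     ultimately show ?thesis using bspec[OF e(10) t] unfolding Qg by simp
    qed
    ultimately show "((%t. m2 (F (ray g t), F h)) hvd H.X (cc g t) (m2 (F ?y, F h))) (at t within {0..1})"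
     by (simp only:)
   next
    have "F (P1 g) = tg2 (F h)" using e(13,18) Ph by simp
    thus "F (m1 (ray g 0, h)) = m2 (F (ray g 0), F h)" using e(16,17) c by simp
   qed simp
   from bspec[OF this, of 1] show "F (m1 (g, h)) = m2 (F g, F h)" by simp
  qed
 qed
qed

end

section \<open>Existence and uniqueness of germs of integrations\<close>

context local_morphism begin

text \<open>The total equation tested on right-invariant fields, which span the tangent space of the
  source fibre at each point near 0.\<close>

definition related :: "('a => 'b) => bool" where
 "related F \<longleftrightarrow> (near g ~ 0. ALL v. D F g (G.X v g) = H.X (f (tg1 g) v) (F g))"

theorem local_existence:
 obtains F where "sm_at F 0" "F 0 = 0" "near g ~ 0. F (P1 g) = fi g"
  "near g ~ 0. P2 (F g) = fi g" "near g ~ 0. tg2 (F g) = fi (tg1 g)" "related F"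
  "near q ~ (0, 0). P1 (fst q) = tg1 (snd q) --> F (m1 q) = m2 (F (fst q), F (snd q))"
proof -
 obtain F where F: "sm_at F 0" "F 0 = 0" "near g ~ 0. F (P1 g) = fi g"
  "near g ~ 0. ALL t:{0..1}. ((%s. F (P1 g + s *. G.Q g)) has_vector_derivative
   B (P1 g + t *. G.Q g, F (P1 g + t *. G.Q g)) (G.Q g)) (at t within {0..1})"
  by (rule radial_solution)
 interpret R: radial_solution P1 tg1 io1 m1 P2 tg2 io2 m2 fi f F
  by unfold_locales (rule F)+
 show ?thesis
  by (rule that[OF F(1-3) R.P_F R.tau_F _ R.F_mul]) (simp add: related_def R.F_related)
qed

text \<open>Along a ray both germs are driven by the same coefficient curve, which involves only the
  first groupoid and \<open>f\<close>; they start from the same value at the unit.\<close>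

theorem local_uniqueness:
 assumes F: "sm_at F 0" "F 0 = 0" "related F" and F': "sm_at F' 0" "F' 0 = 0" "related F'"
  and units: "near x ~ 0. P1 x = x --> F x = F' x"
 shows "near g ~ 0. F g = F' g"
proof -
 obtain r where r: "r > 0" "!!(c :: real => 'b) k l a b M s. (ALL t:{a..b}. norm (c t) <= M & norm (k t) < r & norm (l t) < r &
   (k hvd H.X (c t) (k t)) (at t within {a..b}) &
   (l hvd H.X (c t) (l t)) (at t within {a..b})) & s : {a..b} & k s = l s ==>
   ALL t:{a..b}. k t = l t"
  using H.X_ode_unique by blast
 have lin: "near g ~ 0. linear (%w. f (tg1 g) (G.th g w))"
  using G.linear_theta
 proof eventually_elim
  case (elim g)
  from linear_compose[OF elim linear_f, of "tg1 g"] show ?case by (simp add: o_def)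
 qed
 have "isCont (%g. f (tg1 g) (G.th g w)) 0" for w
 proof -
  have "sm_at (%g. G.th g w) 0"
   using sm_at_compose[of "%g. (g, w)" 0 "%q. G.th (fst q) (snd q)"] G.smooth_theta
   by (simp add: sm_at_Pair sm_at_id sm_at_const)
  from sm_at_compose[OF sm_at_Pair[OF G.smooth_tau this], of "%p. f (fst p) (snd p)"] smooth_f2
  have "sm_at (%g. f (tg1 g) (G.th g w)) 0" by simp
  thus ?thesis by (rule sm_at_isCont)
 qed
 from linear_family_bounded[OF lin this] obtain M where M: "M >= 0"
  "near g ~ 0. ALL w. norm (f (tg1 g) (G.th g w)) <= M * norm w" by blast
 have n: "near g ~ 0. norm (K g) < r & sm_at K g & (ALL v. D K g (G.X v g) = H.X (f (tg1 g) v) (K g))"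
  if "sm_at K 0" "K 0 = 0" "related K" for K
  using sm_at_near[OF that(1)] that(3)[unfolded related_def]
   sm_at_eventually[OF that(1), unfolded that(2), OF near_norm_less[OF r(1)]]
  by eventually_elim blast
 show ?thesis
  using G.near_ray[OF M(2)] G.near_ray[OF n[OF F]] G.near_ray[OF n[OF F']] G.near_ray[OF units]
   G.near_ray[OF G.X_theta]
 proof eventually_elim
  case (elim g)
  let ?y = "%t. P1 g + t *. G.Q g"
  let ?c = "%t. f (tg1 (?y t)) (G.th (?y t) (G.Q g))"
  have K: "((%t. K (?y t)) hvd H.X (?c t) (K (?y t))) (at t within {0..1})"
   if t: "t : {0..1}" and k: "sm_at K (?y t)" "ALL v. D K (?y t) (G.X v (?y t)) = H.X (f (tg1 (?y t)) v) (K (?y t))"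
   for K t
  proof -
   have "((%t. K (?y t)) hvd D K (?y t) (G.Q g)) (at t within {0..1})"
    by (rule curve_deriv_within[of K ?y, OF k(1) G.ray_derivative])
   moreover have "G.X (G.th (?y t) (G.Q g)) (?y t) = G.Q g" using elim(5) t by simp
   ultimately show ?thesis using k(2) by metis
  qed
  have "ALL t:{0..1}. F (?y t) = F' (?y t)"
  proof (rule r(2)[of 0 1 ?c "M * norm (G.Q g)" "%t. F (?y t)" "%t. F' (?y t)" 0], intro conjI ballI K)
   show "F (?y 0) = F' (?y 0)" using bspec[OF elim(4), of 0] by simp
  qed (use elim(1,2,3) in auto)
  from bspec[OF this, of 1] show ?case by (simp add: G.P_Q_add)
 qed
qed

text \<open>Differentiate
 \<open>F (gh) = F g F h\<close> in \<open>g\<close> at the unit \<open>tg1 h\<close>.\<close>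

theorem multiplicative_related:
 assumes F: "sm_at F 0" "F 0 = 0"
  and units: "near x ~ 0. P1 x = x --> F x = fi x & (ALL v. D F x (G.Q v) = f x v)"
  and comp: "near q ~ (0, 0). P1 (fst q) = tg1 (snd q) --> P2 (F (fst q)) = tg2 (F (snd q))"
  and mul: "near q ~ (0, 0). P1 (fst q) = tg1 (snd q) --> F (m1 q) = m2 (F (fst q), F (snd q))"
 shows "related F"
proof -
 have nF: "near g ~ 0. R (F g)" if "near y ~ 0. R y" for R
  using sm_at_eventually[OF F(1), unfolded F(2), OF that] .
 show ?thesis unfolding related_def
  using G.near_tau_pair[OF comp] G.near_tau_pair[OF mul] G.near_tau[OF units] G.P_tau
   sm_at_near[OF F(1)] G.near_tau[OF sm_at_near[OF F(1)]]
   G.near_smooth_X G.unit_mul nF[OF H.near_smooth_X] G.near_tau[OF P_f] G.near_tau[OF P_phi]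
 proof eventually_elim
  case (elim h)
  have Ft: "F (tg1 h) = tg2 (F h)"
   using near_self[OF elim(1)] elim(3,4,11) by simp
  show ?case
  proof
   fix v
   let ?c = "%e. tg1 h + e *. G.Q v"
   have "((%e. F (m1 (?c e, h))) hvd D F h (G.X v h)) (at 0)"
    using curve_deriv[OF _ G.mul_line_derivative[OF elim(7), of "G.Q v"], of F] elim(5,8)
    by (simp add: G.X_def)
   moreover have "((%e. m2 (F (?c e), F h)) hvd H.X (f (tg1 h) v) (F h)) (at 0)"
   proof -
    have "((%e. F (?c e)) hvd D F (tg1 h) (G.Q v)) (at 0)"
     using curve_deriv[OF _ line_derivative[of "tg1 h" "G.Q v" 0], of F] elim(6) by simp
    hence "((%e. (F (?c e), F h)) hvd (f (tg1 h) v, 0)) (at 0)"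
     using elim(3,4) by (intro has_vector_derivative_Pair has_vector_derivative_const) simp_all
    from curve_deriv[of m2 "%e. (F (?c e), F h)", OF _ this] elim(9,10) Ft
    show ?thesis by (simp add: H.X_def H.Q_ker)
   qed
   moreover have "near e ~ 0. F (m1 (?c e, h)) = m2 (F (?c e), F h)"
    using line_fst[OF elim(2), of "G.Q v"] by eventually_elim (use elim(4) in simp)
   ultimately show "D F h (G.X v h) = H.X (f (tg1 h) v) (F h)" by (rule curve_deriv_unique[rotated])
  qed
 qed
qed

end

section \<open>Charts\<close>

definition chart0 :: "'m set => ('m => 'e::real_normed_vector) => bool" where
 "chart0 U fi \<longleftrightarrow> inj_on fi U & open (fi ` U)"

text \<open>The germ at x of a transition map, including that \<open>V\<close> is a neighbourhood of
  x in the chart \<open>U\<close>. With a constant for \<open>ps\<close> only the latter remains, so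
  \<open>link_trans\<close> also transports openness between charts.\<close>

definition link :: "'m set => ('m => 'e::real_normed_vector) => 'm set => ('m => 'd::real_normed_vector) => 'm => bool" where
 "link U fi V ps x \<longleftrightarrow> sm_at (%z. ps (inv_into U fi z)) (fi x) & (near z ~ (fi x). inv_into U fi z : V)"

text \<open>The charts of the maximal atlas: those compatible with every chart of
  \<open>A\<close>.\<close>

definition achart :: "('m, 'e::real_normed_vector) chart set => 'm set => ('m => 'e) => bool" where
 "achart A U fi \<longleftrightarrow> chart0 U fi & U \<subseteq> mfd_space A &
  (ALL (V, ps):A. ALL x:U \<inter> V. link U fi V ps x & link V ps U fi x)"

definition gatlas :: "('m, 'e::real_normed_vector) chart set => bool" where
 "gatlas A \<longleftrightarrow> (ALL (U, fi):A. achart A U fi)"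

text \<open>\<open>h\<close> is a smooth extension of the coordinate expression of f near x. It is
  compared with f only on \<open>S\<close>, which need not be a neighbourhood of x.\<close>

definition reps where
 "reps U fi V ps S f x h \<longleftrightarrow> sm_at h (fi x) &
  (near z ~ (fi x). inv_into U fi z : S --> f (inv_into U fi z) : V & ps (f (inv_into U fi z)) = h z)"

lemma chart0_inv: "chart0 U fi ==> x : U ==> inv_into U fi (fi x) = x"
 by (simp add: chart0_def)

lemma chart0_near: "chart0 U fi ==> x : U ==>
 near z ~ (fi x). inv_into U fi z : U & fi (inv_into U fi z) = z"
 using near_open_set[of "fi ` U" "fi x"]
 by (auto simp: chart0_def inv_into_into f_inv_into_f elim!: eventually_mono)

lemma achart0: "achart A U fi ==> chart0 U fi" by (simp add: achart_def)

lemma achart_link: "achart A U fi ==> (V, ps) : A ==> x : U ==> x : V ==> link U fi V ps x & link V ps U fi x"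
 unfolding achart_def by fastforce

lemma good_achart: "gatlas A ==> (U, fi) : A ==> achart A U fi"
 unfolding gatlas_def by fastforce

lemma mfd_spaceE: "x : mfd_space A ==> (!!U fi. (U, fi) : A ==> x : U ==> thesis) ==> thesis"
 unfolding mfd_space_def by auto

lemma achart_space: "achart A U fi ==> x : U ==> x : mfd_space A"
 unfolding achart_def by auto

lemma link_trans:
 fixes ps :: "'m => 'd::model_space"
 assumes "link U fi C ps x" "link C ps V \<chi>' x" "x : U" "x : C" "chart0 U fi" "chart0 C ps"
 shows "link U fi V \<chi>' x"
proof -
 have c: "sm_at (%z. ps (inv_into U fi z)) (fi x)" and m: "near z ~ (fi x). inv_into U fi z : C"
  using assms(1) by (auto simp: link_def)
 have ix: "inv_into U fi (fi x) = x" by (rule chart0_inv[OF assms(5,3)])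
 have e: "near z ~ (fi x). inv_into C ps (ps (inv_into U fi z)) = inv_into U fi z"
  using m by eventually_elim (rule chart0_inv[OF assms(6)])
 have "sm_at (%z. \<chi>' (inv_into C ps (ps (inv_into U fi z)))) (fi x)"
  by (rule sm_at_compose[OF c]) (use assms(2) ix in \<open>simp add: link_def\<close>)
 hence "sm_at (%z. \<chi>' (inv_into U fi z)) (fi x)"
  by (rule sm_at_transform) (use e in \<open>eventually_elim, simp\<close>)
 moreover have "near z ~ (fi x). inv_into C ps (ps (inv_into U fi z)) : V"
  by (rule sm_at_eventually[OF c]) (use assms(2) ix in \<open>simp add: link_def\<close>)
 hence "near z ~ (fi x). inv_into U fi z : V"
  using e by eventually_elim simp
 ultimately show ?thesis by (simp add: link_def)
qed

lemma achart_link2: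
 fixes A :: "('m, 'e::model_space) chart set"
 assumes "gatlas A" "achart A U fi" "achart A V ps" "x : U" "x : V"
 shows "link U fi V ps x"
proof -
 obtain C \<chi>' where C: "(C, \<chi>') : A" "x : C" by (rule mfd_spaceE[OF achart_space[OF assms(2,4)]])
 show ?thesis
  by (rule link_trans[of U fi C \<chi>'])
   (use C assms achart_link[OF assms(2) C(1)] achart_link[OF assms(3) C(1)] achart0
    good_achart[OF assms(1) C(1)] in auto)
qed

lemma reps_change:
 fixes A :: "('m, 'e::model_space) chart set" and B :: "('n, 'd::model_space) chart set"
 assumes A: "gatlas A" "achart A U fi" "achart A U' fi'" and B: "gatlas B" "achart B V ps" "achart B V' ps'"
  and r: "reps U fi V ps S f x h" and x: "x : U" "x : U'" "x : S" and fx: "f x : V'"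
 shows "EX h'. reps U' fi' V' ps' S f x h'"
proof -
 have ix: "inv_into U fi (fi x) = x" "inv_into U' fi' (fi' x) = x"
  using chart0_inv[OF achart0[OF A(2)] x(1)] chart0_inv[OF achart0[OF A(3)] x(2)] by auto
 have r1: "sm_at h (fi x)" and r2: "near z ~ (fi x). inv_into U fi z : S -->
   f (inv_into U fi z) : V & ps (f (inv_into U fi z)) = h z"
  using r by (auto simp: reps_def)
 have fV: "f x : V" "ps (f x) = h (fi x)" using near_self[OF r2] x ix by auto
 have l1: "sm_at (%z. fi (inv_into U' fi' z)) (fi' x)" "near z ~ (fi' x). inv_into U' fi' z : U"
  using achart_link2[OF A(1,3,2) x(2,1)] by (auto simp: link_def)
 have l2: "sm_at (%z. ps' (inv_into V ps z)) (ps (f x))" "near z ~ (ps (f x)). inv_into V ps z : V'"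
  using achart_link2[OF B fV(1) fx] by (auto simp: link_def)
 let ?h = "%z. ps' (inv_into V ps (h (fi (inv_into U' fi' z))))"
 have s1: "sm_at (%z. h (fi (inv_into U' fi' z))) (fi' x)"
  by (rule sm_at_compose[OF l1(1)]) (simp add: ix r1)
 have "sm_at ?h (fi' x)"
  by (rule sm_at_compose[OF s1]) (use l2(1) fV in \<open>simp add: ix\<close>)
 moreover have "near z ~ (fi' x). inv_into V ps (h (fi (inv_into U' fi' z))) : V'"
  by (rule sm_at_eventually[OF s1, where Q="%w. inv_into V ps w : V'"]) (use l2(2) fV in \<open>simp add: ix\<close>)
 moreover have "near z ~ (fi' x). inv_into U fi (fi (inv_into U' fi' z)) : S -->
   f (inv_into U fi (fi (inv_into U' fi' z))) : V &
   ps (f (inv_into U fi (fi (inv_into U' fi' z)))) = h (fi (inv_into U' fi' z))"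
  by (rule sm_at_eventually[OF l1(1), where Q="%w. inv_into U fi w : S -->
   f (inv_into U fi w) : V & ps (f (inv_into U fi w)) = h w"]) (use r2 in \<open>simp add: ix\<close>)
 ultimately show ?thesis
  unfolding reps_def
 proof (intro exI[of _ ?h] conjI)
  show "near z ~ (fi' x). inv_into U' fi' z : S --> f (inv_into U' fi' z) : V' & ps' (f (inv_into U' fi' z)) = ?h z"
   if "near z ~ (fi' x). inv_into V ps (h (fi (inv_into U' fi' z))) : V'"
    "near z ~ (fi' x). inv_into U fi (fi (inv_into U' fi' z)) : S -->
     f (inv_into U fi (fi (inv_into U' fi' z))) : V &
     ps (f (inv_into U fi (fi (inv_into U' fi' z)))) = h (fi (inv_into U' fi' z))"
   using that l1(2)
  proof eventually_elim
   case (elim z)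
   have "inv_into U fi (fi (inv_into U' fi' z)) = inv_into U' fi' z"
    by (rule chart0_inv[OF achart0[OF A(2)] elim(3)])
   moreover have "inv_into V ps (ps y) = y" if "y : V" for y
    by (rule chart0_inv[OF achart0[OF B(2)] that])
   ultimately show ?case using elim by metis
  qed
 qed
qed

lemma smooth_map_rep:
 fixes A :: "('m, 'e::model_space) chart set" and B :: "('n, 'd::model_space) chart set"
 assumes A: "gatlas A" "achart A U fi" and B: "gatlas B" "achart B V ps"
  and f: "smooth_map A B S f" and x: "x : S" "x : U" "f x : V"
 obtains h where "reps U fi V ps S f x h"
proof -
 obtain U0 fi0 V0 ps0 W h where *: "(U0, fi0) : A" "(V0, ps0) : B" "x : U0" "f x : V0" "open W" "fi0 x : W"
  "W \<subseteq> fi0 ` U0" "smooth_on W h" "!!y. y : S ==> y : U0 ==> fi0 y : W ==> f y : V0 & ps0 (f y) = h (fi0 y)"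
  using f x unfolding smooth_map_def by fastforce
 have a: "achart A U0 fi0" "achart B V0 ps0" using * good_achart A B by blast+
 have "reps U0 fi0 V0 ps0 S f x h"
  unfolding reps_def
 proof
  show "sm_at h (fi0 x)" by (rule sm_at_on) fact+
  show "near z ~ (fi0 x). inv_into U0 fi0 z : S --> f (inv_into U0 fi0 z) : V0 & ps0 (f (inv_into U0 fi0 z)) = h z"
   using near_open_set[OF *(5,6)] chart0_near[OF achart0[OF a(1)] *(3)]
  proof eventually_elim
   case (elim z)
   thus ?case using *(9)[of "inv_into U0 fi0 z"] by auto
  qed
 qed
 from reps_change[OF A(1) a(1) A(2) B(1) a(2) B(2) this *(3) x(2,1,3)] show ?thesis using that by blast
qed

text \<open>Representatives in charts of the maximal atlas suffice, since \<open>reps_change\<close>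
  transfers them to the charts of the atlas.\<close>

lemma smooth_mapI:
 fixes A :: "('m, 'e::model_space) chart set" and B :: "('n, 'd::model_space) chart set"
 assumes A: "gatlas A" and B: "gatlas B" and S: "S \<subseteq> mfd_space A"
  and f: "!!x. x : S ==> EX U fi V ps h. achart A U fi & achart B V ps & x : U & f x : V & reps U fi V ps S f x h"
 shows "smooth_map A B S f"
 unfolding smooth_map_def
proof (intro conjI ballI)
 show "f ` S \<subseteq> mfd_space B"
 proof clarify
  fix x assume "x : S"
  then obtain V ps where "achart B V ps" "f x : V" using f[of x] by blast
  thus "f x : mfd_space B" by (rule achart_space)
 qed
 fix x assume x: "x : S"
 obtain U fi V ps h where *: "achart A U fi" "achart B V ps" "x : U" "f x : V" "reps U fi V ps S f x h"
  using f[OF x] by blast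
 obtain U0 fi0 where 1: "(U0, fi0) : A" "x : U0" using achart_space[OF *(1,3)] by (rule mfd_spaceE)
 obtain V0 ps0 where 2: "(V0, ps0) : B" "f x : V0" using achart_space[OF *(2,4)] by (rule mfd_spaceE)
 have a: "achart A U0 fi0" "achart B V0 ps0" using 1 2 good_achart A B by blast+
 obtain h0 where h0: "reps U0 fi0 V0 ps0 S f x h0"
  using reps_change[OF A *(1) a(1) B *(2) a(2) *(5,3) 1(2) x 2(2)] by blast
 obtain S1 where S1: "open S1" "fi0 x : S1" "smooth_on S1 h0"
  using h0 unfolding reps_def sm_at_def by blast
 obtain S2 where S2: "open S2" "fi0 x : S2" "!!z. z : S2 ==> inv_into U0 fi0 z : S -->
   f (inv_into U0 fi0 z) : V0 & ps0 (f (inv_into U0 fi0 z)) = h0 z"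
  using h0 unfolding reps_def eventually_nhds by blast
 define W where "W = S1 \<inter> S2 \<inter> fi0 ` U0"
 have W: "open W" "fi0 x : W" "W \<subseteq> fi0 ` U0"
  using S1 S2 achart0[OF a(1)] 1 by (auto simp: W_def chart0_def)
 have "smooth_on W h0" by (rule smooth_on_subset[OF S1(3,1) W(1)]) (auto simp: W_def)
 moreover have "ALL y:S \<inter> U0. fi0 y : W --> f y : V0 & ps0 (f y) = h0 (fi0 y)"
  using S2(3) chart0_inv[OF achart0[OF a(1)]] by (auto simp: W_def) metis+
 ultimately have "EX W h. x : U0 & f x : V0 & open W & fi0 x : W & W \<subseteq> fi0 ` U0 & smooth_on W h &
    (ALL y:S \<inter> U0. fi0 y : W --> f y : V0 & ps0 (f y) = h (fi0 y))"
  using W 1 2 by blast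
 thus "EX (U, fi):A. EX (V, ps):B. EX W h. x : U & f x : V & open W & fi x : W & W \<subseteq> fi ` U & smooth_on W h &
    (ALL y:S \<inter> U. fi y : W --> f y : V & ps (f y) = h (fi y))"
  using 1(1) 2(1) by blast
qed (rule S)

lemma satlas_good:
 fixes A :: "('m, 'e::model_space) chart set"
 assumes "smooth_atlas A" shows "gatlas A"
proof -
 have c: "chart0 U fi" if "(U, fi) : A" for U fi using assms that unfolding smooth_atlas_def chart0_def by fastforce
 have t: "open (fi ` (U \<inter> V))" "smooth_on (fi ` (U \<inter> V)) (ps \<circ> inv_into U fi)" if "(U, fi) : A" "(V, ps) : A" for U fi V ps
  using assms that unfolding smooth_atlas_def by fastforce+
 have l: "link U fi V ps x" if a: "(U, fi) : A" "(V, ps) : A" "x : U \<inter> V" for U fi V ps x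
  unfolding link_def
 proof
  show "sm_at (%z. ps (inv_into U fi z)) (fi x)"
   using sm_at_on[OF t(2,1)[OF a(1,2)], of "fi x"] a(3) by (auto simp: o_def)
  show "near z ~ (fi x). inv_into U fi z : V"
   using near_open_set[OF t(1)[OF a(1,2)], of "fi x"] a(3)
   by (auto elim!: eventually_mono simp: chart0_inv[OF c[OF a(1)]])
 qed
 show ?thesis unfolding gatlas_def achart_def
  using c l by (auto simp: mfd_space_def)
qed

lemma openin_near:
 fixes A :: "('m, 'e::model_space) chart set"
 assumes A: "smooth_atlas A" and W: "openin (mfd_top A) W" and U: "achart A U fi" and x: "x : U" "x : W"
 shows "near z ~ (fi x). inv_into U fi z : W"
proof -
 obtain C ps where C: "(C, ps) : A" "x : C" by (rule mfd_spaceE[OF achart_space[OF U x(1)]])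
 have cC: "chart0 C ps" using good_achart[OF satlas_good[OF A] C(1)] achart0 by blast
 have "open (ps ` (C \<inter> W))" using W C(1) unfolding openin_mfd_top[OF A] by fastforce
 hence "near z ~ (ps x). inv_into C ps z : W"
  using near_open_set[of "ps ` (C \<inter> W)" "ps x"] C x
  by (auto elim!: eventually_mono simp: chart0_inv[OF cC])
 \<comment> \<open>The constant coordinate map turns membership in the open set \<open>W\<close>
   into a link.\<close>
 hence l1: "link C ps W (%_. 0::real) x" by (simp add: link_def sm_at_const)
 have l2: "link U fi C ps x" using achart_link[OF U C(1) x(1) C(2)] by blast
 have "link U fi W (%_. 0::real) x"
  by (rule link_trans[OF l2 l1 x(1) C(2) achart0[OF U] cC])
 thus ?thesis by (simp add: link_def)
qed

lemma openin_nearI: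
 fixes A :: "('m, 'e::model_space) chart set"
 assumes A: "smooth_atlas A" and W: "W \<subseteq> mfd_space A"
  and n: "!!x. x : W ==> EX U fi. achart A U fi & x : U & (near z ~ (fi x). inv_into U fi z : W)"
 shows "openin (mfd_top A) W"
 unfolding openin_mfd_top[OF A]
proof (intro conjI W ballI, clarify)
 fix C ps assume C: "(C, ps) : A"
 have aC: "achart A C ps" by (rule good_achart[OF satlas_good[OF A] C])
 have ev: "near w ~ z. w : ps ` (C \<inter> W)" if "z : ps ` (C \<inter> W)" for z
 proof -
  obtain x where x: "z = ps x" "x : C" "x : W" using \<open>z : ps ` (C \<inter> W)\<close> by blast
  obtain U fi where U: "achart A U fi" "x : U" "near z ~ (fi x). inv_into U fi z : W" using n[OF x(3)] by blast
  have l1: "link C ps U fi x" using achart_link[OF U(1) C U(2) x(2)] by blast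
  have l2: "link U fi W (%_. 0::real) x" using U(3) by (simp add: link_def sm_at_const)
  have "link C ps W (%_. 0::real) x"
   by (rule link_trans[OF l1 l2 x(2) U(2) achart0[OF aC] achart0[OF U(1)]])
  hence "near w ~ (ps x). inv_into C ps w : W" by (simp add: link_def)
  thus ?thesis unfolding x(1) using chart0_near[OF achart0[OF aC] x(2)]
  proof eventually_elim
   case (elim w)
   hence "ps (inv_into C ps w) : ps ` (C \<inter> W)" by blast
   thus ?case using elim by simp
  qed
 qed
 show "open (ps ` (C \<inter> W))"
 proof (rule open_subopen[THEN iffD2], rule ballI)
  fix z assume "z : ps ` (C \<inter> W)"
  from ev[OF this] show "EX T. open T & z : T & T \<subseteq> ps ` (C \<inter> W)"
   unfolding eventually_nhds by blast
 qed
qed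

lemma achart_real: "gatlas real_atlas" "achart real_atlas UNIV (%t. t)"
proof -
 have "smooth_atlas real_atlas"
  by (auto simp: smooth_atlas_def real_atlas_def o_def inv_into_def smooth_on_id image_def)
 thus 1: "gatlas real_atlas" by (rule satlas_good)
 show "achart real_atlas UNIV (%t. t)" by (rule good_achart[OF 1]) (simp add: real_atlas_def)
qed

lemma inv_into_ident [simp]: "inv_into UNIV (%t. t) z = z"
 by (simp add: inv_into_def)

lemma chart0_prod: "chart0 U fi ==> chart0 V ps ==> chart0 (U \<times> V) (map_prod fi ps)"
 by (auto simp: chart0_def map_prod_inj_on map_prod_surj_on[OF refl refl] intro: open_Times)

lemma near_Pair:
 assumes "near z ~ x. R z" "near w ~ y. R' w"
 shows "near q ~ (x, y). R (fst q) & R' (snd q)"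
 unfolding nhds_prod eventually_prod_filter using assms by (intro exI[of _ R] exI[of _ R']) simp

lemma inv_prod_near:
 assumes "chart0 U fi" "chart0 V ps" "x : U" "y : V"
 shows "near q ~ (fi x, ps y). inv_into (U \<times> V) (map_prod fi ps) q = (inv_into U fi (fst q), inv_into V ps (snd q))"
 using near_Pair[OF chart0_near[OF assms(1,3)] chart0_near[OF assms(2,4)]]
proof eventually_elim
 case (elim q)
 show ?case
  by (rule inv_into_f_eq[OF chart0_prod[OF assms(1,2), unfolded chart0_def, THEN conjunct1]])
   (use elim in \<open>auto simp: prod_eq_iff\<close>)
qed

lemma link_prod:
 fixes fi :: "'m => 'e::model_space" and ps :: "'n => 'd::model_space"
 assumes "link U fi U' fi' x" "link V ps V' ps' y" "chart0 U fi" "chart0 V ps" "x : U" "y : V"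
 shows "link (U \<times> V) (map_prod fi ps) (U' \<times> V') (map_prod fi' ps') (x, y)"
proof -
 have e: "near q ~ (fi x, ps y). inv_into (U \<times> V) (map_prod fi ps) q = (inv_into U fi (fst q), inv_into V ps (snd q))"
  by (rule inv_prod_near[OF assms(3-6)])
 have "sm_at (%q. (fi' (inv_into U fi (fst q)), ps' (inv_into V ps (snd q)))) (fi x, ps y)"
  by (intro sm_at_Pair sm_at_compose[of fst _ "%z. fi' (inv_into U fi z)"]
    sm_at_compose[of snd _ "%z. ps' (inv_into V ps z)"] sm_at_fst sm_at_snd sm_at_id)
   (use assms in \<open>simp_all add: link_def\<close>)
 hence "sm_at (%q. map_prod fi' ps' (inv_into (U \<times> V) (map_prod fi ps) q)) (fi x, ps y)"
  by (rule sm_at_transform) (use e in \<open>eventually_elim, simp\<close>)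
 moreover have "near q ~ (fi x, ps y). inv_into (U \<times> V) (map_prod fi ps) q : U' \<times> V'"
  using e near_Pair[OF assms(1)[unfolded link_def, THEN conjunct2] assms(2)[unfolded link_def, THEN conjunct2]]
  by eventually_elim simp
 ultimately show ?thesis by (simp add: link_def)
qed

lemma achart_prod:
 fixes A :: "('m, 'e::model_space) chart set" and B :: "('n, 'd::model_space) chart set"
 assumes "gatlas A" "gatlas B" "achart A U fi" "achart B V ps"
 shows "achart (prod_atlas A B) (U \<times> V) (map_prod fi ps)"
 unfolding achart_def
proof (intro conjI ballI)
 show "chart0 (U \<times> V) (map_prod fi ps)" by (rule chart0_prod[OF achart0[OF assms(3)] achart0[OF assms(4)]])
 show "U \<times> V \<subseteq> mfd_space (prod_atlas A B)"
 proof clarify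
  fix x y assume "x : U" "y : V"
  obtain U' fi' where 1: "(U', fi') : A" "x : U'" using achart_space[OF assms(3) \<open>x : U\<close>] by (rule mfd_spaceE)
  obtain V' ps' where 2: "(V', ps') : B" "y : V'" using achart_space[OF assms(4) \<open>y : V\<close>] by (rule mfd_spaceE)
  have "(U' \<times> V', map_prod fi' ps') : prod_atlas A B" unfolding prod_atlas_def using 1 2 by blast
  thus "(x, y) : mfd_space (prod_atlas A B)"
   unfolding mfd_space_def using 1 2 by blast
 qed
 fix c assume "c : prod_atlas A B"
 then obtain U' fi' V' ps' where c: "c = (U' \<times> V', map_prod fi' ps')" "(U', fi') : A" "(V', ps') : B"
  unfolding prod_atlas_def by blast
 have a: "chart0 U' fi'" "chart0 V' ps'" using c good_achart assms(1,2) achart0 by blast+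
 have "link (U \<times> V) (map_prod fi ps) (U' \<times> V') (map_prod fi' ps') q & link (U' \<times> V') (map_prod fi' ps') (U \<times> V) (map_prod fi ps) q"
  if q: "q : (U \<times> V) \<inter> (U' \<times> V')" for q
 proof -
  obtain x y where xy: "q = (x, y)" "x : U" "x : U'" "y : V" "y : V'" using q by blast
  note l = achart_link[OF assms(3) c(2) xy(2,3)] achart_link[OF assms(4) c(3) xy(4,5)]
  show ?thesis unfolding xy(1)
   by (intro conjI link_prod achart0[OF assms(3)] achart0[OF assms(4)] a xy
    l[THEN conjunct1] l[THEN conjunct2])
 qed
 thus "case c of (V', ps') => ALL x:(U \<times> V) \<inter> V'. link (U \<times> V) (map_prod fi ps) V' ps' x & link V' ps' (U \<times> V) (map_prod fi ps) x"
  unfolding c(1) by simp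
qed

lemma good_atlas_prod:
 fixes A :: "('m, 'e::model_space) chart set" and B :: "('n, 'd::model_space) chart set"
 assumes "gatlas A" "gatlas B" shows "gatlas (prod_atlas A B)"
 unfolding gatlas_def
proof clarify
 fix W c assume "(W, c) : prod_atlas A B"
 then obtain U fi V ps where c: "W = U \<times> V" "c = map_prod fi ps" "(U, fi) : A" "(V, ps) : B"
  unfolding prod_atlas_def by blast
 show "achart (prod_atlas A B) W c"
  unfolding c by (rule achart_prod[OF assms good_achart[OF assms(1) c(3)] good_achart[OF assms(2) c(4)]])
qed

lemma achart_diffeo:
 fixes A :: "('m, 'e::model_space) chart set" and Ps Th :: "'e => 'e"
 assumes U: "gatlas A" "achart A U fi" and o: "open S" "open V" and S: "S \<subseteq> fi ` U"
  and sm: "smooth_on S Ps" "smooth_on V Th"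
  and f: "!!z. z : S ==> Ps z : V & Th (Ps z) = z" and b: "!!w. w : V ==> Th w : S & Ps (Th w) = w"
 shows "achart A {x : U. fi x : S} (%x. Ps (fi x))" "(%x. Ps (fi x)) ` {x : U. fi x : S} = V"
  "!!w. w : V ==> inv_into {x : U. fi x : S} (%x. Ps (fi x)) w = inv_into U fi (Th w)"
proof -
 let ?U = "{x : U. fi x : S}" and ?fi = "%x. Ps (fi x)"
 note cU = achart0[OF U(2)]
 have inj: "inj_on ?fi ?U"
 proof (rule inj_onI)
  fix x y assume x: "x : ?U" "y : ?U" "?fi x = ?fi y"
  hence "Th (?fi x) = fi x" "Th (?fi y) = fi y"
   using f[THEN conjunct2, of "fi x"] f[THEN conjunct2, of "fi y"] by blast+
  hence "fi x = fi y" unfolding x(3) by metis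
  thus "x = y" using cU x unfolding chart0_def by (blast dest: inj_onD)
 qed
 have mem: "inv_into U fi (Th w) : ?U & ?fi (inv_into U fi (Th w)) = w" if "w : V" for w
  using b[OF that] S by (auto simp: inv_into_into f_inv_into_f subset_eq)
 show im: "?fi ` ?U = V"
 proof
  show "?fi ` ?U \<subseteq> V" using f by auto
  show "V \<subseteq> ?fi ` ?U"
  proof
   fix w assume "w : V"
   from mem[OF this] show "w : ?fi ` ?U" by (intro image_eqI[of w ?fi "inv_into U fi (Th w)"]) simp_all
  qed
 qed
 show inv: "inv_into ?U ?fi w = inv_into U fi (Th w)" if "w : V" for w
  by (rule inv_into_f_eq[OF inj]) (use mem[OF that] in auto)
 have c0: "chart0 ?U ?fi" unfolding chart0_def im using inj o by simp
 have "link ?U ?fi C ps x & link C ps ?U ?fi x" if C: "(C, ps) : A" and x: "x : ?U" "x : C" for C ps x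
 proof -
  have l: "link U fi C ps x" "link C ps U fi x" using achart_link[OF U(2) C] x by auto
  have cC: "chart0 C ps" by (rule achart0[OF good_achart[OF U(1) C]])
  have xV: "?fi x : V" "Th (?fi x) = fi x" using f x by auto
  have "link ?U ?fi U fi x"
   unfolding link_def
  proof
   have "sm_at Th (?fi x)" by (rule sm_at_on[OF sm(2) o(2) xV(1)])
   thus "sm_at (%z. fi (inv_into ?U ?fi z)) (?fi x)"
    by (rule sm_at_transform)
     (use near_open_set[OF o(2) xV(1)] in \<open>eventually_elim, use inv b S in \<open>auto simp: f_inv_into_f subset_eq\<close>\<close>)
   show "near z ~ (?fi x). inv_into ?U ?fi z : U"
    using near_open_set[OF o(2) xV(1)] by eventually_elim (use mem inv in auto)
  qed
  hence 1: "link ?U ?fi C ps x"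
   by (rule link_trans[OF _ l(1) x(1) _ c0 cU]) (use x in simp)
  have "link U fi ?U ?fi x"
   unfolding link_def
  proof
   have near: "near z ~ (fi x). z : S" by (rule near_open_set[OF o(1)]) (use x in simp)
   have "sm_at Ps (fi x)" by (rule sm_at_on[OF sm(1) o(1)]) (use x in simp)
   thus "sm_at (%z. ?fi (inv_into U fi z)) (fi x)"
    by (rule sm_at_transform) (use near in \<open>eventually_elim, use S in \<open>auto simp: f_inv_into_f subset_eq\<close>\<close>)
   show "near z ~ (fi x). inv_into U fi z : ?U"
    using near by eventually_elim (use S in \<open>auto simp: inv_into_into f_inv_into_f subset_eq\<close>)
  qed
  hence "link C ps ?U ?fi x"
   by (rule link_trans[OF l(2) _ x(2) _ cC cU]) (use x in simp)
  with 1 show ?thesis by simp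
 qed
 thus "achart A ?U ?fi" using c0 U(2) unfolding achart_def by auto
qed

section \<open>Tangent vectors, curves and brackets in arbitrary charts\<close>

lemma chart_at_mem: "x : mfd_space A ==> (fst (chart_at A x), coord A x) : A & x : fst (chart_at A x)"
proof -
 assume "x : mfd_space A"
 hence "EX c. c : A & x : fst c" unfolding mfd_space_def by force
 hence "chart_at A x : A & x : fst (chart_at A x)" unfolding chart_at_def by (rule someI_ex)
 thus ?thesis by (simp add: coord_def)
qed

lemma achart_coord: "gatlas A ==> x : mfd_space A ==> achart A (fst (chart_at A x)) (coord A x)"
 by (rule good_achart[OF _ conjunct1[OF chart_at_mem]])

text \<open>The inverse of \<open>tangent_coord A fi x\<close>: it leads from the coordinates in
  \<open>fi\<close> back to those in the chart chosen at x.\<close>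

definition tinv ::
 "('m, 'e::real_normed_vector) chart set => 'm set => ('m => 'e) => 'm => 'e => 'e" where
 "tinv A U fi x = D (%z. coord A x (inv_into U fi z)) (fi x)"

lemma D_ident: "D (%z. z) x v = v" by (rule D_eqI) (rule has_derivative_ident)

lemma D_transform:
 assumes "sm_at f x" "near y ~ x. f y = g y" shows "D g x v = D f x v"
 by (rule D_eqI, rule hder_transform[OF sm_at_has_derivative[OF assms(1)] assms(2)])

lemma D_near_ident:
 fixes x :: "'a::model_space"
 assumes "near y ~ x. y = g y" shows "D g x v = v"
 using D_transform[OF sm_at_id assms, of v] by (simp add: D_ident)

lemma D_compose:
 assumes "sm_at f x" "sm_at g (f x)"
 shows "D (%z. g (f z)) x v = D g (f x) (D f x v)"
 by (rule D_eqI, rule has_derivative_compose[OF sm_at_has_derivative[OF assms(1)] sm_at_has_derivative[OF assms(2)]])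

lemma D_link:
 fixes ps :: "'m => 'd::model_space" and \<chi>' :: "'m => 'f::model_space" and fi :: "'m => 'e::model_space"
 assumes l: "link U fi C ps x" "link C ps V \<chi>' x" and x: "x : U" and c: "chart0 U fi" "chart0 C ps"
 shows "D (%z. \<chi>' (inv_into U fi z)) (fi x) v =
  D (%z. \<chi>' (inv_into C ps z)) (ps x) (D (%z. ps (inv_into U fi z)) (fi x) v)"
proof -
 have ix: "inv_into U fi (fi x) = x" by (rule chart0_inv[OF c(1) x])
 have s: "sm_at (%z. ps (inv_into U fi z)) (fi x)" "sm_at (%z. \<chi>' (inv_into C ps z)) (ps (inv_into U fi (fi x)))"
  using l ix by (simp_all add: link_def)
 have "near z ~ (fi x). inv_into U fi z : C" using l by (simp add: link_def)
 hence "near z ~ (fi x). \<chi>' (inv_into C ps (ps (inv_into U fi z))) = \<chi>' (inv_into U fi z)"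
  by eventually_elim (simp add: chart0_inv[OF c(2)])
 thus ?thesis
  using D_transform[OF sm_at_compose[OF s]] D_compose[OF s] by (simp add: ix)
qed

context
 fixes A :: "('m, 'e::model_space) chart set"
 assumes A: "gatlas A"
begin

lemma tcoord_eq: "tangent_coord A fi x v = D (%z. fi (inv_into (fst (chart_at A x)) (coord A x) z)) (coord A x x) v"
 by (simp add: tangent_coord_def o_def coord_inv_def)

lemma tcoord_change:
 assumes "achart A U fi" "achart A V ps" "x : U" "x : V"
 shows "tangent_coord A ps x v = D (%z. ps (inv_into U fi z)) (fi x) (tangent_coord A fi x v)"
proof -
 have x: "x : mfd_space A" by (rule achart_space[OF assms(1,3)])
 note c = achart_coord[OF A x]
 show ?thesis unfolding tcoord_eq
  by (rule D_link[OF achart_link2[OF A c assms(1)] achart_link2[OF A assms(1,2)] _ achart0[OF c] achart0[OF assms(1)]])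
   (use chart_at_mem[OF x] assms in auto)
qed

lemma tcoord_self:
 assumes "x : mfd_space A" shows "tangent_coord A (coord A x) x v = v"
proof -
 have c: "chart0 (fst (chart_at A x)) (coord A x)" "x : fst (chart_at A x)"
  using achart0[OF achart_coord[OF A assms]] chart_at_mem[OF assms] by auto
 have "near z ~ (coord A x x). z = coord A x (inv_into (fst (chart_at A x)) (coord A x) z)"
  using chart0_near[OF c] by eventually_elim simp
 thus ?thesis unfolding tcoord_eq by (rule D_near_ident)
qed

lemma tinv_coord:
 assumes "achart A U fi" "x : U" shows "tinv A U fi x (tangent_coord A fi x v) = v"
proof -
 have x: "x : mfd_space A" by (rule achart_space[OF assms])
 show ?thesis
  unfolding tinv_def
  using tcoord_change[OF assms(1) achart_coord[OF A x] assms(2), of v] chart_at_mem[OF x] tcoord_self[OF x]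
  by simp
qed

lemma lin_tcoord:
 assumes "achart A U fi" "x : U" shows "linear (tangent_coord A fi x)"
proof -
 have x: "x : mfd_space A" by (rule achart_space[OF assms])
 have "link (fst (chart_at A x)) (coord A x) U fi x"
  by (rule achart_link2[OF A achart_coord[OF A x] assms(1)]) (use chart_at_mem[OF x] assms in auto)
 thus ?thesis unfolding tcoord_eq[abs_def] by (intro sm_at_linear) (simp add: link_def)
qed

lemma linear_tinv:
 assumes "achart A U fi" "x : U" shows "linear (tinv A U fi x)"
proof -
 have x: "x : mfd_space A" by (rule achart_space[OF assms])
 have "link U fi (fst (chart_at A x)) (coord A x) x"
  by (rule achart_link2[OF A assms(1) achart_coord[OF A x]]) (use chart_at_mem[OF x] assms in auto)
 thus ?thesis unfolding tinv_def by (intro sm_at_linear) (simp add: link_def)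
qed

lemma tcoord_inv:
 assumes "achart A U fi" "x : U" shows "tangent_coord A fi x (tinv A U fi x w) = w"
proof -
 have x: "x : mfd_space A" by (rule achart_space[OF assms])
 note c = achart_coord[OF A x] and m = chart_at_mem[OF x]
 have "D (%z. fi (inv_into U fi z)) (fi x) w = tangent_coord A fi x (tinv A U fi x w)"
  unfolding tcoord_eq tinv_def
  by (rule D_link[OF achart_link2[OF A assms(1) c] achart_link2[OF A c assms(1)]])
   (use m assms achart0[OF assms(1)] achart0[OF c] in auto)
 moreover have "near z ~ (fi x). z = fi (inv_into U fi z)"
  using chart0_near[OF achart0[OF assms(1)] assms(2)] by eventually_elim simp
 hence "D (%z. fi (inv_into U fi z)) (fi x) w = w" by (rule D_near_ident)
 ultimately show ?thesis by simp
qed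

lemma velocity_coord:
 assumes "achart A U fi" "c t : U" and S: "at t within S ~= bot" "t : S"
  and d: "((%s. fi (c s)) hvd w) (at t within S)"
  and cU: "\<forall>\<^sub>F s in at t within S. c s : U"
 shows "tangent_coord A fi (c t) (velocity A S c t) = w"
  and "velocity A S c t = tinv A U fi (c t) w"
proof -
 have x: "c t : mfd_space A" by (rule achart_space[OF assms(1,2)])
 note k = achart_coord[OF A x] and m = chart_at_mem[OF x]
 have "sm_at (%z. coord A (c t) (inv_into U fi z)) (fi (c t))"
  using achart_link2[OF A assms(1) k assms(2)] m by (simp add: link_def)
 from curve_deriv_within[where c="%s. fi (c s)", OF this d]
 have "((%s. coord A (c t) (inv_into U fi (fi (c s)))) hvd tinv A U fi (c t) w) (at t within S)"
  by (simp add: tinv_def)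
 hence "((%s. coord A (c t) (c s)) hvd tinv A U fi (c t) w) (at t within S)"
  unfolding has_vector_derivative_def
 proof (rule has_derivative_transform_eventually)
  show "\<forall>\<^sub>F s in at t within S. coord A (c t) (inv_into U fi (fi (c s))) = coord A (c t) (c s)"
   using cU by eventually_elim (simp add: chart0_inv[OF achart0[OF assms(1)]])
 qed (use assms(2) S(2) chart0_inv[OF achart0[OF assms(1)]] in auto)
 thus *: "velocity A S c t = tinv A U fi (c t) w"
  unfolding velocity_def using S by (intro vector_derivative_within) auto
 show "tangent_coord A fi (c t) (velocity A S c t) = w"
  unfolding * by (rule tcoord_inv[OF assms(1,2)])
qed

end

lemma sm_at_vector_derivative:
 "sm_at c (t::real) ==> (c hvd D c t 1) (at t)"
proof -
 assume s: "sm_at c t"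
 have "D c t h = h *. D c t 1" for h using linear_scale[OF sm_at_linear[OF s], of h 1] by simp
 hence "D c t = (%h. h *. D c t 1)" by (rule ext)
 with sm_at_has_derivative[OF s] show ?thesis unfolding has_vector_derivative_def by (rule back_subst)
qed

lemma good_atlas_smooth:
 fixes A :: "('m, 'e::model_space) chart set"
 assumes "gatlas A" shows "smooth_atlas A"
proof -
 have c: "chart0 U fi" if "(U, fi) : A" for U fi by (rule achart0[OF good_achart[OF assms that]])
 have "open (fi ` (U \<inter> V)) & smooth_on (fi ` (U \<inter> V)) (ps \<circ> inv_into U fi)"
  if a: "(U, fi) : A" "(V, ps) : A" for U fi V ps
 proof -
  have l: "link U fi V ps x" if "x : U" "x : V" for x
   using achart_link[OF good_achart[OF assms a(1)] a(2) that] by blast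
  have o: "open (fi ` (U \<inter> V))"
  proof (rule open_subopen[THEN iffD2], rule ballI)
   fix z assume "z : fi ` (U \<inter> V)"
   then obtain x where x: "z = fi x" "x : U" "x : V" by blast
   have "near w ~ (fi x). inv_into U fi w : V" using l[OF x(2,3)] by (simp add: link_def)
   hence "near w ~ z. w : fi ` (U \<inter> V)" unfolding x(1) using chart0_near[OF c[OF a(1)] x(2)]
   proof eventually_elim
    case (elim w)
    thus ?case by (intro image_eqI[of w fi "inv_into U fi w"]) simp_all
   qed
   thus "EX T. open T & z : T & T \<subseteq> fi ` (U \<inter> V)" unfolding eventually_nhds by blast
  qed
  have "sm_at (ps \<circ> inv_into U fi) z" if z: "z : fi ` (U \<inter> V)" for z
   using l z by (auto simp: link_def o_def)
  thus ?thesis using o smooth_on_iff_near[OF o] by blast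
 qed
 thus ?thesis using c unfolding smooth_atlas_def chart0_def by fast
qed

context
 fixes A :: "('m, 'e::model_space) chart set" and U fi
 assumes A: "gatlas A" and U: "achart A U fi"
begin

lemma curve_inD:
 assumes x: "x : U" and c: "curve_in A S x v c"
 shows "c 0 = x" "near t ~ 0. c t : S & c t : U" "sm_at (%t. fi (c t)) 0"
  "((%t. fi (c t)) hvd tangent_coord A fi x v) (at 0)"
proof -
 show c0: "c 0 = x" using c by (simp add: curve_in_def)
 obtain e where e: "e > 0" "smooth_map real_atlas A {-e<..<e} c" "c ` {-e<..<e} \<subseteq> S"
  using c by (auto simp: curve_in_def)
 obtain h where "reps UNIV (%t. t) U fi {-e<..<e} c 0 h"
  by (rule smooth_map_rep[OF achart_real A U e(2), of 0]) (use e x c0 in auto)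
 hence h: "sm_at h 0" "near t ~ 0. t : {-e<..<e} --> c t : U & fi (c t) = h t"
  by (auto simp: reps_def)
 have ev: "near t ~ (0::real). t : {-e<..<e}"
  by (rule near_open_set) (use e in auto)
 show ev2: "near t ~ 0. c t : S & c t : U"
  using ev h(2) by eventually_elim (use e in auto)
 show s: "sm_at (%t. fi (c t)) 0"
  by (rule sm_at_transform[OF h(1)]) (use ev h(2) in \<open>eventually_elim, simp\<close>)
 have d: "((%t. fi (c t)) hvd D (%t. fi (c t)) 0 1) (at 0)"
  by (rule sm_at_vector_derivative[OF s])
 have "near t ~ 0. c t : U" using ev2 by eventually_elim simp
 hence "\<forall>\<^sub>F t in at 0. c t : U" by (simp add: eventually_nhds_conv_at)
 from velocity_coord(1)[OF A U _ _ _ d this] have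
  "tangent_coord A fi x (velocity A UNIV c 0) = D (%t. fi (c t)) 0 1" using x c0 by simp
 thus "((%t. fi (c t)) hvd tangent_coord A fi x v) (at 0)"
  using d c by (simp add: curve_in_def)
qed

lemma curve_inI:
 assumes x: "x : U" and g: "sm_at ga (0::real)" "ga 0 = fi x" "(ga hvd w) (at 0)"
  and S: "near t ~ 0. inv_into U fi (ga t) : S"
 shows "curve_in A S x (tinv A U fi x w) (%t. inv_into U fi (ga t))"
proof -
 have U0: "chart0 U fi" by (rule achart0[OF U])
 have ev: "near t ~ 0. inv_into U fi (ga t) : U & fi (inv_into U fi (ga t)) = ga t"
  by (rule sm_at_eventually[OF g(1)], unfold g(2), rule chart0_near[OF U0 x])
 have "near t ~ 0. (inv_into U fi (ga t) : U & fi (inv_into U fi (ga t)) = ga t) & sm_at ga t & inv_into U fi (ga t) : S"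
  using ev sm_at_near[OF g(1)] S by eventually_elim simp
 then obtain e where e: "e > 0" "!!t. dist t 0 < e ==> (inv_into U fi (ga t) : U & fi (inv_into U fi (ga t)) = ga t) & sm_at ga t & inv_into U fi (ga t) : S"
  unfolding eventually_nhds_metric by blast
 have e': "(inv_into U fi (ga t) : U & fi (inv_into U fi (ga t)) = ga t) & sm_at ga t & inv_into U fi (ga t) : S"
  if "t : {-e<..<e}" for t
  by (rule e(2)) (use that in \<open>auto simp: dist_real_def\<close>)
 have sm: "smooth_map real_atlas A {-e<..<e} (%t. inv_into U fi (ga t))"
 proof (rule smooth_mapI[OF achart_real(1) A])
  show "{-e<..<e} \<subseteq> mfd_space real_atlas" by (simp add: mfd_space_def real_atlas_def)
  fix t assume t: "t : {-e<..<e}"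
  have "reps UNIV (%t. t) U fi {-e<..<e} (%t. inv_into U fi (ga t)) t ga"
   unfolding reps_def using e' t by simp
  thus "EX Ua fia V ps h. achart real_atlas Ua fia & achart A V ps & t : Ua & inv_into U fi (ga t) : V &
    reps Ua fia V ps {-e<..<e} (%t. inv_into U fi (ga t)) t h"
   using achart_real(2) U e'[OF t] by blast
 qed
 have i0: "inv_into U fi (ga 0) = x" unfolding g(2) by (rule chart0_inv[OF U0 x])
 have "velocity A UNIV (%t. inv_into U fi (ga t)) 0 = tinv A U fi (inv_into U fi (ga 0)) w"
 proof (rule velocity_coord(2)[OF A U])
  show "((%t. fi (inv_into U fi (ga t))) hvd w) (at 0)"
   by (rule hvd_transform[OF g(3)]) (use ev in \<open>eventually_elim, simp\<close>)
  have "near t ~ 0. inv_into U fi (ga t) : U" using ev by eventually_elim simp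
  thus "\<forall>\<^sub>F t in at 0. inv_into U fi (ga t) : U" by (simp add: eventually_nhds_conv_at)
 qed (use i0 x in auto)
 moreover have "(%t. inv_into U fi (ga t)) ` {-e<..<e} \<subseteq> S" using e' by blast
 ultimately show ?thesis unfolding curve_in_def i0 using e(1) sm by auto
qed

lemma tangent_spaceI:
 assumes x: "x : U" and S: "near t ~ (0::real). inv_into U fi (fi x + t *. tangent_coord A fi x v) : S"
 shows "v : tangent_space A S x"
proof -
 have "curve_in A S x (tinv A U fi x (tangent_coord A fi x v)) (%t. inv_into U fi (fi x + t *. tangent_coord A fi x v))"
  by (rule curve_inI[OF x _ _ line_derivative S])
   (auto intro!: sm_at_add sm_at_scaleR sm_at_const sm_at_id)
 thus ?thesis unfolding tangent_space_def tinv_coord[OF A U x] by blast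
qed

lemma differential_coord:
 fixes B :: "('n, 'd::model_space) chart set"
 assumes B: "gatlas B" "achart B V ps" and f: "reps U fi V ps S f x h" and x: "x : U" "f x : V"
  and S: "near z ~ (fi x). inv_into U fi z : S"
 shows "differential A B f x v = tinv B V ps (f x) (D h (fi x) (tangent_coord A fi x v))"
proof -
 have xs: "x : mfd_space A" "f x : mfd_space B" using achart_space[OF U x(1)] achart_space[OF B(2) x(2)] by auto
 let ?C = "fst (chart_at A x)" and ?c = "coord A x"
 note c = achart_coord[OF A xs(1)] and c' = achart_coord[OF B(1) xs(2)]
 have m: "x : ?C" "f x : fst (chart_at B (f x))" using chart_at_mem[OF xs(1)] chart_at_mem[OF xs(2)] by auto
 have U0: "chart0 U fi" "chart0 V ps" by (rule achart0, fact U, rule achart0, fact B)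
 have l: "sm_at (%z. fi (inv_into ?C ?c z)) (?c x)" "near z ~ (?c x). inv_into ?C ?c z : U"
  using achart_link2[OF A c U m(1) x(1)] by (auto simp: link_def)
 have i: "inv_into ?C ?c (?c x) = x" "inv_into U fi (fi x) = x"
  using chart0_inv[OF achart0[OF c] m(1)] chart0_inv[OF U0(1) x(1)] by auto
 have h: "sm_at h (fi x)" "near z ~ (fi x). f (inv_into U fi z) : V & ps (f (inv_into U fi z)) = h z"
  using f S by (auto simp: reps_def elim: eventually_elim2)
 have hx: "h (fi x) = ps (f x)" using near_self[OF h(2)] i by simp
 have s1: "sm_at (%z. coord B (f x) (inv_into V ps z)) (h (fi x))"
  using achart_link2[OF B c' x(2) m(2)] hx by (simp add: link_def)
 have s2: "sm_at (%z. h (fi (inv_into ?C ?c z))) (?c x)"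
  by (rule sm_at_compose[OF l(1)]) (simp add: i h)
 have s2i: "h (fi (inv_into ?C ?c (?c x))) = h (fi x)" by (simp add: i)
 have ev: "near z ~ (?c x). f (inv_into U fi (fi (inv_into ?C ?c z))) : V &
   ps (f (inv_into U fi (fi (inv_into ?C ?c z)))) = h (fi (inv_into ?C ?c z))"
  by (rule sm_at_eventually[OF l(1), where Q="%w. f (inv_into U fi w) : V & ps (f (inv_into U fi w)) = h w"]) (simp add: i h)
 have ev2: "near z ~ (?c x). coord B (f x) (inv_into V ps (h (fi (inv_into ?C ?c z)))) = (coord B (f x) \<circ> f \<circ> coord_inv A x) z"
  using ev l(2)
 proof eventually_elim
  case (elim z)
  have "inv_into U fi (fi (inv_into ?C ?c z)) = inv_into ?C ?c z" by (rule chart0_inv[OF U0(1) elim(2)])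
  hence "f (inv_into ?C ?c z) : V" "h (fi (inv_into ?C ?c z)) = ps (f (inv_into ?C ?c z))" using elim by auto
  thus ?case by (simp add: coord_inv_def chart0_inv[OF U0(2)])
 qed
 have "differential A B f x v = D (%z. coord B (f x) (inv_into V ps (h (fi (inv_into ?C ?c z))))) (?c x) v"
  unfolding differential_def
  by (rule D_transform[OF sm_at_compose[OF s2 s1[folded s2i]] ev2])
 also have "\<dots> = tinv B V ps (f x) (D (%z. h (fi (inv_into ?C ?c z))) (?c x) v)"
  using D_compose[OF s2 s1[folded s2i], of v] by (simp add: tinv_def i hx)
 also have "D (%z. h (fi (inv_into ?C ?c z))) (?c x) v = D h (fi x) (tangent_coord A fi x v)"
  using D_compose[OF l(1), of h v] h(1) by (simp add: i tcoord_eq[OF A])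
 finally show ?thesis .
qed

lemma tcoord_differential:
 fixes B :: "('n, 'd::model_space) chart set"
 assumes B: "gatlas B" "achart B V ps" and f: "reps U fi V ps S f x h" and x: "x : U" "f x : V"
  and S: "near z ~ (fi x). inv_into U fi z : S"
 shows "tangent_coord B ps (f x) (differential A B f x v) = D h (fi x) (tangent_coord A fi x v)"
 unfolding differential_coord[OF assms] by (rule tcoord_inv[OF B x(2)])

lemma curve_reps:
 assumes f: "reps U fi V ps S f x h" and x: "x : U" and c: "curve_in A S x v c"
 shows "near t ~ 0. f (c t) : V & ps (f (c t)) = h (fi (c t))"
  "((%t. ps (f (c t))) hvd D h (fi x) (tangent_coord A fi x v)) (at 0)"
proof -
 note cd = curve_inD[OF x c]
 have h: "sm_at h (fi (c 0))" "near z ~ (fi (c 0)). inv_into U fi z : S --> f (inv_into U fi z) : V & ps (f (inv_into U fi z)) = h z"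
  using f by (auto simp: reps_def cd(1))
 have "near t ~ 0. inv_into U fi (fi (c t)) : S --> f (inv_into U fi (fi (c t))) : V & ps (f (inv_into U fi (fi (c t)))) = h (fi (c t))"
  by (rule sm_at_eventually[OF cd(3), where Q="%z. inv_into U fi z : S --> f (inv_into U fi z) : V & ps (f (inv_into U fi z)) = h z", OF h(2)])
 with cd(2) show ev: "near t ~ 0. f (c t) : V & ps (f (c t)) = h (fi (c t))"
  by eventually_elim (simp add: chart0_inv[OF achart0[OF U]])
 show "((%t. ps (f (c t))) hvd D h (fi x) (tangent_coord A fi x v)) (at 0)"
  by (rule hvd_transform[OF curve_deriv[of h "%t. fi (c t)", OF h(1) cd(4), unfolded cd(1)]])
   (use ev in \<open>eventually_elim, simp\<close>)
qed

text \<open>Every admissible curve yields the same velocity, so the value picked by the choice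
  operator is determined.\<close>

lemma derivative_along_coord:
 fixes B :: "('n, 'd::model_space) chart set"
 assumes B: "gatlas B" "achart B V ps" and f: "reps U fi V ps S f x h" and x: "x : U" "f x : V"
  and v: "v : tangent_space A S x"
 shows "tangent_coord B ps (f x) (derivative_along A B S f x v) = D h (fi x) (tangent_coord A fi x v)"
  and "derivative_along A B S f x v = tinv B V ps (f x) (D h (fi x) (tangent_coord A fi x v))"
proof -
 have vel: "velocity B UNIV (%t. f (c t)) 0 = tinv B V ps (f x) (D h (fi x) (tangent_coord A fi x v))"
  if c: "curve_in A S x v c" for c
 proof -
  note r = curve_reps[OF f x(1) c] and c0 = curve_inD(1)[OF x(1) c]
  have "near t ~ 0. f (c t) : V" using r(1) by eventually_elim simp
  hence "\<forall>\<^sub>F t in at 0. f (c t) : V" by (simp add: eventually_nhds_conv_at)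
  from velocity_coord(2)[where c="%t. f (c t)", OF B _ _ _ r(2) this] show ?thesis using x c0 by simp
 qed
 obtain c where "curve_in A S x v c" using v by (auto simp: tangent_space_def)
 hence "EX w c. curve_in A S x v c & velocity B UNIV (%t. f (c t)) 0 = w" by blast
 hence "EX c. curve_in A S x v c & velocity B UNIV (%t. f (c t)) 0 = derivative_along A B S f x v"
  unfolding derivative_along_def by (rule someI_ex)
 then obtain c' where "curve_in A S x v c'" "velocity B UNIV (%t. f (c' t)) 0 = derivative_along A B S f x v"
  by blast
 thus *: "derivative_along A B S f x v = tinv B V ps (f x) (D h (fi x) (tangent_coord A fi x v))"
  using vel[of c'] by metis
 show "tangent_coord B ps (f x) (derivative_along A B S f x v) = D h (fi x) (tangent_coord A fi x v)"
  unfolding * by (rule tcoord_inv[OF B x(2)])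
qed

end

text \<open>The bracket is defined in the chart chosen at x. Under the transition map the terms with
  its second derivative cancel by symmetry, and the formula holds in every chart.\<close>

lemma lie_bracket_coord:
 fixes A :: "('m, 'e::model_space) chart set"
 assumes A: "gatlas A" and U: "achart A U fi" and x: "x : U"
  and X: "sm_at Xh (fi x)" "near z ~ (fi x). tangent_coord A fi (inv_into U fi z) (X (inv_into U fi z)) = Xh z"
  and Y: "sm_at Yh (fi x)" "near z ~ (fi x). tangent_coord A fi (inv_into U fi z) (Y (inv_into U fi z)) = Yh z"
 shows "tangent_coord A fi x (lie_bracket A X Y x) = D Yh (fi x) (Xh (fi x)) - D Xh (fi x) (Yh (fi x))"
proof -
 have xs: "x : mfd_space A" by (rule achart_space[OF U x])
 let ?C = "fst (chart_at A x)" and ?c = "coord A x"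
 let ?l = "%u. fi (inv_into ?C ?c u)" and ?k = "%z. ?c (inv_into U fi z)"
 note c = achart_coord[OF A xs]
 have m: "x : ?C" using chart_at_mem[OF xs] by auto
 have U0: "chart0 U fi" "chart0 ?C ?c" by (rule achart0, fact U, rule achart0, fact c)
 have i: "inv_into ?C ?c (?c x) = x" "inv_into U fi (fi x) = x"
  using chart0_inv[OF U0(2) m] chart0_inv[OF U0(1) x] by auto
 have l: "sm_at ?l (?c x)" "near z ~ (?c x). inv_into ?C ?c z : U"
  using achart_link2[OF A c U m x] by (auto simp: link_def)
 have k: "sm_at ?k (fi x)" using achart_link2[OF A U c x m] by (simp add: link_def)
 have key: "D (field_coord A x Z) (?c x) (W x) =
   D (%p. D ?k p (Zh (fi x))) (fi x) (Wh (fi x)) + D ?k (fi x) (D Zh (fi x) (Wh (fi x)))"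
  if Z: "sm_at Zh (fi x)" "near z ~ (fi x). tangent_coord A fi (inv_into U fi z) (Z (inv_into U fi z)) = Zh z"
   and W: "near z ~ (fi x). tangent_coord A fi (inv_into U fi z) (W (inv_into U fi z)) = Wh z" for Z Zh W Wh
 proof -
  have ev: "near u ~ (?c x). tangent_coord A fi (inv_into U fi (?l u)) (Z (inv_into U fi (?l u))) = Zh (?l u)"
   by (rule sm_at_eventually[OF l(1), where Q="%z. tangent_coord A fi (inv_into U fi z) (Z (inv_into U fi z)) = Zh z"])
    (simp add: i Z)
  have ev2: "near u ~ (?c x). D ?k (?l u) (Zh (?l u)) = field_coord A x Z u"
   using ev l(2) chart0_near[OF U0(2) m]
  proof eventually_elim
   case (elim u)
   have e: "inv_into U fi (?l u) = inv_into ?C ?c u" by (rule chart0_inv[OF U0(1) elim(2)])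
   have "field_coord A x Z u = D ?k (?l u) (tangent_coord A fi (inv_into ?C ?c u) (Z (inv_into ?C ?c u)))"
    unfolding field_coord_def Let_def coord_inv_def
    by (rule tcoord_change[OF A U c]) (use elim in auto)
   thus ?case using elim(1) unfolding e by simp
  qed
  have Wx: "Wh (fi x) = tangent_coord A fi x (W x)" using near_self[OF W] i by simp
  have s: "sm_at (%z. D ?k z (Zh z)) (fi x)"
   by (rule sm_at_D_compose[where g="%z. z", OF k sm_at_id Z(1)])
  have lx: "?l (?c x) = fi x" by (simp add: i)
  have s': "sm_at (%z. D ?k z (Zh z)) (?l (?c x))" by (simp only: lx s)
  have "D (field_coord A x Z) (?c x) (W x) = D (%u. D ?k (?l u) (Zh (?l u))) (?c x) (W x)"
   by (rule D_transform[OF sm_at_compose[OF l(1) s'] ev2])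
  also have "\<dots> = D (%z. D ?k z (Zh z)) (fi x) (D ?l (?c x) (W x))"
   using D_compose[OF l(1) s', of "W x"] by (simp only: lx)
  also have "D ?l (?c x) (W x) = Wh (fi x)" by (simp add: Wx tcoord_eq[OF A])
  finally have 1: "D (field_coord A x Z) (?c x) (W x) = D (%z. D ?k z (Zh z)) (fi x) (Wh (fi x))" .
  let ?w = "Wh (fi x)"
  have line: "((%e. fi x + e *. ?w) hvd ?w) (at 0)" by (rule line_derivative)
  have z0: "fi x + 0 *. ?w = fi x" by simp
  have d1: "((%e. D ?k (fi x + e *. ?w) (Zh (fi x + e *. ?w))) hvd D (%z. D ?k z (Zh z)) (fi x) ?w) (at 0)"
   using curve_deriv[where f="%z. D ?k z (Zh z)" and c="%e. fi x + e *. ?w", OF _ line] s by simp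
  have d2: "((%e. Zh (fi x + e *. ?w)) hvd D Zh (fi x) ?w) (at 0)"
   using curve_deriv[where f=Zh and c="%e. fi x + e *. ?w", OF _ line] Z(1) by simp
  have d3: "((%e. D ?k (fi x + e *. ?w) (Zh (fi x + e *. ?w))) has_vector_derivative
   D (%p. D ?k p (Zh (fi x))) (fi x) ?w + D ?k (fi x) (D Zh (fi x) ?w)) (at 0)"
   using D_curve[where f="?k" and c="%e. fi x + e *. ?w", OF _ line d2] k by simp
  show ?thesis unfolding 1 by (rule vector_derivative_unique_at[OF d1 d3])
 qed
 have "lie_bracket A X Y x = D (field_coord A x Y) (?c x) (X x) - D (field_coord A x X) (?c x) (Y x)"
  by (simp add: lie_bracket_def)
 also have "\<dots> = D ?k (fi x) (D Yh (fi x) (Xh (fi x))) - D ?k (fi x) (D Xh (fi x) (Yh (fi x)))"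
  unfolding key[OF Y X(2)] key[OF X Y(2)] using second_derivative_symmetric_near[OF k, of "Yh (fi x)" "Xh (fi x)"] by simp
 also have "\<dots> = tinv A U fi x (D Yh (fi x) (Xh (fi x)) - D Xh (fi x) (Yh (fi x)))"
  unfolding tinv_def by (rule linear_diff[OF sm_at_linear[OF k], symmetric])
 finally show ?thesis by (simp add: tcoord_inv[OF A U x])
qed

section \<open>Charts of the tangent bundle\<close>

abbreviation tchart :: "('m, 'e::real_normed_vector) chart set => ('m => 'e) => 'm \<times> 'e => 'e \<times> 'e" where
 "tchart A fi \<equiv> %(x, v). (fi x, tangent_coord A fi x v)"

context
 fixes A :: "('m, 'e::model_space) chart set"
 assumes A: "gatlas A"
begin

lemma chart0_tangent:
 assumes U: "achart A U fi" shows "chart0 (U \<times> UNIV) (tchart A fi)" "tchart A fi ` (U \<times> UNIV) = fi ` U \<times> UNIV"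
proof -
 note U0 = achart0[OF U]
 show im: "tchart A fi ` (U \<times> UNIV) = fi ` U \<times> UNIV"
 proof
  show "fi ` U \<times> UNIV \<subseteq> tchart A fi ` (U \<times> UNIV)"
  proof clarify
   fix x w assume x: "x : U"
   show "(fi x, w) : tchart A fi ` (U \<times> UNIV)"
    by (rule image_eqI[of _ _ "(x, tinv A U fi x w)"]) (auto simp: tcoord_inv[OF A U x] x)
  qed
 qed auto
 have "inj_on (tchart A fi) (U \<times> UNIV)"
 proof (rule inj_onI, clarify)
  fix x v y w assume a: "x : U" "y : U" "fi x = fi y" "tangent_coord A fi x v = tangent_coord A fi y w"
  hence "x = y" using U0 unfolding chart0_def by (blast dest: inj_onD)
  moreover have "v = tinv A U fi x (tangent_coord A fi x v)" by (rule tinv_coord[OF A U a(1), symmetric])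
  ultimately show "x = y & v = w" using a(4) tinv_coord[OF A U a(2), of w] by simp
 qed
 thus "chart0 (U \<times> UNIV) (tchart A fi)"
  using U0 unfolding chart0_def im by (auto intro: open_Times)
qed

lemma inv_tangent_near:
 assumes U: "achart A U fi" and x: "x : U"
 shows "near q ~ (fi x, w). inv_into (U \<times> UNIV) (tchart A fi) q =
  (inv_into U fi (fst q), tinv A U fi (inv_into U fi (fst q)) (snd q)) & inv_into U fi (fst q) : U"
 using near_Pair[OF chart0_near[OF achart0[OF U] x] eventually_True[of "nhds w"]]
proof eventually_elim
 case (elim q)
 hence i: "inv_into U fi (fst q) : U" "fi (inv_into U fi (fst q)) = fst q" by auto
 have "inv_into (U \<times> UNIV) (tchart A fi) q = (inv_into U fi (fst q), tinv A U fi (inv_into U fi (fst q)) (snd q))"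
  by (rule inv_into_f_eq[OF conjunct1[OF chart0_tangent(1)[OF U, unfolded chart0_def]]])
   (auto simp: i tcoord_inv[OF A U i(1)])
 thus ?case using i by simp
qed

lemma link_tangent:
 assumes U: "achart A U fi" and V: "achart A V ps" and x: "x : U" "x : V"
 shows "link (U \<times> UNIV) (tchart A fi) (V \<times> UNIV) (tchart A ps) (x, v)"
proof -
 have l: "sm_at (%z. ps (inv_into U fi z)) (fi x)" "near z ~ (fi x). inv_into U fi z : V"
  using achart_link2[OF A U V x] by (auto simp: link_def)
 let ?w = "tangent_coord A fi x v"
 note near = inv_tangent_near[OF U x(1), of ?w]
 have nV: "near q ~ (fi x, ?w). inv_into U fi (fst q) : V"
  using near_Pair[OF l(2) eventually_True[of "nhds ?w"]] by eventually_elim simp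
 have "sm_at (%q. (ps (inv_into U fi (fst q)), D (%z. ps (inv_into U fi z)) (fst q) (snd q))) (fi x, ?w)"
 proof (rule sm_at_Pair)
  have f: "sm_at fst (fi x, ?w)" "sm_at snd (fi x, ?w)" by (intro sm_at_fst sm_at_snd sm_at_id)+
  show "sm_at (%q. ps (inv_into U fi (fst q))) (fi x, ?w)"
   by (rule sm_at_compose[where f=fst and g="%z. ps (inv_into U fi z)", OF f(1)]) (simp add: l)
  show "sm_at (%q. D (%z. ps (inv_into U fi z)) (fst q) (snd q)) (fi x, ?w)"
   by (rule sm_at_D_compose[where g=fst and u=snd, OF _ f]) (simp add: l)
 qed
 hence "sm_at (%q. tchart A ps (inv_into (U \<times> UNIV) (tchart A fi) q)) (fi x, ?w)"
 proof (rule sm_at_transform)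
  show "near q ~ (fi x, ?w). (ps (inv_into U fi (fst q)), D (%z. ps (inv_into U fi z)) (fst q) (snd q)) =
    tchart A ps (inv_into (U \<times> UNIV) (tchart A fi) q)"
   using near nV near_Pair[OF chart0_near[OF achart0[OF U] x(1)] eventually_True[of "nhds ?w"]]
  proof eventually_elim
   case (elim q)
   thus ?case using tcoord_change[OF A U V, of "inv_into U fi (fst q)" "tinv A U fi (inv_into U fi (fst q)) (snd q)"]
    by (simp add: tcoord_inv[OF A U])
  qed
 qed
 moreover have "near q ~ (fi x, ?w). inv_into (U \<times> UNIV) (tchart A fi) q : V \<times> UNIV"
  using near nV by eventually_elim simp
 ultimately show ?thesis by (simp add: link_def)
qed

lemma mfd_space_tangent: "mfd_space (tangent_atlas A) = mfd_space A \<times> UNIV"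
 unfolding mfd_space_def tangent_atlas_def by auto

lemma achart_tangent:
 assumes U: "achart A U fi" shows "achart (tangent_atlas A) (U \<times> UNIV) (tchart A fi)"
 unfolding achart_def
proof (intro conjI ballI)
 show "U \<times> UNIV \<subseteq> mfd_space (tangent_atlas A)" unfolding mfd_space_tangent using achart_space[OF U] by blast
 fix c assume "c : tangent_atlas A"
 then obtain V ps where c: "c = (V \<times> UNIV, tchart A ps)" "(V, ps) : A" unfolding tangent_atlas_def by blast
 note V = good_achart[OF A c(2)]
 have "link (U \<times> UNIV) (tchart A fi) (V \<times> UNIV) (tchart A ps) q & link (V \<times> UNIV) (tchart A ps) (U \<times> UNIV) (tchart A fi) q"
  if "q : (U \<times> UNIV) \<inter> (V \<times> UNIV)" for q
 proof -
  obtain x v where q: "q = (x, v)" "x : U" "x : V" using \<open>q : _\<close> by blast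
  show ?thesis unfolding q(1) by (rule conjI[OF link_tangent[OF U V q(2,3)] link_tangent[OF V U q(3,2)]])
 qed
 thus "case c of (V', ps') => ALL x:(U \<times> UNIV) \<inter> V'. link (U \<times> UNIV) (tchart A fi) V' ps' x & link V' ps' (U \<times> UNIV) (tchart A fi) x"
  unfolding c(1) by simp
qed (rule chart0_tangent(1)[OF U])

lemma good_atlas_tangent: "gatlas (tangent_atlas A)"
 unfolding gatlas_def
proof clarify
 fix W c assume "(W, c) : tangent_atlas A"
 then obtain V ps where c: "W = V \<times> UNIV" "c = tchart A ps" "(V, ps) : A" unfolding tangent_atlas_def by blast
 show "achart (tangent_atlas A) W c" unfolding c by (rule achart_tangent[OF good_achart[OF A c(3)]])
qed

end

text \<open>When \<open>P\<close> is a linear projection, a box, unlike a general ball, is mapped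
  into itself by \<open>P\<close> and contains the rays from P z to its points z.\<close>

definition box :: "('e => 'e) => real => 'e::real_normed_vector set" where
 "box P r = {z. norm (P z) < r & norm (z - P z) < r}"

lemma open_box:
 assumes "bounded_linear P" shows "open (box P r)"
 unfolding box_def
 by (intro open_Collect_conj open_Collect_less continuous_intros linear_continuous_on[OF assms])

lemma near_boxes:
 assumes ev: "near z ~ (0::'e::real_normed_vector). R z" obtains r where "r > 0" "!!z. z : box P r ==> R z"
proof -
 obtain e where e: "e > 0" "!!z. dist z 0 < e ==> R z" using ev unfolding eventually_nhds_metric by blast
 have "R z" if "z : box P (e / 2)" for z
 proof (rule e(2))
  have "norm (P z + (z - P z)) <= norm (P z) + norm (z - P z)" by (rule norm_triangle_ineq)
  thus "dist z 0 < e" using that by (simp add: box_def)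
 qed
 thus ?thesis using that[of "e / 2"] e(1) by simp
qed

text \<open>A smooth idempotent \<open>si\<close> with fixed point z0 and derivative P there is
  conjugate to P. The map Ps z = P (si z - z0) + (1 - P) (z - si z) has the identity as derivative
  at z0 and satisfies Ps (si z) = P (Ps z). Applied to the source map, this turns the units into the
  fixed points of P.\<close>

lemma retraction_chart:
 fixes A :: "('m, 'e::model_space) chart set"
 assumes A: "gatlas A" and s: "smooth_map A A (mfd_space A) s"
  and idem: "!!g. g : mfd_space A ==> s (s g) = s g" and x0: "x0 : mfd_space A" "s x0 = x0"
 obtains U ps P r where "achart A U ps" "x0 : U" "ps x0 = 0" "linear P" "!!z. P (P z) = P z" "r > 0" "ps ` U = box P r"
  "!!g. g : U ==> s g : U & ps (s g) = P (ps g)"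
proof -
 obtain U0 fi where U0: "(U0, fi) : A" "x0 : U0" using x0(1) by (rule mfd_spaceE)
 note aU = good_achart[OF A U0(1)]
 note cU = achart0[OF aU]
 let ?e = "inv_into U0 fi" and ?z = "fi x0"
 have ez: "?e ?z = x0" by (rule chart0_inv[OF cU U0(2)])
 obtain si where "reps U0 fi U0 fi (mfd_space A) s x0 si"
  by (rule smooth_map_rep[OF A aU A aU s x0(1) U0(2)]) (use x0 U0 in simp)
 hence sm: "sm_at si ?z" and rep0: "near z ~ ?z. ?e z : mfd_space A --> s (?e z) : U0 & fi (s (?e z)) = si z"
  by (auto simp: reps_def)
 have rep: "near z ~ ?z. s (?e z) : U0 & fi (s (?e z)) = si z & ?e (si z) = s (?e z)"
  using rep0 chart0_near[OF cU U0(2)]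
 proof eventually_elim
  case (elim z)
  hence "s (?e z) : U0 & fi (s (?e z)) = si z" using achart_space[OF aU] by blast
  thus ?case using chart0_inv[OF cU] by metis
 qed
 have sz: "si ?z = ?z" using near_self[OF rep] ez x0 by simp
 have idem': "near z ~ ?z. si (si z) = si z"
  using rep sm_at_eventually[OF sm, unfolded sz, OF rep] chart0_near[OF cU U0(2)]
 proof eventually_elim
  case (elim z)
  have "s (s (?e z)) = s (?e z)" by (rule idem[OF achart_space[OF aU]]) (use elim in blast)
  thus ?case using elim by simp
 qed
 define P where "P = D si ?z"
 have linP: "linear P" unfolding P_def by (rule sm_at_linear[OF sm])
 have bP: "bounded_linear P" by (rule linear_imp_bounded_linear[OF linP])
 have PP: "P (P v) = P v" for v
 proof -
  have "D (%z. si (si z)) ?z v = P (P v)" using D_compose[OF sm, of si v] sm by (simp add: sz P_def)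
  moreover have "D (%z. si (si z)) ?z v = P v" unfolding P_def
   by (rule D_transform[OF sm]) (use idem' in \<open>eventually_elim, simp\<close>)
  ultimately show ?thesis by simp
 qed
 define Ps where "Ps z = P (si z - ?z) + (z - si z) - P (z - si z)" for z
 have smP: "sm_at Ps ?z" unfolding Ps_def
  by (intro sm_at_add sm_at_diff sm_at_linear_image[OF bP] sm_at_const sm_at_id sm)
 have dP: "D Ps ?z v = v" for v
 proof -
  have "(Ps hder (%v. P (D si ?z v - 0) + (v - D si ?z v) - P (v - D si ?z v))) (at ?z)"
   unfolding Ps_def
   by (intro has_derivative_add has_derivative_diff bounded_linear.has_derivative[OF bP] has_derivative_const has_derivative_ident
     sm_at_has_derivative[OF sm])
  from D_eqI[OF this, of v] show ?thesis
   by (simp add: P_def[symmetric] PP linear_diff[OF linP])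
 qed
 have P0: "Ps ?z = 0" by (simp add: Ps_def sz linear_0[OF linP])
 have conj: "near z ~ ?z. Ps (si z) = P (Ps z)"
  using idem' by eventually_elim (simp add: Ps_def linear_diff[OF linP] linear_add[OF linP] linear_0[OF linP] PP)
 obtain S where S: "open S" "?z : S" "smooth_on S Ps" using smP unfolding sm_at_def by blast
 let ?S = "S \<inter> fi ` U0"
 have S': "open ?S" "?z : ?S" using S cU U0 by (auto simp: chart0_def)
 obtain U' V Th where inv: "open U'" "?z : U'" "U' \<subseteq> ?S" "open V" "smooth_on V Th"
  "!!x. x : U' ==> Ps x : V & Th (Ps x) = x" "!!y. y : V ==> Th y : U' & Ps (Th y) = y"
  by (rule smooth_inverse_function[OF S' smooth_on_subset[OF S(3,1) S'(1)] dP]) auto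
 have T0: "0 : V" "Th 0 = ?z" using inv(6)[OF inv(2)] P0 by auto
 have smT: "sm_at Th 0" by (rule sm_at_on[OF inv(5,4) T0(1)])
 have "near z ~ ?z. si z : U'"
  by (rule sm_at_eventually[OF sm]) (use near_open_set[OF inv(1,2)] sz in simp)
 with conj rep have "near z ~ ?z. Ps (si z) = P (Ps z) & si z : U' & s (?e z) : U0 & fi (s (?e z)) = si z"
  by eventually_elim simp
 hence "near z ~ 0. Ps (si (Th z)) = P (Ps (Th z)) & si (Th z) : U' & s (?e (Th z)) : U0 & fi (s (?e (Th z))) = si (Th z)"
  using sm_at_eventually[OF smT, where Q="%z. Ps (si z) = P (Ps z) & si z : U' & s (?e z) : U0 & fi (s (?e z)) = si z"] T0 by simp
 with near_open_set[OF inv(4) T0(1)]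
 have "near z ~ 0. z : V & Ps (si (Th z)) = P (Ps (Th z)) & si (Th z) : U' & s (?e (Th z)) : U0 & fi (s (?e (Th z))) = si (Th z)"
  by eventually_elim simp
 then obtain r where r: "r > 0" "!!z. z : box P r ==> z : V & Ps (si (Th z)) = P (Ps (Th z)) & si (Th z) : U' & s (?e (Th z)) : U0 & fi (s (?e (Th z))) = si (Th z)"
  by (rule near_boxes[where P=P]) blast+
 define W where "W = {z : U'. Ps z : box P r}"
 have oB: "open (box P r)" by (rule open_box[OF bP])
 have "continuous_on U' Ps"
  by (rule continuous_on_subset[OF smooth_on_continuous[OF S(3)]]) (use inv(3) in auto)
 from continuous_on_open_vimage[OF inv(1), THEN iffD1, OF this, rule_format, OF oB]
 have oW: "open W" by (simp add: W_def vimage_def Int_def conj_commute)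
 have WB: "z : W ==> Ps z : box P r & Th (Ps z) = z" for z using inv(6) by (auto simp: W_def)
 have BW: "w : box P r ==> Th w : W & Ps (Th w) = w" for w using inv(7) r(2) by (auto simp: W_def)
 have smW: "smooth_on W Ps" by (rule smooth_on_subset[OF S(3,1) oW]) (use inv(3) in \<open>auto simp: W_def\<close>)
 have smB: "smooth_on (box P r) Th" by (rule smooth_on_subset[OF inv(5,4) oB]) (use r(2) in auto)
 have WU: "W \<subseteq> fi ` U0" using inv(3) by (auto simp: W_def)
 note d = achart_diffeo[OF A aU oW oB WU smW smB WB BW]
 show ?thesis
 proof (rule that[OF d(1) _ _ linP PP r(1) d(2)])
  show "x0 : {x : U0. fi x : W}" using U0 inv(2) r(1) by (simp add: W_def P0 box_def linear_0[OF linP])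
  show "Ps (fi x0) = 0" by (rule P0)
  fix g assume g: "g : {x : U0. fi x : W}"
  hence B: "Ps (fi g) : box P r" "Th (Ps (fi g)) = fi g" using WB by auto
  have eg: "?e (fi g) = g" by (rule chart0_inv[OF cU]) (use g in simp)
  note * = r(2)[OF B(1), unfolded B(2) eg]
  have "P (Ps (fi g)) : box P r" using B(1) r(1) by (simp add: box_def PP)
  thus "s g : {x : U0. fi x : W} & Ps (fi (s g)) = P (Ps (fi g))"
   using * by (simp add: W_def)
 qed
qed

section \<open>Charts adapted to the units\<close>

locale lie_groupoid =
 fixes G :: "('g, 'e::model_space) local_groupoid"
 assumes lie: "local_Lie_groupoid G"
begin

abbreviation "A \<equiv> atlas G"

lemma smooth_atlas: "smooth_atlas A" and hausdorff: "Hausdorff_space (gtop G)" and second_cnt: "second_countable (gtop G)"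
 and smooth_src: "smooth_map A A (gspace G) (src G)"
 and src_units: "g : gspace G ==> src G g : units G" and src_unit: "x : units G ==> src G x = x"
 and open_tgt: "openin (gtop G) (tgt_dom G)" and units_tgt: "units G \<subseteq> tgt_dom G"
 and smooth_tgt: "smooth_map A A (tgt_dom G) (tgt G)" and tgt_units: "g : tgt_dom G ==> tgt G g : units G"
 and tgt_unit: "x : units G ==> tgt G x = x"
 and open_inv: "openin (gtop G) (inv_dom G)" and units_inv: "units G \<subseteq> inv_dom G"
 and smooth_invg: "smooth_map A A (inv_dom G) (invg G)" and inv_unit: "x : units G ==> invg G x = x"
 and unit_mul_dom: "x : units G ==> (x, x) : mul_dom G"
 and smooth_mulg: "smooth_map (prod_atlas A A) A (mul_dom G) (%(g, h). mul G g h)"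
 and open_mul: "openin (subtopology (prod_topology (gtop G) (gtop G)) (composable2 G)) (mul_dom G)"
 and units_space: "units G \<subseteq> gspace G"
 using lie unfolding local_Lie_groupoid_def smooth_manifold_def embedded_submanifold_def
 by - (elim conjE, (assumption | erule (1) bspec | (erule subsetD, rule imageI, assumption)))+

lemma
 shows ax_src_mul: "near_units2 G (%g h. (g, h) : mul_dom G & src G (mul G g h) = src G h)"
 and ax_tgt_mul: "near_units2 G (%g h. (g, h) : mul_dom G & g : tgt_dom G & mul G g h : tgt_dom G &
             tgt G (mul G g h) = tgt G g)"
 and ax_assoc: "near_units3 G (%g h k. (g, h) : mul_dom G & (mul G g h, k) : mul_dom G &
              (h, k) : mul_dom G & (g, mul G h k) : mul_dom G &
              mul G (mul G g h) k = mul G g (mul G h k))"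
 and ax_unit_mul: "near_units1 G (%g. g : tgt_dom G & (tgt G g, g) : mul_dom G & mul G (tgt G g) g = g)"
 and ax_mul_unit: "near_units1 G (%g. (g, src G g) : mul_dom G & mul G g (src G g) = g)"
 and ax_src_inv: "near_units1 G (%g. g : inv_dom G & g : tgt_dom G & src G (invg G g) = tgt G g)"
 and ax_tgt_inv: "near_units1 G (%g. g : inv_dom G & invg G g : tgt_dom G & tgt G (invg G g) = src G g)"
 and ax_mul_inv: "near_units1 G (%g. g : inv_dom G & g : tgt_dom G & (g, invg G g) : mul_dom G &
            mul G g (invg G g) = tgt G g)"
 and ax_inv_mul: "near_units1 G (%g. g : inv_dom G & (invg G g, g) : mul_dom G &
            mul G (invg G g) g = src G g)"
 using lie unfolding local_Lie_groupoid_def by - (elim conjE, assumption)+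

lemma good: "gatlas A" by (rule satlas_good[OF smooth_atlas])

lemma openin_space: "openin (gtop G) W ==> g : W ==> g : gspace G"
 unfolding openin_mfd_top[OF smooth_atlas] by blast

lemma openin_gspace: "openin (gtop G) (gspace G)"
proof (rule openin_nearI[OF smooth_atlas order_refl])
 fix x assume "x : gspace G"
 then obtain U fi where U: "(U, fi) : A" "x : U" by (rule mfd_spaceE)
 have a: "achart A U fi" by (rule good_achart[OF good U(1)])
 have "near z ~ (fi x). inv_into U fi z : gspace G"
  using chart0_near[OF achart0[OF a] U(2)] by eventually_elim (use achart_space[OF a] in blast)
 thus "EX U fi. achart A U fi & x : U & (near z ~ (fi x). inv_into U fi z : gspace G)"
  using a U(2) by blast
qed

end

text \<open>A chart centred at the unit \<open>x0\<close> whose image is a box and in which the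
  source map is the projection \<open>P\<close>, as provided by
  \<open>retraction_chart\<close>.\<close>

locale unit_chart = lie_groupoid G for G :: "('g, 'e::model_space) local_groupoid" +
 fixes x0 :: 'g and U :: "'g set" and ps :: "'g => 'e" and P :: "'e => 'e" and r :: real
 assumes x0_unit: "x0 : units G" and chart: "achart A U ps" and x0_U: "x0 : U" and psi_x0 [simp]: "ps x0 = 0"
  and lin_P: "linear P" and idem_P [simp]: "P (P z) = P z" and r_pos: "r > 0" and image_U: "ps ` U = box P r"
  and src_U: "g : U ==> src G g : U & ps (src G g) = P (ps g)"

lemma (in lie_groupoid) unit_chart_exists:
 assumes "x : units G" obtains U ps P r where "unit_chart G x U ps P r"
proof -
 have x: "x : gspace G" using assms units_space by blast
 show ?thesis
 proof (rule retraction_chart[OF good smooth_src src_unit[OF src_units] x src_unit[OF assms]])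
  fix U ps P r
  assume "achart A U ps" "x : U" "ps x = 0" "linear P" "!!z. P (P z) = P z" "r > 0" "ps ` U = box P r"
   "!!g. g : U ==> src G g : U & ps (src G g) = P (ps g)"
  hence "unit_chart G x U ps P r" using assms lie_groupoid_axioms
   unfolding unit_chart_def unit_chart_axioms_def by blast
  thus ?thesis by (rule that)
 qed
qed

context unit_chart
begin

abbreviation "e \<equiv> inv_into U ps"
abbreviation "ch x \<equiv> tangent_coord A ps x"
abbreviation "chi x \<equiv> tinv A U ps x"

lemma chart': "chart0 U ps" by (rule achart0[OF chart])

lemma e_psi [simp]: "g : U ==> e (ps g) = g" by (rule chart0_inv[OF chart'])

lemma e_0 [simp]: "e 0 = x0" using e_psi[OF x0_U] by simp

lemma bdd_P: "bounded_linear P" by (rule linear_imp_bounded_linear[OF lin_P])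

lemma near_P: "near z ~ 0. R z ==> near z ~ 0. R (P z)"
 by (rule sm_at_eventually[OF sm_at_blinear[OF bdd_P]]) (simp add: linear_0[OF lin_P])

lemma near_U: "near z ~ 0. e z : U & ps (e z) = z"
 using chart0_near[OF chart' x0_U] by simp

lemma U_space: "g : U ==> g : gspace G" by (rule achart_space[OF chart])

lemma near_open: "openin (gtop G) W ==> x0 : W ==> near z ~ 0. e z : W"
 using openin_near[OF smooth_atlas _ chart x0_U] by simp

lemma near_units1: "near_units1 G R ==> near z ~ 0. R (e z)"
proof -
 assume "near_units1 G R"
 then obtain W where W: "openin (gtop G) W" "x0 : W" "!!g. g : W ==> R g"
  using x0_unit unfolding near_units1_def by blast
 show ?thesis using near_open[OF W(1,2)] by eventually_elim (rule W(3))
qed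

lemma e_src: "near z ~ 0. src G (e z) = e (P z)"
 using near_U
proof eventually_elim
 case (elim z)
 hence "src G (e z) : U" "ps (src G (e z)) = P z" using src_U[of "e z"] by auto
 thus ?case using e_psi[of "src G (e z)"] by simp
qed

definition "tg z = ps (tgt G (e z))"
definition "io z = ps (invg G (e z))"

lemma near_rep:
 assumes W: "openin (gtop G) W" "x0 : W" and f: "smooth_map A A W f" "f x0 = x0"
 shows "sm_at (%z. ps (f (e z))) 0" "near z ~ 0. f (e z) : U & e (ps (f (e z))) = f (e z)"
proof -
 obtain h where h: "reps U ps U ps W f x0 h"
  by (rule smooth_map_rep[OF good chart good chart f(1) W(2) x0_U]) (use f x0_U in simp)
 have ev: "near z ~ 0. f (e z) : U & ps (f (e z)) = h z"
  using near_open[OF W] h by (auto simp: reps_def elim: eventually_elim2)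
 show "sm_at (%z. ps (f (e z))) 0"
  by (rule sm_at_transform[of h]) (use h ev in \<open>auto simp: reps_def elim: eventually_mono\<close>)
 show "near z ~ 0. f (e z) : U & e (ps (f (e z))) = f (e z)"
  using ev by eventually_elim (metis e_psi)
qed

lemmas tau_rep = near_rep[OF open_tgt subsetD[OF units_tgt x0_unit] smooth_tgt tgt_unit[OF x0_unit], folded tg_def]
lemmas inv_rep = near_rep[OF open_inv subsetD[OF units_inv x0_unit] smooth_invg inv_unit[OF x0_unit], folded io_def]

lemma tau_zero [simp]: "tg 0 = 0" by (simp add: tg_def tgt_unit[OF x0_unit])
lemma iota_zero [simp]: "io 0 = 0" by (simp add: io_def inv_unit[OF x0_unit])

lemma near_taug: "near z ~ 0. R z ==> near z ~ 0. R (tg z)"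
 by (rule sm_at_eventually[OF tau_rep(1)]) simp

lemma e_tgt: "near z ~ 0. e z : tgt_dom G & tgt G (e z) : U & e (tg z) = tgt G (e z)"
 using tau_rep(2) near_open[OF open_tgt subsetD[OF units_tgt x0_unit]] by eventually_elim simp

lemma e_inv: "near z ~ 0. e z : inv_dom G & invg G (e z) : U & e (io z) = invg G (e z)"
 using inv_rep(2) near_open[OF open_inv subsetD[OF units_inv x0_unit]] by eventually_elim simp

lemma near_first: "near z ~ (0::'e). R z ==> near q ~ (0::'e, y::'b::topological_space). R (fst q)"
 using near_Pair[OF _ eventually_True] by (auto elim: eventually_mono)

lemma near_second: "near z ~ y. R z ==> near q ~ (0::'e, y::'b::topological_space). R (snd q)"
 using near_Pair[OF eventually_True] by (auto elim: eventually_mono)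

lemma near_comp2: "near q ~ (0, 0). P (fst q) = tg (snd q) --> (e (fst q), e (snd q)) : composable2 G"
 using near_first[OF near_U] near_first[OF e_src] near_second[OF e_tgt]
 by eventually_elim (auto simp: composable2_def U_space)

lemma near_units2: 
 assumes "near_units2 G R" shows "near q ~ (0, 0). P (fst q) = tg (snd q) --> R (e (fst q)) (e (snd q))"
proof -
 obtain T where T: "openin (prod_topology (gtop G) (gtop G)) T" "(x0, x0) : T" "!!q. q : T \<inter> composable2 G ==> R (fst q) (snd q)"
  using assms x0_unit unfolding near_units2_def openin_subtopology by fastforce
 then obtain W W' where W: "openin (gtop G) W" "openin (gtop G) W'" "x0 : W" "x0 : W'" "W \<times> W' \<subseteq> T"
  unfolding openin_prod_topology_alt by meson
 show ?thesis using near_first[OF near_open[OF W(1,3)]] near_second[OF near_open[OF W(2,4)]] near_comp2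
 proof eventually_elim
  case (elim q)
  thus ?case using T(3)[of "(e (fst q), e (snd q))"] W(5) by auto
 qed
qed

lemma near_units3: 
 assumes "near_units3 G R" shows "near q ~ (0, 0, 0). P (fst q) = tg (fst (snd q)) & P (fst (snd q)) = tg (snd (snd q)) -->
  R (e (fst q)) (e (fst (snd q))) (e (snd (snd q)))"
proof -
 obtain T where T: "openin (prod_topology (gtop G) (prod_topology (gtop G) (gtop G))) T" "(x0, x0, x0) : T"
  "!!q. q : T \<inter> composable3 G ==> R (fst q) (fst (snd q)) (snd (snd q))"
  using assms x0_unit unfolding near_units3_def openin_subtopology by fastforce
 then obtain W T' where W: "openin (gtop G) W" "openin (prod_topology (gtop G) (gtop G)) T'" "x0 : W" "(x0, x0) : T'" "W \<times> T' \<subseteq> T"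
  unfolding openin_prod_topology_alt[of _ _ T] by meson
 then obtain W' W'' where W': "openin (gtop G) W'" "openin (gtop G) W''" "x0 : W'" "x0 : W''" "W' \<times> W'' \<subseteq> T'"
  unfolding openin_prod_topology_alt[of _ _ T'] by meson
 show ?thesis using near_first[OF near_open[OF W(1,3)]] near_second[OF near_first[OF near_open[OF W'(1,3)]]]
  near_second[OF near_second[OF near_open[OF W'(2,4)]]] near_first[OF near_U] near_first[OF e_src]
  near_second[OF near_first[OF e_src]] near_second[OF near_first[OF e_tgt]] near_second[OF near_second[OF e_tgt]]
 proof eventually_elim
  case (elim q)
  show ?case
  proof
   assume c: "P (fst q) = tg (fst (snd q)) & P (fst (snd q)) = tg (snd (snd q))"
   have "(e (fst q), e (fst (snd q)), e (snd (snd q))) : composable3 G"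
    using elim c by (simp add: composable3_def U_space)
   moreover have "(e (fst q), e (fst (snd q)), e (snd (snd q))) : T" using elim W(5) W'(5) by blast
   ultimately show "R (e (fst q)) (e (fst (snd q))) (e (snd (snd q)))"
    using T(3)[of "(e (fst q), e (fst (snd q)), e (snd (snd q)))"] by simp
  qed
 qed
qed

text \<open>The multiplication lives on composable pairs, in general not an open subset of the
  product. \<open>mm\<close> is a smooth extension of its coordinate expression to a neighbourhood
  of the origin, so that it can be differentiated in each argument separately.\<close>

definition "mm = (SOME h. reps (U \<times> U) (map_prod ps ps) U ps (mul_dom G) (%(g, h). mul G g h) (x0, x0) h)"

lemma mul_x0 [simp]: "mul G x0 x0 = x0"
 using near_units1[OF ax_mul_unit, THEN near_self] src_unit[OF x0_unit] by simp

lemma mm_reps: "reps (U \<times> U) (map_prod ps ps) U ps (mul_dom G) (%(g, h). mul G g h) (x0, x0) mm"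
proof -
 obtain h where "reps (U \<times> U) (map_prod ps ps) U ps (mul_dom G) (%(g, h). mul G g h) (x0, x0) h"
  by (rule smooth_map_rep[OF good_atlas_prod[OF good good] achart_prod[OF good good chart chart] good chart smooth_mulg])
   (use unit_mul_dom[OF x0_unit] x0_U in auto)
 hence "EX h. reps (U \<times> U) (map_prod ps ps) U ps (mul_dom G) (%(g, h). mul G g h) (x0, x0) h" by blast
 thus ?thesis unfolding mm_def by (rule someI_ex)
qed

lemma smooth_mm: "sm_at mm (0, 0)" using mm_reps by (simp add: reps_def)

lemma mm_zero [simp]: "mm (0, 0) = 0"
proof -
 have a: "near q ~ (0, 0). inv_into (U \<times> U) (map_prod ps ps) q : mul_dom G -->
   (%(g, h). mul G g h) (inv_into (U \<times> U) (map_prod ps ps) q) : U & ps ((%(g, h). mul G g h) (inv_into (U \<times> U) (map_prod ps ps) q)) = mm q"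
  using mm_reps by (simp add: reps_def)
 have b: "near q ~ (0, 0). inv_into (U \<times> U) (map_prod ps ps) q = (e (fst q), e (snd q))"
  using inv_prod_near[OF chart' chart' x0_U x0_U] by simp
 have "ps (mul G x0 x0) = mm (0, 0)"
  using near_self[OF a] near_self[OF b] unit_mul_dom[OF x0_unit] by simp
 thus ?thesis by simp
qed

lemma mm_rep: "near q ~ (0, 0). P (fst q) = tg (snd q) --> (e (fst q), e (snd q)) : mul_dom G &
  mul G (e (fst q)) (e (snd q)) : U & ps (mul G (e (fst q)) (e (snd q))) = mm q & e (mm q) = mul G (e (fst q)) (e (snd q))"
proof -
 have "near q ~ (0, 0). inv_into (U \<times> U) (map_prod ps ps) q : mul_dom G -->
   (%(g, h). mul G g h) (inv_into (U \<times> U) (map_prod ps ps) q) : U & ps ((%(g, h). mul G g h) (inv_into (U \<times> U) (map_prod ps ps) q)) = mm q"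
  using mm_reps by (simp add: reps_def)
 moreover have "near q ~ (0, 0). inv_into (U \<times> U) (map_prod ps ps) q = (e (fst q), e (snd q))"
  using inv_prod_near[OF chart' chart' x0_U x0_U] by simp
 ultimately show ?thesis using near_units2[OF ax_src_mul]
 proof eventually_elim
  case (elim q)
  show ?case
  proof
   assume c: "P (fst q) = tg (snd q)"
   hence d: "(e (fst q), e (snd q)) : mul_dom G" using elim(3) by blast
   hence "mul G (e (fst q)) (e (snd q)) : U & ps (mul G (e (fst q)) (e (snd q))) = mm q" using elim by simp
   moreover hence "e (mm q) = mul G (e (fst q)) (e (snd q))" using e_psi by metis
   ultimately show "(e (fst q), e (snd q)) : mul_dom G &
    mul G (e (fst q)) (e (snd q)) : U & ps (mul G (e (fst q)) (e (snd q))) = mm q & e (mm q) = mul G (e (fst q)) (e (snd q))"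
    using d by blast
  qed
 qed
qed

lemma near_mm: "near z ~ 0. R z ==> near q ~ (0, 0). R (mm q)"
 by (rule sm_at_eventually[OF smooth_mm]) simp

lemma near_map:
 assumes "near q ~ (0, 0). R q" "isCont f (0, 0, 0)" "f (0, 0, 0) = (0, 0)"
 shows "near q ~ (0, 0, 0). R (f q)"
 by (rule isCont_eventually[OF assms(2), of R]) (simp add: assms)

lemma unit_iff: "g : U ==> g : units G \<longleftrightarrow> P (ps g) = ps g"
proof
 assume g: "g : U" and "P (ps g) = ps g"
 hence "ps (src G g) = ps g" using src_U by simp
 hence "src G g = g" using src_U[OF g] e_psi[OF g] e_psi[of "src G g"] by simp
 thus "g : units G" using src_units[OF U_space[OF g]] by simp
qed (use src_unit src_U in metis)

lemma e_unit: "near z ~ 0. P z = z --> e z : units G"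
 using near_U by eventually_elim (auto simp: unit_iff)

lemma P_taug: "near z ~ 0. P (tg z) = tg z"
 using e_tgt by eventually_elim (use tgt_units unit_iff in \<open>auto simp: tg_def\<close>)

lemma mm_facts: "near q ~ (0, 0). P (fst q) = tg (snd q) --> P (mm q) = P (snd q) & tg (mm q) = tg (fst q)"
 using mm_rep near_units2[OF ax_src_mul] near_units2[OF ax_tgt_mul] near_second[OF near_U]
proof eventually_elim
 case (elim q)
 show ?case
 proof
  assume c: "P (fst q) = tg (snd q)"
  let ?m = "mul G (e (fst q)) (e (snd q))"
  have m: "?m : U" "ps ?m = mm q" "e (mm q) = ?m" using elim(1) c by auto
  have "P (mm q) = ps (src G ?m)" using src_U[OF m(1)] m by simp
  also have "\<dots> = ps (src G (e (snd q)))" using elim(2) c by simp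
  also have "\<dots> = P (snd q)" using src_U[of "e (snd q)"] elim(4) by simp
  finally show "P (mm q) = P (snd q) & tg (mm q) = tg (fst q)" using elim(3) c m(3) by (simp add: tg_def)
 qed
qed

lemma mm_assoc: "near q ~ (0, 0, 0). P (fst q) = tg (fst (snd q)) & P (fst (snd q)) = tg (snd (snd q)) -->
   mm (mm (fst q, fst (snd q)), snd (snd q)) = mm (fst q, mm (snd q))"
proof -
 have c1: "isCont (%q::'e \<times> 'e \<times> 'e. (fst q, fst (snd q))) (0, 0, 0)" by (intro continuous_intros)
 have c2: "isCont (%q::'e \<times> 'e \<times> 'e. snd q) (0, 0, 0)" by (intro continuous_intros)
 have mc: "isCont mm (0, 0)" by (rule sm_at_isCont[OF smooth_mm])
 have "isCont (%q::'e \<times> 'e \<times> 'e. mm (fst q, fst (snd q))) (0, 0, 0)" by (rule isCont_o2[OF c1, where g=mm]) (simp add: mc)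
 hence c3: "isCont (%q::'e \<times> 'e \<times> 'e. (mm (fst q, fst (snd q)), snd (snd q))) (0, 0, 0)" by (intro continuous_intros)
 have "isCont (%q::'e \<times> 'e \<times> 'e. mm (snd q)) (0, 0, 0)" by (rule isCont_o2[OF c2, where g=mm]) (simp add: mc)
 hence c4: "isCont (%q::'e \<times> 'e \<times> 'e. (fst q, mm (snd q))) (0, 0, 0)" by (intro continuous_intros)
 have t: "near q ~ (0, 0). P (fst q) = tg (snd q) --> P (mm q) = P (snd q) & tg (mm q) = tg (fst q)" by (rule mm_facts)
 have z: "(fst (0::'e, 0::'e, 0::'e), fst (snd (0::'e, 0::'e, 0::'e))) = (0, 0)" "snd (0::'e, 0::'e, 0::'e) = (0, 0)"
  "(mm (fst (0::'e, 0::'e, 0::'e), fst (snd (0::'e, 0::'e, 0::'e))), snd (snd (0::'e, 0::'e, 0::'e))) = (0, 0)"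
  "(fst (0::'e, 0::'e, 0::'e), mm (snd (0::'e, 0::'e, 0::'e))) = (0, 0)" by simp_all
 show ?thesis
  using near_map[OF mm_rep c1 z(1)] near_map[OF mm_rep c2 z(2)] near_map[OF mm_rep c3 z(3)] near_map[OF mm_rep c4 z(4)]
   near_map[OF t c1 z(1)] near_map[OF t c2 z(2)] near_units3[OF ax_assoc]
 proof eventually_elim
  case (elim q)
  show ?case
  proof
   assume c: "P (fst q) = tg (fst (snd q)) & P (fst (snd q)) = tg (snd (snd q))"
   obtain g h k where q: "q = (g, h, k)" by (metis prod.collapse)
   have "P g = tg h" "P h = tg k" using c q by auto
   hence "ps (mul G (e (mm (g, h))) (e k)) = mm (mm (g, h), k)" "ps (mul G (e g) (e (mm (h, k)))) = mm (g, mm (h, k))"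
    "e (mm (g, h)) = mul G (e g) (e h)" "e (mm (h, k)) = mul G (e h) (e k)"
    "mul G (mul G (e g) (e h)) (e k) = mul G (e g) (mul G (e h) (e k))"
    using elim unfolding q by simp_all
   thus "mm (mm (fst q, fst (snd q)), snd (snd q)) = mm (fst q, mm (snd q))" unfolding q by simp
  qed
 qed
qed

sublocale local_model P tg io mm
proof
 show "sm_at tg 0" "sm_at io 0" by (rule tau_rep inv_rep)+
 show "near x ~ 0. P x = x --> tg x = x"
  using e_unit near_U by eventually_elim (auto simp: tg_def tgt_unit)
 show "near q ~ (0, 0). P (fst q) = tg (snd q) --> P (mm q) = P (snd q)"
  and "near q ~ (0, 0). P (fst q) = tg (snd q) --> tg (mm q) = tg (fst q)"
  using mm_facts by (eventually_elim, simp)+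
 show "near g ~ 0. P (io g) = tg g"
  using near_units1[OF ax_src_inv] e_inv
 proof eventually_elim
  case (elim z)
  thus ?case using src_U[of "invg G (e z)"] by (simp add: tg_def io_def)
 qed
 show "near g ~ 0. tg (io g) = P g"
  using near_units1[OF ax_tgt_inv] e_inv near_U
 proof eventually_elim
  case (elim z)
  thus ?case using src_U[of "e z"] by (simp add: tg_def)
 qed
 have t0: "sm_at (%z. (tg z, z)) 0" "sm_at (%z. (z, P z)) 0" "sm_at (%z. (z, io z)) 0" "sm_at (%z. (io z, z)) 0"
  by (intro sm_at_Pair sm_at_id sm_at_linear_image[OF bdd_P] tau_rep(1) inv_rep(1))+
 have P0: "P 0 = 0" by (rule linear_0[OF lin_P])
 have tu: "near x ~ 0. tg (P x) = P x"
  using near_P[OF e_unit] near_P[OF near_U] by eventually_elim (simp add: tg_def tgt_unit)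
 have m1: "near z ~ 0. P (tg z) = tg z --> ps (mul G (e (tg z)) (e z)) = mm (tg z, z)"
  using sm_at_eventually[OF t0(1), unfolded tau_zero, OF mm_rep] by eventually_elim simp
 show "near g ~ 0. mm (tg g, g) = g"
  using m1 P_taug near_units1[OF ax_unit_mul] e_tgt near_U by eventually_elim simp
 have m2: "near z ~ 0. P z = tg (P z) --> ps (mul G (e z) (e (P z))) = mm (z, P z)"
  using sm_at_eventually[OF t0(2), unfolded P0, OF mm_rep] by eventually_elim simp
 show "near g ~ 0. mm (g, P g) = g"
  using m2 tu near_units1[OF ax_mul_unit] e_src near_U by eventually_elim simp
 have m3: "near z ~ 0. P z = tg (io z) --> ps (mul G (e z) (e (io z))) = mm (z, io z)"
  using sm_at_eventually[OF t0(3), unfolded iota_zero, OF mm_rep] by eventually_elim simp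
 show "near g ~ 0. mm (g, io g) = tg g"
  using m3 \<open>near g ~ 0. tg (io g) = P g\<close> near_units1[OF ax_mul_inv] e_inv by eventually_elim (simp add: tg_def)
 have m4: "near z ~ 0. P (io z) = tg z --> ps (mul G (e (io z)) (e z)) = mm (io z, z)"
  using sm_at_eventually[OF t0(4), unfolded iota_zero, OF mm_rep] by eventually_elim simp
 show "near g ~ 0. mm (io g, g) = P g"
  using m4 \<open>near g ~ 0. P (io g) = tg g\<close> near_units1[OF ax_inv_mul] e_inv near_U
 proof eventually_elim
  case (elim z)
  thus ?case using src_U[of "e z"] by simp
 qed
qed (rule linear_add[OF lin_P] linear_scale[OF lin_P] idem_P smooth_mm P_taug mm_assoc iota_zero)+

end

section \<open>Curves, the Maurer-Cartan form and invariant fields in charts\<close>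

lemma at_unit_interval_not_bot: "t : {0..1::real} ==> at t within {0..1} ~= bot"
 using connected_imp_perfect[of "{0..1::real}" t] trivial_limit_within[of t "{0..1}"] by auto

context
 fixes A :: "('m, 'e::model_space) chart set" and U fi
 assumes A: "gatlas A" and U: "achart A U fi"
begin

text \<open>The representative \<open>h\<close> is smooth on a full neighbourhood of
  \<open>t0\<close>, so it gives the one-sided velocities at the ends of the interval as
  well.\<close>

lemma curve_coords:
 assumes k: "smooth_map real_atlas A {0..1} k" and t0: "t0 : {0..1}" "k t0 : U"
 obtains h where "sm_at h t0" "h t0 = fi (k t0)"
  "near t ~ t0. t : {0..1} --> k t : U & fi (k t) = h t & tangent_coord A fi (k t) (velocity A {0..1} k t) = D h t 1"
proof -
 obtain h where "reps UNIV (%t. t) U fi {0..1} k t0 h"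
  by (rule smooth_map_rep[OF achart_real A U k t0(1)]) (use t0 in auto)
 hence h: "sm_at h t0" "near t ~ t0. t : {0..1} --> k t : U & fi (k t) = h t"
  by (auto simp: reps_def)
 have "near t ~ t0. t : {0..1} --> k t : U & fi (k t) = h t & tangent_coord A fi (k t) (velocity A {0..1} k t) = D h t 1"
  using h(2) near_near[OF h(2)] sm_at_near[OF h(1)]
 proof eventually_elim
  case (elim t)
  show ?case
  proof
   assume t: "t : {0..1}"
   have e: "\<forall>\<^sub>F s in at t within {0..1}. k s : U & h s = fi (k s)"
    unfolding eventually_at_filter using elim(2) by eventually_elim auto
   have "(h hvd D h t 1) (at t within {0..1})"
    by (rule has_vector_derivative_at_within[OF sm_at_vector_derivative[OF elim(3)]])
   hence d: "((%s. fi (k s)) hvd D h t 1) (at t within {0..1})"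
    unfolding has_vector_derivative_def
    by (rule has_derivative_transform_eventually) (use e elim(1) t in \<open>auto elim: eventually_mono\<close>)
   have "\<forall>\<^sub>F s in at t within {0..1}. k s : U" using e by eventually_elim simp
   from velocity_coord(1)[OF A U _ at_unit_interval_not_bot[OF t] t d this] elim(1) t
   show "k t : U & fi (k t) = h t & tangent_coord A fi (k t) (velocity A {0..1} k t) = D h t 1" by blast
  qed
 qed
 moreover have "h t0 = fi (k t0)" using near_self[OF h(2)] t0 by simp
 ultimately show ?thesis using that h(1) by blast
qed

end

lemma smooth_map_near:
 fixes A :: "('m, 'e::model_space) chart set" and B :: "('n, 'd::model_space) chart set"
 assumes A: "gatlas A" "achart A U fi" and B: "smooth_atlas B" "openin (mfd_top B) W"
  and f: "smooth_map A B S f" and x: "x : S" "x : U" "f x : W"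
 shows "near z ~ (fi x). inv_into U fi z : S --> f (inv_into U fi z) : W"
proof -
 have "f x : mfd_space B" using B(2) x(3) unfolding openin_mfd_top[OF B(1)] by blast
 then obtain V ps where V: "(V, ps) : B" "f x : V" by (rule mfd_spaceE)
 note B' = satlas_good[OF B(1)]
 note aV = good_achart[OF B' V(1)]
 obtain h where h: "reps U fi V ps S f x h"
  by (rule smooth_map_rep[OF A B' aV f x(1,2) V(2)])
 hence h1: "sm_at h (fi x)" and h2: "near z ~ (fi x). inv_into U fi z : S -->
   f (inv_into U fi z) : V & ps (f (inv_into U fi z)) = h z" by (auto simp: reps_def)
 have "h (fi x) = ps (f x)"
  using near_self[OF h2] x chart0_inv[OF achart0[OF A(2)] x(2)] by simp
 hence "near z ~ (fi x). inv_into V ps (h z) : W"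
  using sm_at_eventually[OF h1, where Q="%w. inv_into V ps w : W"] openin_near[OF B aV V(2) x(3)] by simp
 thus ?thesis using h2
 proof eventually_elim
  case (elim z)
  show ?case
  proof
   assume "inv_into U fi z : S"
   hence "f (inv_into U fi z) : V" "h z = ps (f (inv_into U fi z))" using elim(2) by auto
   thus "f (inv_into U fi z) : W" using elim(1) chart0_inv[OF achart0[OF aV]] by simp
  qed
 qed
qed

context unit_chart
begin

lemma ch_eq_0: "g : U ==> ch g v = 0 \<longleftrightarrow> v = 0"
 using tinv_coord[OF good chart] linear_0[OF lin_tcoord[OF good chart]]
  linear_0[OF linear_tinv[OF good chart]] by metis

lemma src_reps: "g : U ==> reps U ps U ps UNIV (src G) g P"
 unfolding reps_def
proof
 assume g: "g : U"
 show "sm_at P (ps g)" by (rule sm_at_blinear[OF bdd_P])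
 show "near z ~ (ps g). e z : UNIV --> src G (e z) : U & ps (src G (e z)) = P z"
  using chart0_near[OF chart' g] by eventually_elim (use src_U in auto)
qed

lemma D_linear: "bounded_linear L ==> D L x v = L v"
 by (rule D_eqI) (rule bounded_linear.has_derivative[OF _ has_derivative_ident])

lemma ch_differential_src: "g : U ==> ch (src G g) (differential A A (src G) g v) = P (ch g v)"
 using tcoord_differential[OF good chart good chart src_reps, of g v] src_U D_linear[OF bdd_P] by simp

lemma ker_src: "g : U ==> differential A A (src G) g v = 0 \<longleftrightarrow> P (ch g v) = 0"
 using ch_differential_src[of g v] ch_eq_0[of "src G g" "differential A A (src G) g v"] src_U by simp

lemma algebroid_iff: "x : U ==> (x, a) : algebroid G \<longleftrightarrow> x : units G & P (ch x a) = 0"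
 by (simp add: algebroid_def ker_src)

lemma e_line:
 assumes g: "g : U"
 shows "near t ~ (0::real). e (ps g + t *. w) : U & ps (e (ps g + t *. w)) = ps g + t *. w"
 by (rule eventually_on_line[where x="ps g" and v=w and Q="%z. e z : U & ps (e z) = z", OF chart0_near[OF chart' g]])

lemma src_eq: "g : U ==> h : U ==> src G g = src G h \<longleftrightarrow> P (ps g) = P (ps h)"
 using src_U[of g] src_U[of h] e_psi[of "src G g"] e_psi[of "src G h"] by auto

lemma fibre_tangent:
 assumes g: "g : U" and v: "P (ch g v) = 0" shows "v : tangent_space A {h : gspace G. src G h = src G g} g"
proof (rule tangent_spaceI[OF good chart g])
 show "near t ~ 0. e (ps g + t *. ch g v) : {h : gspace G. src G h = src G g}"
  using e_line[OF g, of "ch g v"]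
 proof eventually_elim
  case (elim t)
  thus ?case using src_eq[of "e (ps g + t *. ch g v)" g] g v by (simp add: U_space P_add P_scale)
 qed
qed

lemma unit_tangent:
 assumes x: "x : U" "x : units G" and v: "P (ch x v) = ch x v" shows "v : tangent_space A (units G) x"
proof (rule tangent_spaceI[OF good chart x(1)])
 show "near t ~ 0. e (ps x + t *. ch x v) : units G"
  using e_line[OF x(1), of "ch x v"]
 proof eventually_elim
  case (elim t)
  thus ?case using x v by (simp add: unit_iff P_add P_scale)
 qed
qed

lemma near_first_arg:
 fixes a b :: 'e
 assumes "near q ~ (a, b). R q" shows "near z ~ a. R (z, b)"
 by (rule isCont_eventually[where f="%z. (z, b)" and Q=R]) (use assms in \<open>auto intro!: continuous_intros\<close>)

lemma D_mm_first:
 assumes "sm_at mm (z, b)" shows "sm_at (%z. mm (z, b)) z" "D (%z. mm (z, b)) z w = D mm (z, b) (w, 0)"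
proof -
 have s: "sm_at (%z. (z, b)) z" by (intro sm_at_Pair sm_at_id sm_at_const)
 show "sm_at (%z. mm (z, b)) z" by (rule sm_at_compose[OF s assms])
 have "D (%z. (z, b)) z w = (w, 0)"
  by (rule D_eqI) (intro has_derivative_Pair has_derivative_ident has_derivative_const)
 thus "D (%z. mm (z, b)) z w = D mm (z, b) (w, 0)" using D_compose[OF s assms, of w] by simp
qed

lemma e_mc_dom: "near z ~ 0. e z : mc_dom G"
 using near_units1[OF ax_mul_inv] by eventually_elim (simp add: mc_dom_def)

text \<open>On the source fibre of g, right translation by its inverse is represented by
  \<open>%z'. mm (z', io z)\<close>; composability persists because the source is constant there.
  The partial derivative of \<open>mm\<close> in its first argument is \<open>th z\<close>.\<close>

lemma mc_form_coord: "near z ~ 0. ALL v. P (ch (e z) v) = 0 -->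
  fst (mc_form G (e z) v) = e (tg z) & ch (e (tg z)) (snd (mc_form G (e z) v)) = th z (ch (e z) v)"
 using near_U e_tgt e_inv tau_inv near_inv_pair[OF mm_rep] near_smooth_theta near_units1[OF ax_mul_inv]
proof eventually_elim
 case (elim z)
 show ?case
 proof (intro allI impI)
  fix v assume v: "P (ch (e z) v) = 0"
  let ?g = "e z" and ?S = "{h : gspace G. src G h = src G (e z)}"
  have g: "?g : U" "ps ?g = z" using elim(1) by auto
  have f: "mul G ?g (invg G ?g) = tgt G ?g" using elim by simp
  have r: "reps U ps U ps ?S (%h. mul G h (invg G ?g)) ?g (%z'. mm (z', io z))"
   unfolding reps_def g(2)
  proof
   show "sm_at (%z'. mm (z', io z)) z" by (rule D_mm_first(1)[OF elim(6)])
   show "near z' ~ z. e z' : ?S --> mul G (e z') (invg G ?g) : U & ps (mul G (e z') (invg G ?g)) = mm (z', io z)"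
    using near_first_arg[OF elim(5)] chart0_near[OF chart' g(1), unfolded g(2)]
   proof eventually_elim
    case (elim z')
    show ?case
    proof
     assume "e z' : ?S"
     hence "P z' = P z" using src_eq[of "e z'" ?g] elim(2) g by simp
     hence "P z' = tg (io z)" using \<open>tg (io z) = P z\<close> by simp
     thus "mul G (e z') (invg G ?g) : U & ps (mul G (e z') (invg G ?g)) = mm (z', io z)"
      using elim(1) \<open>e z : inv_dom G & invg G (e z) : U & e (io z) = invg G (e z)\<close> by simp
    qed
   qed
  qed
  have fU: "mul G ?g (invg G ?g) : U" using f elim by simp
  have "ch (mul G ?g (invg G ?g)) (derivative_along A A ?S (%h. mul G h (invg G ?g)) ?g v) = D (%z'. mm (z', io z)) (ps ?g) (ch ?g v)"
   by (rule derivative_along_coord(1)[OF good chart good chart r g(1) fU fibre_tangent[OF g(1) v]])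
  also have "\<dots> = th z (ch ?g v)" unfolding g(2) D_mm_first(2)[OF elim(6)] th_def Q_ker[OF v] ..
  finally show "fst (mc_form G (e z) v) = e (tg z) & ch (e (tg z)) (snd (mc_form G (e z) v)) = th z (ch (e z) v)"
   using elim by (simp add: mc_form_def f)
 qed
qed

text \<open>Right translation by g, restricted to the source fibre of the unit
  \<open>tgt G g\<close>, is represented by \<open>%z'. mm (z', z)\<close>, whose derivative at
  \<open>tg z\<close> is \<open>X\<close>.\<close>

lemma right_invariant_coord: "near z ~ 0. \<forall>al. P (ch (e (tg z)) (al (e (tg z)))) = 0 -->
  ch (e z) (right_invariant_field G al (e z)) = X (ch (e (tg z)) (al (e (tg z)))) z"
 using near_U e_tgt near_tau_pair[OF mm_rep] near_smooth_X near_units1[OF ax_unit_mul] P_taug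
proof eventually_elim
 case (elim z)
 show ?case
 proof (intro allI impI)
  fix al assume v: "P (ch (e (tg z)) (al (e (tg z)))) = 0"
  let ?g = "e z" and ?y = "e (tg z)" and ?S = "{h : gspace G. src G h = src G (e (tg z))}"
  have y: "?y = tgt G ?g" "?y : U" "ps ?y = tg z" using elim by (auto simp: tg_def)
  have sy: "src G ?y = tgt G ?g" unfolding y(1) by (rule src_unit[OF tgt_units]) (use elim in simp)
  have f: "mul G ?y ?g = ?g" using elim by simp
  have r: "reps U ps U ps ?S (%h. mul G h ?g) ?y (%z'. mm (z', z))"
   unfolding reps_def y(3)
  proof
   show "sm_at (%z'. mm (z', z)) (tg z)" by (rule D_mm_first(1)[OF elim(4)])
   show "near z' ~ (tg z). e z' : ?S --> mul G (e z') ?g : U & ps (mul G (e z') ?g) = mm (z', z)"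
    using near_first_arg[OF elim(3)] chart0_near[OF chart' y(2), unfolded y(3)]
   proof eventually_elim
    case (elim z')
    show ?case
    proof
     assume "e z' : ?S"
     hence "P z' = P (tg z)" using src_eq[of "e z'" ?y] elim(2) y by simp
     hence "P z' = tg z" using \<open>P (tg z) = tg z\<close> by simp
     thus "mul G (e z') ?g : U & ps (mul G (e z') ?g) = mm (z', z)"
      using elim(1) by simp
    qed
   qed
  qed
  have fU: "mul G ?y ?g : U" using f elim by simp
  have "ch (mul G ?y ?g) (derivative_along A A ?S (%h. mul G h ?g) ?y (al ?y)) = D (%z'. mm (z', z)) (ps ?y) (ch ?y (al ?y))"
   by (rule derivative_along_coord(1)[OF good chart good chart r y(2) fU fibre_tangent[OF y(2) v]])
  also have "\<dots> = X (ch ?y (al ?y)) z" unfolding y(3) D_mm_first(2)[OF elim(4)] X_def Q_ker[OF v] ..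
  finally show "ch (e z) (right_invariant_field G al (e z)) = X (ch (e (tg z)) (al (e (tg z)))) z"
   using sy y(1) unfolding right_invariant_field_def f by simp
 qed
qed

end

lemma near_box_ex:
 assumes "near z ~ (0::'e::real_normed_vector). R z" shows "EX r>0. ALL z:box P r. R z"
 by (rule near_boxes[OF assms, where P=P]) blast

section \<open>Uniqueness of curves with prescribed Maurer-Cartan form\<close>

context lie_groupoid
begin

text \<open>Local uniqueness as a property of open sets, free of coordinates: two curves in source
  fibres with the same Maurer-Cartan form that meet inside \<open>W\<close> agree near the meeting
  time. It can thus be used along curves that leave any single chart.\<close>

definition mc_unique :: "'g set => bool" where
 "mc_unique W \<longleftrightarrow> openin (gtop G) W & (ALL k l t0. t0 : {0..1} & smooth_map real_atlas A {0..1} k &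
  smooth_map real_atlas A {0..1} l &
  (ALL t:{0..1}. src G (k t) = src G (k 0) & src G (l t) = src G (l 0) &
   mc_form G (k t) (velocity A {0..1} k t) = mc_form G (l t) (velocity A {0..1} l t)) &
  k t0 = l t0 & k t0 : W --> (near t ~ t0. t : {0..1} --> k t = l t))"

lemma mc_uniqueD:
 assumes "mc_unique W" and t0: "t0 : {0..1}" and k: "smooth_map real_atlas A {0..1} k" and l: "smooth_map real_atlas A {0..1} l"
  and s: "!!t. t : {0..1} ==> src G (k t) = src G (k 0) & src G (l t) = src G (l 0)"
  and mc: "!!t. t : {0..1} ==> mc_form G (k t) (velocity A {0..1} k t) = mc_form G (l t) (velocity A {0..1} l t)"
  and kl: "k t0 = l t0" "k t0 : W"
 shows "near t ~ t0. t : {0..1} --> k t = l t"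
proof -
 have "ALL t:{0..1}. src G (k t) = src G (k 0) & src G (l t) = src G (l 0) &
   mc_form G (k t) (velocity A {0..1} k t) = mc_form G (l t) (velocity A {0..1} l t)"
  using s mc by blast
 thus ?thesis using conjunct2[OF assms(1)[unfolded mc_unique_def], rule_format, of t0 k l] t0 k l kl by blast
qed

lemma curve_near:
 assumes "smooth_map real_atlas A {0..1} k" "t : {0..1}" "openin (gtop G) W" "k t : W"
 shows "near s ~ t. s : {0..1} --> k s : W"
 using smooth_map_near[OF achart_real smooth_atlas assms(3,1,2)] assms(4) by simp

text \<open>The set of times at which the curves agree is open by local uniqueness and closed by the
  Hausdorff property, and the time interval is connected. Only the points of \<open>k\<close> have
  to lie in sets with local uniqueness.\<close>

lemma mc_unique_global:
 assumes k: "smooth_map real_atlas A {0..1} k" and l: "smooth_map real_atlas A {0..1} l"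
  and s: "!!t. t : {0..1} ==> src G (k t) = src G (k 0) & src G (l t) = src G (l 0)"
  and mc: "!!t. t : {0..1} ==> mc_form G (k t) (velocity A {0..1} k t) = mc_form G (l t) (velocity A {0..1} l t)"
  and k0: "k 0 = l 0" and W: "!!t. t : {0..1} ==> EX W. mc_unique W & k t : W" and t: "t : {0..1}"
 shows "k t = l t"
proof (rule connected_induction_simple[where S="{0..1::real}" and a=0 and P="%t. k t = l t", OF _ _ t k0])
 fix a :: real assume a: "a : {0..1}"
 have sp: "k a : gspace G" "l a : gspace G" using k l a unfolding smooth_map_def by auto
 have "EX b. near t ~ a. t : {0..1} --> (k t = l t) = b"
 proof (cases "k a = l a")
  case True
  obtain W where "mc_unique W" "k a : W" using W[OF a] by blast
  have "near t ~ a. t : {0..1} --> k t = l t"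
   by (rule mc_uniqueD[OF \<open>mc_unique W\<close> a k l _ _ True \<open>k a : W\<close>, OF s mc])
  thus ?thesis by (intro exI[of _ True]) simp
 next
  case False
  have "k a : topspace (gtop G)" "l a : topspace (gtop G)"
   using sp openin_gspace openin_subset by blast+
  then obtain V V' where V: "openin (gtop G) V" "openin (gtop G) V'" "k a : V" "l a : V'" "V \<inter> V' = {}"
   using hausdorff False unfolding Hausdorff_space_def disjnt_def by metis
  have "near t ~ a. t : {0..1} --> (k t = l t) = False"
   using curve_near[OF k a V(1,3)] curve_near[OF l a V(2,4)]
  proof eventually_elim
   case (elim t)
   thus ?case using V(5) by (metis disjoint_iff)
  qed
  thus ?thesis by blast
 qed
 then obtain b S where S: "open S" "a : S" "!!t. t : S ==> t : {0..1} --> (k t = l t) = b"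
  unfolding eventually_nhds by blast
 show "EX T. openin (top_of_set {0..1}) T & a : T & (ALL x:T. ALL y:T. (k x = l x) --> (k y = l y))"
 proof (intro exI[of _ "{0..1} \<inter> S"] conjI ballI impI)
  show "openin (top_of_set {0..1}) ({0..1} \<inter> S)" using S(1) by (rule openin_open_Int)
  fix x y assume "x : {0..1} \<inter> S" "y : {0..1} \<inter> S" "k x = l x"
  thus "k y = l y" using S(3)[of x] S(3)[of y] by simp
 qed (use a S in simp)
qed auto

end

context unit_chart
begin

lemma open_e_image: 
 assumes "open B" "B \<subseteq> box P r" shows "openin (gtop G) (e ` B)"
proof (rule openin_nearI[OF smooth_atlas])
 have eB: "e z : U & ps (e z) = z" if "z : B" for z
  using that assms(2) image_U by (metis (no_types, lifting) f_inv_into_f inv_into_into subsetD)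
 show "e ` B \<subseteq> gspace G" using eB U_space by blast
 fix x assume "x : e ` B"
 then obtain z where z: "x = e z" "z : B" by blast
 have "near w ~ z. e w : e ` B" using near_open_set[OF assms(1) z(2)] by eventually_elim blast
 thus "EX U fi. achart A U fi & x : U & (near z ~ (fi x). inv_into U fi z : e ` B)"
  using chart eB[OF z(2)] z(1) by metis
qed

lemma fibre_velocity:
 assumes k: "smooth_map real_atlas A {0..1} k" and s: "!!t. t : {0..1} ==> src G (k t) = src G (k 0)"
  and t: "t : {0..1}" "k t : U"
 shows "P (ch (k t) (velocity A {0..1} k t)) = 0"
proof -
 obtain h where h: "sm_at h t" "h t = ps (k t)"
  "near s ~ t. s : {0..1} --> k s : U & ps (k s) = h s & ch (k s) (velocity A {0..1} k s) = D h s 1"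
  by (rule curve_coords[OF good chart k t])
 have "((%s. P (h s)) hvd P (D h t 1)) (at t within {0..1})"
  by (rule bounded_linear.has_vector_derivative[OF bdd_P has_vector_derivative_at_within[OF sm_at_vector_derivative[OF h(1)]]])
 moreover have "((%s. P (h s)) hvd 0) (at t within {0..1})"
 proof -
  have "\<forall>\<^sub>F x in at t within {0..1}. P (h t) = P (h x)"
   unfolding eventually_at_filter using h(3)
  proof eventually_elim
   case (elim x)
   show ?case
   proof (intro impI)
    assume x: "x : {0..1}"
    have "src G (k x) = src G (k t)" using s[OF x] s[OF t(1)] by simp
    thus "P (h t) = P (h x)" using src_eq[of "k x" "k t"] elim x t h(2) by simp
   qed
  qed
  with has_derivative_const show ?thesis unfolding has_vector_derivative_def scaleR_zero_right
   by (rule has_derivative_transform_eventually) (use t in auto)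
 qed
 ultimately have "P (D h t 1) = 0"
  by (rule vector_derivative_unique_within[OF at_unit_interval_not_bot[OF t(1)]])
 thus ?thesis using near_self[OF h(3)] t by simp
qed

text \<open>In the adapted chart both curves are driven by the coordinates of their common
  Maurer-Cartan form, and \<open>X_ode_unique\<close> applies.\<close>

lemma mc_unique_exists: "EX W. mc_unique W & x0 : W"
proof -
 obtain r' where r': "r' > 0" "!!(c :: real => 'e) k l a b M s. (ALL t:{a..b}. norm (c t) <= M & norm (k t) < r' & norm (l t) < r' &
   (k hvd X (c t) (k t)) (at t within {a..b}) &
   (l hvd X (c t) (l t)) (at t within {a..b})) & s : {a..b} & k s = l s ==>
   ALL t:{a..b}. k t = l t"
  using X_ode_unique by blast
 have "isCont (%p. th p b) 0" for b
  using sm_at_isCont[OF sm_at_compose[where f="%p. (p, b)" and g="%q. th (fst q) (snd q)" and x=0]]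
   sm_at_Pair[OF sm_at_id sm_at_const[of b]] smooth_theta by force
 then obtain M where M: "near p ~ 0. ALL v. norm (th p v) <= M * norm v" "M >= 0"
  using linear_family_bounded[OF linear_theta] by blast
 let ?R = "%z. (e z : U & ps (e z) = z) & norm z < r' & (ALL v. norm (th z v) <= M * norm v) & (ALL w. X (th z w) z = Q w) &
  (ALL v. P (ch (e z) v) = 0 --> fst (mc_form G (e z) v) = e (tg z) & ch (e (tg z)) (snd (mc_form G (e z) v)) = th z (ch (e z) v)) &
  e (tg z) = tgt G (e z)"
 have "near z ~ 0. ?R z" using near_U near_norm_less[OF r'(1)] M(1) X_theta mc_form_coord e_tgt
  by eventually_elim simp
 from near_box_ex[OF this, of P] obtain ro where ro: "ro > 0" and ro': "ALL z:box P ro. ?R z" by (elim exE conjE)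
 note ro = ro bspec[OF ro']
 define si where "si = min ro r"
 have b: "box P si \<subseteq> box P r" "box P si \<subseteq> box P ro" by (auto simp: box_def si_def)
 have ob: "open (box P si)" by (rule open_box[OF bdd_P])
 let ?W = "e ` box P si"
 have W: "openin (gtop G) ?W" by (rule open_e_image[OF ob b(1)])
 have loc: "near t ~ t0. t : {0..1} --> k t = l t"
  if t0: "t0 : {0..1}" and k: "smooth_map real_atlas A {0..1} k" and l: "smooth_map real_atlas A {0..1} l"
   and H: "ALL t:{0..1}. src G (k t) = src G (k 0) & src G (l t) = src G (l 0) &
   mc_form G (k t) (velocity A {0..1} k t) = mc_form G (l t) (velocity A {0..1} l t)"
   and kl: "k t0 = l t0" "k t0 : ?W" for k l t0
 proof -
  have kU: "k t0 : U" "ps (k t0) : box P si" using kl(2) ro(2) b(2) by auto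
  obtain h where h: "sm_at h t0" "h t0 = ps (k t0)"
   "near s ~ t0. s : {0..1} --> k s : U & ps (k s) = h s & ch (k s) (velocity A {0..1} k s) = D h s 1"
   by (rule curve_coords[OF good chart k t0 kU(1)])
  obtain h' where h': "sm_at h' t0" "h' t0 = ps (l t0)"
   "near s ~ t0. s : {0..1} --> l s : U & ps (l s) = h' s & ch (l s) (velocity A {0..1} l s) = D h' s 1"
   by (rule curve_coords[OF good chart l t0 kU(1)[unfolded kl(1)]])
  have nb: "near s ~ t0. h s : box P si" "near s ~ t0. h' s : box P si"
   using sm_at_eventually[OF h(1) near_open_set[OF ob]] sm_at_eventually[OF h'(1) near_open_set[OF ob]]
    kU h(2) h'(2) kl by simp_all
  have "near s ~ t0. norm (D h s 1) < norm (D h t0 1) + 1"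
  proof (rule isCont_eventually[where f="%s. D h s 1" and Q="%y. norm y < norm (D h t0 1) + 1"])
   show "isCont (%s. D h s 1) t0" by (rule sm_at_isCont[OF sm_at_D[OF h(1)]])
   have "isCont norm (D h t0 1)" by (intro continuous_intros)
   thus "near y ~ (D h t0 1). norm y < norm (D h t0 1) + 1"
    by (rule isCont_eventually[where Q="%y. y < norm (D h t0 1) + 1"])
     (use near_open_set[of "{..<norm (D h t0 1) + 1}" "norm (D h t0 1)"] in simp)
  qed
  with h(3) h'(3) nb sm_at_near[OF h(1)] sm_at_near[OF h'(1)]
  have "near s ~ t0. sm_at h s & sm_at h' s & h s : box P si & h' s : box P si & norm (D h s 1) < norm (D h t0 1) + 1 &
   (s : {0..1} --> k s : U & ps (k s) = h s & ch (k s) (velocity A {0..1} k s) = D h s 1 &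
    l s : U & ps (l s) = h' s & ch (l s) (velocity A {0..1} l s) = D h' s 1)"
   by eventually_elim blast
  then obtain ep where ep: "ep > 0" "!!s. dist s t0 < ep ==> sm_at h s & sm_at h' s & h s : box P si & h' s : box P si & norm (D h s 1) < norm (D h t0 1) + 1 &
   (s : {0..1} --> k s : U & ps (k s) = h s & ch (k s) (velocity A {0..1} k s) = D h s 1 &
    l s : U & ps (l s) = h' s & ch (l s) (velocity A {0..1} l s) = D h' s 1)"
   unfolding eventually_nhds_metric by blast
  \<comment> \<open>The interval around \<open>t0\<close> is clipped to \<open>{0..1}\<close>. Half
    of \<open>ep\<close> keeps its end points at distance less than \<open>ep\<close>.\<close>
  define a where "a = max 0 (t0 - ep / 2)"
  define b' where "b' = min 1 (t0 + ep / 2)"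
  have ab: "s : {0..1}" "dist s t0 < ep" if "s : {a..b'}" for s
   using that ep(1) by (auto simp: a_def b'_def dist_real_def)
  have eq: "ALL t:{a..b'}. h t = h' t"
  proof (rule r'(2)[of a b' "%t. th (h t) (D h t 1)" "M * (norm (D h t0 1) + 1)" h h' t0], intro conjI ballI)
   show "t0 : {a..b'}" using t0 ep(1) by (auto simp: a_def b'_def)
   show "h t0 = h' t0" using h(2) h'(2) kl by simp
   fix t assume t: "t : {a..b'}"
   note E = ep(2)[OF ab(2)[OF t]] and t1 = ab(1)[OF t]
   have R: "?R (h t)" "?R (h' t)" by (rule ro(2), use E b(2) in blast)+
   have Ek: "k t : U" "ps (k t) = h t" "ch (k t) (velocity A {0..1} k t) = D h t 1"
    and El: "l t : U" "ps (l t) = h' t" "ch (l t) (velocity A {0..1} l t) = D h' t 1" using E t1 by blast+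
   have e: "e (h t) = k t" "e (h' t) = l t" using e_psi[OF Ek(1)] e_psi[OF El(1)] unfolding Ek(2) El(2) by auto
   show "norm (h t) < r'" "norm (h' t) < r'" using R by blast+
   have "norm (th (h t) (D h t 1)) <= M * norm (D h t 1)" using R by blast
   also have "\<dots> <= M * (norm (D h t0 1) + 1)" using E M(2) by (intro mult_left_mono) auto
   finally show "norm (th (h t) (D h t 1)) <= M * (norm (D h t0 1) + 1)" .
   have P0: "P (ch (k t) (velocity A {0..1} k t)) = 0" "P (ch (l t) (velocity A {0..1} l t)) = 0"
    by (rule fibre_velocity[OF k _ t1 Ek(1)], use H in blast, rule fibre_velocity[OF l _ t1 El(1)], use H in blast)
   have mc: "mc_form G (k t) (velocity A {0..1} k t) = mc_form G (l t) (velocity A {0..1} l t)" using H t1 by blast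
   have m1: "fst (mc_form G (k t) (velocity A {0..1} k t)) = e (tg (h t))"
     "ch (e (tg (h t))) (snd (mc_form G (k t) (velocity A {0..1} k t))) = th (h t) (D h t 1)"
    using R(1)[unfolded e, THEN conjunct2, THEN conjunct2, THEN conjunct2, THEN conjunct2, THEN conjunct1, rule_format, OF P0(1), unfolded Ek(3)] by blast+
   have m2: "fst (mc_form G (l t) (velocity A {0..1} l t)) = e (tg (h' t))"
     "ch (e (tg (h' t))) (snd (mc_form G (l t) (velocity A {0..1} l t))) = th (h' t) (D h' t 1)"
    using R(2)[unfolded e, THEN conjunct2, THEN conjunct2, THEN conjunct2, THEN conjunct2, THEN conjunct1, rule_format, OF P0(2), unfolded El(3)] by blast+
   have th: "th (h t) (D h t 1) = th (h' t) (D h' t 1)" using m1 m2 mc by metis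
   have q: "Q (D h t 1) = D h t 1" "Q (D h' t 1) = D h' t 1" by (rule Q_ker, use P0 in \<open>simp only: Ek El\<close>)+
   have "X (th (h t) (D h t 1)) (h t) = D h t 1" "X (th (h' t) (D h' t 1)) (h' t) = D h' t 1"
    using R(1)[THEN conjunct2, THEN conjunct2, THEN conjunct2, THEN conjunct1] R(2)[THEN conjunct2, THEN conjunct2, THEN conjunct2, THEN conjunct1] q
    by metis+
   thus "(h hvd X (th (h t) (D h t 1)) (h t)) (at t within {a..b'})"
    "(h' hvd X (th (h t) (D h t 1)) (h' t)) (at t within {a..b'})"
    unfolding th using E by (auto intro!: has_vector_derivative_at_within sm_at_vector_derivative simp: th)
  qed
  have "near t ~ t0. dist t t0 < ep / 2"
   unfolding eventually_nhds_metric using ep(1) by (intro exI[of _ "ep / 2"]) simp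
  thus ?thesis
  proof eventually_elim
   case (elim t)
   show ?case
   proof
    assume t: "t : {0..1}"
    hence ta: "t : {a..b'}" using elim unfolding a_def b'_def dist_real_def by (simp, arith)
    have "ps (k t) = ps (l t)" using ep(2)[OF ab(2)[OF ta]] t bspec[OF eq ta] by simp
    moreover have "k t : U" "l t : U" using ep(2)[OF ab(2)[OF ta]] t by auto
    ultimately show "k t = l t" using e_psi by metis
   qed
  qed
 qed
 have "mc_unique ?W" unfolding mc_unique_def using W loc by blast
 moreover have "x0 : ?W"
 proof (rule image_eqI)
  show "(0::'e) : box P si" using ro(1) r_pos by (simp add: box_def si_def)
 qed simp
 ultimately show ?thesis by blast
qed

end

section \<open>Compact balls and extension by zero from a chart\<close>

lemma compact_cube: "finite B ==> compact {SUM b:B. c b *. b | c. ALL b:B. \<bar>c b\<bar> <= R}" for B :: "'e::real_normed_vector set" and R :: real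
proof (induction B rule: finite_induct)
 case empty
 thus ?case by simp
next
 case (insert b B)
 let ?S = "%B. {SUM b:B. c b *. b | c. ALL b:B. \<bar>c b\<bar> <= R}"
 have eq: "?S (insert b B) = {x + y | x y. x : (%t. t *. b) ` {-R..R} & y : ?S B}"
 proof (intro set_eqI iffI)
  fix z assume "z : ?S (insert b B)"
  then obtain c where c: "z = (SUM b:insert b B. c b *. b)" "ALL b:insert b B. \<bar>c b\<bar> <= R" by blast
  have "z = c b *. b + (SUM b:B. c b *. b)" using c(1) insert by simp
  moreover have "c b *. b : (%t. t *. b) ` {-R..R}" using c(2) by (intro imageI) auto
  moreover have "(SUM b:B. c b *. b) : ?S B" using c(2) by blast
  ultimately show "z : {x + y | x y. x : (%t. t *. b) ` {-R..R} & y : ?S B}" by blast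
 next
  fix z assume "z : {x + y | x y. x : (%t. t *. b) ` {-R..R} & y : ?S B}"
  then obtain t c where c: "z = t *. b + (SUM b:B. c b *. b)" "t : {-R..R}" "ALL b:B. \<bar>c b\<bar> <= R" by blast
  have "(SUM a:B. (c(b := t)) a *. a) = (SUM b:B. c b *. b)" using insert(2) by (intro sum.cong) auto
  hence "z = (SUM a:insert b B. (c(b := t)) a *. a)" using c(1) insert(1,2) by simp
  moreover have "ALL a:insert b B. \<bar>(c(b := t)) a\<bar> <= R" using c by auto
  ultimately show "z : ?S (insert b B)" by blast
 qed
 have "compact ((%t. t *. b) ` {-R..R})" by (intro compact_continuous_image continuous_intros) simp
 from compact_sums[OF this insert.IH] show ?case unfolding eq .
qed

lemma compact_model_cball: "compact (cball (0::'e::model_space) R)"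
proof -
 let ?C = "{SUM b:mb. c b *. b | c. ALL b:mb. \<bar>c b\<bar> <= R} :: 'e set"
 have "cball 0 R \<subseteq> ?C"
 proof
  fix z :: 'e assume z: "z : cball 0 R"
  have "\<bar>inner z b\<bar> <= R" if "b : mb" for b
  proof -
   have "norm b = 1" using inner_mb[OF that that] by (simp add: norm_eq_sqrt_inner)
   thus ?thesis using Cauchy_Schwarz_ineq2[of z b] z by simp
  qed
  thus "z : ?C" using mb_rep[of z] by (intro CollectI exI[of _ "inner z"]) simp
 qed
 hence "cball 0 R = ?C \<inter> cball 0 R" by blast
 moreover have "compact (?C \<inter> cball 0 R)"
  by (rule compact_Int_closed[OF compact_cube[OF finite_mb] closed_cball])
 ultimately show ?thesis by simp
qed

context unit_chart
begin

lemma e_box: "z : box P r ==> e z : U & ps (e z) = z"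
 using image_U by (metis (no_types, lifting) f_inv_into_f inv_into_into)

lemma psi_box: "g : U ==> ps g : box P r" using image_U by blast

text \<open>A closed ball in the chart is compact, hence closed in the Hausdorff space of arrows.
  This is what makes extension by zero smooth.\<close>

lemma closed_e_cball:
 assumes R: "cball 0 R \<subseteq> box P r" shows "closedin (gtop G) (e ` cball 0 R)"
proof (rule compactin_imp_closedin[OF hausdorff])
 have "continuous_map (top_of_set (box P r)) (gtop G) e"
  unfolding continuous_map
 proof (intro conjI allI impI)
  show "e ` topspace (top_of_set (box P r)) \<subseteq> topspace (gtop G)"
   using e_box U_space openin_subset[OF openin_gspace] by auto
  fix W assume W: "openin (gtop G) W"
  have "open {z : box P r. e z : W}"
  proof (rule open_subopen[THEN iffD2], rule ballI)
   fix z assume z: "z : {z : box P r. e z : W}"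
   have "near w ~ z. e w : W"
    using openin_near[OF smooth_atlas W chart, of "e z"] e_box[of z] z by simp
   with near_open_set[OF open_box[OF bdd_P, of r], of z] z
   have "near w ~ z. w : {z : box P r. e z : W}" by (auto elim: eventually_elim2)
   thus "EX T. open T & z : T & T \<subseteq> {z : box P r. e z : W}" unfolding eventually_nhds by blast
  qed
  moreover have "{z : topspace (top_of_set (box P r)). e z : W} = {z : box P r. e z : W}" by simp
  ultimately show "openin (top_of_set (box P r)) {z : topspace (top_of_set (box P r)). e z : W}"
   unfolding openin_open_eq[OF open_box[OF bdd_P, of r]] by auto
 qed
 moreover have "compactin (top_of_set (box P r)) (cball 0 R)"
  using R compact_model_cball by (simp add: compactin_subtopology)
 ultimately show "compactin (gtop G) (e ` cball 0 R)" by (intro image_compactin)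
qed

text \<open>The complement of the closed ball is a neighbourhood of a point outside the chart;
  functions and sections vanishing beyond radius \<open>R\<close> are zero on it.\<close>

lemma off_support:
 assumes R: "cball 0 R \<subseteq> box P r" and x: "x : gspace G" "x ~: U"
 shows "EX O'. openin (gtop G) O' & x : O' & (ALL g:O'. g : U --> norm (ps g) > R)"
proof (intro exI[of _ "gspace G - e ` cball 0 R"] conjI ballI impI)
 have "x ~: e ` cball 0 R" using x e_box R by blast
 thus "x : gspace G - e ` cball 0 R" using x by simp
 show "openin (gtop G) (gspace G - e ` cball 0 R)"
  by (rule openin_diff[OF openin_gspace closed_e_cball[OF R]])
 fix g assume g: "g : gspace G - e ` cball 0 R" "g : U"
 hence "ps g ~: cball 0 R" by (metis DiffD2 e_psi imageI)
 thus "norm (ps g) > R" by simp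
qed

definition ext_field :: "('e => 'e) => 'g => 'e" where
 "ext_field W g = (if g : U then chi g (W (ps g)) else 0)"

lemma ext_field_section:
 assumes R: "cball 0 R \<subseteq> box P r" and W: "!!z. z : box P r ==> sm_at W z" "!!z. P (W z) = 0" "!!z. norm z >= R ==> W z = 0"
 shows "algebroid_section G (ext_field W)"
 unfolding algebroid_section_def
proof (intro conjI ballI)
 have off: "EX O'. openin (gtop G) O' & x : O' & (ALL g:O'. ext_field W g = 0)" if x: "x : units G" "x ~: U" for x
 proof -
  have "x : gspace G" using x units_space by blast
  from off_support[OF R this x(2)] obtain O' where O': "openin (gtop G) O'" "x : O'" "ALL g:O'. g : U --> norm (ps g) > R"
   by blast
  have "ext_field W g = 0" if "g : O'" for g
  proof (cases "g : U")
   case True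
   hence "W (ps g) = 0" using O'(3) that W(3)[of "ps g"] by auto
   thus ?thesis by (simp add: ext_field_def linear_0[OF linear_tinv[OF good chart True]])
  qed (simp add: ext_field_def)
  thus ?thesis using O' by blast
 qed
 show "(x, ext_field W x) : algebroid G" if x: "x : units G" for x
 proof (cases "x : U")
  case True
  thus ?thesis using x by (simp add: algebroid_iff ext_field_def tcoord_inv[OF good chart] W)
 next
  case False
  hence 0: "ext_field W x = 0" using off[OF x] by blast
  obtain U' ps' P' r' where "unit_chart G x U' ps' P' r'" by (rule unit_chart_exists[OF x])
  then interpret C: unit_chart G x U' ps' P' r' .
  show ?thesis unfolding 0 C.algebroid_iff[OF C.x0_U]
   using x linear_0[OF lin_tcoord[OF good C.chart C.x0_U]] C.P_0 by simp
 qed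
 show "smooth_map A (tangent_atlas A) (units G) (%x. (x, ext_field W x))"
 proof (rule smooth_mapI[OF good good_atlas_tangent[OF good] units_space])
  fix x assume x: "x : units G"
  show "EX U fi V ps h. achart A U fi & achart (tangent_atlas A) V ps & x : U & (x, ext_field W x) : V &
    reps U fi V ps (units G) (%x. (x, ext_field W x)) x h"
  proof (cases "x : U")
   case True
   have "reps U ps (U \<times> UNIV) (tchart A ps) (units G) (%x. (x, ext_field W x)) x (%z. (z, W z))"
    unfolding reps_def
   proof
    show "sm_at (%z. (z, W z)) (ps x)" by (intro sm_at_Pair sm_at_id W psi_box True)
    show "near z ~ (ps x). e z : units G --> (e z, ext_field W (e z)) : U \<times> UNIV & tchart A ps (e z, ext_field W (e z)) = (z, W z)"
     using chart0_near[OF chart' True]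
     by eventually_elim (simp add: ext_field_def tcoord_inv[OF good chart])
   qed
   thus ?thesis using chart achart_tangent[OF good chart] True by blast
  next
   case False
   obtain O' where O': "openin (gtop G) O'" "x : O'" "ALL g:O'. ext_field W g = 0" using off[OF x False] by blast
   obtain U' ps' P' r' where "unit_chart G x U' ps' P' r'" by (rule unit_chart_exists[OF x])
   then interpret C: unit_chart G x U' ps' P' r' .
   have "reps U' ps' (U' \<times> UNIV) (tchart A ps') (units G) (%x. (x, ext_field W x)) x (%z. (z, 0::'e))"
    unfolding reps_def
   proof
    show "sm_at (%z. (z, 0::'e)) (ps' x)" by (intro sm_at_Pair sm_at_id sm_at_const)
    have "near z ~ (ps' x). C.e z : O'" using openin_near[OF smooth_atlas O'(1) C.chart C.x0_U O'(2)] .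
    thus "near z ~ (ps' x). C.e z : units G --> (C.e z, ext_field W (C.e z)) : U' \<times> UNIV & tchart A ps' (C.e z, ext_field W (C.e z)) = (z, 0)"
     using chart0_near[OF C.chart' C.x0_U]
     by eventually_elim (use O'(3) in \<open>simp add: linear_0[OF lin_tcoord[OF good C.chart]]\<close>)
   qed
   thus ?thesis using C.chart achart_tangent[OF good C.chart] C.x0_U by blast
  qed
 qed
qed

lemma ext_function_smooth:
 fixes w :: "'e => real"
 assumes R: "cball 0 R \<subseteq> box P r" and W: "!!z. z : box P r ==> sm_at w z" "!!z. norm z >= R ==> w z = 0"
 shows "smooth_map A real_atlas (units G) (%g. if g : U then w (ps g) else 0)" (is "smooth_map _ _ _ ?u")
proof (rule smooth_mapI[OF good achart_real(1) units_space])
 fix x assume x: "x : units G"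
 hence xs: "x : gspace G" using units_space by blast
 show "EX U fi V ps h. achart A U fi & achart real_atlas V ps & x : U & ?u x : V & reps U fi V ps (units G) ?u x h"
 proof (cases "x : U")
  case True
  have "reps U ps UNIV (%t. t) (units G) ?u x w"
   unfolding reps_def
  proof
   show "sm_at w (ps x)" by (rule W(1)[OF psi_box[OF True]])
   show "near z ~ (ps x). e z : units G --> ?u (e z) : UNIV & ?u (e z) = w z"
    using chart0_near[OF chart' True] by eventually_elim simp
  qed
  thus ?thesis using chart achart_real(2) True by blast
 next
  case False
  obtain O' where O': "openin (gtop G) O'" "x : O'" "ALL g:O'. g : U --> norm (ps g) > R"
   using off_support[OF R xs False] by blast
  obtain U' ps' P' r' where "unit_chart G x U' ps' P' r'" by (rule unit_chart_exists[OF x])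
  then interpret C: unit_chart G x U' ps' P' r' .
  have "reps U' ps' UNIV (%t. t) (units G) ?u x (%z. 0)"
   unfolding reps_def
  proof
   show "sm_at (%z. 0::real) (ps' x)" by (rule sm_at_const)
   show "near z ~ (ps' x). C.e z : units G --> ?u (C.e z) : UNIV & ?u (C.e z) = 0"
    using openin_near[OF smooth_atlas O'(1) C.chart C.x0_U O'(2)] 
    by eventually_elim (use O'(3) W(2) in \<open>auto intro: less_imp_le\<close>)
  qed
  thus ?thesis using C.chart achart_real(2) C.x0_U by blast
 qed
qed

lemma P_D_tau: "near z ~ 0. ALL w. P (D tg z w) = D tg z w"
 using near_near[OF P_taug] sm_at_near[OF tau_rep(1)]
proof eventually_elim
 case (elim z)
 show ?case
 proof
  fix w
  have "D (%z. P (tg z)) z w = P (D tg z w)"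
   using D_compose[OF elim(2) sm_at_blinear[OF bdd_P], of w] D_linear[OF bdd_P] by simp
  moreover have "D (%z. P (tg z)) z w = D tg z w"
   by (rule D_transform[OF elim(2)]) (use elim(1) in \<open>eventually_elim, simp\<close>)
  ultimately show "P (D tg z w) = D tg z w" by simp
 qed
qed

lemma anchor_coord: "near z ~ 0. P z = z --> (ALL a. ch (e z) (anchor G (e z) a) = D tg z (ch (e z) a))"
 using near_U near_near[OF e_tgt] sm_at_near[OF tau_rep(1)] e_unit
proof eventually_elim
 case (elim z)
 show ?case
 proof (intro impI allI)
  fix a assume Pz: "P z = z"
  have z: "e z : U" "ps (e z) = z" "e z : units G" using elim Pz by auto
  have t: "tgt G (e z) = e z" by (rule tgt_unit[OF z(3)])
  have "reps U ps U ps UNIV (tgt G) (e z) tg" unfolding reps_def z(2)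
   using elim(3) by (rule conjI) (use elim(2) in \<open>eventually_elim, simp add: tg_def\<close>)
  from tcoord_differential[OF good chart good chart this z(1)] z t
  show "ch (e z) (anchor G (e z) a) = D tg z (ch (e z) a)" unfolding anchor_def by simp
 qed
qed

lemma anchor_tangent: "near z ~ 0. P z = z --> (ALL a. anchor G (e z) a : tangent_space A (units G) (e z))"
 using near_U e_unit anchor_coord P_D_tau
proof eventually_elim
 case (elim z)
 show ?case
  by (intro impI allI unit_tangent) (use elim in auto)
qed

lemma derivative_along_units:
 fixes B :: "('n, 'd::model_space) chart set"
 assumes B: "gatlas B" "achart B V et" and h: "sm_at h 0" "near z ~ 0. P z = z --> u (e z) : V & et (u (e z)) = h z"
 shows "near z ~ 0. P z = z --> (ALL a. tangent_coord B et (u (e z)) (derivative_along A B (units G) u (e z) (anchor G (e z) a)) =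
  D h z (D tg z (ch (e z) a)))"
 using near_U e_unit anchor_coord anchor_tangent near_near[OF h(2)] sm_at_near[OF h(1)] h(2)
proof eventually_elim
 case (elim z)
 show ?case
 proof (intro impI allI)
  fix a assume Pz: "P z = z"
  have z: "e z : U" "ps (e z) = z" using elim by auto
  have r: "reps U ps V et (units G) u (e z) h" unfolding reps_def z(2)
  proof
   show "near w ~ z. e w : units G --> u (e w) : V & et (u (e w)) = h w"
    using elim(5) chart0_near[OF chart' z(1), unfolded z(2)]
    by eventually_elim (auto simp: unit_iff)
  qed (rule elim(6))
  have uV: "u (e z) : V" using elim(7) Pz by blast
  have at: "anchor G (e z) a : tangent_space A (units G) (e z)" using elim(4) Pz by blast
  show "tangent_coord B et (u (e z)) (derivative_along A B (units G) u (e z) (anchor G (e z) a)) = D h z (D tg z (ch (e z) a))"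
   using derivative_along_coord(1)[OF good chart B r z(1) uV at] elim(3) Pz z(2) by simp
 qed
qed

text \<open>The right-invariant field at an arrow depends only on the value of the section at the
  target unit. A section that is constant in the chart near \<open>x0\<close> therefore induces
  \<open>X v\<close> near \<open>x0\<close>.\<close>

lemma bracket_coord:
 assumes al: "near z ~ 0. P z = z --> ch (e z) (al (e z)) = Q v"
  and be: "near z ~ 0. P z = z --> ch (e z) (be (e z)) = Q w"
 shows "near z ~ 0. ch (e z) (algebroid_bracket G al be (e z)) = br v w z"
proof -
 have key: "near z ~ 0. ch (e z) (right_invariant_field G al (e z)) = X v z"
  if al: "near z ~ 0. P z = z --> ch (e z) (al (e z)) = Q v" for al v
  using right_invariant_coord near_taug[OF al] P_taug
 proof eventually_elim
  case (elim z)
  hence "ch (e (tg z)) (al (e (tg z))) = Q v" by simp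
  thus ?case using elim(1)[rule_format, of al] by (simp add: X_Q)
 qed
 show ?thesis
  using near_near[OF key[OF al]] near_near[OF key[OF be]] near_U near_smooth_Xv
 proof eventually_elim
  case (elim z)
  have z: "e z : U" "ps (e z) = z" using elim by auto
  show ?case unfolding algebroid_bracket_def br_def
   using lie_bracket_coord[OF good chart z(1), of "X v" "right_invariant_field G al" "X w" "right_invariant_field G be"]
    elim unfolding z(2) by simp
 qed
qed

end

lemma tcoord_real [simp]: "tangent_coord real_atlas (%t. t) x v = v"
proof -
 have x: "x : mfd_space real_atlas" by (simp add: mfd_space_def real_atlas_def)
 have "coord real_atlas x = (%t. t)" using chart_at_mem[OF x] by (auto simp: real_atlas_def)
 thus ?thesis using tcoord_self[OF achart_real(1) x, of v] by simp
qed

lemma linear_eq_lift: "linear L ==> (SUM b:mb. inner x b *. L b) = L (x::'a::model_space)"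
 using lin_mb_sum[of L x] by simp

context local_model
begin

lemma linear_D_X: "near h ~ 0. ALL u. linear (%w. D (X w) h u)"
 using near_near[OF linear_X] near_smooth_Xv
proof eventually_elim
 case (elim h)
 show ?case
 proof (intro allI linearI)
  fix u v w and c :: real
  have s: "(X v hder D (X v) h) (at h)" for v using elim(2) sm_at_has_derivative by blast
  have "near y ~ h. X v y + X w y = X (v + w) y" using elim(1)
  proof eventually_elim
   case (elim y)
   from linear_add[OF this, of v w] show ?case by simp
  qed
  from D_eqI[OF hder_transform[OF has_derivative_add[OF s s] this]]
  show "D (X (v + w)) h u = D (X v) h u + D (X w) h u" .
  have "near y ~ h. c *. X v y = X (c *. v) y" using elim(1)
  proof eventually_elim
   case (elim y)
   from linear_scale[OF this, of c v] show ?case by simp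
  qed
  from D_eqI[OF hder_transform[OF has_derivative_scaleR_right[OF s] this]]
  show "D (X (c *. v)) h u = c *. D (X v) h u" .
 qed
qed

lemma bilinear_br: "near h ~ 0. (ALL w. linear (%v. br v w h)) & (ALL v. linear (%w. br v w h))"
 using linear_D_X linear_X near_smooth_Xv
proof eventually_elim
 case (elim h)
 have D: "linear (D (X w) h)" for w using elim(3) sm_at_linear by blast
 have 1: "linear (%v. D (X w) h (X v h))" for w using linear_compose[OF elim(2) D[of w]] by (simp add: o_def)
 have 2: "linear (%v. D (X v) h (X w h))" for w using elim(1) by blast
 show ?case unfolding br_def using 1 2 by (auto intro: linear_compose_sub)
qed

end

section \<open>Morphisms in adapted charts\<close>

locale mor_charts = C: unit_chart G x0 U ps P r + K: unit_chart H "fM x0" V et P' r'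
 for G :: "('g, 'a::model_space) local_groupoid" and x0 U ps P r
  and H :: "('h, 'b::model_space) local_groupoid" and fM V et P' r' +
 fixes f :: "'g \<times> 'a => 'h \<times> 'b"
 assumes morph: "algebroid_morphism G H f fM"
begin

lemma
 shows smooth_fM: "smooth_map C.A K.A (units G) fM" and fM_units: "x : units G ==> fM x : units H"
  and smooth_fg: "smooth_map (tangent_atlas C.A) (tangent_atlas K.A) (algebroid G) f"
  and f_alg: "q : algebroid G ==> f q : algebroid H"
 using morph unfolding algebroid_morphism_def by - (elim conjE, (assumption | (erule subsetD, rule imageI, assumption)))+

lemma
 shows f_fst': "ALL (x, a):algebroid G. fst (f (x, a)) = fM x"
  and f_lin': "ALL x a b r s. (x, a) : algebroid G --> (x, b) : algebroid G -->
    snd (f (x, r *. a + s *. b)) = r *. snd (f (x, a)) + s *. snd (f (x, b))"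
  and f_anchor': "ALL (x, a):algebroid G. anchor H (fM x) (snd (f (x, a)))
     = derivative_along (atlas G) (atlas H) (units G) fM x (anchor G x a)"
  and f_bracket': "\<forall>al be m a zi n b \<zeta>.
    algebroid_section G al --> algebroid_section G be -->
    decomposition G H f fM al m a zi --> decomposition G H f fM be n b \<zeta> -->
    (ALL x:units G.
     snd (f (x, algebroid_bracket G al be x)) =
      (\<Sum>i<m. \<Sum>j<n. (a i x * b j x) *. algebroid_bracket H (zi i) (\<zeta> j) (fM x)) +
      (\<Sum>j<n. anchor_derivative G al (b j) x *. \<zeta> j (fM x)) -
      (\<Sum>i<m. anchor_derivative G be (a i) x *. zi i (fM x)))"
 using morph unfolding algebroid_morphism_def by - (elim conjE, assumption)+

lemma f_fst: "(x, a) : algebroid G ==> fst (f (x, a)) = fM x" using f_fst' by auto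

lemmas f_lin = f_lin'[rule_format]

lemma f_anchor: "(x, a) : algebroid G ==> anchor H (fM x) (snd (f (x, a))) = derivative_along C.A K.A (units G) fM x (anchor G x a)"
 using f_anchor' by auto

lemmas f_bracket = f_bracket'[rule_format]

definition "ph z = et (fM (C.e (P z)))"
text \<open>Composition with \<open>P\<close> and \<open>C.Q\<close> extends the bundle map to all
  points and vectors. The value 0 outside the chart keeps \<open>fh z\<close> linear for every z, as
  \<open>local_morphism\<close> demands.\<close>

definition "fh z v = (if P z : box P r & fM (C.e (P z)) : V
 then K.ch (fM (C.e (P z))) (snd (f (C.e (P z), C.chi (C.e (P z)) (C.Q v)))) else 0)"

lemma near_box: "near z ~ 0. z : box P r"
 by (rule near_open_set[OF open_box[OF C.bdd_P]]) (use C.r_pos in \<open>simp add: box_def\<close>)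

lemma e_P_unit: "P z : box P r ==> C.e (P z) : U & C.e (P z) : units G & ps (C.e (P z)) = P z"
 using C.e_box[of "P z"] C.unit_iff by simp

lemma alg_Q: "P z : box P r ==> (C.e (P z), C.chi (C.e (P z)) (C.Q v)) : algebroid G"
 using e_P_unit[of z] by (simp add: C.algebroid_iff tcoord_inv[OF C.good C.chart])

lemma linear_fh: "linear (fh z)"
proof (cases "P z : box P r & fM (C.e (P z)) : V")
 case True
 let ?x = "C.e (P z)"
 note x = e_P_unit[of z]
 have lc: "linear (%v. C.chi ?x (C.Q v))"
  using linear_compose[OF C.linear_Q linear_tinv[OF C.good C.chart, of ?x]] x True by (simp add: o_def)
 have lf: "linear (%v. snd (f (?x, C.chi ?x (C.Q v))))"
 proof (rule linearI)
  fix v w and c :: real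
  note al = alg_Q[of z, OF conjunct1[OF True]]
  show "snd (f (?x, C.chi ?x (C.Q (v + w)))) = snd (f (?x, C.chi ?x (C.Q v))) + snd (f (?x, C.chi ?x (C.Q w)))"
   using f_lin[OF al[of v] al[of w], of 1 1] linear_add[OF lc, of v w] by simp
  show "snd (f (?x, C.chi ?x (C.Q (c *. v)))) = c *. snd (f (?x, C.chi ?x (C.Q v)))"
   using f_lin[OF al[of v] al[of v], of c 0] linear_scale[OF lc, of c v] by simp
 qed
 have "linear (K.ch (fM ?x))" by (rule lin_tcoord[OF K.good K.chart]) (use True in blast)
 from linear_compose[OF lf this] show ?thesis using True unfolding fh_def[abs_def] o_def by simp
next
 case False
 hence "fh z = (%v. 0)" by (intro ext) (auto simp: fh_def)
 thus ?thesis by (simp add: linear_zero)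
qed

lemma fM_rep: "near z ~ 0. P z = z --> fM (C.e z) : V & et (fM (C.e z)) = ph z" "sm_at ph 0"
  and fM_V: "near z ~ 0. fM (C.e (P z)) : V"
proof -
 obtain h where "reps U ps V et (units G) fM x0 h"
  by (rule smooth_map_rep[OF C.good C.chart K.good K.chart smooth_fM C.x0_unit C.x0_U K.x0_U])
 hence h: "sm_at h 0" "near z ~ 0. C.e z : units G --> fM (C.e z) : V & et (fM (C.e z)) = h z"
  by (auto simp: reps_def)
 have 1: "near z ~ 0. fM (C.e (P z)) : V & ph z = h (P z)"
  using C.near_P[OF h(2)] C.near_P[OF C.e_unit] by eventually_elim (simp add: ph_def)
 thus "near z ~ 0. fM (C.e (P z)) : V" by eventually_elim simp
 show "near z ~ 0. P z = z --> fM (C.e z) : V & et (fM (C.e z)) = ph z"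
  using 1 by eventually_elim (metis ph_def)
 have "sm_at (%z. h (P z)) 0"
  by (rule sm_at_compose[OF sm_at_blinear[OF C.bdd_P]]) (simp add: h)
 thus "sm_at ph 0" by (rule sm_at_transform) (use 1 in \<open>eventually_elim, simp\<close>)
qed

lemma ph_0 [simp]: "ph 0 = 0" by (simp add: ph_def)

lemma near_ph: "near y ~ 0. R y ==> near z ~ 0. R (ph z)"
 by (rule sm_at_eventually[OF fM_rep(2)]) simp

lemma e_ph: "near z ~ 0. K.e (ph z) = fM (C.e (P z))"
 using fM_V by eventually_elim (simp add: ph_def)

lemma P_ph: "near z ~ 0. P' (ph z) = ph z"
 using fM_V C.near_P[OF near_box]
proof eventually_elim
 case (elim z)
 thus ?case using K.unit_iff[of "fM (C.e (P z))"] fM_units e_P_unit[of z] by (simp add: ph_def)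
qed

lemma P_fh: "P' (fh z v) = 0"
proof (cases "P z : box P r & fM (C.e (P z)) : V")
 case True
 let ?q = "(C.e (P z), C.chi (C.e (P z)) (C.Q v))"
 have q: "?q : algebroid G" using alg_Q True by blast
 have "f ?q = (fM (C.e (P z)), snd (f ?q))" using f_fst[OF q] by (metis prod.collapse)
 hence "(fM (C.e (P z)), snd (f ?q)) : algebroid H" using f_alg[OF q] by metis
 thus ?thesis using K.algebroid_iff True unfolding fh_def by simp
qed (auto simp: fh_def K.P_0)

lemma Q_fh: "K.Q (fh z v) = fh z v" by (rule K.Q_ker[OF P_fh])

lemma fh_eq: "P z = z ==> z : box P r ==> fM (C.e z) : V ==> fh z v = K.ch (fM (C.e z)) (snd (f (C.e z, C.chi (C.e z) (C.Q v))))"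
 by (simp add: fh_def)

text \<open>A representative of f is available only near the zero vector over \<open>x0\<close>. The
  vector \<open>v\<close> is scaled into that region by a small s, and linearity of f on fibres
  undoes the scaling.\<close>

lemma smooth_fh: "sm_at (%z. fh z v) 0"
proof -
 have x0a: "(x0, 0) : algebroid G"
  using C.x0_unit C.x0_U by (simp add: C.algebroid_iff linear_0[OF lin_tcoord[OF C.good C.chart]])
 have t0: "tangent_coord C.A ps x0 0 = 0" by (rule linear_0[OF lin_tcoord[OF C.good C.chart C.x0_U]])
 have "fst (f (x0, 0)) : V" using f_fst[OF x0a] K.x0_U by simp
 hence fV: "f (x0, 0) : V \<times> UNIV" by (metis UNIV_I mem_Times_iff)
 obtain h where "reps (U \<times> UNIV) (tchart C.A ps) (V \<times> UNIV) (tchart K.A et) (algebroid G) f (x0, 0) h"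
  by (rule smooth_map_rep[OF good_atlas_tangent[OF C.good] achart_tangent[OF C.good C.chart] good_atlas_tangent[OF K.good]
    achart_tangent[OF K.good K.chart] smooth_fg x0a _ fV]) (use C.x0_U in simp)
 hence h: "sm_at h (0, 0)" "near q ~ (0, 0). inv_into (U \<times> UNIV) (tchart C.A ps) q : algebroid G -->
   f (inv_into (U \<times> UNIV) (tchart C.A ps) q) : V \<times> UNIV & tchart K.A et (f (inv_into (U \<times> UNIV) (tchart C.A ps) q)) = h q"
  by (auto simp: reps_def t0)
 have "near q ~ (0, 0). inv_into (U \<times> UNIV) (tchart C.A ps) q =
   (C.e (fst q), C.chi (C.e (fst q)) (snd q)) & C.e (fst q) : U"
  using inv_tangent_near[OF C.good C.chart C.x0_U, of 0] by simp
 with h(2) have "near q ~ (0, 0). (C.e (fst q), C.chi (C.e (fst q)) (snd q)) : algebroid G -->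
   tchart K.A et (f (C.e (fst q), C.chi (C.e (fst q)) (snd q))) = h q"
  by eventually_elim simp
 with sm_at_near[OF h(1)] have "near q ~ (0, 0). sm_at h q & ((C.e (fst q), C.chi (C.e (fst q)) (snd q)) : algebroid G -->
   tchart K.A et (f (C.e (fst q), C.chi (C.e (fst q)) (snd q))) = h q)" (is "near q ~ (0, 0). ?E q")
  by eventually_elim simp
 hence E2: "near q ~ (0, 0). near q' ~ q. ?E q'" by (rule near_near)
 have "near s ~ (0::real). near q' ~ (0, s *. C.Q v). ?E q'"
  by (rule isCont_eventually[where f="%s. (0, s *. C.Q v)" and Q="%q. near q' ~ q. ?E q'"])
   (use E2 in \<open>auto intro!: continuous_intros\<close>)
 then obtain d where d: "d > 0" "!!s. dist s 0 < d ==> near q' ~ (0, s *. C.Q v). ?E q'"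
  unfolding eventually_nhds_metric[of _ "0::real"] by blast
 define s where "s = d / 2"
 have s: "s > 0" "near q' ~ (0, s *. C.Q v). ?E q'" using d by (auto simp: s_def)
 have smP: "sm_at (%z. (P z, s *. C.Q v)) 0"
  by (intro sm_at_Pair sm_at_blinear[OF C.bdd_P] sm_at_const)
 have hs: "sm_at h (0, s *. C.Q v)" using near_self[OF s(2)] by blast
 have "sm_at (%z. h (P z, s *. C.Q v)) 0" by (rule sm_at_compose[OF smP]) (simp add: hs)
 hence "sm_at (%z. (1 / s) *. snd (h (P z, s *. C.Q v))) 0"
  by (intro sm_at_scaleR sm_at_const sm_at_snd)
 moreover have "near z ~ 0. ?E (P z, s *. C.Q v)"
  by (rule sm_at_eventually[OF smP, where Q="?E"]) (use s(2) in simp)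
 hence "near z ~ 0. (1 / s) *. snd (h (P z, s *. C.Q v)) = fh z v"
  using C.near_P[OF near_box] fM_V
 proof eventually_elim
  case (elim z)
  let ?x = "C.e (P z)"
  have Qs: "C.Q (s *. v) = s *. C.Q v" by (rule linear_scale[OF C.linear_Q])
  have a: "(?x, C.chi ?x (s *. C.Q v)) : algebroid G" using alg_Q[OF elim(2), of "s *. v"] unfolding Qs .
  let ?w = "f (?x, C.chi ?x (s *. C.Q v))"
  have "h (P z, s *. C.Q v) = tchart K.A et ?w" using elim(1) a by simp
  also have "\<dots> = (et (fst ?w), tangent_coord K.A et (fst ?w) (snd ?w))" by (simp only: case_prod_unfold)
  also have "fst ?w = fM ?x" by (rule f_fst[OF a])
  finally have "snd (h (P z, s *. C.Q v)) = K.ch (fM ?x) (snd ?w)" by simp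
  also have "\<dots> = fh z (s *. v)" using elim unfolding fh_def Qs by simp
  finally show ?case using s(1) by (simp add: linear_scale[OF linear_fh])
 qed
 ultimately show ?thesis by (rule sm_at_transform)
qed

lemma near_smooth_fh: "near z ~ 0. ALL v. sm_at (%z. fh z v) z"
proof -
 have "near z ~ 0. ALL b:mb. sm_at (%z. fh z b) z"
  by (intro eventually_ball_finite finite_mb ballI sm_at_near smooth_fh)
 thus ?thesis
 proof eventually_elim
  case (elim z)
  show ?case
  proof
   fix v
   have "sm_at (%z. SUM b:mb. inner v b *. fh z b) z"
    by (intro sm_at_sum sm_at_scaleR sm_at_const) (use elim in blast)
   thus "sm_at (%z. fh z v) z" unfolding lin_mb_sum[OF linear_fh, symmetric] .
  qed
 qed
qed

lemma D_fh_ker: "sm_at (%z. fh z v) z ==> K.Q (D (%z. fh z v) z u) = D (%z. fh z v) z u"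
proof (rule K.Q_ker)
 assume s: "sm_at (%z. fh z v) z"
 have "D (%z. P' (fh z v)) z u = P' (D (%z. fh z v) z u)"
  using D_compose[OF s sm_at_blinear[OF K.bdd_P], of u] K.D_linear[OF K.bdd_P] by simp
 moreover have "D (%z. P' (fh z v)) z u = 0" unfolding P_fh by (rule D_eqI) (rule has_derivative_const)
 ultimately show "P' (D (%z. fh z v) z u) = 0" by simp
qed

lemma anchor_fh: "near x ~ 0. P x = x --> (ALL v. D ph x (D C.tg x (C.Q v)) = D K.tg (ph x) (fh x v))"
 using C.derivative_along_units[OF K.good K.chart fM_rep(2) fM_rep(1)] near_ph[OF K.anchor_coord] e_ph P_ph near_box fM_V
proof eventually_elim
 case (elim z)
 show ?case
 proof (intro impI allI)
  fix v assume Pz: "P z = z"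
  let ?x = "C.e z" and ?a = "C.chi (C.e z) (C.Q v)"
  have x: "?x : U" using C.e_box[OF elim(5)] by blast
  have a: "(?x, ?a) : algebroid G" using alg_Q[of z v] elim(5) Pz by simp
  have ca: "C.ch ?x ?a = C.Q v" by (rule tcoord_inv[OF C.good C.chart x])
  have eph: "K.e (ph z) = fM ?x" using elim(3) Pz by simp
  have "D ph z (D C.tg z (C.Q v)) = K.ch (fM ?x) (derivative_along C.A K.A (units G) fM ?x (anchor G ?x ?a))"
   using elim(1)[rule_format, OF Pz, of ?a] by (simp only: ca)
  also have "\<dots> = K.ch (fM ?x) (anchor H (fM ?x) (snd (f (?x, ?a))))" by (simp add: f_anchor[OF a])
  also have "\<dots> = D K.tg (ph z) (K.ch (fM ?x) (snd (f (?x, ?a))))" using elim(2,4) by (simp add: eph)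
  also have "K.ch (fM ?x) (snd (f (?x, ?a))) = fh z v" using fh_eq[OF Pz elim(5)] elim(6) Pz by simp
  finally show "D ph z (D C.tg z (C.Q v)) = D K.tg (ph z) (fh z v)" .
 qed
qed

end

lemma bump_times:
 fixes be :: "'e::model_space => real" and w :: "'e => 'b::real_normed_vector"
 assumes be: "smooth_on UNIV be" "!!z. norm z >= R ==> be z = 0" and w: "!!z. norm z < d ==> sm_at w z" and d: "R < d"
 shows "sm_at (%z. be z *. w z) z"
proof (cases "norm z < d")
 case True
 thus ?thesis by (intro sm_at_scaleR sm_at_on[OF be(1)] w) auto
next
 case False
 have "open {z::'e. R < norm z}" by (intro open_Collect_less continuous_intros)
 hence "near y ~ z. y : {z. R < norm z}" by (rule near_open_set) (use False d in simp)
 hence "near y ~ z. 0 = be y *. w y" by eventually_elim (simp add: be(2))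
 thus ?thesis by (rule sm_at_transform[OF sm_at_const])
qed

context mor_charts
begin

text \<open>The constant sections \<open>C.Q v\<close> and \<open>K.Q b\<close> are cut off to
  global sections \<open>al v\<close> and \<open>zi b\<close>. The coefficients
  \<open>a v b\<close>, cut off by the same function as \<open>al v\<close>, decompose the image of
  \<open>al v\<close>. Near the origin all cutoffs equal 1, so the hypothesis on brackets becomes
  the coordinate formula.\<close>

lemma bracket_fh: "near x ~ 0. P x = x --> (ALL v w. fh x (C.br v w x) = K.br (fh x v) (fh x w) (ph x) +
   D (%x. fh x w) x (D C.tg x (C.Q v)) - D (%x. fh x v) x (D C.tg x (C.Q w)))"
proof -
 obtain d' where d': "d' > 0" "!!y. norm y < d' ==> y : box P' r'"
 proof -
  have "near y ~ 0. y : box P' r'"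
   by (rule near_open_set[OF open_box[OF K.bdd_P]]) (use K.r_pos in \<open>simp add: box_def K.P_0\<close>)
  thus ?thesis unfolding eventually_nhds_metric using that by (auto simp: dist_norm)
 qed
 define ro' where "ro' = d' / 3"
 have ro': "ro' > 0" "2 * ro' < d'" using d' by (auto simp: ro'_def)
 have R': "cball 0 (2 * ro') \<subseteq> box P' r'"
 proof
  fix y :: 'b assume "y : cball 0 (2 * ro')"
  thus "y : box P' r'" using d'(2)[of y] ro'(2) by simp
 qed
 obtain be' :: "'b => real" where be': "smooth_on UNIV be'" "!!z. norm z <= ro' ==> be' z = 1"
  "!!z. norm z >= 2 * ro' ==> be' z = 0" by (rule bump_function[OF ro'(1)]) blast
 \<comment> \<open>The last conjunct makes the cutoff \<open>be'\<close> equal to 1 at the base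
   image of every point in the support of \<open>be\<close>, so that cutting off \<open>zi\<close>
   leaves the decomposition intact.\<close>
 have "near z ~ 0. z : box P r & (ALL v. sm_at (%z. fh z v) z) & fM (C.e (P z)) : V & norm (ph z) < ro'"
  using near_box near_smooth_fh fM_V near_ph[OF near_norm_less[OF ro'(1)]] by eventually_elim blast
 then obtain d where d: "d > 0" "!!z. norm z < d ==> z : box P r & (ALL v. sm_at (%z. fh z v) z) & fM (C.e (P z)) : V & norm (ph z) < ro'"
  unfolding eventually_nhds_metric by (auto simp: dist_norm)
 define ro where "ro = d / 3"
 have ro: "ro > 0" "2 * ro < d" using d by (auto simp: ro_def)
 have R: "cball 0 (2 * ro) \<subseteq> box P r"
 proof
  fix y :: 'a assume "y : cball 0 (2 * ro)"
  thus "y : box P r" using d(2)[of y] ro(2) by simp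
 qed
 obtain be :: "'a => real" where be: "smooth_on UNIV be" "!!z. norm z <= ro ==> be z = 1"
  "!!z. norm z >= 2 * ro ==> be z = 0" by (rule bump_function[OF ro(1)]) blast
 define al where "al v = C.ext_field (%z. be z *. C.Q v)" for v
 define zi where "zi b = K.ext_field (%z. be' z *. K.Q b)" for b
 define a where "a v b g = (if g : U then be (ps g) *. inner (fh (ps g) v) b else 0)" for v b g
 have al_sec: "algebroid_section G (al v)" for v unfolding al_def
  by (rule C.ext_field_section[OF R]) (auto intro: bump_times[OF be(1,3) sm_at_const ro(2)] simp: C.P_scale be(3))
 have zi_sec: "algebroid_section H (zi v)" for v unfolding zi_def
  by (rule K.ext_field_section[OF R']) (auto intro: bump_times[OF be'(1,3) sm_at_const ro'(2)] simp: K.P_scale be'(3))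
 have a_smooth: "smooth_map C.A real_atlas (units G) (a v b)" for v b unfolding a_def
 proof (rule C.ext_function_smooth[OF R])
  fix z
  show "sm_at (%z. be z *. inner (fh z v) b) z"
   by (rule bump_times[OF be(1,3) sm_at_inner_const ro(2)], assumption)
    (rule d(2)[THEN conjunct2, THEN conjunct1, THEN spec])
 qed (simp add: be(3))
 define m where "m = card (mb :: 'b set)"
 obtain bb where bb: "bij_betw bb {0..<m} (mb :: 'b set)" using ex_bij_betw_nat_finite[OF finite_mb] unfolding m_def by blast
 have bsum: "(\<Sum>i<m. F (bb i)) = (SUM b:mb. F b)" for F :: "'b => 'b"
  using sum.reindex_bij_betw[OF bb, of F] by (simp add: lessThan_atLeast0)
 have dec: "decomposition G H f fM (al v) m (%i. a v (bb i)) (%i. zi (bb i))" for v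
  unfolding decomposition_def
 proof (intro conjI allI impI ballI a_smooth zi_sec)
  fix x assume x: "x : units G"
  have x0: "(x, 0) : algebroid G ==> snd (f (x, 0)) = 0" using f_lin[of x 0 0 0 0] by simp
  have ax: "(x, al v x) : algebroid G" using al_sec x unfolding algebroid_section_def by blast
  show "snd (f (x, al v x)) = (\<Sum>i<m. a v (bb i) x *. zi (bb i) (fM x))"
  \<comment> \<open>Off the support of \<open>be\<close> the section \<open>al v\<close> and all
    coefficients vanish, so both sides are 0.\<close>
  proof (cases "x : U & norm (ps x) < 2 * ro")
   case True
   hence xU: "x : U" and n: "norm (ps x) < d" using ro by auto
   have Pz: "P (ps x) = ps x" using C.unit_iff[OF xU] x by blast
   have ex: "C.e (ps x) = x" by (rule C.e_psi[OF xU])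
   note dd = d(2)[OF n, unfolded Pz ex]
   have fx: "fM x : V" "et (fM x) = ph (ps x)" using dd by (auto simp: ph_def Pz ex)
   have b1: "be' (et (fM x)) = 1" using dd fx by (simp add: be'(2))
   let ?q = "C.chi x (C.Q v)"
   have q: "(x, ?q) : algebroid G" using alg_Q[of "ps x" v] dd Pz ex by simp
   have al: "al v x = be (ps x) *. ?q" using xU linear_scale[OF linear_tinv[OF C.good C.chart xU]]
    by (simp add: al_def C.ext_field_def)
   have fhx: "fh (ps x) v = K.ch (fM x) (snd (f (x, ?q)))" using fh_eq[OF Pz, of v] dd fx ex by simp
   have lin: "linear (%b. K.chi (fM x) (K.Q b))"
    using linear_compose[OF K.linear_Q linear_tinv[OF K.good K.chart fx(1)]] by (simp add: o_def)
   have "(\<Sum>i<m. a v (bb i) x *. zi (bb i) (fM x)) = (SUM b:mb. a v b x *. zi b (fM x))" by (rule bsum)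
   also have "\<dots> = (SUM b:mb. be (ps x) *. inner (fh (ps x) v) b *. K.chi (fM x) (K.Q b))"
    using xU fx(1) by (simp add: a_def zi_def K.ext_field_def b1)
   also have "\<dots> = be (ps x) *. K.chi (fM x) (K.Q (fh (ps x) v))"
    unfolding scaleR_sum_right[symmetric] linear_eq_lift[OF lin] ..
   also have "\<dots> = be (ps x) *. snd (f (x, ?q))"
    unfolding trans[OF Q_fh fhx] tinv_coord[OF K.good K.chart fx(1)] ..
   also have "\<dots> = snd (f (x, al v x))" using f_lin[OF q q, of "be (ps x)" 0] by (simp add: al)
   finally show ?thesis by simp
  next
   case False
   have "a v b x = 0" for b using False by (auto simp: a_def be(3))
   moreover have "al v x = 0"
   proof (cases "x : U")
    case True
    thus ?thesis using False linear_0[OF linear_tinv[OF C.good C.chart True]]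
     by (simp add: al_def C.ext_field_def be(3))
   qed (simp add: al_def C.ext_field_def)
   ultimately show ?thesis using x0 ax by simp
  qed
 qed
 have al_near: "near z ~ 0. C.ch (C.e z) (al v (C.e z)) = C.Q v" for v
  using C.near_U near_norm_less[OF ro(1)]
  by eventually_elim (simp add: al_def C.ext_field_def be(2) tcoord_inv[OF C.good C.chart])
 have zi_near: "near z ~ 0. K.ch (K.e z) (zi v (K.e z)) = K.Q v" for v
  using K.near_U near_norm_less[OF ro'(1)]
  by eventually_elim (simp add: zi_def K.ext_field_def be'(2) tcoord_inv[OF K.good K.chart])
 have al_br: "near z ~ 0. C.ch (C.e z) (algebroid_bracket G (al v) (al w) (C.e z)) = C.br v w z" for v w
  by (rule C.bracket_coord) (use al_near[of v] al_near[of w] in \<open>eventually_elim, simp\<close>)+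
 have zi_br: "near z ~ 0. K.ch (K.e z) (algebroid_bracket H (zi v) (zi w) (K.e z)) = K.br v w z" for v w
  by (rule K.bracket_coord) (use zi_near[of v] zi_near[of w] in \<open>eventually_elim, simp\<close>)+
 have a_near: "near z ~ 0. a v b (C.e z) = inner (fh z v) b" for v b
  using C.near_U near_norm_less[OF ro(1)] by eventually_elim (simp add: a_def be(2))
 have a_anchor: "near z ~ 0. P z = z --> anchor_derivative G (al v) (a w b) (C.e z) = inner (D (%z. fh z w) z (D C.tg z (C.Q v))) b" for v w b
 proof -
  have "near z ~ 0. P z = z --> a w b (C.e z) : UNIV & a w b (C.e z) = inner (fh z w) b"
   using a_near[of w b] by eventually_elim simp
  from C.derivative_along_units[OF achart_real sm_at_inner_const[OF smooth_fh] this] al_near[of v] near_smooth_fh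
  show ?thesis
  proof eventually_elim
   case (elim z)
   have "D (%z. inner (fh z w) b) z u = inner (D (%z. fh z w) z u) b" for u
    by (rule D_eqI) (rule has_derivative_inner_left, use elim(3) sm_at_has_derivative in blast)
   thus ?case using elim(1,2) by (auto simp: anchor_derivative_def)
  qed
 qed
 have main: "near z ~ 0. P z = z --> fh z (C.br v w z) = K.br (fh z v) (fh z w) (ph z) +
   D (%x. fh x w) z (D C.tg z (C.Q v)) - D (%x. fh x v) z (D C.tg z (C.Q w))" for v w
 proof -
  have fin: "near z ~ 0. ALL b:mb. ALL c:mb. K.ch (K.e (ph z)) (algebroid_bracket H (zi b) (zi c) (K.e (ph z))) = K.br b c (ph z)"
   by (intro eventually_ball_finite finite_mb ballI near_ph zi_br)
  have fin2: "near z ~ 0. ALL b:mb. K.ch (K.e (ph z)) (zi b (K.e (ph z))) = K.Q b & a v b (C.e z) = inner (fh z v) b & a w b (C.e z) = inner (fh z w) b &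
   (P z = z --> anchor_derivative G (al v) (a w b) (C.e z) = inner (D (%z. fh z w) z (D C.tg z (C.Q v))) b &
   anchor_derivative G (al w) (a v b) (C.e z) = inner (D (%z. fh z v) z (D C.tg z (C.Q w))) b)"
  proof (intro eventually_ball_finite finite_mb ballI)
   fix b :: 'b
   show "near z ~ 0. K.ch (K.e (ph z)) (zi b (K.e (ph z))) = K.Q b & a v b (C.e z) = inner (fh z v) b & a w b (C.e z) = inner (fh z w) b &
   (P z = z --> anchor_derivative G (al v) (a w b) (C.e z) = inner (D (%z. fh z w) z (D C.tg z (C.Q v))) b &
   anchor_derivative G (al w) (a v b) (C.e z) = inner (D (%z. fh z v) z (D C.tg z (C.Q w))) b)"
    using near_ph[OF zi_near[of b]] a_near[of v b] a_near[of w b] a_anchor[of v w b] a_anchor[of w v b]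
    by eventually_elim simp
  qed
  show ?thesis
   using fin fin2 al_br[of v w] near_box fM_V e_ph C.P_br near_ph[OF K.bilinear_br] near_smooth_fh
  proof eventually_elim
   case (elim z)
   show ?case
   proof
    assume Pz: "P z = z"
    let ?x = "C.e z" and ?y = "fM (C.e z)"
    have x: "?x : U" "?x : units G" "ps ?x = z" using e_P_unit[of z] elim(4) Pz by auto
    have y: "?y : V" "K.e (ph z) = ?y" using elim(5,6) Pz by auto
    let ?T = "K.ch ?y"
    have lT: "linear ?T" by (rule lin_tcoord[OF K.good K.chart y(1)])
    have "C.chi ?x (C.Q (C.br v w z)) = algebroid_bracket G (al v) (al w) ?x"
     using elim(3,7) tinv_coord[OF C.good C.chart x(1)] C.Q_ker by metis
    hence "fh z (C.br v w z) = ?T (snd (f (?x, algebroid_bracket G (al v) (al w) ?x)))"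
     using fh_eq[OF Pz elim(4) y(1)] by simp
    also have "\<dots> = ?T ((\<Sum>i<m. \<Sum>j<m. (a v (bb i) ?x * a w (bb j) ?x) *. algebroid_bracket H (zi (bb i)) (zi (bb j)) ?y) +
      (\<Sum>j<m. anchor_derivative G (al v) (a w (bb j)) ?x *. zi (bb j) ?y) -
      (\<Sum>i<m. anchor_derivative G (al w) (a v (bb i)) ?x *. zi (bb i) ?y))"
     by (simp only: f_bracket[OF al_sec al_sec dec dec x(2)])
    also have "\<dots> = ?T ((SUM b:mb. SUM c:mb. (a v b ?x * a w c ?x) *. algebroid_bracket H (zi b) (zi c) ?y) +
      (SUM c:mb. anchor_derivative G (al v) (a w c) ?x *. zi c ?y) -
      (SUM b:mb. anchor_derivative G (al w) (a v b) ?x *. zi b ?y))"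
     using bsum[of "%b. \<Sum>j<m. (a v b ?x * a w (bb j) ?x) *. algebroid_bracket H (zi b) (zi (bb j)) ?y"]
      bsum[of "%c. (a v b ?x * a w c ?x) *. algebroid_bracket H (zi b) (zi c) ?y" for b]
      bsum[of "%c. anchor_derivative G (al v) (a w c) ?x *. zi c ?y"]
      bsum[of "%b. anchor_derivative G (al w) (a v b) ?x *. zi b ?y"] by simp
    also have "\<dots> = (SUM b:mb. SUM c:mb. (a v b ?x * a w c ?x) *. ?T (algebroid_bracket H (zi b) (zi c) ?y)) +
      (SUM c:mb. anchor_derivative G (al v) (a w c) ?x *. ?T (zi c ?y)) -
      (SUM b:mb. anchor_derivative G (al w) (a v b) ?x *. ?T (zi b ?y))"
     by (simp add: linear_add[OF lT] linear_diff[OF lT] linear_sum[OF lT] linear_scale[OF lT])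
    also have "(SUM b:mb. SUM c:mb. (a v b ?x * a w c ?x) *. ?T (algebroid_bracket H (zi b) (zi c) ?y)) =
      (SUM b:mb. inner (fh z v) b *. (SUM c:mb. inner (fh z w) c *. K.br b c (ph z)))"
     unfolding scaleR_sum_right using elim(1,2) unfolding y(2) by (intro sum.cong refl) simp
    also have "\<dots> = K.br (fh z v) (fh z w) (ph z)"
     using linear_eq_lift[of "%c. K.br b c (ph z)" "fh z w" for b] linear_eq_lift[of "%b. K.br b (fh z w) (ph z)" "fh z v"]
      elim(8) by simp
    also have "(SUM c:mb. anchor_derivative G (al v) (a w c) ?x *. ?T (zi c ?y)) =
      (SUM c:mb. inner (D (%z. fh z w) z (D C.tg z (C.Q v))) c *. K.Q c)"
     using elim(2) Pz unfolding y(2) by (intro sum.cong refl) simp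
    also have "\<dots> = D (%z. fh z w) z (D C.tg z (C.Q v))"
     unfolding linear_eq_lift[OF K.linear_Q] using elim(9) by (intro D_fh_ker) blast
    also have "(SUM b:mb. anchor_derivative G (al w) (a v b) ?x *. ?T (zi b ?y)) =
      (SUM b:mb. inner (D (%z. fh z v) z (D C.tg z (C.Q w))) b *. K.Q b)"
     using elim(2) Pz unfolding y(2) by (intro sum.cong refl) simp
    also have "\<dots> = D (%z. fh z v) z (D C.tg z (C.Q w))"
     unfolding linear_eq_lift[OF K.linear_Q] using elim(9) by (intro D_fh_ker) blast
    finally show "fh z (C.br v w z) = K.br (fh z v) (fh z w) (ph z) +
     D (%x. fh x w) z (D C.tg z (C.Q v)) - D (%x. fh x v) z (D C.tg z (C.Q w))" .
   qed
  qed
 qed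
 \<comment> \<open>The neighbourhood in \<open>main\<close> depends on v and w. The finitely many
   pairs from \<open>mb\<close> share one neighbourhood, and bilinearity of the difference
   \<open>E\<close> of the two sides extends the formula to all v and w.\<close>
 have bas: "near z ~ 0. ALL v:mb. ALL w:mb. P z = z --> fh z (C.br v w z) = K.br (fh z v) (fh z w) (ph z) +
   D (%x. fh x w) z (D C.tg z (C.Q v)) - D (%x. fh x v) z (D C.tg z (C.Q w))"
  by (intro eventually_ball_finite finite_mb ballI main)
 show ?thesis
  using bas C.bilinear_br near_ph[OF K.bilinear_br] near_smooth_fh sm_at_near[OF C.tau_rep(1)]
 proof eventually_elim
  case (elim z)
  show ?case
  proof (intro impI allI)
   fix v w assume Pz: "P z = z"
   have Df: "linear (%v. D (%x. fh x v) z u)" for u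
   proof (rule linearI)
    have s: "((%x. fh x v) hder D (%x. fh x v) z) (at z)" for v
     using elim(4) sm_at_has_derivative by blast
    fix v w and c :: real
    show "D (%x. fh x (v + w)) z u = D (%x. fh x v) z u + D (%x. fh x w) z u"
     unfolding linear_add[OF linear_fh] by (rule D_eqI[OF has_derivative_add[OF s s]])
    show "D (%x. fh x (c *. v)) z u = c *. D (%x. fh x v) z u"
     unfolding linear_scale[OF linear_fh] by (rule D_eqI[OF has_derivative_scaleR_right[OF s]])
   qed
   have Dt: "linear (%v. D C.tg z (C.Q v))"
    using linear_compose[OF C.linear_Q sm_at_linear[OF elim(5)]] by (simp add: o_def)
   have D2: "linear (%v. D (%x. fh x w) z (D C.tg z (C.Q v)))" for w
    using linear_compose[OF Dt sm_at_linear[OF elim(4)[rule_format]]] by (simp add: o_def)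
   have k1: "linear (%v. K.br (fh z v) c (ph z))" for c
    using linear_compose[OF linear_fh, of "%v. K.br v c (ph z)"] elim(3) by (simp add: o_def)
   have k2: "linear (%v. K.br c (fh z v) (ph z))" for c
    using linear_compose[OF linear_fh, of "%v. K.br c v (ph z)"] elim(3) by (simp add: o_def)
   have c1: "linear (%v. fh z (C.br v w z))" for w
    using linear_compose[OF _ linear_fh, of "%v. C.br v w z"] elim(2) by (simp add: o_def)
   have c2: "linear (%w. fh z (C.br v w z))" for v
    using linear_compose[OF _ linear_fh, of "%w. C.br v w z"] elim(2) by (simp add: o_def)
   define E where "E v w = fh z (C.br v w z) - (K.br (fh z v) (fh z w) (ph z) +
    D (%x. fh x w) z (D C.tg z (C.Q v)) - D (%x. fh x v) z (D C.tg z (C.Q w)))" for v w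
   have E1: "linear (%v. E v w)" for w unfolding E_def
    by (rule linear_compose_sub[OF c1 linear_compose_sub[OF linear_compose_add[OF k1 D2] Df]])
   have E2: "linear (E v)" for v unfolding E_def
    by (rule linear_compose_sub[OF c2 linear_compose_sub[OF linear_compose_add[OF k2 Df] D2]])
   have Eb: "E b c = 0" if "b : mb" "c : mb" for b c
    using elim(1) that Pz by (simp add: E_def)
   have "E b w = 0" if "b : mb" for b w
    using lin_mb_sum[OF E2[of b], of w] Eb[OF that] by simp
   hence "E v w = 0" using lin_mb_sum[OF E1[of w], of v] by simp
   thus "fh z (C.br v w z) = K.br (fh z v) (fh z w) (ph z) +
    D (%x. fh x w) z (D C.tg z (C.Q v)) - D (%x. fh x v) z (D C.tg z (C.Q w))" by (simp add: E_def)
  qed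
 qed
qed

sublocale local_morphism P C.tg C.io C.mm P' K.tg K.io K.mm ph fh
proof
 show "ph (P z) = ph z" for z by (simp add: ph_def)
 show "fh x (C.Q v) = fh x v" for x v by (simp add: fh_def)
 show "near x ~ 0. ALL v. P' (fh x v) = 0" by (simp add: P_fh)
qed (rule ph_0 fM_rep(2) P_ph smooth_fh linear_add[OF linear_fh] linear_scale[OF linear_fh] anchor_fh bracket_fh)+

end

section \<open>Compositions and restrictions of smooth maps\<close>

lemma reps_compose:
 fixes A :: "('m, 'e::model_space) chart set" and B :: "('n, 'd::model_space) chart set" and C :: "('k, 'c::model_space) chart set"
 assumes U: "achart A U fi" "x : U" "x : S" and V: "achart B V ps" and r: "reps U fi V ps S f x h" "reps V ps W om T g (f x) k"
  and ST: "f ` S \<subseteq> T"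
 shows "reps U fi W om S (%x. g (f x)) x (%z. k (h z))"
proof -
 have h: "sm_at h (fi x)" "near z ~ (fi x). inv_into U fi z : S --> f (inv_into U fi z) : V & ps (f (inv_into U fi z)) = h z"
  and k: "sm_at k (ps (f x))" "near z ~ (ps (f x)). inv_into V ps z : T --> g (inv_into V ps z) : W & om (g (inv_into V ps z)) = k z"
  using r by (auto simp: reps_def)
 have hx: "h (fi x) = ps (f x)" using near_self[OF h(2)] U chart0_inv[OF achart0[OF U(1)] U(2)] by simp
 have "near z ~ (fi x). inv_into V ps (h z) : T --> g (inv_into V ps (h z)) : W & om (g (inv_into V ps (h z))) = k (h z)"
  by (rule sm_at_eventually[OF h(1), where Q="%z. inv_into V ps z : T --> g (inv_into V ps z) : W & om (g (inv_into V ps z)) = k z"])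
   (use k hx in simp)
 with h(2) have "near z ~ (fi x). inv_into U fi z : S --> g (f (inv_into U fi z)) : W & om (g (f (inv_into U fi z))) = k (h z)"
 proof eventually_elim
  case (elim z)
  show ?case
  proof
   assume s: "inv_into U fi z : S"
   hence "inv_into V ps (h z) = f (inv_into U fi z)" using elim(1) chart0_inv[OF achart0[OF V]] by metis
   thus "g (f (inv_into U fi z)) : W & om (g (f (inv_into U fi z))) = k (h z)" using elim(2) s ST by auto
  qed
 qed
 moreover have "sm_at (%z. k (h z)) (fi x)" by (rule sm_at_compose[OF h(1)]) (simp add: hx k)
 ultimately show ?thesis by (simp add: reps_def)
qed

lemma smooth_map_space: "smooth_map A B S f ==> x : S ==> x : mfd_space A & f x : mfd_space B"
 unfolding smooth_map_def by - (elim conjE, simp add: image_subset_iff subset_iff)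

lemma smooth_map_compose:
 fixes A :: "('m, 'e::model_space) chart set" and B :: "('n, 'd::model_space) chart set" and C :: "('k, 'c::model_space) chart set"
 assumes A: "gatlas A" and B: "gatlas B" and C: "gatlas C"
  and f: "smooth_map A B S f" and g: "smooth_map B C T g" and ST: "f ` S \<subseteq> T"
 shows "smooth_map A C S (%x. g (f x))"
proof (rule smooth_mapI[OF A C])
 show "S \<subseteq> mfd_space A" using f by (simp add: smooth_map_def)
 fix x assume x: "x : S"
 have sp: "x : mfd_space A" "f x : mfd_space B" "g (f x) : mfd_space C" "f x : T"
  using smooth_map_space[OF f x] smooth_map_space[OF g, of "f x"] x ST by auto
 obtain U fi where U: "(U, fi) : A" "x : U" by (rule mfd_spaceE[OF sp(1)])
 obtain V ps where V: "(V, ps) : B" "f x : V" by (rule mfd_spaceE[OF sp(2)])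
 obtain W om where W: "(W, om) : C" "g (f x) : W" by (rule mfd_spaceE[OF sp(3)])
 note a = good_achart[OF A U(1)] good_achart[OF B V(1)] good_achart[OF C W(1)]
 obtain h where h: "reps U fi V ps S f x h" by (rule smooth_map_rep[OF A a(1) B a(2) f x U(2) V(2)])
 obtain k where k: "reps V ps W om T g (f x) k" by (rule smooth_map_rep[OF B a(2) C a(3) g sp(4) V(2) W(2)])
 show "EX U fi V ps h. achart A U fi & achart C V ps & x : U & g (f x) : V & reps U fi V ps S (%x. g (f x)) x h"
  using reps_compose[OF a(1) U(2) x a(2) h k ST] a U W by blast
qed

lemma smooth_map_subset:
 assumes f: "smooth_map A B S f" and T: "T \<subseteq> S" shows "smooth_map A B T f"
 unfolding smooth_map_def
proof (intro conjI ballI)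
 show "T \<subseteq> mfd_space A" "f ` T \<subseteq> mfd_space B" using smooth_map_space[OF f] T by blast+
 fix x assume "x : T"
 hence x: "x : S" using T by blast
 obtain U fi V ps W h where *: "(U, fi) : A" "(V, ps) : B" "x : U & f x : V & open W & fi x : W & W \<subseteq> fi ` U & smooth_on W h"
  and **: "!!y. y : S ==> y : U ==> fi y : W ==> f y : V & ps (f y) = h (fi y)"
  using f x unfolding smooth_map_def by fastforce
 have "ALL y:T \<inter> U. fi y : W --> f y : V & ps (f y) = h (fi y)" using ** T by blast
 hence "EX W h. x : U & f x : V & open W & fi x : W & W \<subseteq> fi ` U & smooth_on W h &
   (ALL y:T \<inter> U. fi y : W --> f y : V & ps (f y) = h (fi y))" using *(3) by blast
 thus "EX (U, fi):A. EX (V, ps):B. EX W h. x : U & f x : V & open W & fi x : W & W \<subseteq> fi ` U & smooth_on W h &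
   (ALL y:T \<inter> U. fi y : W --> f y : V & ps (f y) = h (fi y))"
  using *(1,2) by blast
qed

lemma velocity_compose:
 fixes A :: "('m, 'e::model_space) chart set" and B :: "('n, 'd::model_space) chart set"
 assumes A: "smooth_atlas A" and B: "smooth_atlas B" and f: "smooth_map A B S f" "openin (mfd_top A) S"
  and k: "smooth_map real_atlas A {0..1} k" and t: "t : {0..1}" "k t : S"
 shows "velocity B {0..1} (%t. f (k t)) t = differential A B f (k t) (velocity A {0..1} k t)"
proof -
 note A' = satlas_good[OF A] and B' = satlas_good[OF B]
 have sp: "k t : mfd_space A" "f (k t) : mfd_space B" using smooth_map_space[OF f(1) t(2)] by auto
 obtain U fi where U: "(U, fi) : A" "k t : U" by (rule mfd_spaceE[OF sp(1)])
 obtain V ps where V: "(V, ps) : B" "f (k t) : V" by (rule mfd_spaceE[OF sp(2)])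
 note a = good_achart[OF A' U(1)] good_achart[OF B' V(1)]
 obtain h where h: "reps U fi V ps S f (k t) h"
  by (rule smooth_map_rep[OF A' a(1) B' a(2) f(1) t(2) U(2) V(2)])
 obtain c where c: "sm_at c t" "c t = fi (k t)"
  "near s ~ t. s : {0..1} --> k s : U & fi (k s) = c s & tangent_coord A fi (k s) (velocity A {0..1} k s) = D c s 1"
  by (rule curve_coords[OF A' a(1) k t(1) U(2)])
 have S: "near z ~ (fi (k t)). inv_into U fi z : S" by (rule openin_near[OF A f(2) a(1) U(2) t(2)])
 have h1: "sm_at h (fi (k t))" "near z ~ (fi (k t)). f (inv_into U fi z) : V & ps (f (inv_into U fi z)) = h z"
  using h S by (auto simp: reps_def elim: eventually_elim2)
 have "near s ~ t. f (inv_into U fi (c s)) : V & ps (f (inv_into U fi (c s))) = h (c s)"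
  by (rule sm_at_eventually[OF c(1), where Q="%z. f (inv_into U fi z) : V & ps (f (inv_into U fi z)) = h z"]) (use h1 c in simp)
 with c(3) have ev: "near s ~ t. s : {0..1} --> f (k s) : V & h (c s) = ps (f (k s))"
 proof eventually_elim
  case (elim s)
  show ?case
  proof
   assume "s : {0..1}"
   hence "k s : U" "c s = fi (k s)" using elim(1) by auto
   hence "inv_into U fi (c s) = k s" using chart0_inv[OF achart0[OF a(1)]] by simp
   thus "f (k s) : V & h (c s) = ps (f (k s))" using elim(2) by simp
  qed
 qed
 have "((%s. h (c s)) hvd D h (c t) (D c t 1)) (at t within {0..1})"
  by (rule curve_deriv_within[OF _ has_vector_derivative_at_within[OF sm_at_vector_derivative[OF c(1)]]]) (simp add: c h1)
 hence d: "((%s. ps (f (k s))) hvd D h (c t) (D c t 1)) (at t within {0..1})"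
  unfolding has_vector_derivative_def
 proof (rule has_derivative_transform_eventually)
  show "\<forall>\<^sub>F s in at t within {0..1}. h (c s) = ps (f (k s))"
   unfolding eventually_at_filter using ev by eventually_elim simp
  show "h (c t) = ps (f (k t))" using near_self[OF ev] t by blast
 qed (rule t)
 have "\<forall>\<^sub>F s in at t within {0..1}. f (k s) : V"
  unfolding eventually_at_filter using ev by eventually_elim simp
 from velocity_coord(2)[where c="%t. f (k t)", OF B' a(2) V(2) at_unit_interval_not_bot[OF t(1)] t(1) d this]
 have "velocity B {0..1} (%t. f (k t)) t = tinv B V ps (f (k t)) (D h (fi (k t)) (tangent_coord A fi (k t) (velocity A {0..1} k t)))"
  using near_self[OF c(3)] t c(2) by simp
 also have "\<dots> = differential A B f (k t) (velocity A {0..1} k t)"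
  by (rule differential_coord[OF A' a(1) B' a(2) h U(2) V(2) S, symmetric])
 finally show ?thesis .
qed

section \<open>Gluing\<close>

text \<open>Enumerate the pairs of base sets with a closed set \<open>C i\<close> between them. Each
  x gets a pair number \<open>n x\<close>, whose first set contains x and whose second lies in
  \<open>E x\<close>. For every i \<le> n x, \<open>N x\<close> is kept inside the second set if x
  is in \<open>C i\<close>, and off \<open>C i\<close> otherwise. If n x \<le> n y and N x meets N
  y, the common point lies in \<open>C (n x)\<close>; so y does too, and N y lies in the second set
  of that pair, hence in E x.\<close>

lemma compatible_shrinking:
 assumes sc: "second_countable X" and E: "!!x. x : M ==> openin X (E x) & x : E x"
  and reg: "!!x W. x : M ==> openin X W ==> x : W ==> EX O' C. openin X O' & closedin X C & x : O' & O' \<subseteq> C & C \<subseteq> W"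
 obtains N where "!!x. x : M ==> openin X (N x) & x : N x & N x \<subseteq> E x"
  "!!x y. x : M ==> y : M ==> N x \<inter> N y ~= {} ==> N x \<subseteq> E y \<or> N y \<subseteq> E x"
proof -
 obtain \<B> where \<B>: "countable \<B>" "!!V. V : \<B> ==> openin X V" "!!W x. openin X W ==> x : W ==> EX V:\<B>. x : V & V \<subseteq> W"
  using sc unfolding second_countable_def by metis
 define \<P> where "\<P> = {q : \<B> \<times> \<B>. EX C. closedin X C & fst q \<subseteq> C & C \<subseteq> snd q}"
 have cP: "countable \<P>" unfolding \<P>_def
  by (rule countable_subset[of _ "\<B> \<times> \<B>"]) (use \<B>(1) in auto)
 have inP: "EX q:\<P>. x : fst q & snd q \<subseteq> E x" if x: "x : M" for x
 proof -
  obtain B where B: "B : \<B>" "x : B" "B \<subseteq> E x" using \<B>(3)[of "E x" x] E[OF x] by blast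
  obtain O' C where O': "openin X O'" "closedin X C" "x : O'" "O' \<subseteq> C" "C \<subseteq> B" using reg[OF x \<B>(2)[OF B(1)] B(2)] by blast
  obtain A where A: "A : \<B>" "x : A" "A \<subseteq> O'" using \<B>(3)[OF O'(1,3)] by blast
  have "(A, B) : \<P>" unfolding \<P>_def using A B O' by auto
  thus ?thesis using A B by force
 qed
 define q where "q = from_nat_into \<P>"
 have "EX i. q i : \<P> & x : fst (q i) & snd (q i) \<subseteq> E x" if "x : M" for x
  using inP[OF that] from_nat_into_surj[OF cP] unfolding q_def by metis
 then obtain n where n: "!!x. x : M ==> q (n x) : \<P> & x : fst (q (n x)) & snd (q (n x)) \<subseteq> E x" by metis
 have "EX C. q i : \<P> --> closedin X C & fst (q i) \<subseteq> C & C \<subseteq> snd (q i)" for i unfolding \<P>_def by auto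
 then obtain C where C: "!!i. q i : \<P> ==> closedin X (C i) & fst (q i) \<subseteq> C i & C i \<subseteq> snd (q i)" by metis
 have oP: "openin X (fst (q i))" "openin X (snd (q i))" if "q i : \<P>" for i
  using that \<B>(2) unfolding \<P>_def by (auto simp: mem_Times_iff)
 define L where "L x i = (if q i : \<P> then (if x : C i then snd (q i) else topspace X - C i) else topspace X)" for x i
 define N where "N x = fst (q (n x)) \<inter> (INT i:{..n x}. L x i)" for x
 have oL: "openin X (L x i)" for x i unfolding L_def using oP C by (auto intro: openin_diff)
 have xL: "x : L x i" if "x : M" for x i
 proof -
  have "x : topspace X" using E[OF that] openin_subset by blast
  thus ?thesis unfolding L_def using C[of i] by auto
 qed
 show ?thesis
 proof (rule that[of N])
  fix x assume x: "x : M"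
  have "openin X (INT i:{..n x}. L x i)" by (rule openin_Inter) (auto intro: oL)
  hence "openin X (N x)" unfolding N_def using oP(1) n[OF x] by blast
  moreover have "fst (q (n x)) \<subseteq> E x" using C[of "n x"] n[OF x] by blast
  ultimately show "openin X (N x) & x : N x & N x \<subseteq> E x" unfolding N_def using xL[OF x] n[OF x] by auto
 next
  have key: "N y \<subseteq> E x" if x: "x : M" and y: "y : M" and m: "N x \<inter> N y ~= {}" and le: "n x <= n y" for x y
  proof -
   obtain g where g: "g : N x" "g : N y" using m by blast
   have p: "q (n x) : \<P>" using n[OF x] by blast
   have gA: "g : fst (q (n x))" using g by (simp add: N_def)
   have gL: "g : L y (n x)" using g(2) le by (simp add: N_def)
   have yC: "y : C (n x)" using gL gA C[OF p] p unfolding L_def by (auto split: if_splits)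
   have "N y \<subseteq> L y (n x)" using le by (auto simp: N_def)
   also have "\<dots> = snd (q (n x))" using yC p by (simp add: L_def)
   finally show ?thesis using n[OF x] by blast
  qed
  fix x y assume "x : M" "y : M" "N x \<inter> N y ~= {}"
  thus "N x \<subseteq> E y \<or> N y \<subseteq> E x" using key[of x y] key[of y x] by (metis inf_commute linear)
 qed
qed

lemma (in unit_chart) small_box:
 assumes W: "openin (gtop G) W" "x0 : W"
 obtains s where "s > 0" "s <= r" "e ` box P s \<subseteq> W"
proof -
 obtain s where s: "s > 0" "ALL z:box P s. e z : W" using near_box_ex[OF near_open[OF W], of P] by blast
 have "e ` box P (min s r) \<subseteq> W" using s(2) by (auto simp: box_def)
 thus ?thesis using that[of "min s r"] s(1) r_pos by auto
qed

lemma (in unit_chart) regular_at: 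
 assumes W: "openin (gtop G) W" "x0 : W"
 shows "EX O' C. openin (gtop G) O' & closedin (gtop G) C & x0 : O' & O' \<subseteq> C & C \<subseteq> W"
proof -
 have "near z ~ 0. e z : W & z : box P r"
  using near_open[OF W] near_open_set[OF open_box[OF bdd_P, of r], of 0] r_pos
  by (auto simp: box_def P_0 elim: eventually_elim2)
 then obtain d where d: "d > 0" "!!z. norm z < d ==> e z : W & z : box P r"
  unfolding eventually_nhds_metric by (auto simp: dist_norm)
 have R: "cball 0 (d / 2) \<subseteq> box P r" "ball 0 (d / 2) \<subseteq> box P r" using d by auto
 show ?thesis
 proof (intro exI conjI)
  show "openin (gtop G) (e ` ball 0 (d / 2))" by (rule open_e_image[OF open_ball R(2)])
  show "closedin (gtop G) (e ` cball 0 (d / 2))" by (rule closed_e_cball[OF R(1)])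
  show "x0 : e ` ball 0 (d / 2)" using d(1) by (intro image_eqI[of _ _ 0]) auto
  show "e ` ball 0 (d / 2) \<subseteq> e ` cball 0 (d / 2)" by auto
  show "e ` cball 0 (d / 2) \<subseteq> W" using d by auto
 qed
qed

text \<open>The ray of the chart joins g to its source unit without leaving the box. Along it two
  local integrations will be compared.\<close>

lemma (in unit_chart) fibre_path:
 assumes s: "s > 0" "s <= r" and g: "g : e ` box P s"
 obtains c where "smooth_map real_atlas A {0..1} c" "c 0 = src G g" "c 1 = g"
  "!!t. t : {0..1} ==> c t : e ` box P s & src G (c t) = src G g"
proof -
 obtain z where z: "g = e z" "z : box P s" using g by blast
 have sr: "box P s \<subseteq> box P r" using s by (auto simp: box_def)
 define ga where "ga t = P z + t *. Q z" for t :: real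
 have ga: "ga t : box P s" if "t : {0..1}" for t
 proof -
  have "\<bar>t\<bar> * norm (Q z) <= 1 * norm (Q z)" using that by (intro mult_right_mono) auto
  thus ?thesis using z(2) by (simp add: ga_def box_def P_add P_scale Q_def[symmetric])
 qed
 have ega: "e (ga t) : U & ps (e (ga t)) = ga t" if "t : {0..1}" for t using e_box ga[OF that] sr by blast
 have gU: "g : U" "ps g = z" using e_box[of z] z sr by auto
 have sU: "src G g : U" "ps (src G g) = P z" using src_U[OF gU(1)] gU(2) by auto
 have src: "src G g = e (P z)" using e_psi[OF sU(1)] unfolding sU(2) by (rule sym)
 have "smooth_map real_atlas A {0..1} (%t. e (ga t))"
 proof (rule smooth_mapI[OF achart_real(1) good])
  show "{0..1} \<subseteq> mfd_space real_atlas" by (simp add: mfd_space_def real_atlas_def)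
  fix t :: real assume t: "t : {0..1}"
  have "sm_at ga t" unfolding ga_def by (intro sm_at_add sm_at_scaleR sm_at_const sm_at_id)
  hence "reps UNIV (%t. t) U ps {0..1} (%t. e (ga t)) t ga"
   unfolding reps_def using ega by simp
  thus "EX Ua fi V ps h. achart real_atlas Ua fi & achart A V ps & t : Ua & e (ga t) : V & reps Ua fi V ps {0..1} (%t. e (ga t)) t h"
   using achart_real(2) chart ega[OF t] by blast
 qed
 moreover have "e (ga 0) = src G g" by (simp add: ga_def src)
 moreover have "e (ga 1) = g" by (simp add: ga_def P_Q_add z(1))
 moreover have "e (ga t) : e ` box P s & src G (e (ga t)) = src G g" if "t : {0..1}" for t
  using ga[OF that] src_eq[of "e (ga t)" g] ega[OF that] gU by (simp add: ga_def)
 ultimately show ?thesis using that by blast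
qed

lemma smooth_map_local:
 fixes A :: "('m, 'e::model_space) chart set" and B :: "('n, 'd::model_space) chart set"
 assumes A: "smooth_atlas A" and B: "smooth_atlas B"
  and l: "!!x. x : S ==> EX W F'. openin (mfd_top A) W & x : W & smooth_map A B W F' & (ALL y:W. F' y = F y)"
 shows "smooth_map A B S F"
proof (rule smooth_mapI[OF satlas_good[OF A] satlas_good[OF B]])
 note A' = satlas_good[OF A] and B' = satlas_good[OF B]
 show "S \<subseteq> mfd_space A"
 proof
  fix x assume "x : S"
  from l[OF this] obtain W F' where "x : W" "smooth_map A B W F'" by blast
  thus "x : mfd_space A" using smooth_map_space[of A B W F' x] by blast
 qed
 fix x assume x: "x : S"
 obtain W F' where W: "openin (mfd_top A) W" "x : W" "smooth_map A B W F'" "!!y. y : W ==> F' y = F y" using l[OF x] by blast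
 have sp: "x : mfd_space A" "F x : mfd_space B" using smooth_map_space[OF W(3,2)] W(4)[OF W(2)] by auto
 obtain U fi where U: "(U, fi) : A" "x : U" by (rule mfd_spaceE[OF sp(1)])
 obtain V ps where V: "(V, ps) : B" "F x : V" by (rule mfd_spaceE[OF sp(2)])
 note a = good_achart[OF A' U(1)] good_achart[OF B' V(1)]
 obtain h where h: "reps U fi V ps W F' x h"
  by (rule smooth_map_rep[OF A' a(1) B' a(2) W(3,2) U(2)]) (use V(2) W in simp)
 have "reps U fi V ps S F x h" unfolding reps_def
 proof
  show "sm_at h (fi x)" using h by (simp add: reps_def)
  have "near z ~ (fi x). inv_into U fi z : W --> F' (inv_into U fi z) : V & ps (F' (inv_into U fi z)) = h z"
   using h by (simp add: reps_def)
  with openin_near[OF A W(1) a(1) U(2) W(2)]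
  show "near z ~ (fi x). inv_into U fi z : S --> F (inv_into U fi z) : V & ps (F (inv_into U fi z)) = h z"
   by eventually_elim (simp add: W(4))
 qed
 thus "EX U fi V ps h. achart A U fi & achart B V ps & x : U & F x : V & reps U fi V ps S F x h"
  using a U V by blast
qed

lemma differential_cong:
 fixes A :: "('m, 'e::model_space) chart set" and B :: "('n, 'd::model_space) chart set"
 assumes A: "smooth_atlas A" and B: "smooth_atlas B" and W: "openin (mfd_top A) W" "x : W" and F: "smooth_map A B W F"
  and eq: "!!y. y : W ==> F' y = F y"
 shows "differential A B F' x v = differential A B F x v"
proof -
 note A' = satlas_good[OF A] and B' = satlas_good[OF B]
 have sp: "x : mfd_space A" "F x : mfd_space B" using smooth_map_space[OF F W(2)] by auto
 obtain U fi where U: "(U, fi) : A" "x : U" by (rule mfd_spaceE[OF sp(1)])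
 obtain V ps where V: "(V, ps) : B" "F x : V" by (rule mfd_spaceE[OF sp(2)])
 note a = good_achart[OF A' U(1)] good_achart[OF B' V(1)]
 obtain h where h: "reps U fi V ps W F x h"
  by (rule smooth_map_rep[OF A' a(1) B' a(2) F W(2) U(2) V(2)])
 have Fx: "F' x = F x" by (rule eq[OF W(2)])
 have h': "reps U fi V ps W F' x h"
  unfolding reps_def using h eq by (auto simp: reps_def elim!: eventually_mono)
 have V': "F' x : V" using V Fx by simp
 note near = openin_near[OF A W(1) a(1) U(2) W(2)]
 show ?thesis
  using differential_coord[OF A' a(1) B' a(2) h U(2) V(2) near] differential_coord[OF A' a(1) B' a(2) h' U(2) V' near] Fx by simp
qed

lemma velocity_const:
 assumes "!!s. s : {0..1} ==> k s = y" "t : {0..1}"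
 shows "velocity A {0..1} k t = 0"
proof -
 have "((%s. coord A (k t) (k s)) hvd 0) (at t within {0..1})"
  by (rule has_vector_derivative_transform[OF assms(2) _ has_vector_derivative_const[of "coord A (k t) y"]]) (simp add: assms)
 thus ?thesis unfolding velocity_def by (rule vector_derivative_within[OF at_unit_interval_not_bot[OF assms(2)]])
qed

lemma (in lie_groupoid) velocity_ker_src:
 assumes c: "smooth_map real_atlas A {0..1} c" and s: "!!t. t : {0..1} ==> src G (c t) = y" and t: "t : {0..1}"
 shows "differential A A (src G) (c t) (velocity A {0..1} c t) = 0"
proof -
 have "velocity A {0..1} (%t. src G (c t)) t = 0" by (rule velocity_const[OF s t])
 thus ?thesis
  using velocity_compose[OF smooth_atlas smooth_atlas smooth_src openin_gspace c t] smooth_map_space[OF c t] by simp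
qed

text \<open>At a unit \<open>X\<close> is the identity on the kernel of \<open>P\<close>, hence so
  is its inverse \<open>th\<close>.\<close>

lemma (in unit_chart) mc_form_unit:
 assumes "(x0, a) : algebroid G" shows "mc_form G x0 a = (x0, a)"
proof -
 have Pa: "P (ch x0 a) = 0" using assms x0_U by (simp add: algebroid_iff)
 have m: "fst (mc_form G x0 a) = x0" "ch x0 (snd (mc_form G x0 a)) = th 0 (ch x0 a)"
  using near_self[OF mc_form_coord] Pa by simp_all
 have "X (ch x0 a) 0 = Q (ch x0 a)" using near_self[OF X_unit] by (simp add: P_0)
 hence "th 0 (Q (ch x0 a)) = Q (ch x0 a)" using near_self[OF theta_X] by metis
 hence "ch x0 (snd (mc_form G x0 a)) = ch x0 a" using m(2) Q_ker[OF Pa] by simp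
 hence "snd (mc_form G x0 a) = a" using tinv_coord[OF good chart x0_U] by metis
 thus ?thesis using m(1) by (simp add: prod_eq_iff)
qed

section \<open>The Maurer-Cartan condition without coordinates\<close>

locale lie_morphism = G: lie_groupoid G + H: lie_groupoid H
 for G :: "('g, 'a::model_space) local_groupoid" and H :: "('h, 'b::model_space) local_groupoid" +
 fixes f :: "'g \<times> 'a => 'h \<times> 'b" and fM
 assumes morph: "algebroid_morphism G H f fM"
begin

text \<open>The equation th(dF) = f(th) at the arrow g, bundled with what its use requires: both
  forms are evaluated in their domains, the sources match, and uniqueness of curves holds around
  \<open>F g\<close>.\<close>

definition mc_at :: "('g => 'h) => 'g => bool" where
 "mc_at F g \<longleftrightarrow> g : mc_dom G & F g : mc_dom H & (EX W. H.mc_unique W & F g : W) & src H (F g) = fM (src G g) &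
  (ALL v. differential G.A G.A (src G) g v = 0 --> differential H.A H.A (src H) (F g) (differential G.A H.A F g v) = 0 &
   mc_form H (F g) (differential G.A H.A F g v) = f (mc_form G g v))"

lemma fM_unit: "x : units G ==> fM x : units H"
 using morph unfolding algebroid_morphism_def by - (elim conjE, (erule subsetD, rule imageI, assumption))

lemma charts_exist:
 assumes "x : units G" obtains U ps P r V et P' r' where "mor_charts G x U ps P r H fM V et P' r' f"
proof -
 obtain U ps P r where C: "unit_chart G x U ps P r" by (rule G.unit_chart_exists[OF assms])
 obtain V et P' r' where K: "unit_chart H (fM x) V et P' r'" by (rule H.unit_chart_exists[OF fM_unit[OF assms]])
 have "mor_charts G x U ps P r H fM V et P' r' f"
  using C K morph unfolding mor_charts_def mor_charts_axioms_def by blast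
 thus ?thesis by (rule that)
qed

lemma mc_at_velocity:
 assumes F: "openin (gtop G) S" "smooth_map G.A H.A S F" and c: "smooth_map real_atlas G.A {0..1} c"
  and s: "!!t. t : {0..1} ==> src G (c t) = y" and t: "t : {0..1}" "c t : S" "mc_at F (c t)"
 shows "mc_form H (F (c t)) (velocity H.A {0..1} (%t. F (c t)) t) = f (mc_form G (c t) (velocity G.A {0..1} c t))"
 unfolding velocity_compose[OF G.smooth_atlas H.smooth_atlas F(2,1) c t(1,2)]
 using t(3) G.velocity_ker_src[OF c s t(1)] unfolding mc_at_def by blast

text \<open>The images of the curve under both maps have the Maurer-Cartan form that
  \<open>f\<close> assigns to that of the curve, and they start at the same point.\<close>

lemma mc_agree:
 assumes F: "openin (gtop G) S" "smooth_map G.A H.A S F" and F': "openin (gtop G) S'" "smooth_map G.A H.A S' F'"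
  and c: "smooth_map real_atlas G.A {0..1} c"
  and H: "!!t. t : {0..1} ==> src G (c t) = y & c t : S & c t : S' & mc_at F (c t) & mc_at F' (c t)"
  and F0: "F (c 0) = F' (c 0)"
 shows "F (c 1) = F' (c 1)"
proof (rule H.mc_unique_global[where k="%t. F (c t)" and l="%t. F' (c t)" and t=1])
 show "smooth_map real_atlas H.A {0..1} (%t. F (c t))"
  by (rule smooth_map_compose[OF achart_real(1) G.good H.good c F(2)]) (use H in blast)
 show "smooth_map real_atlas H.A {0..1} (%t. F' (c t))"
  by (rule smooth_map_compose[OF achart_real(1) G.good H.good c F'(2)]) (use H in blast)
 fix t :: real assume t: "t : {0..1}"
 have z: "(0::real) : {0..1}" by simp
 show "src H (F (c t)) = src H (F (c 0)) & src H (F' (c t)) = src H (F' (c 0))"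
  using H[OF t] H[OF z] unfolding mc_at_def by simp
 show "mc_form H (F (c t)) (velocity H.A {0..1} (%t. F (c t)) t) = mc_form H (F' (c t)) (velocity H.A {0..1} (%t. F' (c t)) t)"
  using mc_at_velocity[OF F c _ t, of y] mc_at_velocity[OF F' c _ t, of y] H H[OF t] by simp
 show "EX W. H.mc_unique W & F (c t) : W" using H[OF t] unfolding mc_at_def by blast
qed (use F0 in auto)

end

context mor_charts
begin

sublocale M: lie_morphism G H f fM by unfold_locales (rule morph)

lemma reps_near:
 assumes Fh: "sm_at Fh 0" and rep: "near z ~ 0. F (C.e z) : V & et (F (C.e z)) = Fh z"
 shows "near z ~ 0. C.e z : U & ps (C.e z) = z & reps U ps V et UNIV F (C.e z) Fh"
 using near_near[OF rep] sm_at_near[OF Fh] C.near_U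
 by eventually_elim (simp add: reps_def)

text \<open>A vector tangent to the source fibre is X t with t its Maurer-Cartan form.
  \<open>related\<close> sends it to X (f t), whose Maurer-Cartan form is f t.\<close>

lemma related_mc_at:
 assumes Fh: "sm_at Fh 0" "Fh 0 = 0" "related Fh" and P: "near z ~ 0. P' (Fh z) = ph z"
  and t: "near z ~ 0. K.tg (Fh z) = ph (C.tg z)"
  and rep: "near z ~ 0. F (C.e z) : V & et (F (C.e z)) = Fh z"
 shows "near z ~ 0. M.mc_at F (C.e z)"
proof -
 have nF: "near y ~ 0. R y ==> near z ~ 0. R (Fh z)" for R
  by (rule sm_at_eventually[OF Fh(1)]) (simp add: Fh(2))
 obtain W where W: "K.mc_unique W" "fM x0 : W" using K.mc_unique_exists by blast
 have oW: "openin (gtop H) W" using W(1) unfolding K.mc_unique_def by blast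
 have box': "near z ~ 0. z : box P r" by (rule near_box)
 have A: "near z ~ 0. C.e z : mc_dom G & F (C.e z) : mc_dom H & F (C.e z) : W & src H (F (C.e z)) = fM (src G (C.e z))"
  using C.e_mc_dom nF[OF K.e_mc_dom] nF[OF K.near_open[OF oW W(2)]] rep nF[OF K.e_src] P e_ph C.e_src
 proof eventually_elim
  case (elim z)
  have e: "K.e (Fh z) = F (C.e z)" using elim(4) K.e_psi by metis
  show ?case using elim unfolding e by simp
 qed
 have B: "near z ~ 0. ALL v. P (C.ch (C.e z) v) = 0 --> P' (K.ch (F (C.e z)) (differential C.A K.A F (C.e z) v)) = 0 &
   mc_form H (F (C.e z)) (differential C.A K.A F (C.e z) v) = f (mc_form G (C.e z) v)"
  using reps_near[OF Fh(1) rep] rep Fh(3)[unfolded related_def] C.mc_form_coord nF[OF K.mc_form_coord] C.X_theta nF[OF K.P_X] nF[OF K.theta_X]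
   C.P_theta t C.near_taug[OF e_ph] C.near_taug[OF near_box] C.P_taug C.near_taug[OF fM_V]
 proof eventually_elim
  case (elim z)
  show ?case
  proof (intro allI impI)
   fix v assume v: "P (C.ch (C.e z) v) = 0"
   let ?g = "C.e z" and ?w = "C.ch (C.e z) v"
   let ?d = "differential C.A K.A F ?g v"
   let ?t = "C.th z ?w"
   let ?y = "C.e (C.tg z)"
   have e: "K.e (Fh z) = F ?g" using elim(2) K.e_psi by metis
   have g: "?g : U" "ps ?g = z" "F ?g : V" using elim(1,2) by auto
   have r: "reps U ps V et UNIV F ?g Fh" using elim(1) by blast
   have "K.ch (F ?g) ?d = D Fh z ?w"
    using tcoord_differential[OF C.good C.chart K.good K.chart r g(1,3), of v] g(2) by simp
   also have "?w = C.X ?t z" using elim(6) C.Q_ker[OF v] by simp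
   also have "D Fh z (C.X ?t z) = K.X (fh (C.tg z) ?t) (Fh z)" using elim(3) by blast
   finally have d: "K.ch (F ?g) ?d = K.X (fh (C.tg z) ?t) (Fh z)" .
   have Pd: "P' (K.ch (F ?g) ?d) = 0" unfolding d using elim(7) by blast
   have m: "fst (mc_form H (F ?g) ?d) = K.e (K.tg (Fh z))" "K.ch (K.e (K.tg (Fh z))) (snd (mc_form H (F ?g) ?d)) = K.th (Fh z) (K.ch (F ?g) ?d)"
    using elim(5) Pd unfolding e by auto
   have th: "K.th (Fh z) (K.ch (F ?g) ?d) = fh (C.tg z) ?t" unfolding d using elim(8) Q_fh by simp
   have k: "K.e (K.tg (Fh z)) = fM ?y" using elim(10,11,13) by simp
   have Pt: "P ?t = 0" using elim(9) by blast
   have m': "fst (mc_form G ?g v) = ?y" "C.ch ?y (snd (mc_form G ?g v)) = ?t" using elim(4) v by auto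
   have tb: "C.tg z : box P r" by (rule elim(12))
   have y: "?y : U" using C.e_box[OF tb] by blast
   have yV: "fM ?y : V" using elim(14,13) by simp
   have s: "snd (mc_form G ?g v) = C.chi ?y ?t" using tinv_coord[OF C.good C.chart y] m'(2) by metis
   have q: "mc_form G ?g v = (?y, C.chi ?y (C.Q ?t))" using m'(1) s C.Q_ker[OF Pt] by (simp add: prod_eq_iff)
   have al: "(?y, C.chi ?y (C.Q ?t)) : algebroid G" using alg_Q[of "C.tg z" ?t] tb elim(13) by simp
   have fq: "fst (f (mc_form G ?g v)) = fM ?y" unfolding q by (rule f_fst[OF al])
   have "K.ch (fM ?y) (snd (f (mc_form G ?g v))) = fh (C.tg z) ?t"
    unfolding q by (rule fh_eq[OF elim(13) tb yV, symmetric])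
   hence "K.ch (fM ?y) (snd (f (mc_form G ?g v))) = K.ch (fM ?y) (snd (mc_form H (F ?g) ?d))"
    using m(2) th unfolding k by simp
   hence "snd (f (mc_form G ?g v)) = snd (mc_form H (F ?g) ?d)"
    using tinv_coord[OF K.good K.chart yV] by metis
   thus "P' (K.ch (F ?g) ?d) = 0 & mc_form H (F ?g) ?d = f (mc_form G ?g v)"
    using Pd m(1) fq k by (simp add: prod_eq_iff)
  qed
 qed
 show ?thesis
  using A B rep C.near_U
 proof eventually_elim
  case (elim z)
  hence g: "C.e z : U" "F (C.e z) : V" by auto
  show ?case unfolding M.mc_at_def C.ker_src[OF g(1)] K.ker_src[OF g(2)] using elim W(1) by blast
 qed
qed

end

context mor_charts
begin

lemma near_pair_box:
 assumes "near q ~ (0::'a, 0::'a). R q" obtains s where "s > 0" "s <= r" "!!z w. z : box P s ==> w : box P s ==> R (z, w)"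
proof -
 obtain R' where R': "near z ~ (0::'a). R' z" "!!z w. R' z ==> R' w ==> R (z, w)"
  using assms unfolding nhds_prod eventually_prod_same by blast
 obtain s where s: "s > 0" "ALL z:box P s. R' z" using near_box_ex[OF R'(1), of P] by blast
 show ?thesis
 proof (rule that[of "min s r"])
  fix z w assume "z : box P (min s r)" "w : box P (min s r)"
  hence "z : box P s" "w : box P s" by (auto simp: box_def)
  thus "R (z, w)" using R'(2) s(2) by blast
 qed (use s C.r_pos in auto)
qed

text \<open>The last clause is stated for every neighbourhood \<open>W\<close>, because gluing
  shrinks the domain of the piece before multiplicativity is used: the factors and the product must
  land in the smaller domain.\<close>

lemma local_piece:
 "EX S F. openin (gtop G) S & x0 : S & smooth_map C.A K.A S F & (ALL g:S. M.mc_at F g) & (ALL x:S \<inter> units G. F x = fM x) &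
  (ALL W. openin (gtop G) W & x0 : W --> (EX N. openin (gtop G) N & x0 : N &
    (ALL g h. g : N --> h : N --> (g, h) : composable2 G --> g : W & h : W & (g, h) : mul_dom G & mul G g h : W &
     (F g, F h) : mul_dom H & F (mul G g h) = mul H (F g) (F h))))"
proof -
 obtain Fh where Fh: "sm_at Fh 0" "Fh 0 = 0" "near g ~ 0. Fh (P g) = ph g"
  "near g ~ 0. P' (Fh g) = ph g" "near g ~ 0. K.tg (Fh g) = ph (C.tg g)" "related Fh"
  "near q ~ (0, 0). P (fst q) = C.tg (snd q) --> Fh (C.mm q) = K.mm (Fh (fst q), Fh (snd q))"
  by (rule local_existence)
 define F where "F g = K.e (Fh (ps g))" for g
 have nF: "near y ~ 0. R y ==> near z ~ 0. R (Fh z)" for R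
  by (rule sm_at_eventually[OF Fh(1)]) (simp add: Fh(2))
 have box': "near y ~ 0. y : box P' r'"
  by (rule near_open_set[OF open_box[OF K.bdd_P]]) (use K.r_pos in \<open>simp add: box_def K.P_0\<close>)
 have rep: "near z ~ 0. F (C.e z) : V & et (F (C.e z)) = Fh z"
  using C.near_U nF[OF box'] by eventually_elim (simp add: F_def K.e_box)
 have mc: "near z ~ 0. M.mc_at F (C.e z)"
  by (rule related_mc_at[OF Fh(1,2,6,4,5) rep])
 have "near z ~ 0. C.e z : U & ps (C.e z) = z & F (C.e z) : V & et (F (C.e z)) = Fh z & sm_at Fh z &
  M.mc_at F (C.e z) & (P z = z --> F (C.e z) = fM (C.e z))"
  using C.near_U rep sm_at_near[OF Fh(1)] mc Fh(3) e_ph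
 proof eventually_elim
  case (elim z)
  thus ?case by (simp add: F_def) metis
 qed
 from near_box_ex[OF this, of P] obtain s where s0: "s > 0" and s1: "ALL z:box P s. C.e z : U & ps (C.e z) = z & F (C.e z) : V & et (F (C.e z)) = Fh z & sm_at Fh z &
  M.mc_at F (C.e z) & (P z = z --> F (C.e z) = fM (C.e z))" by (elim exE conjE)
 define s' where "s' = min s r"
 have s': "s' > 0" "box P s' \<subseteq> box P s" "box P s' \<subseteq> box P r" using s0 C.r_pos by (auto simp: s'_def box_def)
 have ob: "open (box P s')" by (rule open_box[OF C.bdd_P])
 let ?S = "C.e ` box P s'"
 have S: "openin (gtop G) ?S" "x0 : ?S"
  using C.open_e_image[OF ob s'(3)] s'(1) by (auto intro!: image_eqI[of _ _ 0] simp: box_def C.P_0)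
 have SF: "g : U & F g : V & et (F g) = Fh (ps g) & sm_at Fh (ps g) & M.mc_at F g & (g : units G --> F g = fM g)"
  if "g : ?S" for g
 proof -
  obtain z where z: "g = C.e z" "z : box P s'" using \<open>g : ?S\<close> by blast
  note b = bspec[OF s1, of z, OF subsetD[OF s'(2) z(2)]]
  thus ?thesis unfolding z(1) using C.unit_iff[of "C.e z"] by simp
 qed
 have sm: "smooth_map C.A K.A ?S F"
 proof (rule smooth_mapI[OF C.good K.good])
  show "?S \<subseteq> gspace G" using SF C.U_space by blast
  fix x assume x: "x : ?S"
  have "reps U ps V et ?S F x Fh" unfolding reps_def
  proof
   show "sm_at Fh (ps x)" using SF[OF x] by blast
   show "near z ~ (ps x). C.e z : ?S --> F (C.e z) : V & et (F (C.e z)) = Fh z"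
    using chart0_near[OF C.chart' conjunct1[OF SF[OF x]]]
   proof eventually_elim
    case (elim z)
    show ?case using SF[of "C.e z"] elim by auto
   qed
  qed
  thus "EX U fi V ps h. achart C.A U fi & achart K.A V ps & x : U & F x : V & reps U fi V ps ?S F x h"
   using C.chart K.chart SF[OF x] by blast
 qed
 have mul: "EX N. openin (gtop G) N & x0 : N &
    (ALL g h. g : N --> h : N --> (g, h) : composable2 G --> g : W & h : W & (g, h) : mul_dom G & mul G g h : W &
     (F g, F h) : mul_dom H & F (mul G g h) = mul H (F g) (F h))" if W: "openin (gtop G) W" "x0 : W" for W
 proof -
  have FF: "near q ~ (0, 0). R q ==> near q ~ (0, 0). R (Fh (fst q), Fh (snd q))" for R
  proof -
   assume R: "near q ~ (0, 0). R q"
   have "sm_at (%q. (Fh (fst q), Fh (snd q))) (0, 0)"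
    by (intro sm_at_Pair sm_at_compose[where f=fst and g=Fh] sm_at_compose[where f=snd and g=Fh] sm_at_fst sm_at_snd sm_at_id)
     (simp_all add: Fh(1))
   from sm_at_eventually[OF this, of R] R show ?thesis by (simp add: Fh(2))
  qed
  have "near q ~ (0, 0). e' (fst q) & e' (snd q) & (P (fst q) = C.tg (snd q) -->
    (C.e (fst q), C.e (snd q)) : mul_dom G & mul G (C.e (fst q)) (C.e (snd q)) : W &
    (F (C.e (fst q)), F (C.e (snd q))) : mul_dom H &
    F (mul G (C.e (fst q)) (C.e (snd q))) = mul H (F (C.e (fst q))) (F (C.e (snd q))))"
   if "near z ~ 0. e' z" for e'
   using C.near_first[OF that] C.near_second[OF that] C.near_first[OF C.near_U] C.near_second[OF C.near_U] C.mm_rep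
    C.near_mm[OF C.near_open[OF W]] FF[OF K.mm_rep] Fh(7) C.near_first[OF Fh(4)] C.near_second[OF Fh(5)] C.near_mm[OF C.near_U]
  proof eventually_elim
   case (elim q)
   show ?case
   proof (intro conjI impI)
    show "e' (fst q)" "e' (snd q)" using elim by auto
    assume c: "P (fst q) = C.tg (snd q)"
    have c': "P' (Fh (fst q)) = K.tg (Fh (snd q))"
     using elim(9,10) c phi_P[of "fst q"] by simp
    have m: "mul G (C.e (fst q)) (C.e (snd q)) = C.e (C.mm q)" using elim(5) c by simp
    have Fe: "F (C.e (fst q)) = K.e (Fh (fst q))" "F (C.e (snd q)) = K.e (Fh (snd q))" "F (C.e (C.mm q)) = K.e (Fh (C.mm q))"
     using elim(3,4,11) by (simp_all add: F_def)
    show "(C.e (fst q), C.e (snd q)) : mul_dom G" using elim(5) c by blast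
    show "mul G (C.e (fst q)) (C.e (snd q)) : W" unfolding m by (rule elim(6))
    show "(F (C.e (fst q)), F (C.e (snd q))) : mul_dom H" unfolding Fe using elim(7) c' by simp
    show "F (mul G (C.e (fst q)) (C.e (snd q))) = mul H (F (C.e (fst q))) (F (C.e (snd q)))"
     unfolding m Fe using elim(7,8) c c' by simp
   qed
  qed
  from this[of "%z. (C.e z : U & ps (C.e z) = z) & C.e z : W & (C.e z : tgt_dom G & tgt G (C.e z) : U & C.e (C.tg z) = tgt G (C.e z))"]
  have "near q ~ (0, 0). ((C.e (fst q) : U & ps (C.e (fst q)) = fst q) & C.e (fst q) : W) & C.e (snd q) : W & (P (fst q) = C.tg (snd q) -->
    (C.e (fst q), C.e (snd q)) : mul_dom G & mul G (C.e (fst q)) (C.e (snd q)) : W &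
    (F (C.e (fst q)), F (C.e (snd q))) : mul_dom H &
    F (mul G (C.e (fst q)) (C.e (snd q))) = mul H (F (C.e (fst q))) (F (C.e (snd q))))"
   using C.near_U C.near_open[OF W] C.e_tgt by (auto elim!: eventually_mono simp: eventually_conj_iff)
  then obtain ro where ro: "ro > 0" "ro <= r" "!!z w. z : box P ro ==> w : box P ro ==> ((C.e z : U & ps (C.e z) = z) & C.e z : W) & C.e w : W & (P z = C.tg w -->
    (C.e z, C.e w) : mul_dom G & mul G (C.e z) (C.e w) : W &
    (F (C.e z), F (C.e w)) : mul_dom H & F (mul G (C.e z) (C.e w)) = mul H (F (C.e z)) (F (C.e w)))"
   by (rule near_pair_box) auto
  show ?thesis
  proof (intro exI[of _ "C.e ` box P ro"] conjI allI impI)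
   show "openin (gtop G) (C.e ` box P ro)"
    by (rule C.open_e_image[OF open_box[OF C.bdd_P]]) (use ro(2) in \<open>auto simp: box_def\<close>)
   show "x0 : C.e ` box P ro" using ro(1) by (intro image_eqI[of _ _ 0]) (auto simp: box_def C.P_0)
   fix g h assume "g : C.e ` box P ro" "h : C.e ` box P ro" and c: "(g, h) : composable2 G"
   then obtain z w where z: "g = C.e z" "z : box P ro" "h = C.e w" "w : box P ro" by blast
   note R = ro(3)[OF z(2,4)]
   have "P z = ps (src G g)" using C.src_U[of g] R z(1) by simp
   also have "\<dots> = C.tg w" using c z(3) by (simp add: composable2_def C.tg_def)
   finally have "P z = C.tg w" .
   thus "g : W" "h : W" "(g, h) : mul_dom G" "mul G g h : W" "(F g, F h) : mul_dom H" "F (mul G g h) = mul H (F g) (F h)"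
    using R unfolding z(1,3) by auto
  qed
 qed
 show ?thesis
  by (intro exI[of _ ?S] exI[of _ F] conjI S sm ballI allI impI mul) (use SF in auto)
qed

end

section \<open>Global existence\<close>

context lie_morphism
begin

text \<open>At a unit both Maurer-Cartan forms are the identity, so the condition reduces to dF = f
  there.\<close>

lemma mc_at_integrates:
 assumes mc: "mc_at F x" and Fx: "F x = fM x" and a: "(x, a) : algebroid G"
 shows "(F x, differential G.A H.A F x a) = f (x, a)"
proof -
 have x: "x : units G" "differential G.A G.A (src G) x a = 0" using a by (auto simp: algebroid_def)
 obtain U ps P r V et P' r' where "mor_charts G x U ps P r H fM V et P' r' f" by (rule charts_exist[OF x(1)])
 then interpret T: mor_charts G x U ps P r H fM V et P' r' f .
 let ?d = "differential G.A H.A F x a"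
 have m: "differential H.A H.A (src H) (fM x) ?d = 0" "mc_form H (fM x) ?d = f (mc_form G x a)"
  using mc x(2) Fx unfolding mc_at_def by auto
 have "(fM x, ?d) : algebroid H" using m(1) fM_unit[OF x(1)] by (simp add: algebroid_def)
 from T.K.mc_form_unit[OF this] T.C.mc_form_unit[OF a] m(2) Fx show ?thesis by simp
qed

text \<open>Each unit x has a piece \<open>F x\<close> on \<open>S x\<close>. After
  \<open>compatible_shrinking\<close>, whenever two of the smaller sets meet, one of them lies in
  the domain of the other piece. There both pieces are defined along a whole path from the source
  unit, where each equals \<open>fM\<close>, and \<open>mc_agree\<close> identifies them.\<close>

lemma global_existence: "EX S F. local_groupoid_map G H S F & integrates G H F f"
proof -
 let ?piece = "%x S F. openin (gtop G) S & x : S & smooth_map G.A H.A S F & (ALL g:S. mc_at F g) & (ALL x:S \<inter> units G. F x = fM x)"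
 let ?mul = "%x F W N. openin (gtop G) N & x : N &
    (ALL g h. g : N --> h : N --> (g, h) : composable2 G --> g : W & h : W & (g, h) : mul_dom G & mul G g h : W &
     (F g, F h) : mul_dom H & F (mul G g h) = mul H (F g) (F h))"
 define ok where "ok x p \<longleftrightarrow> ?piece x (fst p) (snd p) & (ALL W. openin (gtop G) W & x : W --> (EX N. ?mul x (snd p) W N))" for x p
 have "EX p. ok x p" if "x : units G" for x
 proof -
  obtain U ps P r V et P' r' where "mor_charts G x U ps P r H fM V et P' r' f" using \<open>x : units G\<close> by (rule charts_exist)
  then interpret T: mor_charts G x U ps P r H fM V et P' r' f .
  obtain S F where SF: "?piece x S F" "ALL W. openin (gtop G) W & x : W --> (EX N. ?mul x F W N)"
   using T.local_piece by (elim exE conjE) (rule that, intro conjI, assumption+)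
  hence "ok x (S, F)" unfolding ok_def fst_conv snd_conv by (rule conjI)
  thus ?thesis by (rule exI)
 qed
 hence "ALL x:units G. EX p. ok x p" by blast
 then obtain p where p: "ALL x:units G. ok x (p x)" by (rule bchoice[THEN exE])
 define S where "S x = fst (p x)" for x
 define F where "F x = snd (p x)" for x
 note ok = bspec[OF p, unfolded ok_def S_def[symmetric] F_def[symmetric]]
 note SF = conjunct1[OF ok] and mul = conjunct2[OF ok, rule_format, OF _ conjI]
 have reg: "EX O' C. openin (gtop G) O' & closedin (gtop G) C & x : O' & O' \<subseteq> C & C \<subseteq> W"
  if x: "x : units G" and W: "openin (gtop G) W" "x : W" for x W
 proof -
  obtain U ps P r where "unit_chart G x U ps P r" by (rule G.unit_chart_exists[OF x])
  then interpret T: unit_chart G x U ps P r .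
  show ?thesis by (rule T.regular_at[OF W])
 qed
 obtain N0 where N0: "!!x. x : units G ==> openin (gtop G) (N0 x) & x : N0 x & N0 x \<subseteq> S x"
  "!!x y. x : units G ==> y : units G ==> N0 x \<inter> N0 y ~= {} ==> N0 x \<subseteq> S y \<or> N0 y \<subseteq> S x"
 proof (rule compatible_shrinking[OF G.second_cnt, of "units G" S])
  show "openin (gtop G) (S x) & x : S x" if "x : units G" for x using SF[OF that] by blast
  show "EX O' C. openin (gtop G) O' & closedin (gtop G) C & x : O' & O' \<subseteq> C & C \<subseteq> W"
   if "x : units G" "openin (gtop G) W" "x : W" for x W by (rule reg[OF that])
  fix N assume a: "!!x. x : units G ==> openin (gtop G) (N x) & x : N x & N x \<subseteq> S x"
   "!!x y. x : units G ==> y : units G ==> N x \<inter> N y ~= {} ==> N x \<subseteq> S y \<or> N y \<subseteq> S x"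
  show thesis
   apply (rule that[of N])
   subgoal by (rule a(1))
   subgoal by (rule a(2))
   done
 qed
 let ?path = "%N g. EX c. smooth_map real_atlas G.A {0..1} c & c 0 = src G g & c 1 = g & (ALL t:{0..1}. c t : N & src G (c t) = src G g)"
 have nex: "ALL x:units G. EX N. openin (gtop G) N & x : N & N \<subseteq> N0 x & (ALL g:N. ?path N g)"
 proof
  fix x assume x: "x : units G"
  obtain U ps P r where "unit_chart G x U ps P r" by (rule G.unit_chart_exists[OF x])
  then interpret T: unit_chart G x U ps P r .
  obtain s where s: "s > 0" "s <= r" "T.e ` box P s \<subseteq> N0 x"
   using N0(1)[OF x] by (elim conjE) (rule T.small_box)
  show "EX N. openin (gtop G) N & x : N & N \<subseteq> N0 x & (ALL g:N. ?path N g)"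
  proof (intro exI[of _ "T.e ` box P s"] conjI ballI s(3))
   show "openin (gtop G) (T.e ` box P s)"
    by (rule T.open_e_image[OF open_box[OF T.bdd_P]]) (use s(2) in \<open>auto simp: box_def\<close>)
   show "x : T.e ` box P s" using s(1) by (intro image_eqI[of _ _ 0]) (auto simp: box_def T.P_0)
   fix g assume "g : T.e ` box P s"
   then obtain c where "smooth_map real_atlas G.A {0..1} c" "c 0 = src G g" "c 1 = g"
    "ALL t:{0..1}. c t : T.e ` box P s & src G (c t) = src G g"
    using T.fibre_path[OF s(1,2), of g thesis] by blast
   thus "?path (T.e ` box P s) g" by (intro exI conjI)
  qed
 qed
 obtain N where NN: "ALL x:units G. openin (gtop G) (N x) & x : N x & N x \<subseteq> N0 x & (ALL g:N x. ?path (N x) g)"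
  using bchoice[OF nex] by (elim exE)
 have N: "openin (gtop G) (N x) & x : N x & N x \<subseteq> N0 x" if "x : units G" for x using bspec[OF NN that] by (elim conjE) (intro conjI)
 have path: "?path (N x) g" if "x : units G" "g : N x" for x g using bspec[OF NN that(1)] by (elim conjE) (erule bspec[OF _ that(2)])
 \<comment> \<open>The choice of the unit is arbitrary; \<open>F'_eq\<close> shows that every piece
   covering g gives the same value.\<close>
 define F' where "F' g = F (SOME x. x : units G & g : N x) g" for g
 have agree: "F x g = F y g" if x: "x : units G" "g : N x" and y: "y : units G" and sub: "N x \<subseteq> S y" for x y g
 proof -
  obtain c where c: "smooth_map real_atlas G.A {0..1} c" "c 0 = src G g" "c 1 = g" "!!t. t : {0..1} ==> c t : N x & src G (c t) = src G g"
   using path[OF x] by blast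
  have Sx: "N x \<subseteq> S x" using N[OF x(1)] N0(1)[OF x(1)] by blast
  have z: "(0::real) : {0..1}" by simp
  have c0: "c 0 : N x" using c(4)[OF z] by blast
  have gs: "g : gspace G" using G.openin_space[of "N x" g] N[OF x(1)] x(2) by blast
  have u: "c 0 : units G" unfolding c(2) by (rule G.src_units[OF gs])
  have "F x (c 1) = F y (c 1)"
  proof (rule mc_agree[where S="S x" and S'="S y" and y="src G g"])
   show "F x (c 0) = F y (c 0)" using SF[OF x(1)] SF[OF y] c0 Sx sub u by (metis IntI subsetD)
   show "src G (c t) = src G g & c t : S x & c t : S y & mc_at (F x) (c t) & mc_at (F y) (c t)" if "t : {0..1}" for t
    using c(4)[OF that] SF[OF x(1)] SF[OF y] Sx sub by blast
  qed (use SF[OF x(1)] SF[OF y] c(1) in auto)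
  thus ?thesis by (simp add: c(3))
 qed
 have F'_eq: "F' g = F x g" if x: "x : units G" "g : N x" for x g
 proof -
  define y where "y = (SOME x. x : units G & g : N x)"
  have y: "y : units G" "g : N y" using someI[of "%x. x : units G & g : N x" x] x unfolding y_def by auto
  have "N0 x \<inter> N0 y ~= {}" using x(2) y(2) N[OF x(1)] N[OF y(1)] by blast
  from N0(2)[OF x(1) y(1) this] have "N x \<subseteq> S y \<or> N y \<subseteq> S x" using N[OF x(1)] N[OF y(1)] by blast
  hence "F y g = F x g" using agree[OF x y(1)] agree[OF y x(1)] by metis
  thus ?thesis by (simp add: F'_def y_def[symmetric])
 qed
 let ?D = "UN x:units G. N x"
 have NS: "N x \<subseteq> S x" if "x : units G" for x using N[OF that] N0(1)[OF that] by blast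
 have oD: "openin (gtop G) ?D" using N by (intro openin_Union) auto
 have smN: "smooth_map G.A H.A (N x) (F x)" if "x : units G" for x
  by (rule smooth_map_subset[OF _ NS[OF that]]) (use SF[OF that] in blast)
 have F'x: "F' x = fM x" if x: "x : units G" for x
 proof -
  have "F' x = F x x" by (rule F'_eq[OF x]) (use N[OF x] in blast)
  also have "\<dots> = fM x" using SF[OF x] x by blast
  finally show ?thesis .
 qed
 have sm: "smooth_map G.A H.A ?D F'"
 proof (rule smooth_map_local[OF G.smooth_atlas H.smooth_atlas])
  fix g assume "g : ?D"
  then obtain x where x: "x : units G" "g : N x" by blast
  show "EX W F''. openin (gtop G) W & g : W & smooth_map G.A H.A W F'' & (ALL y:W. F'' y = F' y)"
   by (intro exI[of _ "N x"] exI[of _ "F x"] conjI ballI smN x F'_eq[symmetric]) (use N[OF x(1)] x in auto)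
 qed
 \<comment> \<open>With \<open>N x\<close> as the prescribed neighbourhood, both factors and the
   product stay where \<open>F'\<close> coincides with the single piece \<open>F x\<close>.\<close>
 have "EX N'. ?mul x (F x) (N x) N'" if x: "x : units G" for x
  by (rule mul[OF x, of "N x"]) (use N[OF x] in blast)+
 hence "ALL x:units G. EX N'. ?mul x (F x) (N x) N'" by (intro ballI)
 from bchoice[OF this] obtain N' where NN': "ALL x:units G. ?mul x (F x) (N x) (N' x)" by (elim exE)
 note N' = bspec[OF NN']
 let ?T = "(UN x:units G. N' x \<times> N' x) \<inter> composable2 G"
 have "near_units2 G (%g h. g : ?D & h : ?D & (g, h) : mul_dom G & mul G g h : ?D &
             (F' g, F' h) : mul_dom H & F' (mul G g h) = mul H (F' g) (F' h))"
  unfolding near_units2_def openin_subtopology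
 proof (rule exI[of _ "?T"], intro conjI ballI)
  have "openin (prod_topology (gtop G) (gtop G)) (UN x:units G. N' x \<times> N' x)"
   using N' by (intro openin_Union) (auto simp: openin_prod_Times_iff)
  thus "EX T. openin (prod_topology (gtop G) (gtop G)) T & ?T = T \<inter> composable2 G" by blast
  fix x assume x: "x : units G"
  have "(x, x) : composable2 G"
   using x G.units_space G.units_tgt G.src_unit[OF x] G.tgt_unit[OF x] by (auto simp: composable2_def)
  thus "(x, x) : (UN x:units G. N' x \<times> N' x) \<inter> composable2 G" using N'[OF x] x by blast
 next
  fix q assume q: "q : (UN x:units G. N' x \<times> N' x) \<inter> composable2 G"
  obtain g h where gh: "q = (g, h)" by fastforce
  obtain x where x: "x : units G" "g : N' x" "h : N' x" "(g, h) : composable2 G" using q gh by blast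
  have m: "g : N x & h : N x & (g, h) : mul_dom G & mul G g h : N x & (F x g, F x h) : mul_dom H & F x (mul G g h) = mul H (F x g) (F x h)"
   using N'[OF x(1)] x by blast
  hence "F' g = F x g" "F' h = F x h" "F' (mul G g h) = F x (mul G g h)" using F'_eq[OF x(1)] by auto
  thus "case q of (g, h) => g : ?D & h : ?D & (g, h) : mul_dom G & mul G g h : ?D &
             (F' g, F' h) : mul_dom H & F' (mul G g h) = mul H (F' g) (F' h)"
   unfolding gh using m x(1) by auto
 qed
 moreover have "F' ` units G \<subseteq> units H" using F'x fM_unit by auto
 moreover have "units G \<subseteq> ?D" using N by blast
 ultimately have lgm: "local_groupoid_map G H ?D F'" unfolding local_groupoid_map_def using oD sm by blast
 have "integrates G H F' f" unfolding integrates_def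
 proof clarify
  fix x a assume a: "(x, a) : algebroid G"
  hence x: "x : units G" by (simp add: algebroid_def)
  have "differential G.A H.A F' x a = differential G.A H.A (F x) x a"
   by (rule differential_cong[OF G.smooth_atlas H.smooth_atlas _ _ smN[OF x] F'_eq[OF x]]) (use N[OF x] in auto)
  moreover have "mc_at (F x) x" "F x x = fM x" using SF[OF x] x by blast+
  ultimately show "(F' x, differential G.A H.A F' x a) = f (x, a)"
   using mc_at_integrates[OF _ _ a, of "F x"] F'x[OF x] by simp
 qed
 thus ?thesis using lgm by blast
qed

end

section \<open>Uniqueness near the units\<close>

lemma (in lie_groupoid) mul_dom_composable: "(g, h) : mul_dom G ==> src G g = tgt G h"
 using openin_subset[OF open_mul] by (auto simp: composable2_def)

lemma (in lie_groupoid) near_units1I: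
 assumes "!!x. x : units G ==> EX N. openin (gtop G) N & x : N & (ALL g:N. R g)"
 shows "near_units1 G R"
 unfolding near_units1_def
proof (intro exI conjI)
 let ?W = "\<Union>{N. openin (gtop G) N & (ALL g:N. R g)}"
 show "openin (gtop G) ?W" by (rule openin_Union) blast
 show "units G \<subseteq> ?W" using assms by blast
 show "ALL g:?W. R g" by blast
qed

lemma (in unit_chart) near_nbhd:
 assumes "near z ~ 0. R (e z)"
 shows "EX N. openin (gtop G) N & x0 : N & (ALL g:N. R g)"
proof -
 obtain s where s: "s > 0" "ALL z:box P s. R (e z)" using near_box_ex[OF assms, of P] by blast
 let ?b = "box P (min s r)"
 have b: "?b \<subseteq> box P r" "?b \<subseteq> box P s" by (auto simp: box_def)
 have "openin (gtop G) (e ` ?b)" by (rule open_e_image[OF open_box[OF bdd_P] b(1)])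
 moreover have "x0 : e ` ?b" using s(1) r_pos by (intro image_eqI[of _ _ 0]) (auto simp: box_def P_0)
 moreover have "ALL g:e ` ?b. R g" using s(2) b(2) by blast
 ultimately show ?thesis by blast
qed

context mor_charts
begin

text \<open>Every integration satisfies \<open>related\<close> in coordinates, by
  \<open>multiplicative_related\<close>. The composability of images required there is contained in
  the membership of \<open>(F g, F h)\<close> in \<open>mul_dom H\<close>.\<close>

lemma integrating_chart:
 assumes F: "local_groupoid_map G H S F" "integrates G H F f"
 shows "sm_at (%z. et (F (C.e z))) 0" "et (F (C.e 0)) = 0" "related (%z. et (F (C.e z)))"
  "near z ~ 0. F (C.e z) : V" "near z ~ 0. P z = z --> F (C.e z) = fM (C.e z)"
  "near z ~ 0. C.e z : S"
proof -
 let ?F = "%z. et (F (C.e z))"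
 have S: "openin (gtop G) S" "x0 : S" "smooth_map C.A K.A S F"
  and nu: "near_units2 G (%g h. g : S & h : S & (g, h) : mul_dom G & mul G g h : S &
             (F g, F h) : mul_dom H & F (mul G g h) = mul H (F g) (F h))"
  using F(1) C.x0_unit unfolding local_groupoid_map_def by blast+
 have int: "(F x, differential C.A K.A F x a) = f (x, a)" if "(x, a) : algebroid G" for x a
  using F(2) that unfolding integrates_def by fast
 have Fx: "F (C.e z) = fM (C.e z)" if "z : box P r" "P z = z" for z
 proof -
  have a: "(C.e z, C.chi (C.e z) (C.Q 0)) : algebroid G" using alg_Q[of z 0] that by simp
  from arg_cong[OF int[OF a], of fst] f_fst[OF a] show ?thesis by simp
 qed
 have F0: "F x0 = fM x0" using Fx[of 0] C.r_pos by (simp add: box_def C.P_0)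
 obtain h where h: "reps U ps V et S F x0 h"
  by (rule smooth_map_rep[OF C.good C.chart K.good K.chart S(3,2) C.x0_U]) (use F0 K.x0_U in simp)
 show inS: "near z ~ 0. C.e z : S" by (rule C.near_open[OF S(1,2)])
 have ev: "near z ~ 0. F (C.e z) : V & h z = ?F z"
  using inS h by (auto simp: reps_def elim: eventually_elim2)
 thus FV: "near z ~ 0. F (C.e z) : V" by eventually_elim simp
 show sm: "sm_at ?F 0"
  by (rule sm_at_transform[of h]) (use h ev in \<open>auto simp: reps_def elim: eventually_mono\<close>)
 show F00: "et (F (C.e 0)) = 0" by (simp add: F0)
 show unitsF: "near z ~ 0. P z = z --> F (C.e z) = fM (C.e z)"
  using near_box by eventually_elim (use Fx in blast)
 have nF: "near y ~ 0. R y ==> near z ~ 0. R (?F z)" for R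
  by (rule sm_at_eventually[OF sm]) (simp add: F0)
 have FF: "near q ~ (0, 0). R (?F (fst q), ?F (snd q))" if R: "near q ~ (0, 0). R q" for R
 proof -
  have "sm_at (%q. (?F (fst q), ?F (snd q))) (0, 0)"
   by (intro sm_at_Pair sm_at_compose[where f=fst and g="?F"] sm_at_compose[where f=snd and g="?F"] sm_at_fst sm_at_snd sm_at_id)
    (simp_all add: sm)
  from sm_at_eventually[OF this, of R] R show ?thesis by (simp add: F0)
 qed
 have rep: "near z ~ 0. F (C.e z) : V & et (F (C.e z)) = ?F z" using FV by eventually_elim simp
 show "related ?F"
 proof (rule multiplicative_related[OF sm F00])
  show "near x ~ 0. P x = x --> ?F x = ph x & (ALL v. D ?F x (C.Q v) = fh x v)"
   using reps_near[OF sm rep] unitsF fM_rep(1) near_box FV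
  proof eventually_elim
   case (elim z)
   show ?case
   proof (intro impI conjI allI)
    assume Pz: "P z = z"
    let ?g = "C.e z"
    have g: "?g : U" "ps ?g = z" "F ?g = fM ?g" "fM ?g : V" "F ?g : V" using elim Pz by auto
    show "?F z = ph z" using elim Pz by simp
    fix v
    let ?a = "C.chi ?g (C.Q v)"
    have a: "(?g, ?a) : algebroid G" using alg_Q[of z v] elim(4) Pz by simp
    have r: "reps U ps V et UNIV F ?g ?F" using elim(1) by blast
    have "D ?F z (C.Q v) = K.ch (F ?g) (differential C.A K.A F ?g ?a)"
     using tcoord_differential[OF C.good C.chart K.good K.chart r g(1,5), of ?a] tcoord_inv[OF C.good C.chart g(1)]
     by (simp add: g(2))
    also have "differential C.A K.A F ?g ?a = snd (f (?g, ?a))" using arg_cong[OF int[OF a], of snd] by simp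
    also have "K.ch (F ?g) (snd (f (?g, ?a))) = fh z v" using fh_eq[OF Pz elim(4) g(4)] g(3) by simp
    finally show "D ?F z (C.Q v) = fh z v" .
   qed
  qed
  show comp: "near q ~ (0, 0). P (fst q) = C.tg (snd q) --> P' (?F (fst q)) = K.tg (?F (snd q))"
   using C.near_units2[OF nu] C.near_first[OF FV] C.near_second[OF FV]
  proof eventually_elim
   case (elim q)
   show ?case
   proof
    assume "P (fst q) = C.tg (snd q)"
    hence "src H (F (C.e (fst q))) = tgt H (F (C.e (snd q)))" using elim(1) K.mul_dom_composable by blast
    thus "P' (?F (fst q)) = K.tg (?F (snd q))"
     using K.src_U[OF elim(2)] K.e_psi[OF elim(3)] by (simp add: K.tg_def)
   qed
  qed
  show "near q ~ (0, 0). P (fst q) = C.tg (snd q) --> ?F (C.mm q) = K.mm (?F (fst q), ?F (snd q))"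
   using C.near_units2[OF nu] C.near_first[OF FV] C.near_second[OF FV] comp C.mm_rep FF[OF K.mm_rep]
  proof eventually_elim
   case (elim q)
   show ?case
   proof
    assume c: "P (fst q) = C.tg (snd q)"
    have "?F (C.mm q) = et (mul H (F (C.e (fst q))) (F (C.e (snd q))))" using elim(1,5) c by simp
    also have "\<dots> = et (mul H (K.e (?F (fst q))) (K.e (?F (snd q))))" using K.e_psi[OF elim(2)] K.e_psi[OF elim(3)] by simp
    also have "\<dots> = K.mm (?F (fst q), ?F (snd q))" using elim(4,6) c by simp
    finally show "?F (C.mm q) = K.mm (?F (fst q), ?F (snd q))" .
   qed
  qed
 qed
qed

text \<open>Compatibility with source and target is borrowed from the germ of
  \<open>local_existence\<close>, with which the given integration agrees by
  \<open>local_uniqueness\<close>.\<close>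

lemma integrating_mc_at:
 assumes F: "local_groupoid_map G H S F" "integrates G H F f"
 shows "near z ~ 0. C.e z : S & M.mc_at F (C.e z)"
proof -
 let ?F = "%z. et (F (C.e z))"
 note I = integrating_chart[OF F]
 obtain Fh where Fh: "sm_at Fh 0" "Fh 0 = 0" "near g ~ 0. Fh (P g) = ph g"
  "near g ~ 0. P' (Fh g) = ph g" "near g ~ 0. K.tg (Fh g) = ph (C.tg g)" "related Fh"
  by (rule local_existence)
 have eq: "near z ~ 0. ?F z = Fh z"
 proof (rule local_uniqueness[OF I(1-3) Fh(1,2,6)])
  show "near x ~ 0. P x = x --> ?F x = Fh x"
   using I(5) fM_rep(1) Fh(3) by eventually_elim auto
 qed
 have "near z ~ 0. M.mc_at F (C.e z)"
 proof (rule related_mc_at[OF I(1-3)])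
  show "near z ~ 0. P' (?F z) = ph z" using eq Fh(4) by eventually_elim simp
  show "near z ~ 0. K.tg (?F z) = ph (C.tg z)" using eq Fh(5) by eventually_elim simp
  show "near z ~ 0. F (C.e z) : V & et (F (C.e z)) = ?F z" using I(4) by eventually_elim simp
 qed
 with I(6) show ?thesis by eventually_elim simp
qed

lemma integrating_unique:
 assumes F: "local_groupoid_map G H S F" "integrates G H F f" and F': "local_groupoid_map G H S' F'" "integrates G H F' f"
 shows "near z ~ 0. C.e z : S & C.e z : S' & F (C.e z) = F' (C.e z)"
proof -
 note I = integrating_chart[OF F] and I' = integrating_chart[OF F']
 have "near z ~ 0. et (F (C.e z)) = et (F' (C.e z))"
 proof (rule local_uniqueness[OF I(1-3) I'(1-3)])
  show "near x ~ 0. P x = x --> et (F (C.e x)) = et (F' (C.e x))"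
   using I(5) I'(5) by eventually_elim simp
 qed
 with I(4,6) I'(4,6) show ?thesis by eventually_elim (metis K.e_psi)
qed

end

context lie_morphism
begin

lemma uniqueness:
 assumes F: "local_groupoid_map G H S F" "integrates G H F f" and F': "local_groupoid_map G H S' F'" "integrates G H F' f"
 shows "near_units1 G (%g. g : S & g : S' & F g = F' g)"
proof (rule G.near_units1I)
 fix x assume "x : units G"
 then obtain U ps P r V et P' r' where "mor_charts G x U ps P r H fM V et P' r' f" by (rule charts_exist)
 then interpret T: mor_charts G x U ps P r H fM V et P' r' f .
 show "EX N. openin (gtop G) N & x : N & (ALL g:N. g : S & g : S' & F g = F' g)"
  by (rule T.C.near_nbhd[OF T.integrating_unique[OF F F']])
qed

lemma mc_at_near:
 assumes F: "local_groupoid_map G H S F" "integrates G H F f"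
 shows "near_units1 G (%g. g : S & mc_at F g)"
proof (rule G.near_units1I)
 fix x assume "x : units G"
 then obtain U ps P r V et P' r' where "mor_charts G x U ps P r H fM V et P' r' f" by (rule charts_exist)
 then interpret T: mor_charts G x U ps P r H fM V et P' r' f .
 show "EX N. openin (gtop G) N & x : N & (ALL g:N. g : S & mc_at F g)"
  by (rule T.C.near_nbhd[OF T.integrating_mc_at[OF F]])
qed

text \<open>The first component of the equation at the zero vector over x.\<close>

lemma integrates_unit:
 assumes F: "integrates G H F f" and x: "x : units G" shows "F x = fM x"
proof -
 obtain U ps P r where "unit_chart G x U ps P r" by (rule G.unit_chart_exists[OF x])
 then interpret T: unit_chart G x U ps P r .
 have a: "(x, 0) : algebroid G"
  using x T.x0_U by (simp add: T.algebroid_iff linear_0[OF lin_tcoord[OF G.good T.chart T.x0_U]] T.P_0)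
 have "(F x, differential G.A H.A F x 0) = f (x, 0)" using bspec[OF F[unfolded integrates_def] a] by simp
 from arg_cong[OF this, of fst] have 1: "F x = fst (f (x, 0))" by simp
 have "ALL (x, a):algebroid G. fst (f (x, a)) = fM x"
  using morph unfolding algebroid_morphism_def by - (elim conjE, assumption)
 from bspec[OF this a] show ?thesis unfolding 1 by simp
qed

end

section \<open>Tubular structures and the solution formula\<close>

context unit_chart
begin

text \<open>In a tangent chart \<open>E\<close> is a neighbourhood of the zero vector within the
  algebroid, and it contains all vectors over nearby units with coordinates in a small ball. A ball
  is star-shaped, so the whole segment t a stays in \<open>E\<close> and is mapped into
  \<open>W\<close>.\<close>

lemma tubular_near:
 assumes T: "tubular_structure G E fi" and W: "openin (gtop G) W" "x0 : W"
 shows "near z ~ 0. EX x a. e z : fi ` E & inv_into E fi (e z) = (x, a) & fi (x, a) = e z &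
  src G (e z) = x & x : units G & (ALL t:{0..1}. (x, t *. a) : E & fi (x, t *. a) : W)"
proof -
 have t: "openin (subtopology (mfd_top (tangent_atlas A)) (algebroid G)) E" "!!x. x : units G ==> (x, 0) : E"
  "smooth_map (tangent_atlas A) A E fi" "inj_on fi E" "openin (gtop G) (fi ` E)"
  "smooth_map A (tangent_atlas A) (fi ` E) (inv_into E fi)" "ALL (x, a):E. src G (fi (x, a)) = x" "!!x. x : units G ==> fi (x, 0) = x"
  using T unfolding tubular_structure_def by - (elim conjE, (assumption | erule (1) bspec))+
 note gT = good_atlas_tangent[OF good] and aT = achart_tangent[OF good chart]
 note sT = good_atlas_smooth[OF gT]
 obtain T' where T': "openin (mfd_top (tangent_atlas A)) T'" "E = T' \<inter> algebroid G"
  using t(1) unfolding openin_subtopology by blast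
 have E0: "(x0, 0) : E" "fi (x0, 0) = x0" using t(2,8) x0_unit by auto
 have x0T: "(x0, 0) : U \<times> UNIV" using x0_U by simp
 have c0: "ch x0 0 = 0" by (rule linear_0[OF lin_tcoord[OF good chart x0_U]])
 have tc0: "tchart A ps (x0, 0) = (0, 0)" by (simp add: c0)
 have inv: "near q ~ (0, 0). inv_into (U \<times> UNIV) (tchart A ps) q = (e (fst q), chi (e (fst q)) (snd q)) & e (fst q) : U"
  using inv_tangent_near[OF good chart x0_U, of 0] by simp
 have "near q ~ (0, 0). inv_into (U \<times> UNIV) (tchart A ps) q : T'"
  using openin_near[OF sT T'(1) aT x0T] E0(1) T'(2) unfolding tc0 by blast
 moreover have "near q ~ (0, 0). inv_into (U \<times> UNIV) (tchart A ps) q : E --> fi (inv_into (U \<times> UNIV) (tchart A ps) q) : W"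
  using smooth_map_near[OF gT aT smooth_atlas W(1) t(3) E0(1) x0T] W(2) unfolding tc0 E0(2) by blast
 ultimately have "near q ~ (0, 0). e (fst q) : U & ((e (fst q), chi (e (fst q)) (snd q)) : algebroid G -->
   (e (fst q), chi (e (fst q)) (snd q)) : E & fi (e (fst q), chi (e (fst q)) (snd q)) : W)"
  using inv by eventually_elim (simp add: T'(2))
 then obtain R R' where R: "near z ~ 0. R z" "near w ~ 0. R' w" "!!z w. R z ==> R' w ==>
   e z : U & ((e z, chi (e z) w) : algebroid G --> (e z, chi (e z) w) : E & fi (e z, chi (e z) w) : W)"
  unfolding nhds_prod eventually_prod_filter by auto
 obtain ro where ro: "ro > 0" "!!w. norm w < ro ==> R' w"
  using R(2) unfolding eventually_nhds_metric by (auto simp: dist_norm)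
 have x0E: "x0 : fi ` E" using E0 by (metis imageI)
 have i0: "inv_into E fi x0 = (x0, 0)" using inv_into_f_f[OF t(4) E0(1)] E0(2) by simp
 obtain h where "reps U ps (U \<times> UNIV) (tchart A ps) (fi ` E) (inv_into E fi) x0 h"
  by (rule smooth_map_rep[OF good chart gT aT t(6) x0E x0_U]) (use i0 x0_U in simp)
 hence h: "sm_at h 0" "near z ~ 0. e z : fi ` E --> inv_into E fi (e z) : U \<times> UNIV & tchart A ps (inv_into E fi (e z)) = h z"
  by (auto simp: reps_def)
 have h0: "h 0 = (0, 0)" using near_self[OF h(2)] x0E i0 by (simp add: c0)
 have "near z ~ 0. R (fst (h z)) & norm (snd (h z)) < ro"
  by (rule sm_at_eventually[OF h(1), where Q="%q. R (fst q) & norm (snd q) < ro"])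
   (use near_Pair[OF R(1) near_norm_less[OF ro(1)]] h0 in simp)
 thus ?thesis using h(2) near_open[OF t(5) x0E]
 proof eventually_elim
  case (elim z)
  obtain x a where xa: "inv_into E fi (e z) = (x, a)" by fastforce
  have E: "(x, a) : E" "fi (x, a) = e z"
   using inv_into_into[OF elim(3)] f_inv_into_f[OF elim(3)] unfolding xa by auto
  have al: "(x, a) : algebroid G" using E(1) T'(2) by blast
  have xU: "x : U" "h z = (ps x, ch x a)" using elim(2,3) xa by auto
  have src: "src G (e z) = x" using bspec[OF t(7) E(1)] E(2) by simp
  have xu: "x : units G" "P (ch x a) = 0" using al xU(1) by (auto simp: algebroid_iff)
  have lin: "linear (ch x)" by (rule lin_tcoord[OF good chart xU(1)])
  have "(x, t *. a) : E & fi (x, t *. a) : W" if t: "t : {0..1}" for t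
  proof -
   have ct: "ch x (t *. a) = t *. ch x a" by (rule linear_scale[OF lin])
   have "norm (ch x (t *. a)) = \<bar>t\<bar> * norm (ch x a)" unfolding ct by simp
   also have "\<dots> <= 1 * norm (ch x a)" using t by (intro mult_right_mono) auto
   also have "\<dots> < ro" using elim(1) xU(2) by simp
   finally have R': "R' (ch x (t *. a))" by (rule ro(2))
   have Rx: "R (ps x)" using elim(1) xU(2) by simp
   have alt: "(x, t *. a) : algebroid G" using xu xU(1) by (simp add: algebroid_iff ct P_scale)
   show ?thesis using R(3)[OF Rx R'] alt xU(1) by (simp add: tinv_coord[OF good chart])
  qed
  thus ?case using elim(3) xa E(2) src xu(1) by blast
 qed
qed

end

context lie_groupoid
begin

lemma smooth_ray:
 assumes x: "x : gspace G" shows "smooth_map real_atlas (tangent_atlas A) {0..1} (%t. (x, t *. a))"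
proof (rule smooth_mapI[OF achart_real(1) good_atlas_tangent[OF good]])
 show "{0..1} \<subseteq> mfd_space real_atlas" by (simp add: mfd_space_def real_atlas_def)
 fix t :: real
 obtain U fi where U: "(U, fi) : A" "x : U" using x by (rule mfd_spaceE)
 have a: "achart A U fi" by (rule good_achart[OF good U(1)])
 have "reps UNIV (%t. t) (U \<times> UNIV) (tchart A fi) {0..1} (%t. (x, t *. a)) t (%t. (fi x, t *. tangent_coord A fi x a))"
  unfolding reps_def
 proof
  show "sm_at (%t. (fi x, t *. tangent_coord A fi x a)) t"
   by (intro sm_at_Pair sm_at_scaleR sm_at_const sm_at_id)
 qed (use U(2) in \<open>simp add: linear_scale[OF lin_tcoord[OF good a U(2)]]\<close>)
 thus "EX U fi V ps h. achart real_atlas U fi & achart (tangent_atlas A) V ps & t : U & (x, t *. a) : V &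
   reps U fi V ps {0..1} (%t. (x, t *. a)) t h"
  using achart_real(2) achart_tangent[OF good a] U(2) by blast
qed

end

context lie_morphism
begin

text \<open>The solution is k t = F (t g): \<open>mc_at\<close> holds at every arrow near the units,
  so it applies to the velocity of t g for any tubular structure. Uniqueness is
  \<open>mc_unique_global\<close>, which asks for local uniqueness only at the points of this known
  solution; the competing \<open>k'\<close> may run anywhere in \<open>mc_dom\<close>.\<close>

lemma mc_solution_unique:
 assumes T: "tubular_structure G E fi" and F: "local_groupoid_map G H S F" "integrates G H F f"
 shows "near_units1 G (%g. g : S & (EX k. mc_solution G H f fM E fi g k & F g = k 1 &
       (ALL k'. mc_solution G H f fM E fi g k' --> (ALL t:{0..1}. k' t = k t))))"
proof (rule G.near_units1I)
 fix x0 assume x0: "x0 : units G"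
 have smF: "openin (gtop G) S" "smooth_map G.A H.A S F" using F(1) unfolding local_groupoid_map_def by blast+
 have smphi: "smooth_map (tangent_atlas G.A) G.A E fi" and src_phi: "ALL (x, a):E. src G (fi (x, a)) = x"
  and phi0: "!!x. x : units G ==> fi (x, 0) = x"
  using T unfolding tubular_structure_def by - (elim conjE, (assumption | erule (1) bspec))+
 obtain W where W: "openin (gtop G) W" "units G \<subseteq> W" "!!g. g : W ==> g : S & mc_at F g"
  using mc_at_near[OF F] unfolding near_units1_def by blast
 obtain U ps P r where "unit_chart G x0 U ps P r" by (rule G.unit_chart_exists[OF x0])
 then interpret C: unit_chart G x0 U ps P r .
 have "EX N. openin (gtop G) N & x0 : N & (ALL g:N. EX x a. g : fi ` E & inv_into E fi g = (x, a) & fi (x, a) = g &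
  src G g = x & x : units G & (ALL t:{0..1}. (x, t *. a) : E & fi (x, t *. a) : W))"
  by (rule C.near_nbhd[OF C.tubular_near[OF T W(1) subsetD[OF W(2) x0]]])
 then obtain N where N: "openin (gtop G) N" "x0 : N" "!!g. g : N ==> EX x a. g : fi ` E & inv_into E fi g = (x, a) & fi (x, a) = g &
  src G g = x & x : units G & (ALL t:{0..1}. (x, t *. a) : E & fi (x, t *. a) : W)" by (elim exE conjE) blast
 have main: "g : S & (EX k. mc_solution G H f fM E fi g k & F g = k 1 & (ALL k'. mc_solution G H f fM E fi g k' --> (ALL t:{0..1}. k' t = k t)))"
  if g: "g : N" for g
 proof -
  obtain x a where xa: "g : fi ` E" "inv_into E fi g = (x, a)" "fi (x, a) = g" "src G g = x" "x : units G"
   "!!t. t : {0..1} ==> (x, t *. a) : E & fi (x, t *. a) : W" using N(3)[OF g] by blast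
  define c where "c t = fi (x, t *. a)" for t :: real
  have sc: "scale E fi t g = c t" for t by (simp add: scale_def xa(2) c_def)
  have scd: "(t, g) : scale_dom E fi" if "t : {0..1}" for t
   using xa(1,2) xa(6)[OF that] by (simp add: scale_dom_def)
  have cW: "c t : W" "src G (c t) = x" if "t : {0..1}" for t
   using xa(6)[OF that] bspec[OF src_phi, of "(x, t *. a)"] by (auto simp: c_def)
  have xs: "x : gspace G" using xa(5) G.units_space by blast
  have smc: "smooth_map real_atlas G.A {0..1} c" unfolding c_def
   by (rule smooth_map_compose[OF achart_real(1) good_atlas_tangent[OF G.good] G.good G.smooth_ray[OF xs] smphi]) (use xa(6) in blast)
  define k where "k t = F (c t)" for t
  have mc: "c t : S" "mc_at F (c t)" if "t : {0..1}" for t using W(3)[OF cW(1)[OF that]] by auto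
  have smk: "smooth_map real_atlas H.A {0..1} k" unfolding k_def
   by (rule smooth_map_compose[OF achart_real(1) G.good H.good smc smF(2)]) (use mc(1) in blast)
  have k0: "k 0 = fM (src G g)"
   using phi0[OF xa(5)] integrates_unit[OF F(2) xa(5)] by (simp add: k_def c_def xa(4))
  have k1: "F g = k 1" by (simp add: k_def c_def xa(3))
  have ksrc: "src H (k t) = fM (src G g)" if "t : {0..1}" for t
   using mc(2)[OF that] cW(2)[OF that] xa(4) unfolding mc_at_def k_def by simp
  have kmc: "mc_form H (k t) (velocity H.A {0..1} k t) = f (mc_form G (c t) (velocity G.A {0..1} c t))" if "t : {0..1}" for t
   using mc_at_velocity[OF smF smc cW(2) that mc[OF that]] by (simp add: k_def[abs_def])
  have sol: "mc_solution G H f fM E fi g k"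
   unfolding mc_solution_def sc
  proof (intro conjI ballI smk k0)
   fix t :: real assume t: "t : {0..1}"
   show "src H (k t) = fM (src G g)" by (rule ksrc[OF t])
   show "k t : mc_dom H" "c t : mc_dom G" using mc(2)[OF t] unfolding mc_at_def k_def by auto
   show "(t, g) : scale_dom E fi" by (rule scd[OF t])
   show "mc_form H (k t) (velocity H.A {0..1} k t) = f (mc_form G (c t) (velocity G.A {0..1} (%s. c s) t))"
    by (rule kmc[OF t])
  qed
  have uniq: "k' t = k t" if k': "mc_solution G H f fM E fi g k'" and t: "t : {0..1}" for k' t
  proof -
   have s': "smooth_map real_atlas H.A {0..1} k'" "k' 0 = fM (src G g)"
    "ALL t:{0..1}. src H (k' t) = fM (src G g) & k' t : mc_dom H & (t, g) : scale_dom E fi & c t : mc_dom G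
     & mc_form H (k' t) (velocity H.A {0..1} k' t) = f (mc_form G (c t) (velocity G.A {0..1} c t))"
    using k' unfolding mc_solution_def sc by - (elim conjE, assumption)+
   have z: "(0::real) : {0..1}" by simp
   have "k t = k' t"
   proof (rule H.mc_unique_global[OF smk s'(1) _ _ _ _ t])
    fix t :: real assume t: "t : {0..1}"
    show "src H (k t) = src H (k 0) & src H (k' t) = src H (k' 0)"
     using ksrc[OF t] ksrc[OF z] bspec[OF s'(3) t] bspec[OF s'(3) z] by simp
    show "mc_form H (k t) (velocity H.A {0..1} k t) = mc_form H (k' t) (velocity H.A {0..1} k' t)"
     using kmc[OF t] bspec[OF s'(3) t] by simp
    show "EX W. H.mc_unique W & k t : W" using mc(2)[OF t] unfolding mc_at_def k_def by blast
   qed (simp add: k0 s'(2))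
   thus ?thesis by simp
  qed
  have gS: "g : S" using mc(1)[of 1] by (simp add: c_def xa(3))
  show ?thesis using gS sol k1 uniq by blast
 qed
 thus "EX N. openin (gtop G) N & x0 : N & (ALL g:N. g : S & (EX k. mc_solution G H f fM E fi g k & F g = k 1 &
       (ALL k'. mc_solution G H f fM E fi g k' --> (ALL t:{0..1}. k' t = k t))))"
  using N(1,2) by blast
qed

end

theorem theorem2p4:
  fixes G1 :: "('g1, 'e1::model_space) local_groupoid"
    and G2 :: "('g2, 'e2::model_space) local_groupoid"
    and f :: "'g1 \<times> 'e1 \<Rightarrow> 'g2 \<times> 'e2"
    and fM :: "'g1 \<Rightarrow> 'g2"
  assumes "local_Lie_groupoid G1" and "local_Lie_groupoid G2"
    and "algebroid_morphism G1 G2 f fM"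
  shows "(\<exists>D F. local_groupoid_map G1 G2 D F \<and> integrates G1 G2 F f) \<and>
    (\<forall>D F D' F'.
       local_groupoid_map G1 G2 D F \<and> integrates G1 G2 F f \<and>
       local_groupoid_map G1 G2 D' F' \<and> integrates G1 G2 F' f \<longrightarrow>
       near_units1 G1 (\<lambda>g. g \<in> D \<and> g \<in> D' \<and> F g = F' g)) \<and>
    (\<forall>E \<phi> D F.
       tubular_structure G1 E \<phi> \<and> local_groupoid_map G1 G2 D F \<and> integrates G1 G2 F f \<longrightarrow>
       near_units1 G1 (\<lambda>g. g \<in> D \<and>
         (\<exists>k. mc_solution G1 G2 f fM E \<phi> g k \<and> F g = k 1 \<and>
              (\<forall>k'. mc_solution G1 G2 f fM E \<phi> g k' \<longrightarrow> (\<forall>t\<in>{0..1}. k' t = k t)))))"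
proof -
  interpret lie_morphism G1 G2 f fM
    by unfold_locales (rule assms)+
  show ?thesis
  proof (intro conjI allI impI; (elim conjE)?)
    show "\<exists>D F. local_groupoid_map G1 G2 D F \<and> integrates G1 G2 F f"
      by (rule global_existence)
    show "near_units1 G1 (\<lambda>g. g \<in> D \<and> g \<in> D' \<and> F g = F' g)"
      if "local_groupoid_map G1 G2 D F" "integrates G1 G2 F f" "local_groupoid_map G1 G2 D' F'" "integrates G1 G2 F' f"
      for D F D' F'
      by (rule uniqueness[OF that])
    show "near_units1 G1 (\<lambda>g. g \<in> D \<and> (\<exists>k. mc_solution G1 G2 f fM E \<phi> g k \<and> F g = k 1 \<and>
              (\<forall>k'. mc_solution G1 G2 f fM E \<phi> g k' \<longrightarrow> (\<forall>t\<in>{0..1}. k' t = k t))))"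
      if "tubular_structure G1 E \<phi>" "local_groupoid_map G1 G2 D F" "integrates G1 G2 F f" for E \<phi> D F
      by (rule mc_solution_unique[OF that])
  qed
qed

end
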